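(* Let $q\in(0,1)$, $\tau,\sigma\in\mathbb R$, $u\in\mathbb T=\{u\in\mathbb C:|u|=1\}$, $\lambda\in\{-1,q^{2\tau}\}$, $\xi\in\{-1,q^{2\sigma}\}$, $r\in\mathbb Z$, $x\in-q^{2\mathbb Z}\cup q^{2\sigma+2\mathbb Z}$ and $z\in-q^{2\mathbb Z}\cup q^{2\tau+2\mathbb Z}$, and define $x'=\xi xq^{2r-2\sigma}$ and $z'=\lambda zq^{2r-2\tau}$. Let $R^{\tau,\sigma;\lambda,\xi}_{u,r;x,z}$ be the coupling coefficients defined in the context. Then for $x'\in-q^{2\mathbb N}\cup q^{2\sigma+2\mathbb Z}$ and $z'\in-q^{2\mathbb N}\cup q^{2\tau+2\mathbb Z}$ we have $$R^{\tau,\sigma;\lambda,\xi}_{u,r;x,z}=\mathrm{sgn}(\lambda\xi)^r\sqrt{\frac{|x'z'|\,w(z';a,b;q^2)\,w(x';a,b;q^2)}{K_t(a,b;q^2)\,K_{q^2/abt}(a,b;q^2)}}\;\phi_{x'}(z';a,b;q^2),$$ with $$(a,b,t)=\big(-q^{1+\sigma+\tau-2r}u/(\lambda\xi),\ -q^{1+\sigma+\tau-2r}/(u\lambda\xi),\ \lambda^2q^{2r-2\tau}\big).$$ For $x'\in-q^{-2-2\mathbb N}$ or $z'\in-q^{-2-2\mathbb N}$ we have $R^{\tau,\sigma;\lambda,\xi}_{u,r;x,z}=0$.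
   Context: Notation. $\mathbb N=\{0,1,\dots\}$, $\mu_u=\frac12(u+u^{-1})$; $(a;q)_\infty=\prod_{j\ge0}(1-aq^j)$, $(a;q)_n=(a;q)_\infty/(aq^n;q)_\infty$, $(a_1,\dots,a_r;q)_n=\prod_i(a_i;q)_n$, $(au^{\pm1};q)_n=(au,a/u;q)_n$, $\theta(a;q)=(a;q)_\infty(q/a;q)_\infty$; ${}_r\varphi_s(a_1,\dots,a_r;b_1,\dots,b_s;q,z)=\sum_{n\ge0}\frac{(a_1,\dots,a_r;q)_n}{(q,b_1,\dots,b_s;q)_n}((-1)^nq^{n(n-1)/2})^{1+s-r}z^n$. Functions are defined for a base $q$ and used with base $q^2$. $q$-Meixner functions: $\phi_\gamma(x;a,b;q)={}_2\varphi_2(-1/x,-1/\gamma;a,b;q,ab\gamma x)$; $w(x;a,b;q)=\dfrac{(-qx;q)_\infty}{(-ax,-bx;q)_\infty}$; $K_t(a,b;q)=\dfrac{(q;q)_\infty\theta(-t;q)}{(a,b,-at,-bt;q)_\infty}$. Continuous dual $q$-Hahn functions: $p_n(\mu_u;a,b,c|q)=a^{-n}(ab,ac;q)_n\,{}_3\varphi_2(q^{-n},au,a/u;ab,ac;q,q)$ (a polynomial in $\mu_u$, symmetric in $a,b,c$) and $$\bar p_n(\mu_u;a,b,c|q)=\sqrt{\frac{(u^{\pm2};q)_\infty\,(q^{n+1},abq^n,acq^n,bcq^n;q)_\infty}{2\pi\sqrt{1-\mu_u^2}\,(au^{\pm1},bu^{\pm1},cu^{\pm1};q)_\infty}}\;p_n(\mu_u;a,b,c|q).$$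 For $n,k\in\mathbb N$: $c^{\tau,\sigma}_{u,\lambda q^{2n},x}=\bar p_n(\mu_u;-\lambda q^{1-\tau+\sigma},\lambda q^{1-\tau-\sigma},xq^{1+\tau-\sigma}/\lambda\,|q^2)$ for $\lambda\in\{-1,q^{2\tau}\}$, and, with $\sigma,\tau$ interchanged, $c^{\sigma,\tau}_{u,\xi q^{2k},z}=\bar p_k(\mu_u;-\xi q^{1-\sigma+\tau},\xi q^{1-\sigma-\tau},zq^{1+\sigma-\tau}/\xi\,|q^2)$ for $\xi\in\{-1,q^{2\sigma}\}$. Big $q$-Laguerre functions: $L_n(x;a,b;q)={}_3\varphi_2(q^{-n},0,x;aq,bq;q,q)$, $$\bar L_n(x;a,b;q)=(-abq^2)^{-n/2}q^{-\frac14n(n-1)}\sqrt{\frac{|x|(x/a,x/b,aq,bq;q)_\infty(aq,bq;q)_n}{|aq|(q,x;q)_\infty\theta(b/a;q)(q;q)_n}}\;L_n(x;a,b;q).$$ For $\kappa\in\mathbb R$, $Y\in-q^{2\mathbb Z}\cup q^{2\kappa+2\mathbb Z}$, $n\in\mathbb N$ set $C^\kappa_{X,Y,n}=(\mathrm{sgn}(Y)i)^n\,\bar L_n(-XYq^{2-2\kappa};-Y,Yq^{-2\kappa};q^2)$; when $Y=\lambda q^{2j}$ with $\lambda\in\{-1,q^{2\kappa}\}$, $j<0$ (degenerate parameters), $\bar L_n(\cdots)$ is read as $\bar L_{n+j}(-\lambda Xq^{2-2\kappa};q^{-2j},-\lambda^2q^{-2\kappa};q^2)$ for $n\ge-j$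 and as $0$ for $n<-j$. Put $c^{\tau,\infty}_{X,Y,n}=C^\tau_{X,Y,n}$ and $c^{\infty,\sigma}_{X,n,Y}=C^\sigma_{X,Y,n}$. Coupling coefficients. The coefficients $R^{\tau,\sigma;\lambda,\xi}_{u,r;x,z}$ are determined by $$\sum_{z\in-q^{2\mathbb Z}\cup q^{2\tau+2\mathbb Z}}R^{\tau,\sigma;\lambda,\xi}_{u,r;x,z}\;c^{\sigma,\tau}_{u,\xi q^{2k},z}\;c^{\tau,\infty}_{zq^{2k},\lambda q^{2n-2m},m}=c^{\tau,\sigma}_{u,\lambda q^{2n},x}\;c^{\infty,\sigma}_{xq^{2n},m,\xi q^{2k-2m}},\qquad r=n-m+k,$$ for $k,m,n\in\mathbb N$. Origin. Let $\{e_n\}$ be the standard basis of $\ell^2(\mathbb N)$, $U_n^{(a)}(x;q)=(-a)^nq^{n(n-1)/2}{}_2\varphi_1(q^{-n},x^{-1};0;q,qx/a)$, and for $\kappa\in\mathbb R$ and $x\in-q^{2\mathbb N}\cup q^{2\kappa+2\mathbb N}$ let $v^{(\kappa)}_x=\sum_{n}i^n\sqrt{\frac{q^{-n(n-1)}|x|(-q^2x,xq^{2-2\kappa};q^2)_\infty}{q^{2\kappa n}(q^2;q^2)_n(q^2;q^2)_\infty\theta(-q^{2\kappa};q^2)}}\,U_n^{(-q^{2\kappa})}(-x;q^2)\,e_n$, an orthonormal basis of $\ell^2(\mathbb N)$ (and $v^{(\kappa)}_{\lambda q^{-2n}}=0$ for $\lambda\in\{-1,q^{2\kappa}\}$, $n\ge1$).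 Put $v^{\tau,\infty}_x=v^{(\tau)}_x$, $v^{\infty,\sigma}_x=v^{(\sigma)}_x$, $V^{\tau,\infty}_{X,Y}=\sum_nc^{\tau,\infty}_{X,Y,n}\,v^{\tau,\infty}_{Yq^{2n}}\otimes e_n$ and $V^{\infty,\sigma}_{X,Y}=\sum_nc^{\infty,\sigma}_{X,n,Y}\,e_n\otimes v^{\infty,\sigma}_{Yq^{2n}}$. The formal vectors $F^{\tau,\sigma;\lambda}_{u,x,y}=\sum_nc^{\tau,\sigma}_{u,\lambda q^{2n},x}\,v^{\tau,\infty}_{\lambda q^{2n}}\otimes V^{\infty,\sigma}_{xq^{2n},yq^{2n}}$ and $G^{\tau,\sigma;\xi}_{u,z,v}=\sum_kc^{\sigma,\tau}_{u,\xi q^{2k},z}\,V^{\tau,\infty}_{zq^{2k},vq^{-2k}}\otimes v^{\infty,\sigma}_{\xi q^{2k}}$ are two families of generalized eigenvectors, for the same eigenvalue $\mu_u$, of a self-adjoint element of the quantum $SU(2)$ function algebra in a three-fold tensor product representation. In the expansion $F^{\tau,\sigma;\lambda}_{u,x,y}=\sum_{z,v}\sum_{\xi}(R^{\tau,\sigma}_{u;x,y;z,v})_{\lambda,\xi}\,G^{\tau,\sigma;\xi}_{u,z,v}$ one has $(R^{\tau,\sigma}_{u;x,y;z,v})_{\lambda,\xi}=\delta_{y,\xi q^{2r}}\,\delta_{v,\lambda q^{2r}}\,R^{\tau,\sigma;\lambda,\xi}_{u,r;x,z}$, $r\in\mathbb Z$; the displayed relation is this expansion tested against $v^{\tau,\infty}_{\lambda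 q^{2n}}\otimes e_m\otimes v^{\infty,\sigma}_{\xi q^{2k}}$.
   Formalization: For degenerate Y=λq^{2j}, j<0, a factor (−1)^j is added to L̄_n (else no R exists); R=0 is set where all G-components vanish; at u=±1 the 0/0 u-only weight is cancelled, and u=1 with τ−σ an odd integer, u=−1 with τ+σ an odd integer are excluded. *)

theory Defs
  imports "HOL-Analysis.Analysis"
begin

section \<open>Basic hypergeometric notation\<close>

definition qpoch_inf :: "'a::real_normed_field \<Rightarrow> 'a \<Rightarrow> 'a" where
  "qpoch_inf a q = (\<Prod>j. 1 - a * q ^ j)"

text \<open>The finite product is the value of \<open>(a;q)\<^sub>\<infinity> / (a q\<^sup>n;q)\<^sub>\<infinity>\<close>, also where that
  quotient is \<open>0/0\<close>, as in \<open>(q\<^sup>-\<^sup>m;q)\<^sub>n\<close>.\<close>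

definition qpoch :: "'a::real_normed_field \<Rightarrow> 'a \<Rightarrow> nat \<Rightarrow> 'a" where
  "qpoch a q n = (\<Prod>j<n. 1 - a * q ^ j)"

definition qtheta :: "'a::real_normed_field \<Rightarrow> 'a \<Rightarrow> 'a" where
  "qtheta a q = qpoch_inf a q * qpoch_inf (q / a) q"

definition qhyp :: "'a::real_normed_field list \<Rightarrow> 'a list \<Rightarrow> 'a \<Rightarrow> 'a \<Rightarrow> 'a" where
  "qhyp as bs q z =
     (\<Sum>n. (\<Prod>a\<leftarrow>as. qpoch a q n) / (qpoch q q n * (\<Prod>b\<leftarrow>bs. qpoch b q n))
           * ((-1) ^ n * q ^ (n * (n - 1) div 2)) powi (1 + int (length bs) - int (length as))
           * z ^ n)"

text \<open>\<open>-q\<^sup>2\<^sup>\<int> \<union> q\<^sup>2\<^sup>\<kappa>\<^sup>+\<^sup>2\<^sup>\<int>\<close>, split into its negative and positive parts; the negative part is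
  further split into \<open>-q\<^sup>2\<^sup>\<nat>\<close> and \<open>-q\<^sup>-\<^sup>2\<^sup>-\<^sup>2\<^sup>\<nat>\<close>.\<close>

definition neg_in :: "real \<Rightarrow> real set" where
  "neg_in q = {- (q ^ (2 * j)) |j::nat. True}"

definition neg_out :: "real \<Rightarrow> real set" where
  "neg_out q = {- (q powi (- 2 - 2 * int j)) |j::nat. True}"

definition pos_lattice :: "real \<Rightarrow> real \<Rightarrow> real set" where
  "pos_lattice q \<kappa> = {q powr (2 * \<kappa> + 2 * of_int j) |j::int. True}"

definition lattice_set :: "real \<Rightarrow> real \<Rightarrow> real set" where
  "lattice_set q \<kappa> = {- (q powi (2 * j)) |j::int. True} \<union> pos_lattice q \<kappa>"

section \<open>q-Meixner functions\<close>

definition qMeixner :: "complex \<Rightarrow> complex \<Rightarrow> complex \<Rightarrow> complex \<Rightarrow> complex \<Rightarrow> complex" where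
  "qMeixner \<gamma> x a b q = qhyp [- 1 / x, - 1 / \<gamma>] [a, b] q (a * b * \<gamma> * x)"

definition qMeixner_weight :: "complex \<Rightarrow> complex \<Rightarrow> complex \<Rightarrow> complex \<Rightarrow> complex" where
  "qMeixner_weight x a b q =
     qpoch_inf (- q * x) q / (qpoch_inf (- a * x) q * qpoch_inf (- b * x) q)"

definition qMeixner_K :: "complex \<Rightarrow> complex \<Rightarrow> complex \<Rightarrow> complex \<Rightarrow> complex" where
  "qMeixner_K t a b q =
     qpoch_inf q q * qtheta (- t) q /
     (qpoch_inf a q * qpoch_inf b q * qpoch_inf (- a * t) q * qpoch_inf (- b * t) q)"

section \<open>Continuous dual q-Hahn functions\<close>

definition mu :: "complex \<Rightarrow> complex" where
  "mu u = (u + inverse u) / 2"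

text \<open>The factors \<open>(ab,ac;q)\<^sub>n\<close> are moved into the terminating sum, where they cancel the
  denominators \<open>(ab,ac;q)\<^sub>k\<close>.  This gives the polynomial also when \<open>ab\<close> or \<open>ac\<close> is a nonpositive
  power of \<open>q\<close>, which does occur below; see \<open>cdqH_poly_eq_qhyp\<close> for the other cases.\<close>

definition cdqH_poly ::
  "nat \<Rightarrow> complex \<Rightarrow> complex \<Rightarrow> complex \<Rightarrow> complex \<Rightarrow> complex \<Rightarrow> complex" where
  "cdqH_poly n u a b c q = inverse a ^ n *
     (\<Sum>k\<le>n. qpoch (a * b * q ^ k) q (n - k) * qpoch (a * c * q ^ k) q (n - k)
            * (qpoch (inverse q ^ n) q k * qpoch (a * u) q k * qpoch (a / u) q k / qpoch q q k)
            * q ^ k)"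

text \<open>The part of the weight that depends on \<open>u\<close> only.  At \<open>u = \<plusminus>1\<close> the quotient is \<open>0/0\<close>, and its
  continuous extension is \<open>0\<close>, so that the relation defining the coupling coefficients would
  read \<open>0 = 0\<close>.  The square root of this factor occurs once on either side of that relation and
  does not depend on the summation variable; taking the factor to be 1 at \<open>u = \<plusminus>1\<close> amounts to
  cancelling it.\<close>

definition cdqH_density :: "complex \<Rightarrow> complex \<Rightarrow> complex" where
  "cdqH_density u q =
     (if u ^ 2 = 1 then 1
      else qpoch_inf (u ^ 2) q * qpoch_inf (inverse u ^ 2) q
           / (2 * of_real pi * csqrt (1 - mu u ^ 2)))"

definition cdqH_fun ::
  "nat \<Rightarrow> complex \<Rightarrow> complex \<Rightarrow> complex \<Rightarrow> complex \<Rightarrow> complex \<Rightarrow> complex" where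
  "cdqH_fun n u a b c q =
     csqrt (cdqH_density u q
            * (qpoch_inf (q ^ (n + 1)) q * qpoch_inf (a * b * q ^ n) q
               * qpoch_inf (a * c * q ^ n) q * qpoch_inf (b * c * q ^ n) q)
            / (qpoch_inf (a * u) q * qpoch_inf (a / u) q * qpoch_inf (b * u) q
               * qpoch_inf (b / u) q * qpoch_inf (c * u) q * qpoch_inf (c / u) q))
     * cdqH_poly n u a b c q"

text \<open>\<open>c_fin q \<tau> \<sigma> u l n x\<close> is \<open>c\<^sup>\<tau>\<^sup>,\<^sup>\<sigma>\<close> with indices \<open>u\<close>, \<open>l q\<^sup>2\<^sup>n\<close>, \<open>x\<close>.\<close>

definition c_fin :: "real \<Rightarrow> real \<Rightarrow> real \<Rightarrow> complex \<Rightarrow> real \<Rightarrow> nat \<Rightarrow> real \<Rightarrow> complex" where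
  "c_fin q \<tau> \<sigma> u l n x =
     cdqH_fun n u
       (of_real (- l * q powr (1 - \<tau> + \<sigma>)))
       (of_real (l * q powr (1 - \<tau> - \<sigma>)))
       (of_real (x * q powr (1 + \<tau> - \<sigma>) / l))
       (of_real (q ^ 2))"

section \<open>Big q-Laguerre functions\<close>

definition bqL_poly :: "nat \<Rightarrow> real \<Rightarrow> real \<Rightarrow> real \<Rightarrow> real \<Rightarrow> real" where
  "bqL_poly n x a b q = qhyp [inverse q ^ n, 0, x] [a * q, b * q] q q"

definition bqL_fun :: "nat \<Rightarrow> real \<Rightarrow> real \<Rightarrow> real \<Rightarrow> real \<Rightarrow> real" where
  "bqL_fun n x a b q =
     (- a * b * q ^ 2) powr (- real n / 2) * q powr (- (real n * (real n - 1) / 4))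
     * sqrt (\<bar>x\<bar> * (qpoch_inf (x / a) q * qpoch_inf (x / b) q
                     * qpoch_inf (a * q) q * qpoch_inf (b * q) q)
                  * (qpoch (a * q) q n * qpoch (b * q) q n)
             / (\<bar>a * q\<bar> * (qpoch_inf q q * qpoch_inf x q) * qtheta (b / a) q * qpoch q q n))
     * bqL_poly n x a b q"

text \<open>\<open>c_inf q \<kappa> X l j n\<close> is \<open>C\<^sup>\<kappa>\<close> with indices \<open>X\<close>, \<open>Y = l q\<^sup>2\<^sup>j\<close>, \<open>n\<close>, for \<open>l\<close> equal to \<open>-1\<close> or
  \<open>q\<^sup>2\<^sup>\<kappa>\<close>.

  For \<open>j < 0\<close> one of the parameters \<open>a = -Y\<close>, \<open>b = Y q\<^sup>-\<^sup>2\<^sup>\<kappa>\<close> is the power \<open>q\<^sup>2\<^sup>j\<close>, a pole of the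
  polynomial and a zero of \<open>(aq\<^sup>2,bq\<^sup>2;q\<^sup>2)\<^sub>n\<close>.  For \<open>n \<ge> -j\<close> the product of the polynomial and
  this factor extends continuously, starting at the term \<open>k = -j\<close> of the sum, and there
  \<open>(q\<^sup>-\<^sup>2\<^sup>n;q\<^sup>2)\<^sub>k\<close> contributes the sign \<open>(-1)\<^sup>j\<close>.  This sign cannot be dropped: without it the relations
  defining the coupling coefficients for different \<open>k\<close>, \<open>m\<close>, \<open>n\<close> contradict each other.

  For \<open>X\<close> outside \<open>-q\<^sup>2\<^sup>\<nat> \<union> q\<^sup>2\<^sup>\<kappa>\<^sup>+\<^sup>2\<^sup>\<nat>\<close> the radicand may be \<open>0/0\<close>; in the coupling relation such
  values only occur multiplied by a value of \<open>c_fin\<close> that is 0.\<close>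

definition c_inf :: "real \<Rightarrow> real \<Rightarrow> real \<Rightarrow> real \<Rightarrow> int \<Rightarrow> nat \<Rightarrow> complex" where
  "c_inf q \<kappa> X l j n =
     (let Y = l * q powi (2 * j) in
      (of_real (sgn Y) * \<i>) ^ n * of_real
        (if 0 \<le> j then
           bqL_fun n (- X * Y * q powr (2 - 2 * \<kappa>)) (- Y) (Y * q powr (- 2 * \<kappa>)) (q ^ 2)
         else if - j \<le> int n then
           (- 1) powi j *
           bqL_fun (nat (int n + j)) (- l * X * q powr (2 - 2 * \<kappa>))
             (q powi (- 2 * j)) (- (l ^ 2) * q powr (- 2 * \<kappa>)) (q ^ 2)
         else 0))"

section \<open>Coupling coefficients\<close>

text \<open>\<open>is_coupling q \<tau> \<sigma> l \<xi> u r x R\<close>: the function \<open>z \<mapsto> R z\<close> is the family of coupling coefficients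
  with the remaining indices fixed.  A coefficient \<open>R z\<close> enters the relation only through
  the components of the corresponding vector \<open>G\<close>.  Where all these components vanish,
  the vector is zero and its coefficient is 0 by convention; the relation alone would leave it
  arbitrary.\<close>

definition is_coupling ::
  "real \<Rightarrow> real \<Rightarrow> real \<Rightarrow> real \<Rightarrow> real \<Rightarrow> complex \<Rightarrow> int \<Rightarrow> real \<Rightarrow> (real \<Rightarrow> complex) \<Rightarrow> bool" where
  "is_coupling q \<tau> \<sigma> l \<xi> u r x R \<longleftrightarrow>
     (\<forall>k m n :: nat. r = int n - int m + int k \<longrightarrow>
        ((\<lambda>z. R z * c_fin q \<sigma> \<tau> u \<xi> k z * c_inf q \<tau> (z * q ^ (2 * k)) l (int n - int m) m)
          has_sum
          (c_fin q \<tau> \<sigma> u l n x * c_inf q \<sigma> (x * q ^ (2 * n)) \<xi> (int k - int m) m))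
        (lattice_set q \<tau>)) \<and>
     (\<forall>z \<in> lattice_set q \<tau>.
        (\<forall>k m n :: nat. r = int n - int m + int k \<longrightarrow>
           c_fin q \<sigma> \<tau> u \<xi> k z * c_inf q \<tau> (z * q ^ (2 * k)) l (int n - int m) m = 0)
        \<longrightarrow> R z = 0)"

section \<open>The polynomial as a hypergeometric series\<close>

lemma qpoch_add: "qpoch a q (m + n) = qpoch a q m * qpoch (a * q ^ m) q n"
proof -
  have "{..<m + n} = {..<m} \<union> (\<lambda>j. m + j) ` {..<n}"
  proof (intro equalityI subsetI)
    fix j assume j: "j \<in> {..<m + n}"
    show "j \<in> {..<m} \<union> (\<lambda>j. m + j) ` {..<n}"
    proof (cases "j < m")
      case False
      then have "j = m + (j - m)" "j - m < n" using j by auto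
      then show ?thesis by blast
    qed auto
  qed auto
  moreover have "{..<m} \<inter> (\<lambda>j. m + j) ` {..<n} = {}" by auto
  ultimately show ?thesis
    unfolding qpoch_def
    by (simp add: prod.union_disjoint prod.reindex power_add mult.assoc)
qed

lemma cdqH_poly_eq_qhyp:
  assumes "q \<noteq> 0" and "qpoch (a * b) q n \<noteq> 0" and "qpoch (a * c) q n \<noteq> 0"
  shows "cdqH_poly n u a b c q =
    inverse a ^ n * (qpoch (a * b) q n * qpoch (a * c) q n)
    * qhyp [inverse q ^ n, a * u, a / u] [a * b, a * c] q q"
proof -
  let ?f = "\<lambda>k. qpoch (inverse q ^ n) q k * qpoch (a * u) q k * qpoch (a / u) q k / qpoch q q k
            * q ^ k / (qpoch (a * b) q k * qpoch (a * c) q k)"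
  have z: "qpoch (inverse q ^ n) q k = 0" if "k > n" for k
    unfolding qpoch_def
    using that assms(1) by (auto intro!: prod_zero bexI[of _ n] simp: power_inverse)
  have "qhyp [inverse q ^ n, a * u, a / u] [a * b, a * c] q q = (\<Sum>k. ?f k)"
    unfolding qhyp_def by (intro arg_cong[of _ _ suminf] ext) (simp add: field_simps)
  also have "\<dots> = (\<Sum>k\<le>n. ?f k)"
    by (rule suminf_finite) (auto simp: z)
  finally have 1: "qhyp [inverse q ^ n, a * u, a / u] [a * b, a * c] q q = (\<Sum>k\<le>n. ?f k)" .
  have nz: "qpoch d q k \<noteq> 0" if "k \<le> n" "qpoch d q n \<noteq> 0" for d k
    using qpoch_add[of d q k "n - k"] that by auto
  have 2: "qpoch (d * q ^ k) q (n - k) = qpoch d q n / qpoch d q k"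
    if "k \<le> n" "qpoch d q n \<noteq> 0" for d k
    using qpoch_add[of d q k "n - k"] that nz[OF that] by (auto simp: field_simps)
  have "(\<Sum>k\<le>n. qpoch (a * b * q ^ k) q (n - k) * qpoch (a * c * q ^ k) q (n - k)
            * (qpoch (inverse q ^ n) q k * qpoch (a * u) q k * qpoch (a / u) q k / qpoch q q k)
            * q ^ k) = (\<Sum>k\<le>n. qpoch (a * b) q n * qpoch (a * c) q n * ?f k)"
    by (rule sum.cong) (simp_all add: 2 assms(2,3), simp add: mult_ac)
  then show ?thesis
    unfolding cdqH_poly_def 1 by (simp add: sum_distrib_left mult.assoc)
qed

end

theory Submission
  imports Defs
begin

text \<open>
  In terms of \<open>X = x'\<close>, \<open>Z = z'\<close> and the base \<open>q\<^sup>2\<close>, the defining relation says that a discrete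
  integral over \<open>Z\<close> of a continuous dual \<open>q\<close>-Hahn polynomial times a big \<open>q\<close>-Laguerre polynomial
  times the coupling coefficient is a product of the same kind in \<open>X\<close>.  For the \<open>q\<close>-Meixner function
  as kernel this identity is proved by induction on the degree \<open>n\<close> of the polynomial on the right-hand side.
  For \<open>n = 0\<close> it follows from the Andrews-Askey integral and a \<open>1\<phi>1\<close> summation.  The step applies the
  three-term recurrence of the big \<open>q\<close>-Laguerre polynomials in \<open>Z\<close>, which the second order
  \<open>q\<close>-difference equation of the kernel turns into an operator in \<open>X\<close>; contiguous relations evaluate
  this operator on the right-hand side.  Conversely, for fixed \<open>k\<close> the relations for all \<open>n\<close> determine all
  moments of a function on a bounded set whose points, apart from 0, are isolated, hence its value at each of them.
\<close>

text \<open>The summation identity is proved for complex parameters \<open>q\<close>,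
  \<open>t\<close>, \<open>g\<close>, \<open>u\<close>, \<open>\<rho>\<close>, with
  \<open>a = - g * u\<close> and \<open>b = - g / u\<close>; no square root, sign or phase enters
  there. Exchanging the two sides amounts to exchanging \<open>t\<close> with a dual parameter
  \<open>th\<close>, where \<open>t * th * g ^ 2\<close> is the base, so one evaluation of a product
  \<open>c_fin\<close> times \<open>c_inf\<close> serves both sides.

  Two obstacles shape the rest. The big q-Laguerre parameter
  \<open>\<alpha> = q ^ k * \<rho>\<close> can be a negative power of the base, so
  \<open>bqL_num\<close> keeps the denominator \<open>qpoch (\<alpha> * q) q n\<close> multiplied
  into the sum; the two branches of \<open>c_inf\<close> then fit into one formula, but only after
  multiplication by the root of an infinite product, which is exactly what \<open>c_fin\<close>
  supplies. And a moment argument with \<open>k\<close> fixed sees a coefficient only through its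
  product with a dual q-Hahn value and a weight, either of which may vanish for a given
  \<open>k\<close>; \<open>cdqH_poly_nonvanishing\<close> yields arbitrarily large \<open>k\<close>
  for which the value is nonzero, and for large \<open>k\<close> the weight is positive.\<close>

lemma qpoch_0 [simp]: "qpoch a q 0 = 1"
  by (simp add: qpoch_def)

lemma qpoch_Suc: "qpoch a q (Suc n) = qpoch a q n * (1 - a * q ^ n)"
  by (simp add: qpoch_def)

lemma qpoch_Suc_shift: "qpoch a q (Suc n) = (1 - a) * qpoch (a * q) q n"
  using qpoch_add[of a q 1 n] by (simp add: qpoch_def)

lemma qpoch_eq_0_iff: "qpoch a q n = 0 \<longleftrightarrow> (\<exists>j<n. a * q ^ j = 1)"
  by (auto simp: qpoch_def)

lemma qpoch_self_nonzero:
  fixes q :: "'a::{real_normed_field}"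
  assumes "norm q < 1" shows "qpoch q q n \<noteq> 0"
proof -
  have "q * q ^ j \<noteq> 1" for j
  proof
    assume "q * q ^ j = 1"
    then have "norm q ^ Suc j = 1" by (metis norm_one norm_power power_Suc)
    moreover have "norm q ^ Suc j < 1"
      using assms mult_left_mono[OF power_le_one[of "norm q" j], of "norm q"] by simp
    ultimately show False by simp
  qed
  then show ?thesis by (auto simp: qpoch_eq_0_iff)
qed

lemma qpoch_of_real: "qpoch (of_real a) (of_real q) n = of_real (qpoch a q n)"
  by (simp add: qpoch_def)

section \<open>Infinite q-shifted factorials and the theta function\<close>

lemma qpoch_convergent_prod:
  fixes a q :: "'a::{real_normed_field,banach}"
  assumes "norm q < 1"
  shows "convergent_prod (\<lambda>j. 1 - a * q ^ j)"
proof (rule abs_convergent_prod_imp_convergent_prod, rule summable_imp_abs_convergent_prod)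
  have "summable (\<lambda>j. norm a * norm q ^ j)"
    using assms by (intro summable_mult summable_geometric) auto
  then show "summable (\<lambda>i. norm (1 - a * q ^ i - 1))"
    by (simp add: norm_mult norm_power)
qed

lemma qpoch_LIMSEQ:
  fixes a q :: "'a::{real_normed_field,banach}"
  assumes "norm q < 1"
  shows "(\<lambda>n. qpoch a q n) \<longlonglongrightarrow> qpoch_inf a q"
proof -
  have "(\<lambda>n. \<Prod>j\<le>n. 1 - a * q ^ j) \<longlonglongrightarrow> qpoch_inf a q"
    unfolding qpoch_inf_def by (rule convergent_prod_LIMSEQ[OF qpoch_convergent_prod[OF assms]])
  then have "(\<lambda>n. qpoch a q (Suc n)) \<longlonglongrightarrow> qpoch_inf a q"
    by (simp add: qpoch_def lessThan_Suc_atMost)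
  then show ?thesis by (rule LIMSEQ_imp_Suc)
qed

lemma qpoch_inf_split:
  fixes a q :: "'a::{real_normed_field,banach}"
  assumes "norm q < 1"
  shows "qpoch_inf a q = qpoch a q n * qpoch_inf (a * q ^ n) q"
proof (rule LIMSEQ_unique)
  show "(\<lambda>m. qpoch a q (m + n)) \<longlonglongrightarrow> qpoch_inf a q"
    using LIMSEQ_ignore_initial_segment[OF qpoch_LIMSEQ[OF assms, of a], of n] .
  have "(\<lambda>m. qpoch a q n * qpoch (a * q ^ n) q m) \<longlonglongrightarrow> qpoch a q n * qpoch_inf (a * q ^ n) q"
    by (intro tendsto_intros qpoch_LIMSEQ assms)
  then show "(\<lambda>m. qpoch a q (m + n)) \<longlonglongrightarrow> qpoch a q n * qpoch_inf (a * q ^ n) q"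
    by (simp add: qpoch_add add.commute[of _ n])
qed

lemma qpoch_inf_Suc:
  fixes a q :: "'a::{real_normed_field,banach}"
  assumes "norm q < 1"
  shows "qpoch_inf a q = (1 - a) * qpoch_inf (a * q) q"
  using qpoch_inf_split[OF assms, of a 1] by (simp add: qpoch_def)

lemma qpoch_inf_eq_0_iff:
  fixes a q :: "'a::{real_normed_field,banach}"
  assumes "norm q < 1"
  shows "qpoch_inf a q = 0 \<longleftrightarrow> (\<exists>j. a * q ^ j = 1)"
proof -
  have "(\<lambda>j. 1 - a * q ^ j) has_prod qpoch_inf a q"
    using qpoch_convergent_prod[OF assms, of a] unfolding qpoch_inf_def
    by (simp add: convergent_prod_has_prod_iff)
  from has_prod_eq_0_iff[OF this] show ?thesis
    by (auto simp: eq_commute[of 1])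
qed

lemma qpoch_inf_0 [simp]: "qpoch_inf 0 q = 1"
  by (simp add: qpoch_inf_def)

lemma qpoch_inf_of_real:
  assumes "\<bar>q\<bar> < 1"
  shows "qpoch_inf (of_real a) (of_real q) = (of_real (qpoch_inf a q) :: 'a::{real_normed_field,banach})"
proof (rule LIMSEQ_unique)
  show "(\<lambda>n. qpoch (of_real a) (of_real q :: 'a) n) \<longlonglongrightarrow> qpoch_inf (of_real a) (of_real q)"
    using assms by (intro qpoch_LIMSEQ) simp
  show "(\<lambda>n. qpoch (of_real a) (of_real q :: 'a) n) \<longlonglongrightarrow> of_real (qpoch_inf a q)"
    using assms by (simp add: qpoch_of_real tendsto_of_real qpoch_LIMSEQ)
qed

text \<open>Once \<open>a * q ^ N\<close> is small, all factors are nonzero, and the shifted product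
  is the quotient of an infinite product by its own partial products.\<close>

lemma qpoch_inf_shift_LIMSEQ:
  fixes a q :: "'a::{real_normed_field,banach}"
  assumes "norm q < 1"
  shows "(\<lambda>i. qpoch_inf (a * q ^ i) q) \<longlonglongrightarrow> 1"
proof -
  have "(\<lambda>i. norm (a * q ^ i)) \<longlonglongrightarrow> 0"
    using assms by (auto intro!: tendsto_mult_right_zero LIMSEQ_power_zero tendsto_norm_zero)
  then have "eventually (\<lambda>i. norm (a * q ^ i) < 1) sequentially"
    by (auto dest: order_tendstoD(2)[where a = 1])
  then obtain N where N: "\<And>i. i \<ge> N \<Longrightarrow> norm (a * q ^ i) < 1"
    by (auto simp: eventually_sequentially)
  define b where "b = a * q ^ N"
  have nz: "b * q ^ j \<noteq> 1" for j
    using N[of "N + j"] by (auto simp: b_def power_add mult.assoc)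
  then have Q: "qpoch_inf b q \<noteq> 0" using qpoch_inf_eq_0_iff[OF assms] by blast
  have n: "qpoch b q i \<noteq> 0" for i using nz by (auto simp: qpoch_eq_0_iff)
  have "(\<lambda>i. qpoch_inf b q / qpoch b q i) \<longlonglongrightarrow> qpoch_inf b q / qpoch_inf b q"
    using Q by (intro tendsto_intros qpoch_LIMSEQ assms)
  moreover have "qpoch_inf b q / qpoch b q i = qpoch_inf (a * q ^ (i + N)) q" for i
    using qpoch_inf_split[OF assms, of b i] n[of i]
    by (simp add: b_def power_add mult_ac)
  ultimately have "(\<lambda>i. qpoch_inf (a * q ^ (i + N)) q) \<longlonglongrightarrow> 1"
    using Q by simp
  then show ?thesis by (rule LIMSEQ_offset)
qed

lemma qpoch_inf_shift_bounded:
  fixes a q :: "'a::{real_normed_field,banach}"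
  assumes "norm q < 1"
  obtains C where "C > 0" "\<And>i. norm (qpoch_inf (a * q ^ i) q) \<le> C"
  using convergent_imp_Bseq[OF convergentI[OF qpoch_inf_shift_LIMSEQ[OF assms, of a]]]
  by (auto simp: Bseq_def)

text \<open>Convergence to 1 bounds the reciprocals: the product vanishes for finitely many
  \<open>i\<close> at most, and there the quotient has the value 0. Hence no condition on
  \<open>a\<close> has to be carried along.\<close>

lemma qpoch_inf_shift_inverse_bounded:
  fixes a q :: "'a::{real_normed_field,banach}"
  assumes "norm q < 1"
  obtains C where "C > 0" "\<And>i. norm (1 / qpoch_inf (a * q ^ i) q) \<le> C"
proof -
  have "(\<lambda>i. 1 / qpoch_inf (a * q ^ i) q) \<longlonglongrightarrow> 1 / 1"
    by (intro tendsto_intros qpoch_inf_shift_LIMSEQ assms) auto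
  from convergent_imp_Bseq[OF convergentI[OF this]] show ?thesis
    using that by (auto simp: Bseq_def)
qed

lemma qtheta_shift:
  fixes z q :: "'a::{real_normed_field,banach}"
  assumes "norm q < 1" "q \<noteq> 0" "z \<noteq> 0"
  shows "qtheta (z * q) q = - qtheta z q / z"
proof -
  have 1: "qpoch_inf z q = (1 - z) * qpoch_inf (z * q) q" by (rule qpoch_inf_Suc[OF assms(1)])
  have 2: "qpoch_inf (q / (z * q)) q = (1 - 1 / z) * qpoch_inf (q / z) q"
    using qpoch_inf_Suc[OF assms(1), of "1 / z"] assms by simp
  have "qtheta (z * q) q = qpoch_inf (z * q) q * ((1 - 1 / z) * qpoch_inf (q / z) q)"
    unfolding qtheta_def 2 ..
  also have "\<dots> = - qtheta z q / z"
    unfolding qtheta_def 1 using assms by (simp add: divide_simps) (simp add: algebra_simps)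
  finally show ?thesis .
qed

lemma qtheta_inverse:
  fixes z q :: "'a::{real_normed_field,banach}"
  assumes "norm q < 1" "q \<noteq> 0" "z \<noteq> 0"
  shows "qtheta (1 / z) q = - qtheta z q / z"
  using qtheta_shift[OF assms] assms unfolding qtheta_def by (simp add: mult.commute)

lemma power_eq_iff_norm_less_1:
  fixes q :: "'a::real_normed_field"
  assumes "norm q < 1" "q \<noteq> 0"
  shows "q ^ i = q ^ j \<longleftrightarrow> i = j"
proof
  assume "q ^ i = q ^ j"
  then have "norm q ^ i = norm q ^ j" by (metis norm_power)
  then show "i = j" using assms power_inject_exp'[of "norm q" i j] by auto
qed simp

section \<open>Factorials of negative powers of q and the q-binomial recursion\<close>

lemma qpoch_inverse_power_shift:
  fixes q :: "'a::real_normed_field"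
  assumes "q \<noteq> 0"
  shows "qpoch (inverse q ^ Suc n) q (Suc k) = (1 - inverse q ^ Suc n) * qpoch (inverse q ^ n) q k"
proof -
  have "inverse q ^ Suc n * q = inverse q ^ n" using assms by simp
  then show ?thesis by (simp add: qpoch_Suc_shift del: power_Suc)
qed

text \<open>A quotient relation between the degrees \<open>n + 1\<close> and \<open>n\<close> in
  product form; at \<open>k = Suc n\<close> both sides are 0, so the top index of a terminating sum
  is covered.\<close>

lemma qpoch_inverse_power_step:
  fixes q :: "'a::real_normed_field"
  assumes "q \<noteq> 0"
  shows "qpoch (inverse q ^ Suc n) q k * (q ^ Suc n - q ^ k) = (q ^ Suc n - 1) * qpoch (inverse q ^ n) q k"
proof -
  have "qpoch (inverse q ^ Suc n) q k * (1 - inverse q ^ Suc n * q ^ k)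
      = (1 - inverse q ^ Suc n) * qpoch (inverse q ^ n) q k"
    using qpoch_Suc[of "inverse q ^ Suc n" q k] qpoch_inverse_power_shift[OF assms, of n k] by simp
  moreover have "q ^ Suc n * (1 - inverse q ^ Suc n * q ^ k) = q ^ Suc n - q ^ k"
    using assms by (simp add: field_simps)
  moreover have "q ^ Suc n * (1 - inverse q ^ Suc n) = q ^ Suc n - 1"
    using assms by (simp add: field_simps)
  moreover have "B * x = y" if "B * z = w * A" "v * z = x" "v * w = C" "y = C * A" for A B C v w x y z :: 'a
    using that by (metis mult.assoc mult.left_commute)
  ultimately show ?thesis by blast
qed

lemma qpoch_inverse_power_eq_0:
  fixes q :: "'a::real_normed_field"
  assumes "q \<noteq> 0" "n < k"
  shows "qpoch (inverse q ^ n) q k = 0"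
  using assms by (auto simp: qpoch_eq_0_iff power_inverse intro!: exI[of _ n])

text \<open>Up to a sign and a power of \<open>q\<close>,
  \<open>qpoch (inverse q ^ k) q j / qpoch q q j\<close> is the q-binomial coefficient of
  \<open>k\<close> and \<open>j\<close>. In this normalisation Pascal's rule becomes a
  difference.\<close>

lemma q_pascal:
  fixes q :: "'a::real_normed_field"
  assumes q: "norm q < 1" "q \<noteq> 0"
  shows "q ^ Suc j * qpoch (inverse q ^ Suc k) q (Suc j) / qpoch q q (Suc j)
    = qpoch (inverse q ^ k) q (Suc j) / qpoch q q (Suc j) - qpoch (inverse q ^ k) q j / qpoch q q j"
proof -
  have nz: "qpoch q q j \<noteq> 0" "1 - q * q ^ j \<noteq> 0"
    using qpoch_self_nonzero[OF q(1), of j] qpoch_self_nonzero[OF q(1), of "Suc j"] by (auto simp: qpoch_Suc)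
  have 1: "qpoch (inverse q ^ Suc k) q (Suc j) = (1 - inverse q ^ Suc k) * qpoch (inverse q ^ k) q j"
    by (rule qpoch_inverse_power_shift[OF q(2)])
  have "q ^ Suc j * (1 - inverse q ^ Suc k) = 1 - inverse q ^ k * q ^ j - (1 - q * q ^ j)"
    using q by (simp add: field_simps)
  from arg_cong[OF this, of "\<lambda>x. x * A" for A]
  have 2: "q ^ Suc j * ((1 - inverse q ^ Suc k) * A)
      = A * (1 - inverse q ^ k * q ^ j) - A * (1 - q * q ^ j)" for A
    by (simp only: mult.assoc left_diff_distrib mult.commute[of A])
  show ?thesis
    unfolding 1 2 unfolding qpoch_Suc[of _ q j]
    using nz by (simp add: diff_divide_distrib)
qed

subsection \<open>Continuous dual q-Hahn polynomials\<close>

text \<open>Coefficients with respect to the basis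
  \<open>qpoch (a * u) q k * qpoch (a / u) q k\<close>. The basis involves neither \<open>b\<close>
  nor \<open>c\<close> nor the degree, so relations that change \<open>c\<close> and
  \<open>n\<close> can be checked coefficient by coefficient.\<close>

definition cdqH_coeff :: "nat \<Rightarrow> complex \<Rightarrow> complex \<Rightarrow> complex \<Rightarrow> complex \<Rightarrow> nat \<Rightarrow> complex" where
  "cdqH_coeff n a b c q k = inverse a ^ n * qpoch (a * b * q ^ k) q (n - k)
     * qpoch (a * c * q ^ k) q (n - k) * qpoch (inverse q ^ n) q k / qpoch q q k * q ^ k"

lemma cdqH_poly_coeff:
  "cdqH_poly n u a b c q = (\<Sum>k\<le>n. cdqH_coeff n a b c q k * (qpoch (a * u) q k * qpoch (a / u) q k))"
  unfolding cdqH_poly_def cdqH_coeff_def sum_distrib_left by (intro sum.cong) auto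

lemma cdqH_poly_0 [simp]: "cdqH_poly 0 u a b c q = 1"
  by (simp add: cdqH_poly_def)

text \<open>In the difference of two coefficients the products depending on \<open>c\<close> overlap
  up to one factor at either end, which leaves a multiple of the coefficient of degree
  \<open>n - 1\<close>. For \<open>n = 0\<close> the truncated \<open>n - 1\<close> is harmless
  because \<open>1 - q ^ n\<close> is 0.\<close>

lemma cdqH_diff:
  assumes q: "norm q < 1" "q \<noteq> 0" and a: "a \<noteq> 0"
  shows "cdqH_poly n u a b c q - cdqH_poly n u a b (c * q) q
    = - c * (1 - q ^ n) * (1 - a * b * q ^ n / q) * cdqH_poly (n - 1) u a b (c * q) q"
proof (cases n)
  case (Suc N)
  have *: "cdqH_coeff (Suc N) a b c q k - cdqH_coeff (Suc N) a b (c * q) q k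
      = - c * (1 - q ^ Suc N) * (1 - a * b * q ^ N) * cdqH_coeff N a b (c * q) q k" if "k \<le> N" for k
  proof -
    have k: "Suc N - k = Suc (N - k)" "k + (N - k) = N" using that by auto
    let ?pb = "qpoch (a * b * q ^ k) q (N - k)" and ?pc = "qpoch (a * (c * q) * q ^ k) q (N - k)"
    have b: "qpoch (a * b * q ^ k) q (Suc N - k) = ?pb * (1 - a * b * q ^ N)"
      unfolding k qpoch_Suc using k(2) by (simp add: mult.assoc flip: power_add)
    have c1: "qpoch (a * c * q ^ k) q (Suc N - k) = (1 - a * c * q ^ k) * ?pc"
      unfolding k qpoch_Suc_shift by (simp add: mult_ac)
    have c2: "qpoch (a * (c * q) * q ^ k) q (Suc N - k) = ?pc * (1 - a * c * q ^ Suc N)"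
      unfolding k qpoch_Suc using k(2) by (simp add: mult.assoc flip: power_add)
    have s: "qpoch (inverse q ^ Suc N) q k * (q ^ Suc N - q ^ k) = (q ^ Suc N - 1) * qpoch (inverse q ^ N) q k"
      by (rule qpoch_inverse_power_step[OF q(2)])
    have "cdqH_coeff (Suc N) a b c q k - cdqH_coeff (Suc N) a b (c * q) q k
        = inverse a ^ Suc N * ?pb * (1 - a * b * q ^ N) * ?pc * (a * c) / qpoch q q k * q ^ k
          * (qpoch (inverse q ^ Suc N) q k * (q ^ Suc N - q ^ k))"
    proof -
      have *: "x * (A * B) * ((1 - a * c * y) * C) * D / E * y - x * (A * B) * (C * (1 - a * c * z)) * D / E * y
          = x * A * B * C * (a * c) / E * y * (D * (z - y))" for x A B C D E y z :: complex
        by (simp add: algebra_simps diff_divide_distrib)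
      show ?thesis unfolding cdqH_coeff_def b c1 c2 by (rule *)
    qed
    also have "\<dots> = - c * (1 - q ^ Suc N) * (1 - a * b * q ^ N) * cdqH_coeff N a b (c * q) q k"
    proof -
      have *: "x / a * A * B * C * (a * c) / E * y * ((z - 1) * D)
          = - c * (1 - z) * B * (x * A * C * D / E * y)" for x A B C D E y z :: complex
        using a by (simp add: algebra_simps)
      have i: "inverse a ^ Suc N = inverse a ^ N / a" by (simp add: divide_inverse)
      show ?thesis unfolding s cdqH_coeff_def i by (rule *)
    qed
    finally show ?thesis .
  qed
  have "cdqH_poly n u a b c q - cdqH_poly n u a b (c * q) q
      = (\<Sum>k\<le>Suc N. (cdqH_coeff (Suc N) a b c q k - cdqH_coeff (Suc N) a b (c * q) q k)
          * (qpoch (a * u) q k * qpoch (a / u) q k))"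
    unfolding Suc cdqH_poly_coeff by (simp add: left_diff_distrib sum_subtractf)
  \<comment> \<open>The coefficient of index \<open>Suc N\<close> has empty products in
    \<open>b\<close> and \<open>c\<close>; it is the same for \<open>c\<close> and
    \<open>c * q\<close> and cancels.\<close>
  also have "\<dots> = (\<Sum>k\<le>N. (cdqH_coeff (Suc N) a b c q k - cdqH_coeff (Suc N) a b (c * q) q k)
          * (qpoch (a * u) q k * qpoch (a / u) q k))"
    by (simp add: cdqH_coeff_def)
  also have "\<dots> = - c * (1 - q ^ Suc N) * (1 - a * b * q ^ N) * cdqH_poly N u a b (c * q) q"
    unfolding cdqH_poly_coeff sum_distrib_left by (intro sum.cong) (auto simp: * mult.assoc)
  finally show ?thesis using q Suc by simp
qed simp

text \<open>The coefficient comparison needed for \<open>cdqH_raise\<close>. The term with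
  \<open>k - 1\<close> stems from a basis element that was raised by one. Every summand contains the
  factor \<open>m * pb * pc * (1 - a * c * q ^ k)\<close>; what remains is the rational identity
  \<open>key\<close> in \<open>Q = q ^ N\<close> and \<open>y = q ^ k\<close>.\<close>

lemma cdqH_coeff_raise:
  assumes q: "norm q < 1" "q \<noteq> 0" and a: "a \<noteq> 0" and k: "k \<le> N"
  shows "c * cdqH_coeff (Suc N) a b c q k =
    (1 - a * c * q ^ N) * (1 - b * c * q ^ N) * cdqH_coeff N a b c q k
    - (1 - a * c * q ^ k) * (1 - c / (a * q ^ k)) * cdqH_coeff N a b (c * q) q k
    - (if k = 0 then 0 else c * q / (a * q ^ k) * cdqH_coeff N a b (c * q) q (k - 1))"
proof -
  have kk: "Suc N - k = Suc (N - k)" "k + (N - k) = N" using k by auto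
  let ?y = "q ^ k" and ?Q = "q ^ N"
  define pb where "pb = qpoch (a * b * q ^ k) q (N - k)"
  define pc where "pc = qpoch (a * (c * q) * q ^ k) q (N - k)"
  define m where "m = inverse a ^ N * qpoch (inverse q ^ N) q k / qpoch q q k * q ^ k"
  have ne: "q * ?Q - ?y \<noteq> 0" using power_eq_iff_norm_less_1[OF q, of "Suc N" k] k by auto
  have b: "qpoch (a * b * q ^ k) q (Suc N - k) = pb * (1 - a * b * q ^ N)"
    unfolding kk qpoch_Suc pb_def using kk(2) by (simp add: mult.assoc flip: power_add)
  have c1: "qpoch (a * c * q ^ k) q (Suc N - k) = (1 - a * c * q ^ k) * pc"
    unfolding kk qpoch_Suc_shift pc_def by (simp add: mult_ac)
  have c3: "qpoch (a * c * q ^ k) q (N - k) * (1 - a * c * q ^ N) = (1 - a * c * q ^ k) * pc"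
    unfolding c1[symmetric] kk qpoch_Suc using kk(2) by (simp add: mult.assoc flip: power_add)
  have s: "qpoch (inverse q ^ Suc N) q k = (q * ?Q - 1) * qpoch (inverse q ^ N) q k / (q * ?Q - ?y)"
    using qpoch_inverse_power_step[OF q(2), of N k] ne by (simp add: field_simps)
  have L: "cdqH_coeff (Suc N) a b c q k
      = m * pb * pc * (1 - a * c * ?y) * ((q * ?Q - 1) * (1 - a * b * ?Q) / (a * (q * ?Q - ?y)))"
  proof -
    have *: "i / a * (pb * B) * (C * pc) * (F * D / G) / E * y
        = i * D / E * y * pb * pc * C * (F * B / (a * G))" for i B C D E F G y :: complex
      by (simp add: mult_ac)
    have i: "inverse a ^ Suc N = inverse a ^ N / a" by (simp add: divide_inverse)
    show ?thesis unfolding cdqH_coeff_def b c1 s m_def i by (rule *)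
  qed
  have T1: "(1 - a * c * ?Q) * (1 - b * c * ?Q) * cdqH_coeff N a b c q k
      = m * pb * pc * (1 - a * c * ?y) * (1 - b * c * ?Q)"
  proof -
    have "(1 - a * c * ?Q) * (1 - b * c * ?Q) * cdqH_coeff N a b c q k
      = m * pb * (1 - b * c * ?Q) * (qpoch (a * c * q ^ k) q (N - k) * (1 - a * c * q ^ N))"
      unfolding cdqH_coeff_def m_def pb_def by simp
    then show ?thesis unfolding c3 by (simp add: mult_ac)
  qed
  have T2: "cdqH_coeff N a b (c * q) q k = m * pb * pc"
    unfolding cdqH_coeff_def m_def pb_def pc_def by simp
  have T3: "(if k = 0 then 0 else c * q / (a * ?y) * cdqH_coeff N a b (c * q) q (k - 1))
      = m * pb * pc * (1 - a * c * ?y) * (c / (a * ?y) * (1 - a * b * ?y / q) * (1 - ?y) * (q * ?Q) / (q * ?Q - ?y))"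
  proof (cases k)
    case (Suc j)
    have j: "N - j = Suc (N - k)" using k Suc by auto
    have b': "qpoch (a * b * q ^ j) q (N - j) = (1 - a * b * ?y / q) * pb"
      unfolding j qpoch_Suc_shift pb_def Suc using q by (simp add: mult_ac)
    have c': "qpoch (a * (c * q) * q ^ j) q (N - j) = (1 - a * c * ?y) * pc"
      unfolding j qpoch_Suc_shift pc_def Suc using q by (simp add: mult_ac)
    have yQ: "1 - inverse q ^ N * q ^ j = (q * ?Q - ?y) / (q * ?Q)"
      using q Suc by (simp add: field_simps)
    have y1: "1 - q * q ^ j \<noteq> 0" "qpoch q q j \<noteq> 0"
      using qpoch_self_nonzero[OF q(1), of "Suc j"] by (auto simp: qpoch_Suc)
    have m: "m = inverse a ^ N * (qpoch (inverse q ^ N) q j * ((q * ?Q - ?y) / (q * ?Q))) / (qpoch q q j * (1 - ?y)) * (q * q ^ j)"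
      unfolding m_def Suc qpoch_Suc unfolding yQ[unfolded Suc] by simp
    have r: "inverse a ^ N * qpoch (inverse q ^ N) q j / qpoch q q j * q ^ j * q
       = m * ((1 - ?y) * (q * ?Q) / (q * ?Q - ?y))"
    proof -
      have *: "i * A / E * y * q = i * (A * (D / F)) / (E * G) * (q * y) * (G * F / D)"
        if "D \<noteq> 0" "F \<noteq> 0" "G \<noteq> 0" for i A E y D F G :: complex
        using that by simp
      have "1 - ?y \<noteq> 0" "q * ?Q \<noteq> 0" using y1 q Suc by auto
      then show ?thesis unfolding m by (intro *[OF ne])
    qed
    have "c * q / (a * ?y) * cdqH_coeff N a b (c * q) q j
        = c / (a * ?y) * ((1 - a * b * ?y / q) * pb) * ((1 - a * c * ?y) * pc)
          * (inverse a ^ N * qpoch (inverse q ^ N) q j / qpoch q q j * q ^ j * q)"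
      unfolding cdqH_coeff_def b' c' by (simp add: mult_ac)
    also have "\<dots> = m * pb * pc * (1 - a * c * ?y) * (c / (a * ?y) * (1 - a * b * ?y / q) * (1 - ?y) * (q * ?Q) / (q * ?Q - ?y))"
      unfolding r by (simp add: mult_ac)
    finally show ?thesis using Suc by simp
  qed simp
  have key: "c * ((q * Q - 1) * (1 - a * b * Q) / (a * (q * Q - y)))
      = (1 - b * c * Q) - (1 - c / (a * y)) - c / (a * y) * (1 - a * b * y / q) * (1 - y) * (q * Q) / (q * Q - y)"
    if "y \<noteq> 0" "q * Q - y \<noteq> 0" for Q y :: complex
  proof -
    have "c * ((q * Q - 1) * (1 - a * b * Q)) * y
        = ((c - b * c * Q * (a * y)) * (q * Q - y) - c * (q - a * b * y) * (1 - y) * Q)"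
      by (simp add: algebra_simps)
    then have "c * ((q * Q - 1) * (1 - a * b * Q)) * y / (a * y * (q * Q - y))
        = ((c - b * c * Q * (a * y)) * (q * Q - y) - c * (q - a * b * y) * (1 - y) * Q) / (a * y * (q * Q - y))"
      by simp
    moreover have "c * ((q * Q - 1) * (1 - a * b * Q)) * y / (a * y * (q * Q - y))
        = c * ((q * Q - 1) * (1 - a * b * Q) / (a * (q * Q - y)))"
      using a that by simp
    moreover have "((c - b * c * Q * (a * y)) * (q * Q - y) - c * (q - a * b * y) * (1 - y) * Q) / (a * y * (q * Q - y))
        = (1 - b * c * Q) - (1 - c / (a * y)) - c / (a * y) * (1 - a * b * y / q) * (1 - y) * (q * Q) / (q * Q - y)"
    proof -
      have "(1 - a * b * y / q) = (q - a * b * y) / q" using q by (simp add: field_simps)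
      moreover have "(1 - b * c * Q) - (1 - c / (a * y)) = (c - b * c * Q * (a * y)) / (a * y)"
        using a that by (simp add: field_simps)
      moreover have "c / (a * y) * ((q - a * b * y) / q) * (1 - y) * (q * Q) / (q * Q - y)
          = c * (q - a * b * y) * (1 - y) * Q / (a * y * (q * Q - y))"
        using q by simp
      moreover have "(X * D - Y) / (A * D) = X / A - Y / (A * D)" if "D \<noteq> 0" for X Y A D :: complex
        using that by (simp add: diff_divide_distrib)
      ultimately show ?thesis using that(2) by simp
    qed
    ultimately show ?thesis by simp
  qed
  have "c * cdqH_coeff (Suc N) a b c q k = m * pb * pc * (1 - a * c * ?y)
       * (c * ((q * ?Q - 1) * (1 - a * b * ?Q) / (a * (q * ?Q - ?y))))"
    unfolding L by (simp add: mult_ac)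
  also have "\<dots> = m * pb * pc * (1 - a * c * ?y) * ((1 - b * c * ?Q) - (1 - c / (a * ?y))
       - c / (a * ?y) * (1 - a * b * ?y / q) * (1 - ?y) * (q * ?Q) / (q * ?Q - ?y))"
    using q ne by (subst key) simp_all
  also have "\<dots> = m * pb * pc * (1 - a * c * ?y) * (1 - b * c * ?Q)
        - (1 - a * c * ?y) * (1 - c / (a * ?y)) * (m * pb * pc)
        - m * pb * pc * (1 - a * c * ?y) * (c / (a * ?y) * (1 - a * b * ?y / q) * (1 - ?y) * (q * ?Q) / (q * ?Q - ?y))"
  proof -
    have g: "M * C * (X - Y - Z) = M * C * X - C * Y * M - M * C * Z" for M C X Y Z :: complex
      by (simp add: algebra_simps)
    show ?thesis by (rule g)
  qed
  finally show ?thesis by (simp only: T1 T2 T3)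
qed

text \<open>Multiplication by \<open>(1 - c * u) * (1 - c / u)\<close> maps a basis element to a
  combination of itself and its successor with coefficients free of \<open>u\<close>. The relation
  builds degree \<open>N + 1\<close> from degree \<open>N\<close> with coefficients symmetric in
  \<open>a\<close> and \<open>b\<close>; this is what makes symmetry provable.\<close>

lemma cdqH_raise:
  assumes q: "norm q < 1" "q \<noteq> 0" and a: "a \<noteq> 0" and u: "u \<noteq> 0"
  shows "c * cdqH_poly (Suc N) u a b c q =
    (1 - a * c * q ^ N) * (1 - b * c * q ^ N) * cdqH_poly N u a b c q
    - (1 - c * u) * (1 - c / u) * cdqH_poly N u a b (c * q) q"
proof -
  define B where "B k = qpoch (a * u) q k * qpoch (a / u) q k" for k
  let ?T = "\<lambda>k. cdqH_coeff N a b (c * q) q k" and ?W = "(1 - c * u) * (1 - c / u)"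
  \<comment> \<open>The quadratic \<open>(1 - c * u) * (1 - c / u)\<close> is affine in
    \<open>u + 1 / u\<close>, as is the factor by which \<open>B (Suc k)\<close> differs from
    \<open>B k\<close>; matching the two fixes the coefficients.\<close>
  have W: "?W * B k = (1 - a * c * q ^ k) * (1 - c / (a * q ^ k)) * B k + c / (a * q ^ k) * B (Suc k)" for k
  proof -
    have *: "?W = (1 - a * c * y) * (1 - c / (a * y)) + c / (a * y) * ((1 - a * u * y) * (1 - a / u * y))"
      if "y \<noteq> 0" for y
      using a u that by (simp add: field_simps)
    have E: "?W = (1 - a * c * q ^ k) * (1 - c / (a * q ^ k))
        + c / (a * q ^ k) * ((1 - a * u * q ^ k) * (1 - a / u * q ^ k))"
      using *[of "q ^ k"] q by simp
    have g: "(P + c' * (F * G)) * (X * Y) = P * (X * Y) + c' * ((X * F) * (Y * G))" for P c' F G X Y :: complex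
      by (simp add: algebra_simps)
    show ?thesis unfolding B_def qpoch_Suc E by (rule g)
  qed
  \<comment> \<open>On the right-hand side \<open>B (Suc N)\<close> arises only by raising the last
    basis element, so its coefficient is compared separately.\<close>
  have last: "c * cdqH_coeff (Suc N) a b c q (Suc N) = - (c / (a * q ^ N) * ?T N)"
  proof -
    have "qpoch (inverse q ^ Suc N) q (Suc N) = (1 - inverse q ^ Suc N) * qpoch (inverse q ^ N) q N"
      by (rule qpoch_inverse_power_shift[OF q(2)])
    moreover have "1 - q * q ^ N \<noteq> 0" "qpoch q q N \<noteq> 0"
      using qpoch_self_nonzero[OF q(1), of "Suc N"] by (auto simp: qpoch_Suc)
    ultimately show ?thesis unfolding cdqH_coeff_def
      using a q by (simp add: qpoch_Suc divide_simps) (simp add: algebra_simps)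
  qed
  have shift: "(\<Sum>k\<le>N. f k * B (Suc k)) = (\<Sum>k\<le>N. (if k = 0 then 0 else f (k - 1)) * B k) + f N * B (Suc N)" for f
    using sum.atMost_Suc_shift[of "\<lambda>k. (if k = 0 then 0 else f (k - 1)) * B k" N] by simp
  have "?W * cdqH_poly N u a b (c * q) q = (\<Sum>k\<le>N. ?T k * (?W * B k))"
    unfolding cdqH_poly_coeff B_def sum_distrib_left by (simp add: mult_ac)
  also have "\<dots> = (\<Sum>k\<le>N. (1 - a * c * q ^ k) * (1 - c / (a * q ^ k)) * ?T k * B k)
      + (\<Sum>k\<le>N. (c / (a * q ^ k) * ?T k) * B (Suc k))"
  proof -
    have g: "t * (A * B + C * D) = A * t * B + (C * t) * D" for t A B C D :: complex
      by (simp add: algebra_simps)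
    show ?thesis unfolding W sum.distrib[symmetric] by (intro sum.cong refl) (rule g)
  qed
  also have "(\<Sum>k\<le>N. (c / (a * q ^ k) * ?T k) * B (Suc k))
      = (\<Sum>k\<le>N. (if k = 0 then 0 else c * q / (a * q ^ k) * ?T (k - 1)) * B k) + c / (a * q ^ N) * ?T N * B (Suc N)"
    unfolding shift using q by (intro arg_cong2[where f = "(+)"] sum.cong refl) (auto simp: gr0_conv_Suc)
  finally have 1: "?W * cdqH_poly N u a b (c * q) q =
      (\<Sum>k\<le>N. ((1 - a * c * q ^ k) * (1 - c / (a * q ^ k)) * ?T k
        + (if k = 0 then 0 else c * q / (a * q ^ k) * ?T (k - 1))) * B k) + c / (a * q ^ N) * ?T N * B (Suc N)"
    by (simp add: sum.distrib distrib_right)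
  have "c * cdqH_poly (Suc N) u a b c q
      = (\<Sum>k\<le>N. (c * cdqH_coeff (Suc N) a b c q k) * B k) + (c * cdqH_coeff (Suc N) a b c q (Suc N)) * B (Suc N)"
    unfolding cdqH_poly_coeff B_def[symmetric] by (simp add: sum_distrib_left distrib_left mult_ac)
  also have "(\<Sum>k\<le>N. (c * cdqH_coeff (Suc N) a b c q k) * B k)
      = (\<Sum>k\<le>N. (1 - a * c * q ^ N) * (1 - b * c * q ^ N) * cdqH_coeff N a b c q k * B k)
       - (\<Sum>k\<le>N. ((1 - a * c * q ^ k) * (1 - c / (a * q ^ k)) * ?T k
        + (if k = 0 then 0 else c * q / (a * q ^ k) * ?T (k - 1))) * B k)"
  proof -
    have g: "C * b = X * b - (A + I) * b" if "C = X - A - I" for C X A I b :: complex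
      unfolding that by (simp add: algebra_simps)
    show ?thesis unfolding sum_subtractf[symmetric]
      by (intro sum.cong refl g cdqH_coeff_raise[OF q a]) simp
  qed
  finally show ?thesis
    unfolding 1 last unfolding cdqH_poly_coeff B_def[symmetric] by (simp add: sum_distrib_left mult.assoc)
qed

text \<open>\<open>cdqH_raise\<close> determines degree \<open>n + 1\<close> from degree
  \<open>n\<close> at \<open>c\<close> and at \<open>c * q\<close>, and its coefficients do not
  change when \<open>a\<close> and \<open>b\<close> are exchanged. An induction with
  \<open>c\<close> arbitrary therefore replaces a transformation formula for the series.\<close>

lemma cdqH_commute:
  assumes q: "norm q < 1" "q \<noteq> 0" and "a \<noteq> 0" "b \<noteq> 0" "u \<noteq> 0" "c \<noteq> 0"
  shows "cdqH_poly n u a b c q = cdqH_poly n u b a c q"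
  using \<open>c \<noteq> 0\<close>
proof (induction n arbitrary: c)
  case (Suc n)
  have "c * cdqH_poly (Suc n) u a b c q = c * cdqH_poly (Suc n) u b a c q"
    using Suc assms by (simp add: cdqH_raise Suc.IH[of c] Suc.IH[of "c * q"])
  then show ?case using Suc by simp
qed simp

text \<open>With \<open>d = c / q\<close> the parameter \<open>c\<close> is the raised parameter
  \<open>d * q\<close> in \<open>cdqH_diff\<close> and \<open>cdqH_raise\<close>. Two instances of
  the former and one of the latter allow the values at \<open>d\<close> to be eliminated, which
  leaves three consecutive degrees at \<open>c\<close>.\<close>

lemma cdqH_three_term:
  assumes q: "norm q < 1" "q \<noteq> 0" and a: "a \<noteq> 0" and u: "u \<noteq> 0" and c: "c \<noteq> 0"
  shows "cdqH_poly (Suc n) u a b c q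
      = (u + 1 / u - ((a + b + c) * q ^ n + a * b * c * q ^ n / q * (1 - q ^ n - q * q ^ n))) * cdqH_poly n u a b c q
        - (1 - q ^ n) * (1 - a * b * q ^ n / q) * (1 - a * c * q ^ n / q) * (1 - b * c * q ^ n / q) * cdqH_poly (n - 1) u a b c q"
proof -
  define d where "d = c / q"
  have d: "d \<noteq> 0" "c = d * q" using c q by (auto simp: d_def)
  define P0 P1 P2 where "P0 = cdqH_poly (n - 1) u a b c q" and "P1 = cdqH_poly n u a b c q"
    and "P2 = cdqH_poly (Suc n) u a b c q"
  define D1 where "D1 = cdqH_poly n u a b d q"
  have 1: "D1 = P1 - d * (1 - q ^ n) * (1 - a * b * q ^ n / q) * P0"
    using cdqH_diff[OF q a, of n u b d] unfolding d(2)[symmetric] D1_def[symmetric] P1_def[symmetric] P0_def[symmetric]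
    by (simp add: diff_eq_eq)
  have 2: "d * cdqH_poly (Suc n) u a b d q = (1 - a * d * q ^ n) * (1 - b * d * q ^ n) * D1 - (1 - d * u) * (1 - d / u) * P1"
    using cdqH_raise[OF q a u, of d n b] unfolding d(2)[symmetric] D1_def P1_def by simp
  have 3: "cdqH_poly (Suc n) u a b d q = P2 - d * (1 - q ^ Suc n) * (1 - a * b * q ^ n) * P1"
    using cdqH_diff[OF q a, of "Suc n" u b d] q unfolding d(2)[symmetric] P2_def[symmetric] diff_Suc_1 P1_def[symmetric]
    by (simp add: diff_eq_eq)
  have W: "(1 - d * u) * (1 - d / u) = 1 + d^2 - d * (u + 1 / u)"
  proof -
    have "d * u * (d / u) = d ^ 2" using u by (simp add: power2_eq_square)
    then show ?thesis by (simp add: algebra_simps)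
  qed
  have "d * P2 = d * ((v - ((a + b + d * q) * Q + a * b * d * Q * (1 - Q - q * Q))) * P1
      - (1 - Q) * E * (1 - a * d * Q) * (1 - b * d * Q) * P0)"
    if "d * (P2 - d * (1 - q * Q) * (1 - a * b * Q) * P1)
     = (1 - a * d * Q) * (1 - b * d * Q) * (P1 - d * (1 - Q) * E * P0) - (1 + d^2 - d * v) * P1" for Q E v
    using that by algebra
  from this[of "q ^ n" "1 - a * b * q ^ n / q" "u + 1 / u"]
  have "d * P2 = d * ((u + 1 / u - ((a + b + d * q) * q ^ n + a * b * d * q ^ n * (1 - q ^ n - q * q ^ n))) * P1
      - (1 - q ^ n) * (1 - a * b * q ^ n / q) * (1 - a * d * q ^ n) * (1 - b * d * q ^ n) * P0)"
    using 2 unfolding 3 1 W by simp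
  then show ?thesis unfolding P0_def[symmetric] P1_def[symmetric] P2_def[symmetric]
    using d(1) unfolding d(2) by (simp add: mult.assoc q)
qed

subsection \<open>Big q-Laguerre polynomials\<close>

text \<open>The big q-Laguerre polynomial with parameters \<open>\<alpha>\<close>, \<open>b\<close>,
  multiplied by \<open>qpoch (\<alpha> * q) q k\<close>. The quotient with the denominator of the
  i-th term is written as a product, so that \<open>\<alpha>\<close> may be a negative power of
  \<open>q\<close>.\<close>

definition bqL_num :: "nat \<Rightarrow> 'a::real_normed_field \<Rightarrow> 'a \<Rightarrow> 'a \<Rightarrow> 'a \<Rightarrow> 'a" where
  "bqL_num k \<alpha> b z q = (\<Sum>i\<le>k. qpoch (inverse q ^ k) q i * qpoch z q i * qpoch (\<alpha> * q ^ Suc i) q (k - i)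
     / (qpoch q q i * qpoch (b * q) q i) * q ^ i)"

text \<open>For nonzero \<open>\<alpha>\<close> and \<open>z\<close> this is
  \<open>\<alpha> ^ k\<close> times the series 2phi1 with upper parameters
  \<open>inverse q ^ k\<close>, \<open>b * q / z\<close>, lower parameter \<open>b * q\<close> and
  argument \<open>z / \<alpha>\<close>. Here \<open>\<alpha>\<close> enters through powers
  only.\<close>

definition bqL_alt :: "nat \<Rightarrow> 'a::real_normed_field \<Rightarrow> 'a \<Rightarrow> 'a \<Rightarrow> 'a \<Rightarrow> 'a" where
  "bqL_alt k \<alpha> b z q = (\<Sum>j\<le>k. qpoch (inverse q ^ k) q j / (qpoch q q j * qpoch (b * q) q j)
     * \<alpha> ^ (k - j) * (\<Prod>l<j. z - b * q ^ Suc l))"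

lemma bqL_num_0 [simp]: "bqL_num 0 \<alpha> b z q = 1"
  by (simp add: bqL_num_def)

lemma qpoch_shift_ends:
  assumes "i \<le> k"
  shows "qpoch (x * q ^ i) q (k - i) * (1 - x * q ^ k) = (1 - x * q ^ i) * qpoch (x * q ^ Suc i) q (k - i)"
  using qpoch_Suc[of "x * q ^ i" q "k - i"] qpoch_Suc_shift[of "x * q ^ i" q "k - i"] assms
  by (simp add: mult.assoc mult.commute[of q] flip: power_add)

text \<open>Valid term by term: after moving the factors into the i-th summand, the coefficient
  \<open>z * (1 - \<alpha> * q ^ i) - \<alpha> * (1 - z * q ^ i)\<close> equals
  \<open>z - \<alpha>\<close> and no longer depends on \<open>i\<close>.\<close>

lemma bqL_num_contiguous:
  assumes "q \<noteq> 0"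
  shows "z * (1 - \<alpha> * q ^ k) * bqL_num k (\<alpha> / q) b z q - \<alpha> * (1 - z) * bqL_num k \<alpha> b (z * q) q
    = (z - \<alpha>) * bqL_num k \<alpha> b z q"
proof -
  define A where "A i = qpoch (inverse q ^ k) q i / (qpoch q q i * qpoch (b * q) q i) * q ^ i" for i
  have 1: "qpoch (\<alpha> / q * q ^ Suc i) q (k - i) * (1 - \<alpha> * q ^ k) = (1 - \<alpha> * q ^ i) * qpoch (\<alpha> * q ^ Suc i) q (k - i)"
    if "i \<le> k" for i
    using qpoch_shift_ends[OF that, of \<alpha> q] assms by simp
  have 2: "(1 - z) * qpoch (z * q) q i = qpoch z q i * (1 - z * q ^ i)" for i
    using qpoch_Suc[of z q i] qpoch_Suc_shift[of z q i] by simp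
  have g: "z * t * (A * B * c * d) - \<alpha> * w * (A * e * f * d) = (z - \<alpha>) * (A * B * f * d)"
    if "c * t = (1 - \<alpha> * y) * f" "w * e = B * (1 - z * y)" for A B c d e f t w y
  proof -
    have "z * t * (A * B * c * d) - \<alpha> * w * (A * e * f * d)
        = z * A * B * d * (c * t) - \<alpha> * A * f * d * (w * e)" by (simp add: mult_ac)
    also have "\<dots> = (z - \<alpha>) * (A * B * f * d)" unfolding that by (simp add: algebra_simps)
    finally show ?thesis .
  qed
  have e: "bqL_num k x b y q = (\<Sum>i\<le>k. qpoch (inverse q ^ k) q i * qpoch y q i * qpoch (x * q ^ Suc i) q (k - i)
      * (q ^ i / (qpoch q q i * qpoch (b * q) q i)))" for x y
    unfolding bqL_num_def by (intro sum.cong refl) simp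
  show ?thesis
    unfolding e sum_distrib_left sum_subtractf[symmetric]
  proof (intro sum.cong refl)
    fix i assume "i \<in> {..k}"
    then have "i \<le> k" by simp
    show "z * (1 - \<alpha> * q ^ k) * (qpoch (inverse q ^ k) q i * qpoch z q i * qpoch (\<alpha> / q * q ^ Suc i) q (k - i)
          * (q ^ i / (qpoch q q i * qpoch (b * q) q i)))
        - \<alpha> * (1 - z) * (qpoch (inverse q ^ k) q i * qpoch (z * q) q i * qpoch (\<alpha> * q ^ Suc i) q (k - i)
          * (q ^ i / (qpoch q q i * qpoch (b * q) q i)))
        = (z - \<alpha>) * (qpoch (inverse q ^ k) q i * qpoch z q i * qpoch (\<alpha> * q ^ Suc i) q (k - i)
          * (q ^ i / (qpoch q q i * qpoch (b * q) q i)))"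
      by (rule g[OF 1[OF \<open>i \<le> k\<close>] 2])
  qed
qed

text \<open>Connection coefficients between two polynomial bases in \<open>z\<close>, equivalent to
  a q-Chu-Vandermonde sum. Splitting off the factor \<open>z - c\<close> replaces \<open>c\<close>
  by \<open>c * q\<close>, so \<open>c\<close> is arbitrary in the induction.\<close>

lemma prod_diff_eq_sum_qpoch:
  fixes q :: "'a::real_normed_field"
  assumes q: "norm q < 1" "q \<noteq> 0"
  shows "(\<Prod>l<j. z - c * q ^ l)
    = (\<Sum>i\<le>j. qpoch (inverse q ^ j) q i / qpoch q q i * qpoch (c * q ^ i) q (j - i) * q ^ i * qpoch z q i)"
proof (induction j arbitrary: c)
  case (Suc j)
  define X where "X i = qpoch (inverse q ^ j) q i / qpoch q q i * qpoch (c * q ^ i) q (Suc j - i)" for i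
  define Y where "Y i = qpoch (inverse q ^ j) q i / qpoch q q i * qpoch (c * q ^ Suc i) q (j - i)" for i
  have XY: "X i = Y i * (1 - c * q ^ i)" if "i \<le> j" for i
  proof -
    have "Suc j - i = Suc (j - i)" using that by simp
    then show ?thesis unfolding X_def Y_def by (simp add: qpoch_Suc_shift mult.assoc mult.commute[of q])
  qed
  have X0: "X (Suc j) = 0" using qpoch_inverse_power_eq_0[OF q(2), of j "Suc j"] by (simp add: X_def)
  have "(\<Prod>l<Suc j. z - c * q ^ l) = (z - c) * (\<Prod>l<j. z - c * q * q ^ l)"
    by (simp only: prod.lessThan_Suc_shift power_0 mult_1_right power_Suc mult.assoc)
  also have "\<dots> = (\<Sum>i\<le>j. (z - c) * (Y i * q ^ i * qpoch z q i))"
    unfolding Suc.IH sum_distrib_left Y_def by (simp add: mult.assoc)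
  \<comment> \<open>Uses \<open>(z - c) * q ^ i = (1 - c * q ^ i) - (1 - z * q ^ i)\<close>: the
    first part restores the missing factor of \<open>X i\<close>, the second raises the basis
    element. The q-Pascal rule then recombines the two sums.\<close>
  also have "\<dots> = (\<Sum>i\<le>j. X i * qpoch z q i - Y i * qpoch z q (Suc i))"
    by (intro sum.cong refl) (auto simp: XY qpoch_Suc algebra_simps)
  also have "\<dots> = (\<Sum>i\<le>j. X i * qpoch z q i) + X (Suc j) * qpoch z q (Suc j) - (\<Sum>i\<le>j. Y i * qpoch z q (Suc i))"
    by (simp add: sum_subtractf X0)
  also have "\<dots> = (\<Sum>i\<le>Suc j. X i * qpoch z q i) - (\<Sum>i\<le>j. Y i * qpoch z q (Suc i))"
    by simp
  also have "\<dots> = X 0 + (\<Sum>i\<le>j. (X (Suc i) - Y i) * qpoch z q (Suc i))"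
    unfolding sum.atMost_Suc_shift by (simp add: left_diff_distrib sum_subtractf)
  also have "\<dots> = (\<Sum>i\<le>Suc j. qpoch (inverse q ^ Suc j) q i / qpoch q q i * qpoch (c * q ^ i) q (Suc j - i) * q ^ i * qpoch z q i)"
  proof -
    have "X (Suc i) - Y i = qpoch (inverse q ^ Suc j) q (Suc i) / qpoch q q (Suc i) * qpoch (c * q ^ Suc i) q (Suc j - Suc i) * q ^ Suc i" for i
    proof -
      have "X (Suc i) - Y i = (qpoch (inverse q ^ j) q (Suc i) / qpoch q q (Suc i) - qpoch (inverse q ^ j) q i / qpoch q q i)
          * qpoch (c * q ^ Suc i) q (j - i)"
        unfolding X_def Y_def by (simp add: left_diff_distrib)
      then show ?thesis unfolding q_pascal[OF q, symmetric] by simp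
    qed
    moreover have "X 0 = qpoch (inverse q ^ Suc j) q 0 / qpoch q q 0 * qpoch (c * q ^ 0) q (Suc j - 0) * q ^ 0 * qpoch z q 0"
      by (simp add: X_def)
    ultimately show ?thesis unfolding sum.atMost_Suc_shift by simp
  qed
  finally show ?case .
qed simp

text \<open>The finite q-binomial theorem in reversed order of summation. The q-Pascal rule reduces
  \<open>k + 1\<close> to \<open>k\<close> with \<open>\<alpha>\<close> replaced by
  \<open>\<alpha> * q\<close>.\<close>

lemma q_binomial_sum:
  fixes q :: "'a::real_normed_field"
  assumes q: "norm q < 1" "q \<noteq> 0"
  shows "q ^ (k * (k + 1) div 2) * (\<Sum>j\<le>k. qpoch (inverse q ^ k) q j / qpoch q q j * \<alpha> ^ (k - j))
    = (- 1) ^ k * qpoch (\<alpha> * q) q k"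
proof (induction k arbitrary: \<alpha>)
  case (Suc k)
  define c where "c j = qpoch (inverse q ^ k) q j / qpoch q q j" for j
  have c0: "c (Suc k) = 0" using qpoch_inverse_power_eq_0[OF q(2), of k "Suc k"] by (simp add: c_def)
  have "q ^ k * (\<Sum>j\<le>Suc k. qpoch (inverse q ^ Suc k) q j / qpoch q q j * \<alpha> ^ (Suc k - j))
      = q ^ k * (\<alpha> ^ Suc k + (\<Sum>j\<le>k. inverse q ^ Suc j * (c (Suc j) - c j) * \<alpha> ^ (k - j)))"
  proof -
    have "qpoch (inverse q ^ Suc k) q (Suc j) / qpoch q q (Suc j) = inverse q ^ Suc j * (c (Suc j) - c j)" for j
    proof -
      have "inverse q ^ Suc j * (q ^ Suc j * x) = x" for x using q by (simp add: field_simps)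
      then show ?thesis unfolding c_def q_pascal[OF q, symmetric] by (simp only: times_divide_eq_right[symmetric])
    qed
    then show ?thesis unfolding sum.atMost_Suc_shift by simp
  qed
  also have "\<dots> = q ^ k * ((\<Sum>j\<le>Suc k. inverse q ^ j * c j * \<alpha> ^ (Suc k - j)) - (\<Sum>j\<le>k. inverse q ^ Suc j * c j * \<alpha> ^ (k - j)))"
    unfolding sum.atMost_Suc_shift by (simp add: sum_subtractf algebra_simps c_def)
  also have "\<dots> = q ^ k * (\<Sum>j\<le>k. (\<alpha> - inverse q) * (inverse q ^ j * c j * \<alpha> ^ (k - j)))"
    by (simp add: c0 sum_subtractf[symmetric]) (auto intro!: sum.cong simp: Suc_diff_le algebra_simps)
  also have "\<dots> = (\<alpha> - inverse q) * (\<Sum>j\<le>k. c j * (\<alpha> * q) ^ (k - j))"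
  proof -
    have "q ^ k * inverse q ^ j = q ^ (k - j)" if "j \<le> k" for j
      using q that by (simp add: power_diff power_inverse divide_inverse)
    then have "q ^ k * ((\<alpha> - inverse q) * (inverse q ^ j * c j * \<alpha> ^ (k - j))) = (\<alpha> - inverse q) * (c j * (\<alpha> * q) ^ (k - j))"
      if "j \<le> k" for j
      using that by (simp add: power_mult_distrib mult_ac)
    then show ?thesis unfolding sum_distrib_left by (intro sum.cong) auto
  qed
  finally have *: "q ^ k * (\<Sum>j\<le>Suc k. qpoch (inverse q ^ Suc k) q j / qpoch q q j * \<alpha> ^ (Suc k - j))
      = (\<alpha> - inverse q) * (\<Sum>j\<le>k. c j * (\<alpha> * q) ^ (k - j))" .
  have tri: "Suc k * (Suc k + 1) div 2 = k * (k + 1) div 2 + Suc k"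
    by simp
  have "q ^ (Suc k * (Suc k + 1) div 2) * (\<Sum>j\<le>Suc k. qpoch (inverse q ^ Suc k) q j / qpoch q q j * \<alpha> ^ (Suc k - j))
      = q ^ (k * (k + 1) div 2) * q * (q ^ k * (\<Sum>j\<le>Suc k. qpoch (inverse q ^ Suc k) q j / qpoch q q j * \<alpha> ^ (Suc k - j)))"
    unfolding tri power_add power_Suc by (simp only: mult_ac)
  also have "\<dots> = q * (\<alpha> - inverse q) * (q ^ (k * (k + 1) div 2) * (\<Sum>j\<le>k. c j * (\<alpha> * q) ^ (k - j)))"
    unfolding * by (simp only: mult_ac)
  also have "\<dots> = q * (\<alpha> - inverse q) * ((- 1) ^ k * qpoch (\<alpha> * q * q) q k)"
    unfolding c_def Suc.IH ..
  also have "q * (\<alpha> - inverse q) = - (1 - \<alpha> * q)" using q by (simp add: field_simps)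
  also have "- (1 - \<alpha> * q) * ((- 1) ^ k * qpoch (\<alpha> * q * q) q k) = (- 1) ^ Suc k * qpoch (\<alpha> * q) q (Suc k)"
  proof -
    have "- A * (s * P) = - 1 * s * (A * P)" for A s P :: 'a by simp
    then show ?thesis unfolding qpoch_Suc_shift power_Suc .
  qed
  finally show ?case .
qed simp

text \<open>Each further factor \<open>1 - inverse q ^ j * q ^ i\<close> splits the sum into two of
  the same kind, since multiplying \<open>\<alpha> ^ (k - j)\<close> by \<open>inverse q ^ j\<close>
  only replaces \<open>\<alpha>\<close> by \<open>\<alpha> * q\<close> up to a constant.\<close>

lemma q_binomial_sum_shift:
  fixes q :: "'a::real_normed_field"
  assumes q: "norm q < 1" "q \<noteq> 0" and "i \<le> k"
  shows "q ^ (k * (k + 1) div 2) * (\<Sum>j\<le>k. qpoch (inverse q ^ k) q j / qpoch q q j * \<alpha> ^ (k - j) * qpoch (inverse q ^ j) q i)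
    = (- 1) ^ k * (qpoch (inverse q ^ k) q i * qpoch (\<alpha> * q ^ Suc i) q (k - i))"
  using \<open>i \<le> k\<close>
proof (induction i arbitrary: \<alpha>)
  case 0
  then show ?case using q_binomial_sum[OF q, of k \<alpha>] by simp
next
  case (Suc i)
  let ?H = "\<lambda>i \<alpha>. (\<Sum>j\<le>k. qpoch (inverse q ^ k) q j / qpoch q q j * \<alpha> ^ (k - j) * qpoch (inverse q ^ j) q i)"
  have e: "\<alpha> ^ (k - j) * inverse q ^ j = inverse q ^ k * (\<alpha> * q) ^ (k - j)" if "j \<le> k" for j
    using q that by (simp add: power_mult_distrib power_diff power_inverse field_simps)
  have "?H (Suc i) \<alpha> = ?H i \<alpha> - inverse q ^ k * q ^ i * ?H i (\<alpha> * q)"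
    unfolding sum_distrib_left sum_subtractf[symmetric]
  proof (intro sum.cong refl)
    fix j assume "j \<in> {..k}"
    then have j: "j \<le> k" by simp
    have "A * p * (Z * (1 - I * y)) = A * p * Z - K * y * (A * P * Z)" if "p * I = K * P" for A p Z I y K P :: 'a
    proof -
      have "A * p * (Z * (1 - I * y)) = A * p * Z - A * Z * y * (p * I)" by (simp add: algebra_simps)
      then show ?thesis unfolding that by (simp add: mult_ac)
    qed
    from this[OF e[OF j]]
    show "qpoch (inverse q ^ k) q j / qpoch q q j * \<alpha> ^ (k - j) * qpoch (inverse q ^ j) q (Suc i)
        = qpoch (inverse q ^ k) q j / qpoch q q j * \<alpha> ^ (k - j) * qpoch (inverse q ^ j) q i
         - inverse q ^ k * q ^ i * (qpoch (inverse q ^ k) q j / qpoch q q j * (\<alpha> * q) ^ (k - j) * qpoch (inverse q ^ j) q i)"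
      unfolding qpoch_Suc .
  qed
  then have "q ^ (k * (k + 1) div 2) * ?H (Suc i) \<alpha> = q ^ (k * (k + 1) div 2) * ?H i \<alpha>
      - inverse q ^ k * q ^ i * (q ^ (k * (k + 1) div 2) * ?H i (\<alpha> * q))"
    by (simp only: right_diff_distrib mult.left_commute)
  also have "\<dots> = (- 1) ^ k * (qpoch (inverse q ^ k) q i * qpoch (\<alpha> * q ^ Suc i) q (k - i))
      - inverse q ^ k * q ^ i * ((- 1) ^ k * (qpoch (inverse q ^ k) q i * qpoch (\<alpha> * q * q ^ Suc i) q (k - i)))"
    using Suc by simp
  also have "\<dots> = (- 1) ^ k * (qpoch (inverse q ^ k) q (Suc i) * qpoch (\<alpha> * q ^ Suc (Suc i)) q (k - Suc i))"
  proof -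
    have k: "k - i = Suc (k - Suc i)" "Suc (Suc i) + (k - Suc i) = Suc k" using Suc.prems by auto
    have 1: "qpoch (\<alpha> * q ^ Suc i) q (k - i) = (1 - \<alpha> * q ^ Suc i) * qpoch (\<alpha> * q ^ Suc (Suc i)) q (k - Suc i)"
      unfolding k qpoch_Suc_shift by (simp add: mult_ac)
    have 2: "qpoch (\<alpha> * q * q ^ Suc i) q (k - i) = qpoch (\<alpha> * q ^ Suc (Suc i)) q (k - Suc i) * (1 - \<alpha> * q ^ Suc k)"
    proof -
      have "\<alpha> * q * q ^ Suc i = \<alpha> * q ^ Suc (Suc i)" by (simp add: mult_ac)
      note 1 = this
      have 2: "\<alpha> * q ^ Suc (Suc i) * q ^ (k - Suc i) = \<alpha> * q ^ Suc k"
        using k(2) by (simp only: mult.assoc power_add[symmetric])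
      show ?thesis unfolding k(1) qpoch_Suc 1 2 ..
    qed
    have g: "s * (Z * ((1 - \<alpha> * (q * y)) * p)) - K * y * (s * (Z * (p * (1 - \<alpha> * (q * Q))))) = s * (Z * (1 - K * y) * p)"
      if "K * Q = 1" for s Z y p K Q
      using that by algebra
    show ?thesis unfolding 1 2 unfolding qpoch_Suc[of "inverse q ^ k"] power_Suc[of q i] power_Suc[of q k]
      by (rule g) (use q in \<open>simp add: power_inverse\<close>)
  qed
  finally show ?case .
qed

text \<open>The products in \<open>bqL_alt\<close> are expanded by the connection formula; after
  interchanging the sums, the inner one is a shifted q-binomial sum. The new representation is
  adapted to scaling \<open>z\<close>, the original one to the three-term recurrence.\<close>

lemma bqL_num_eq_alt:
  fixes q :: "'a::real_normed_field"
  assumes q: "norm q < 1" "q \<noteq> 0" and b: "\<And>i. qpoch (b * q) q i \<noteq> 0"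
  shows "bqL_num k \<alpha> b z q = (- 1) ^ k * q ^ (k * (k + 1) div 2) * bqL_alt k \<alpha> b z q"
proof -
  define h where "h j = qpoch (inverse q ^ k) q j / qpoch q q j * \<alpha> ^ (k - j)" for j
  define e where "e i = q ^ i * qpoch z q i / (qpoch q q i * qpoch (b * q) q i)" for i
  have "bqL_alt k \<alpha> b z q = (\<Sum>j\<le>k. \<Sum>i\<le>k. h j * qpoch (inverse q ^ j) q i * e i)"
    unfolding bqL_alt_def
  proof (intro sum.cong refl)
    fix j assume "j \<in> {..k}"
    then have j: "j \<le> k" by simp
    have "(\<Prod>l<j. z - b * q ^ Suc l) = (\<Prod>l<j. z - b * q * q ^ l)" by (simp add: mult.assoc)
    also have "\<dots> = (\<Sum>i\<le>j. qpoch (inverse q ^ j) q i / qpoch q q i * qpoch (b * q * q ^ i) q (j - i) * q ^ i * qpoch z q i)"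
      by (rule prod_diff_eq_sum_qpoch[OF q])
    also have "\<dots> = (\<Sum>i\<le>j. qpoch (b * q) q j * (qpoch (inverse q ^ j) q i * e i))"
    proof (intro sum.cong refl)
      fix i assume "i \<in> {..j}"
      then have "qpoch (b * q) q j = qpoch (b * q) q i * qpoch (b * q * q ^ i) q (j - i)"
        using qpoch_add[of "b * q" q i "j - i"] by simp
      then show "qpoch (inverse q ^ j) q i / qpoch q q i * qpoch (b * q * q ^ i) q (j - i) * q ^ i * qpoch z q i
         = qpoch (b * q) q j * (qpoch (inverse q ^ j) q i * e i)"
        unfolding e_def using b[of i] by simp
    qed
    also have "\<dots> = (\<Sum>i\<le>k. qpoch (b * q) q j * (qpoch (inverse q ^ j) q i * e i))"
      using j by (intro sum.mono_neutral_left) (auto simp: qpoch_inverse_power_eq_0[OF q(2)])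
    finally show "qpoch (inverse q ^ k) q j / (qpoch q q j * qpoch (b * q) q j) * \<alpha> ^ (k - j) * (\<Prod>l<j. z - b * q ^ Suc l)
        = (\<Sum>i\<le>k. h j * qpoch (inverse q ^ j) q i * e i)"
    proof -
      have g: "A / (B * C) * D * (C * (x * y)) = A / B * D * x * y" if "C \<noteq> 0" for A B C D x y :: 'a
        using that by simp
      assume *: "(\<Prod>l<j. z - b * q ^ Suc l) = (\<Sum>i\<le>k. qpoch (b * q) q j * (qpoch (inverse q ^ j) q i * e i))"
      show ?thesis unfolding * sum_distrib_left h_def
        by (intro sum.cong refl) (rule g[OF b])
    qed
  qed
  also have "\<dots> = (\<Sum>i\<le>k. (\<Sum>j\<le>k. h j * qpoch (inverse q ^ j) q i) * e i)"
    by (subst sum.swap) (simp add: sum_distrib_right)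
  finally have "q ^ (k * (k + 1) div 2) * bqL_alt k \<alpha> b z q
     = (\<Sum>i\<le>k. (q ^ (k * (k + 1) div 2) * (\<Sum>j\<le>k. h j * qpoch (inverse q ^ j) q i)) * e i)"
    by (simp only: sum_distrib_left[of "q ^ (k * (k + 1) div 2)" "\<lambda>i. (\<Sum>j\<le>k. h j * qpoch (inverse q ^ j) q i) * e i" "{..k}"] mult.assoc)
  also have "\<dots> = (\<Sum>i\<le>k. (- 1) ^ k * (qpoch (inverse q ^ k) q i * qpoch (\<alpha> * q ^ Suc i) q (k - i)) * e i)"
    unfolding h_def by (intro sum.cong refl arg_cong2[where f = times] q_binomial_sum_shift[OF q]) simp
  also have "\<dots> = (- 1) ^ k * bqL_num k \<alpha> b z q"
    unfolding bqL_num_def sum_distrib_left e_def by (intro sum.cong refl) simp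
  finally have "q ^ (k * (k + 1) div 2) * bqL_alt k \<alpha> b z q = (- 1) ^ k * bqL_num k \<alpha> b z q" .
  moreover have "(- 1) ^ k * ((- 1) ^ k * x) = x" for x :: 'a
    by (simp flip: mult.assoc power_mult_distrib)
  ultimately show ?thesis by (simp only: mult.assoc)
qed

text \<open>Term by term in the second representation: replacing \<open>z\<close> by
  \<open>z * q\<close> moves the window of the product \<open>z - b * q ^ l\<close> by one place,
  and the power of \<open>q\<close> that appears turns powers of \<open>\<alpha>\<close> into powers
  of \<open>\<alpha> * q\<close>.\<close>

lemma bqL_num_shift:
  fixes q :: "'a::real_normed_field"
  assumes q: "norm q < 1" "q \<noteq> 0" and b: "\<And>i. qpoch (b * q) q i \<noteq> 0"
  shows "b * bqL_num k \<alpha> b (z * q) q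
    = (b - z) * bqL_num k \<alpha> b z q + z * inverse q ^ k * bqL_num k (\<alpha> * q) b (z * q) q"
proof -
  have "b * bqL_alt k \<alpha> b (z * q) q
    = (b - z) * bqL_alt k \<alpha> b z q + z * inverse q ^ k * bqL_alt k (\<alpha> * q) b (z * q) q"
    unfolding bqL_alt_def sum_distrib_left sum.distrib[symmetric]
  proof (intro sum.cong refl)
    fix j assume "j \<in> {..k}"
    then have j: "j \<le> k" by simp
    define M where "M = (\<Prod>l<j. z - b * q ^ l)"
    have 1: "(\<Prod>l<j. z * q - b * q ^ Suc l) = q ^ j * M"
    proof -
      have "(\<Prod>l<j. z * q - b * q ^ Suc l) = (\<Prod>l<j. q * (z - b * q ^ l))" by (simp add: algebra_simps)
      then show ?thesis unfolding M_def by (simp add: prod.distrib)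
    qed
    have 2: "(z - b) * (\<Prod>l<j. z - b * q ^ Suc l) = M * (z - b * q ^ j)"
      using prod.lessThan_Suc_shift[of "\<lambda>l. z - b * q ^ l" j] unfolding M_def by simp
    have 3: "inverse q ^ k * (\<alpha> * q) ^ (k - j) * q ^ j = \<alpha> ^ (k - j)"
      using q j by (simp add: power_mult_distrib power_diff power_inverse field_simps)
    have g: "b * (K * a * (Q * M)) = (b - z) * (K * a * N) + z * I * (K * a' * (Q * M))"
      if "(z - b) * N = M * (z - b * Q)" "I * a' * Q = a" for K a Q N I a' :: 'a
    proof -
      have "(b - z) * (K * a * N) + z * I * (K * a' * (Q * M)) = z * K * M * (I * a' * Q) - K * a * ((z - b) * N)"
        by (simp add: algebra_simps)
      also have "\<dots> = b * (K * a * (Q * M))" unfolding that by (simp add: algebra_simps)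
      finally show ?thesis by simp
    qed
    show "b * (qpoch (inverse q ^ k) q j / (qpoch q q j * qpoch (b * q) q j) * \<alpha> ^ (k - j) * (\<Prod>l<j. z * q - b * q ^ Suc l))
       = (b - z) * (qpoch (inverse q ^ k) q j / (qpoch q q j * qpoch (b * q) q j) * \<alpha> ^ (k - j) * (\<Prod>l<j. z - b * q ^ Suc l))
        + z * inverse q ^ k * (qpoch (inverse q ^ k) q j / (qpoch q q j * qpoch (b * q) q j) * (\<alpha> * q) ^ (k - j)
          * (\<Prod>l<j. z * q - b * q ^ Suc l))"
      unfolding 1 by (rule g[OF 2 3])
  qed
  moreover have "b * (s * x) = (b - z) * (s * y) + z * inverse q ^ k * (s * w)"
    if "b * x = (b - z) * y + z * inverse q ^ k * w" for s x y w :: 'a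
  proof -
    have "b * (s * x) = s * (b * x)" by (simp add: mult_ac)
    then show ?thesis unfolding that by (simp add: algebra_simps)
  qed
  ultimately show ?thesis unfolding bqL_num_eq_alt[OF q b] by blast
qed

text \<open>Comparison of the coefficients of \<open>qpoch z q i\<close>. For \<open>n = 0\<close>
  the term with the truncated index \<open>n - 1\<close> carries the factor
  \<open>1 - q ^ n = 0\<close>. The form with \<open>z - 1\<close> on the left is chosen because in
  the application it is a multiple of \<open>Z + 1\<close>, up to a constant.\<close>

lemma bqL_num_three_term:
  fixes q :: "'a::real_normed_field"
  assumes q: "norm q < 1" "q \<noteq> 0" and b: "\<And>i. qpoch (b * q) q i \<noteq> 0"
  shows "(z - 1) * bqL_num n \<alpha> b z q = (1 - b * q ^ Suc n) * bqL_num (Suc n) \<alpha> b z q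
     - ((1 - \<alpha> * q ^ Suc n) * (1 - b * q ^ Suc n) - \<alpha> * b * q ^ Suc n * (1 - q ^ n)) * bqL_num n \<alpha> b z q
     - \<alpha> * b * q ^ Suc n * (1 - q ^ n) * (1 - \<alpha> * q ^ n) * bqL_num (n - 1) \<alpha> b z q"
proof -
  define g where "g n i = qpoch (inverse q ^ n) q i * qpoch (\<alpha> * q ^ Suc i) q (n - i) / (qpoch q q i * qpoch (b * q) q i) * q ^ i" for n i
  define Z where "Z i = qpoch z q i" for i
  let ?Q = "q ^ n"
  define S where "S = (1 - \<alpha> * q ^ Suc n) * (1 - b * q ^ Suc n) - \<alpha> * b * q ^ Suc n * (1 - q ^ n)"
  define T where "T = \<alpha> * b * q ^ Suc n * (1 - q ^ n) * (1 - \<alpha> * q ^ n)"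
  have G: "bqL_num n \<alpha> b z q = (\<Sum>i\<le>n. g n i * Z i)" for n
    unfolding bqL_num_def g_def Z_def by (intro sum.cong refl) simp
  have nz: "qpoch q q i \<noteq> 0" "qpoch (b * q) q i \<noteq> 0" "1 - q ^ Suc i \<noteq> 0" "1 - b * q ^ Suc i \<noteq> 0" for i
    using qpoch_self_nonzero[OF q(1), of i] qpoch_self_nonzero[OF q(1), of "Suc i"] b[of i] b[of "Suc i"]
    by (auto simp: qpoch_Suc mult.assoc)
  have coeff: "(inverse q ^ i - 1) * g n i - (if i = 0 then 0 else inverse q ^ (i - 1) * g n (i - 1))
      = (1 - b * q ^ Suc n) * g (Suc n) i - S * g n i - T * g (n - 1) i" if "i \<le> n" for i
  proof -
    let ?y = "q ^ i"
    have ne: "q * ?Q - ?y \<noteq> 0" "?y \<noteq> 0"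
      using power_eq_iff_norm_less_1[OF q, of "Suc n" i] that q by auto
    define E where "E = qpoch (inverse q ^ n) q i * qpoch (\<alpha> * q ^ Suc i) q (n - i) / (qpoch q q i * qpoch (b * q) q i)"
    have g1: "g n i = E * ?y" by (simp add: g_def E_def)
    have g2: "g (Suc n) i = E * ?y * ((q * ?Q - 1) * (1 - \<alpha> * (q * ?Q)) / (q * ?Q - ?y))"
    proof -
      have "Suc n - i = Suc (n - i)" "Suc i + (n - i) = Suc n" using that by auto
      then have "qpoch (\<alpha> * q ^ Suc i) q (Suc n - i) = qpoch (\<alpha> * q ^ Suc i) q (n - i) * (1 - \<alpha> * q ^ Suc n)"
        by (simp only: qpoch_Suc mult.assoc power_add[symmetric])
      moreover have "qpoch (inverse q ^ Suc n) q i = (q * ?Q - 1) * qpoch (inverse q ^ n) q i / (q * ?Q - ?y)"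
        using qpoch_inverse_power_step[OF q(2), of n i] ne by (simp add: eq_divide_eq)
      moreover have "F * D / G * (p * B) / e * y = D * p / e * y * (F * B / G)" for F D G p B e y :: 'a
        by (simp add: mult_ac)
      ultimately show ?thesis unfolding g_def E_def by (simp only: power_Suc)
    qed
    have g3: "T * g (n - 1) i = - (\<alpha> * b * (q * ?Q) * (?Q - ?y)) * (E * ?y)"
    proof (cases "i = n")
      case True
      then show ?thesis
      proof (cases n)
        case (Suc n')
        have "g (n - 1) i = 0" using qpoch_inverse_power_eq_0[OF q(2), of n' i] True Suc by (simp add: g_def)
        then show ?thesis using True by simp
      qed (simp add: T_def True)
    next
      case False
      then obtain n' where n': "n = Suc n'" "i \<le> n'" using \<open>i \<le> n\<close> by (cases n) auto
      have "n - i = Suc (n' - i)" "Suc i + (n' - i) = n" using n' by auto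
      then have 1: "qpoch (\<alpha> * q ^ Suc i) q (n - i) = qpoch (\<alpha> * q ^ Suc i) q (n' - i) * (1 - \<alpha> * ?Q)"
        by (simp only: qpoch_Suc mult.assoc power_add[symmetric])
      have 2: "qpoch (inverse q ^ n) q i * (?Q - ?y) = (?Q - 1) * qpoch (inverse q ^ n') q i"
        using qpoch_inverse_power_step[OF q(2), of n' i] n' by simp
      have "T * g (n - 1) i = - (\<alpha> * b * (q * ?Q)) * ((?Q - 1) * qpoch (inverse q ^ n') q i)
           * (qpoch (\<alpha> * q ^ Suc i) q (n' - i) * (1 - \<alpha> * ?Q)) / (qpoch q q i * qpoch (b * q) q i) * ?y"
      proof -
        have "x * (1 - Q) * a * (m * p / e * y) = - x * ((Q - 1) * m) * (p * a) / e * y" for x Q a m p e y :: 'a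
          by (simp add: algebra_simps diff_divide_distrib)
        moreover have "n - 1 = n'" using n' by simp
        ultimately show ?thesis unfolding T_def g_def power_Suc[of q n] by simp
      qed
      then show ?thesis unfolding 1[symmetric] 2[symmetric] E_def by simp
    qed
    have g4: "(if i = 0 then 0 else inverse q ^ (i - 1) * g n (i - 1))
       = E * ((1 - ?y) * (1 - b * ?y) * (1 - \<alpha> * ?y) * (q * ?Q) / (q * ?Q - ?y))"
    proof (cases i)
      case (Suc j)
      have j: "n - j = Suc (n - i)" using Suc that by simp
      have 1: "qpoch (\<alpha> * q ^ Suc j) q (n - j) = (1 - \<alpha> * ?y) * qpoch (\<alpha> * q ^ Suc i) q (n - i)"
        unfolding j qpoch_Suc_shift Suc by (simp add: mult_ac)
      have 2: "qpoch (inverse q ^ n) q i = qpoch (inverse q ^ n) q j * ((q * ?Q - ?y) / (q * ?Q))"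
      proof -
        have "1 - inverse q ^ n * q ^ j = (q * ?Q - ?y) / (q * ?Q)"
          unfolding Suc using q by (simp add: field_simps)
        then show ?thesis unfolding Suc qpoch_Suc by simp
      qed
      have 3: "qpoch q q i = qpoch q q j * (1 - ?y)" "qpoch (b * q) q i = qpoch (b * q) q j * (1 - b * ?y)"
        unfolding Suc qpoch_Suc by (simp_all add: mult.assoc)
      have 4: "1 - ?y \<noteq> 0" "1 - b * ?y \<noteq> 0" "q * ?Q \<noteq> 0" using nz[of j] q by (simp_all add: Suc)
      have "inverse q ^ j * q ^ j = 1" using q by (simp add: power_inverse)
      then have "inverse q ^ j * g n j = qpoch (inverse q ^ n) q j * qpoch (\<alpha> * q ^ Suc j) q (n - j) / (qpoch q q j * qpoch (b * q) q j)"
        unfolding g_def by (simp only: mult.left_commute[of "inverse q ^ j"] mult_1_right)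
      then show ?thesis unfolding E_def 1 2 3 using 4 ne Suc by simp
    qed simp
    have key: "(1 / y - 1) * y - (1 - y) * (1 - b * y) * (1 - \<alpha> * y) * (q * Q) / (q * Q - y)
        = (1 - b * (q * Q)) * y * ((q * Q - 1) * (1 - \<alpha> * (q * Q)) / (q * Q - y))
          - ((1 - \<alpha> * (q * Q)) * (1 - b * (q * Q)) - \<alpha> * b * (q * Q) * (1 - Q)) * y
          + \<alpha> * b * (q * Q) * (Q - y) * y"
      if "y \<noteq> 0" "q * Q - y \<noteq> 0" for y Q
    proof -
      define d where "d = q * Q - y"
      have d: "d \<noteq> 0" "q * Q = d + y" using that by (auto simp: d_def)
      have l: "(1 / y - 1) * y = 1 - y" using that by (simp add: field_simps)
      have "(1 - y) * d - (1 - y) * (1 - b * y) * (1 - \<alpha> * y) * (d + y)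
        = (1 - b * (d + y)) * y * ((d + y - 1) * (1 - \<alpha> * (d + y)))
         - ((1 - \<alpha> * (d + y)) * (1 - b * (d + y)) - \<alpha> * b * (d + y) * (1 - Q)) * y * d
         + \<alpha> * b * (d + y) * (Q - y) * y * d"
        by (simp add: algebra_simps)
      then have "((1 - y) * d - (1 - y) * (1 - b * y) * (1 - \<alpha> * y) * (d + y)) / d
        = ((1 - b * (d + y)) * y * ((d + y - 1) * (1 - \<alpha> * (d + y)))
         - ((1 - \<alpha> * (d + y)) * (1 - b * (d + y)) - \<alpha> * b * (d + y) * (1 - Q)) * y * d
         + \<alpha> * b * (d + y) * (Q - y) * y * d) / d" by simp
      then show ?thesis unfolding l d(2) using d(1) by (simp add: add_divide_distrib diff_divide_distrib)
    qed
    have i: "inverse q ^ i = 1 / ?y" by (simp add: power_inverse divide_inverse)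
    have "(inverse q ^ i - 1) * g n i - (if i = 0 then 0 else inverse q ^ (i - 1) * g n (i - 1))
       = E * ((1 / ?y - 1) * ?y - (1 - ?y) * (1 - b * ?y) * (1 - \<alpha> * ?y) * (q * ?Q) / (q * ?Q - ?y))"
      unfolding g1 g4 i by (simp only: right_diff_distrib mult.left_commute[of E] times_divide_eq_right)
    also have "\<dots> = (1 - b * q ^ Suc n) * g (Suc n) i - S * g n i - T * g (n - 1) i"
    proof -
      have e: "E * (x * y * w - s * y + t * y) = x * (E * y * w) - s * (E * y) - (- t) * (E * y)" for x y w s t
        by (simp add: algebra_simps)
      show ?thesis unfolding key[OF ne(2,1)] g1 g2 g3 S_def power_Suc by (rule e)
    qed
    finally show ?thesis .
  qed
  have last: "- (inverse q ^ n * g n n) = (1 - b * q ^ Suc n) * g (Suc n) (Suc n)"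
  proof -
    have 1: "qpoch (inverse q ^ Suc n) q (Suc n) = (1 - inverse q ^ Suc n) * qpoch (inverse q ^ n) q n"
      by (rule qpoch_inverse_power_shift[OF q(2)])
    have 2: "(1 - inverse q ^ Suc n) * q ^ Suc n = - (1 - q ^ Suc n)" using q by (simp add: field_simps)
    have "(1 - b * q ^ Suc n) * g (Suc n) (Suc n) = (1 - b * q ^ Suc n) * (((1 - inverse q ^ Suc n) * q ^ Suc n) * qpoch (inverse q ^ n) q n)
         / ((qpoch q q n * (1 - q ^ Suc n)) * (qpoch (b * q) q n * (1 - b * q ^ Suc n)))"
      unfolding g_def 1 unfolding qpoch_Suc[of q q n] qpoch_Suc[of "b * q" q n] by (simp add: mult_ac)
    also have "\<dots> = - (qpoch (inverse q ^ n) q n / (qpoch q q n * qpoch (b * q) q n))"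
    proof -
      have "A * (- B * C) / ((D * B) * (E * A)) = - (C / (D * E))" if "A \<noteq> 0" "B \<noteq> 0" for A B C D E :: 'a
        using that by simp
      then show ?thesis unfolding 2 using nz[of n] by blast
    qed
    also have "\<dots> = - (inverse q ^ n * g n n)" unfolding g_def using q by (simp add: power_inverse)
    finally show ?thesis by simp
  qed
  have shift: "(\<Sum>i\<le>n. f i * Z (Suc i)) = (\<Sum>i\<le>n. (if i = 0 then 0 else f (i - 1)) * Z i) + f n * Z (Suc n)" for f
    using sum.atMost_Suc_shift[of "\<lambda>k. (if k = 0 then 0 else f (k - 1)) * Z k" n] by simp
  \<comment> \<open>Since \<open>inverse q ^ i * (1 - z * q ^ i) = inverse q ^ i - z\<close>,
    multiplication by \<open>z\<close> maps the basis element of index \<open>i\<close> to those of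
    index \<open>i\<close> and \<open>i + 1\<close>.\<close>
  have zZ: "(z - 1) * Z i = (inverse q ^ i - 1) * Z i - inverse q ^ i * Z (Suc i)" for i
  proof -
    have "inverse q ^ i * q ^ i = 1" using q by (simp add: power_inverse)
    then have "inverse q ^ i * (1 - z * q ^ i) = inverse q ^ i - z" by (simp add: right_diff_distrib mult.left_commute)
    then have "inverse q ^ i * Z (Suc i) = Z i * (inverse q ^ i - z)" unfolding Z_def qpoch_Suc by (simp only: mult.left_commute[of "inverse q ^ i"])
    then show ?thesis by (simp add: algebra_simps)
  qed
  have "(z - 1) * bqL_num n \<alpha> b z q = (\<Sum>i\<le>n. g n i * ((z - 1) * Z i))"
    unfolding G sum_distrib_left by (intro sum.cong refl) (simp only: mult_ac)
  also have "\<dots> = (\<Sum>i\<le>n. (inverse q ^ i - 1) * g n i * Z i) - (\<Sum>i\<le>n. (inverse q ^ i * g n i) * Z (Suc i))"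
    unfolding zZ sum_subtractf[symmetric] by (intro sum.cong refl) (simp add: algebra_simps)
  also have "\<dots> = (\<Sum>i\<le>n. ((inverse q ^ i - 1) * g n i - (if i = 0 then 0 else inverse q ^ (i - 1) * g n (i - 1))) * Z i)
       - inverse q ^ n * g n n * Z (Suc n)"
    unfolding shift by (simp add: sum_subtractf left_diff_distrib)
  also have "\<dots> = (\<Sum>i\<le>n. ((1 - b * q ^ Suc n) * g (Suc n) i - S * g n i - T * g (n - 1) i) * Z i)
       + (1 - b * q ^ Suc n) * g (Suc n) (Suc n) * Z (Suc n)"
    unfolding last[symmetric] by (simp add: coeff)
  also have "\<dots> = (1 - b * q ^ Suc n) * (\<Sum>i\<le>Suc n. g (Suc n) i * Z i) - S * (\<Sum>i\<le>n. g n i * Z i) - T * (\<Sum>i\<le>n. g (n - 1) i * Z i)"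
    by (simp add: sum_subtractf left_diff_distrib sum_distrib_left distrib_left mult.assoc)
  also have "T * (\<Sum>i\<le>n. g (n - 1) i * Z i) = T * (\<Sum>i\<le>n - 1. g (n - 1) i * Z i)"
  proof (cases n)
    case (Suc n')
    have "g n' (Suc n') = 0" using qpoch_inverse_power_eq_0[OF q(2), of n' "Suc n'"] by (simp add: g_def)
    then show ?thesis using Suc by simp
  qed simp
  finally show ?thesis unfolding G[symmetric] S_def T_def .
qed

subsection \<open>Jackson integrals\<close>

lemma tannery_sequence:
  fixes a :: "nat \<Rightarrow> nat \<Rightarrow> complex"
  assumes "\<And>k. (\<lambda>n. a k n) \<longlonglongrightarrow> b k" and "\<And>k n. norm (a k n) \<le> M k" and "summable M"
  shows "(\<lambda>n. suminf (\<lambda>k. a k n)) \<longlonglongrightarrow> suminf b"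
proof -
  have "eventually (\<lambda>(k, n). norm (a k n) \<le> M k) (at_top \<times>\<^sub>F sequentially)"
    by (rule always_eventually) (auto simp: assms(2))
  from tannerys_theorem[OF assms(1) this assms(3)] show ?thesis by simp
qed

text \<open>The majorant is a product of two summable sequences, so the partial sums over
  \<open>i\<close> are dominated by \<open>suminf v * w s\<close> and Tannery's theorem applies to
  the sum over \<open>s\<close>.\<close>

lemma sums_swap:
  fixes h :: "nat \<Rightarrow> nat \<Rightarrow> complex"
  assumes h: "\<And>i s. norm (h i s) \<le> v i * w s" and v: "summable v" and w: "summable w"
    and v0: "\<And>i. v i \<ge> 0" and w0: "\<And>s. w s \<ge> 0"
  shows "(\<lambda>i. \<Sum>s. h i s) sums (\<Sum>s. \<Sum>i. h i s)"
proof -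
  have s1: "summable (\<lambda>s. h i s)" for i
    by (rule summable_comparison_test'[of "\<lambda>s. v i * w s"]) (auto intro: summable_mult w h)
  have s2: "summable (\<lambda>i. h i s)" for s
    by (rule summable_comparison_test'[of "\<lambda>i. v i * w s"]) (auto intro: summable_mult2 v h)
  have "(\<lambda>n. \<Sum>s. \<Sum>i<n. h i s) \<longlonglongrightarrow> (\<Sum>s. \<Sum>i. h i s)"
  proof (rule tannery_sequence[where M = "\<lambda>s. suminf v * w s"])
    show "(\<lambda>n. \<Sum>i<n. h i s) \<longlonglongrightarrow> (\<Sum>i. h i s)" for s
      by (rule summable_LIMSEQ[OF s2])
    show "norm (\<Sum>i<n. h i s) \<le> suminf v * w s" for s n
    proof -
      have "norm (\<Sum>i<n. h i s) \<le> (\<Sum>i<n. v i * w s)" by (rule sum_norm_le) (rule h)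
      also have "\<dots> = (\<Sum>i<n. v i) * w s" by (simp add: sum_distrib_right)
      also have "\<dots> \<le> suminf v * w s" by (intro mult_right_mono sum_le_suminf v w0) (auto simp: v0)
      finally show ?thesis .
    qed
    show "summable (\<lambda>s. suminf v * w s)" by (intro summable_mult w)
  qed
  moreover have "(\<Sum>s. \<Sum>i<n. h i s) = (\<Sum>i<n. \<Sum>s. h i s)" for n
    by (rule suminf_sum) (rule s1)
  ultimately show ?thesis by (simp add: sums_def)
qed

text \<open>\<open>1 - q\<close> times this is the usual \<open>q\<close>-integral from \<open>a\<close> to \<open>b\<close>.\<close>

definition jint :: "complex \<Rightarrow> complex \<Rightarrow> complex \<Rightarrow> (complex \<Rightarrow> complex) \<Rightarrow> complex" where
  "jint q a b F = b * (\<Sum>s. q ^ s * F (b * q ^ s)) - a * (\<Sum>s. q ^ s * F (a * q ^ s))"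

definition jbounded :: "complex \<Rightarrow> complex \<Rightarrow> (complex \<Rightarrow> complex) \<Rightarrow> bool" where
  "jbounded q b F \<longleftrightarrow> (\<exists>C. \<forall>s. norm (F (b * q ^ s)) \<le> C)"

lemma jbounded_mult:
  assumes "jbounded q b F" "jbounded q b G"
  shows "jbounded q b (\<lambda>z. F z * G z)"
proof -
  obtain C D where C: "\<And>s. norm (F (b * q ^ s)) \<le> C" and D: "\<And>s. norm (G (b * q ^ s)) \<le> D"
    using assms by (auto simp: jbounded_def)
  have "norm (F (b * q ^ s) * G (b * q ^ s)) \<le> C * D" for s
    unfolding norm_mult using C[of s] D[of s]
    by (intro mult_mono) (auto intro: order_trans[OF norm_ge_zero])
  then show ?thesis by (auto simp: jbounded_def)
qed

lemma jbounded_add: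
  assumes "jbounded q b F" "jbounded q b G"
  shows "jbounded q b (\<lambda>z. F z + G z)"
proof -
  obtain C D where C: "\<And>s. norm (F (b * q ^ s)) \<le> C" and D: "\<And>s. norm (G (b * q ^ s)) \<le> D"
    using assms by (auto simp: jbounded_def)
  have "norm (F (b * q ^ s) + G (b * q ^ s)) \<le> C + D" for s
    using C[of s] D[of s] by (rule norm_triangle_mono)
  then show ?thesis by (auto simp: jbounded_def)
qed

lemma jbounded_const [simp]: "jbounded q b (\<lambda>_. c)"
  by (auto simp: jbounded_def)

lemma jbounded_ident:
  assumes "norm q < 1" shows "jbounded q b (\<lambda>z. z)"
proof -
  have "norm (b * q ^ s) \<le> norm b" for s
    using assms by (simp add: norm_mult norm_power mult_left_le power_le_one)
  then show ?thesis by (auto simp: jbounded_def)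
qed

lemma jbounded_sum:
  "(\<And>i. i \<in> A \<Longrightarrow> jbounded q b (F i)) \<Longrightarrow> jbounded q b (\<lambda>z. \<Sum>i\<in>A. F i z)"
  by (induction A rule: infinite_finite_induct) (auto intro!: jbounded_add)

lemma jbounded_prod:
  "(\<And>i. i \<in> A \<Longrightarrow> jbounded q b (F i)) \<Longrightarrow> jbounded q b (\<lambda>z. \<Prod>i\<in>A. F i z)"
  by (induction A rule: infinite_finite_induct) (auto intro!: jbounded_mult)

lemma jbounded_qpoch_inf:
  assumes "norm q < 1" shows "jbounded q b (\<lambda>z. qpoch_inf (c * z) q)"
proof -
  obtain C where "\<And>i. norm (qpoch_inf (c * b * q ^ i) q) \<le> C"
    using qpoch_inf_shift_bounded[OF assms] by metis
  then show ?thesis unfolding jbounded_def by (auto simp: mult.assoc)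
qed

lemma jbounded_inverse_qpoch_inf:
  assumes "norm q < 1" shows "jbounded q b (\<lambda>z. 1 / qpoch_inf (c * z) q)"
proof -
  obtain C where "\<And>i. norm (1 / qpoch_inf (c * b * q ^ i) q) \<le> C"
    using qpoch_inf_shift_inverse_bounded[OF assms] by metis
  then show ?thesis unfolding jbounded_def by (auto simp: mult.assoc)
qed

lemma jbounded_summable_norm:
  assumes "norm q < 1" "jbounded q b F"
  shows "summable (\<lambda>s. norm (q ^ s * F (b * q ^ s)))"
proof -
  obtain C where C: "\<And>s. norm (F (b * q ^ s)) \<le> C" using assms by (auto simp: jbounded_def)
  show ?thesis
  proof (rule summable_comparison_test'[of "\<lambda>s. C * norm q ^ s"])
    show "summable (\<lambda>s. C * norm q ^ s)" using assms by (intro summable_mult summable_geometric) auto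
    show "norm (norm (q ^ s * F (b * q ^ s))) \<le> C * norm q ^ s" for s
      using mult_right_mono[OF C[of s], of "norm q ^ s"] by (simp add: norm_mult norm_power mult.commute)
  qed
qed

lemma jbounded_summable:
  assumes "norm q < 1" "jbounded q b F"
  shows "summable (\<lambda>s. q ^ s * F (b * q ^ s))"
  by (rule summable_norm_cancel[OF jbounded_summable_norm[OF assms]])

lemma jint_cmult:
  assumes "norm q < 1" "jbounded q a F" "jbounded q b F"
  shows "jint q a b (\<lambda>z. c * F z) = c * jint q a b F"
  unfolding jint_def mult.left_commute[of _ c]
  by (simp add: suminf_mult jbounded_summable[OF assms(1,2)] jbounded_summable[OF assms(1,3)] algebra_simps)

lemma jint_add:
  assumes "norm q < 1" "jbounded q a F" "jbounded q b F" "jbounded q a G" "jbounded q b G"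
  shows "jint q a b (\<lambda>z. F z + G z) = jint q a b F + jint q a b G"
proof -
  note s = assms(2-)[THEN jbounded_summable[OF assms(1)]]
  show ?thesis
    unfolding jint_def distrib_left suminf_add[OF s(1) s(3), symmetric] suminf_add[OF s(2) s(4), symmetric]
    by simp
qed

lemma jint_zero [simp]: "jint q a b (\<lambda>_. 0) = 0"
  by (simp add: jint_def)

lemma jint_sum:
  assumes "norm q < 1" "finite A" "\<And>i. i \<in> A \<Longrightarrow> jbounded q a (F i)" "\<And>i. i \<in> A \<Longrightarrow> jbounded q b (F i)"
  shows "jint q a b (\<lambda>z. \<Sum>i\<in>A. F i z) = (\<Sum>i\<in>A. jint q a b (F i))"
  using assms(2-)
  by (induction A rule: finite_induct) (simp_all add: jint_add[OF assms(1)] jbounded_sum)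

lemma jint_cong:
  assumes "\<And>s. F (a * q ^ s) = G (a * q ^ s)" "\<And>s. F (b * q ^ s) = G (b * q ^ s)"
  shows "jint q a b F = jint q a b G"
  using assms by (simp add: jint_def)

text \<open>An endpoint of the integral may be moved inwards past zeros of the integrand. This is
  how integrals with different endpoints \<open>-1\<close> and \<open>- (q ^ i)\<close>, or
  \<open>t / q ^ k\<close> and \<open>t / q ^ j\<close>, are identified.\<close>

lemma jsum_drop_zeros:
  assumes q: "norm q < 1" and b: "jbounded q b F" and z: "\<And>s. s < i \<Longrightarrow> F (b * q ^ s) = 0"
  shows "b * (\<Sum>s. q ^ s * F (b * q ^ s)) = (b * q ^ i) * (\<Sum>s. q ^ s * F ((b * q ^ i) * q ^ s))"
proof -
  have "(\<Sum>s. q ^ s * F (b * q ^ s)) = (\<Sum>s. q ^ (s + i) * F (b * q ^ (s + i))) + (\<Sum>s<i. q ^ s * F (b * q ^ s))"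
    by (rule suminf_split_initial_segment[OF jbounded_summable[OF q b]])
  also have "(\<Sum>s<i. q ^ s * F (b * q ^ s)) = 0" by (simp add: z)
  also have "(\<Sum>s. q ^ (s + i) * F (b * q ^ (s + i))) = q ^ i * (\<Sum>s. q ^ s * F ((b * q ^ i) * q ^ s))"
  proof (subst suminf_mult[symmetric])
    show "summable (\<lambda>s. q ^ s * F (b * q ^ i * q ^ s))"
    proof (rule jbounded_summable[OF q])
      obtain C where "\<And>s. norm (F (b * q ^ s)) \<le> C" using b by (auto simp: jbounded_def)
      then have "norm (F (b * q ^ i * q ^ s)) \<le> C" for s by (simp add: mult.assoc flip: power_add)
      then show "jbounded q (b * q ^ i) F" by (auto simp: jbounded_def)
    qed
    show "(\<Sum>s. q ^ (s + i) * F (b * q ^ (s + i))) = (\<Sum>s. q ^ i * (q ^ s * F (b * q ^ i * q ^ s)))"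
      by (simp add: power_add mult_ac)
  qed
  finally show ?thesis by simp
qed

section \<open>The Andrews-Askey integral\<close>

definition aa_kernel :: "complex \<Rightarrow> complex \<Rightarrow> complex \<Rightarrow> complex \<Rightarrow> complex \<Rightarrow> complex \<Rightarrow> complex" where
  "aa_kernel q a b c d z = qpoch_inf (q / a * z) q * qpoch_inf (q / b * z) q / (qpoch_inf (c * z) q * qpoch_inf (d * z) q)"

lemma jbounded_aa_kernel:
  assumes "norm q < 1" shows "jbounded q x (aa_kernel q a b c d)"
proof -
  have "aa_kernel q a b c d = (\<lambda>z. qpoch_inf (q / a * z) q * qpoch_inf (q / b * z) q
      * (1 / qpoch_inf (c * z) q) * (1 / qpoch_inf (d * z) q))"
    by (simp add: aa_kernel_def fun_eq_iff)
  then show ?thesis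
    by (simp only:) (intro jbounded_mult jbounded_qpoch_inf jbounded_inverse_qpoch_inf assms)
qed

text \<open>A telescoping sum gives a linear relation between the integrals of the weight and of
  \<open>z\<close> times the weight. The weight with \<open>c * q\<close> in place of
  \<open>c\<close> is \<open>1 - c * z\<close> times the old one, so its integral is a multiple of
  the old integral.\<close>

lemma aa_step:
  assumes q: "norm q < 1" "q \<noteq> 0" and ab: "a \<noteq> 0" "b \<noteq> 0"
    and nz: "\<And>s. c * a * q ^ s \<noteq> 1" "\<And>s. c * b * q ^ s \<noteq> 1" "\<And>s. d * a * q ^ s \<noteq> 1" "\<And>s. d * b * q ^ s \<noteq> 1"
  shows "(1 - a * b * c * d) * jint q a b (aa_kernel q a b (c * q) d)
    = (1 - a * c) * (1 - b * c) * jint q a b (aa_kernel q a b c d)"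
proof -
  let ?F = "aa_kernel q a b c d"
  \<comment> \<open>\<open>A\<close> and \<open>B\<close> are the coefficients for which
    \<open>W z - W (q * z)\<close> equals \<open>z * (A + B * z)\<close> times the weight.\<close>
  define A where "A = c + d - 1 / a - 1 / b"
  define B where "B = 1 / (a * b) - c * d"
  define W where "W z = qpoch_inf (z / a) q * qpoch_inf (z / b) q / (qpoch_inf (c * z) q * qpoch_inf (d * z) q)" for z
  define I where "I = jint q a b ?F"
  define I1 where "I1 = jint q a b (\<lambda>z. z * ?F z)"
  have bF: "jbounded q x ?F" for x by (rule jbounded_aa_kernel[OF q(1)])
  have bzF: "jbounded q x (\<lambda>z. z * ?F z)" for x by (intro jbounded_mult jbounded_ident bF q)
  have rec: "qpoch_inf y q = (1 - y) * qpoch_inf (q * y) q" for y :: complex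
    using qpoch_inf_Suc[OF q(1), of y] by (simp add: mult.commute)
  \<comment> \<open>At both endpoints \<open>W\<close> vanishes, while it tends to 1 along the
    sequence. Each endpoint thus contributes \<open>-1 / e\<close>, which after multiplication by
    \<open>e\<close> is the same number for \<open>a\<close> and \<open>b\<close>, and the integral
    is 0.\<close>
  have half: "(\<lambda>s. q ^ s * (A * ?F (e * q ^ s) + B * (e * q ^ s * ?F (e * q ^ s)))) sums (- 1 / e)"
    if e: "e \<noteq> 0" "qpoch_inf (e / a) q * qpoch_inf (e / b) q = 0"
      and ne: "\<And>s. c * e * q ^ s \<noteq> 1" "\<And>s. d * e * q ^ s \<noteq> 1" for e
  proof -
    have lim: "(\<lambda>s. W (e * q ^ s)) \<longlonglongrightarrow> 1 * 1 / (1 * 1)"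
    proof -
      have "W (e * q ^ s) = qpoch_inf (e / a * q ^ s) q * qpoch_inf (e / b * q ^ s) q
          / (qpoch_inf (c * e * q ^ s) q * qpoch_inf (d * e * q ^ s) q)" for s
        by (simp add: W_def mult.assoc)
      then show ?thesis by (simp only:) (intro tendsto_intros qpoch_inf_shift_LIMSEQ q, simp)
    qed
    have "W (e * q ^ s) - W (e * q ^ Suc s) = e * (q ^ s * (A * ?F (e * q ^ s) + B * (e * q ^ s * ?F (e * q ^ s))))" for s
    proof -
      define z where "z = e * q ^ s"
      have z: "1 - c * z \<noteq> 0" "1 - d * z \<noteq> 0" using ne[of s] by (auto simp: z_def mult.assoc)
      have nz': "qpoch_inf (c * z) q \<noteq> 0" "qpoch_inf (d * z) q \<noteq> 0"
        using ne[of "s + _"] by (auto simp: z_def qpoch_inf_eq_0_iff[OF q(1)] mult.assoc power_add)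
      have 1: "W z = (1 - z / a) * (1 - z / b) * ?F z"
        unfolding W_def aa_kernel_def rec[of "z / a"] rec[of "z / b"] by simp
      have 2: "W (q * z) = (1 - c * z) * (1 - d * z) * ?F z"
        using z nz' unfolding W_def aa_kernel_def rec[of "c * z"] rec[of "d * z"] by (simp add: mult_ac)
      have "W z - W (q * z) = z * (A + B * z) * ?F z"
        unfolding 1 2 A_def B_def using ab by (simp add: field_simps)
      then show ?thesis by (simp add: z_def algebra_simps)
    qed
    moreover have "W e = 0" using e by (simp add: W_def)
    ultimately have "(\<lambda>s. e * (q ^ s * (A * ?F (e * q ^ s) + B * (e * q ^ s * ?F (e * q ^ s))))) sums (0 - 1)"
      using telescope_sums'[OF lim] by simp
    from sums_mult[OF this, of "1 / e"] show ?thesis using e by simp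
  qed
  have e1: "qpoch_inf 1 q = 0" using qpoch_inf_eq_0_iff[OF q(1), of 1] by (auto intro!: exI[of _ 0])
  have "jint q a b (\<lambda>z. A * ?F z + B * (z * ?F z)) = b * (- 1 / b) - a * (- 1 / a)"
    unfolding jint_def using half[of a] half[of b] ab nz e1 by (simp add: sums_iff)
  also have "\<dots> = 0" using ab by simp
  also have "jint q a b (\<lambda>z. A * ?F z + B * (z * ?F z)) = A * I + B * I1"
    unfolding I_def I1_def by (simp add: jint_add jint_cmult jbounded_mult bF bzF q)
  finally have 1: "A * I + B * I1 = 0" .
  have "jint q a b (aa_kernel q a b (c * q) d) = jint q a b (\<lambda>z. ?F z + (- c) * (z * ?F z))"
  proof (rule jint_cong)
    have "aa_kernel q a b (c * q) d z = ?F z + (- c) * (z * ?F z)" if "c * z \<noteq> 1" for z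
    proof -
      have g: "X / (Y * D) = X / (w * Y * D) + (- c) * (z * (X / (w * Y * D)))" if "w = 1 - c * z" "w \<noteq> 0" for X Y D w
      proof -
        have "y + (- c) * (z * y) = w * y" for y :: complex unfolding that(1) by (simp add: algebra_simps)
        from this[of "X / (w * Y * D)"] show ?thesis using that(2) by simp
      qed
      have "c * q * z = q * (c * z)" by simp
      then show ?thesis unfolding aa_kernel_def rec[of "c * z"] by (simp only:) (rule g, use that in auto)
    qed
    then show "aa_kernel q a b (c * q) d (a * q ^ s) = ?F (a * q ^ s) + (- c) * (a * q ^ s * ?F (a * q ^ s))"
      "aa_kernel q a b (c * q) d (b * q ^ s) = ?F (b * q ^ s) + (- c) * (b * q ^ s * ?F (b * q ^ s))" for s
      using nz(1,2)[of s] by (simp_all add: mult.assoc)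
  qed
  also have "\<dots> = I - c * I1"
    unfolding I_def I1_def by (simp only: jint_add[OF q(1)] jint_cmult[OF q(1)] jbounded_mult jbounded_const bF bzF) simp
  finally have 2: "jint q a b (aa_kernel q a b (c * q) d) = I - c * I1" .
  have AB: "a * b * A = a * b * c + a * b * d - b - a" "a * b * B = 1 - a * b * c * d"
    unfolding A_def B_def using ab by (simp_all add: field_simps)
  have "(1 - a * b * c * d) * (I - c * I1) = (1 - a * b * c * d) * I - c * (a * b * B * I1)"
    unfolding AB by (simp add: algebra_simps)
  also have "a * b * B * I1 = - (a * b * A * I)" using 1 by algebra
  also have "(1 - a * b * c * d) * I - c * (- (a * b * A * I)) = (1 - a * c) * (1 - b * c) * I"
    unfolding AB by (simp add: algebra_simps)
  finally show ?thesis unfolding 2 I_def .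
qed

text \<open>Iterating \<open>aa_step\<close> sends \<open>c * q ^ n\<close> to 0 and accumulates the
  finite products. The shifted reciprocals are uniformly bounded, so Tannery's theorem moves the
  limit inside the integral.\<close>

lemma aa_limit:
  assumes q: "norm q < 1" "q \<noteq> 0" and ab: "a \<noteq> 0" "b \<noteq> 0"
    and nz: "\<And>s. c * a * q ^ s \<noteq> 1" "\<And>s. c * b * q ^ s \<noteq> 1" "\<And>s. d * a * q ^ s \<noteq> 1" "\<And>s. d * b * q ^ s \<noteq> 1"
  shows "qpoch_inf (a * b * c * d) q * jint q a b (aa_kernel q a b 0 d)
    = qpoch_inf (a * c) q * qpoch_inf (b * c) q * jint q a b (aa_kernel q a b c d)"
proof (rule LIMSEQ_unique)
  have *: "qpoch (a * b * c * d) q n * jint q a b (aa_kernel q a b (c * q ^ n) d)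
     = qpoch (a * c) q n * qpoch (b * c) q n * jint q a b (aa_kernel q a b c d)" for n
  proof (induction n)
    case (Suc n)
    have "(1 - a * b * (c * q ^ n) * d) * jint q a b (aa_kernel q a b (c * q ^ n * q) d)
        = (1 - a * (c * q ^ n)) * (1 - b * (c * q ^ n)) * jint q a b (aa_kernel q a b (c * q ^ n) d)"
    proof (rule aa_step[OF q ab _ _ nz(3,4)])
      show "c * q ^ n * a * q ^ s \<noteq> 1" "c * q ^ n * b * q ^ s \<noteq> 1" for s
        using nz(1,2)[of "n + s"] by (simp_all add: power_add mult_ac)
    qed
    then have "qpoch (a * b * c * d) q (Suc n) * jint q a b (aa_kernel q a b (c * q ^ Suc n) d)
        = (1 - a * (c * q ^ n)) * (1 - b * (c * q ^ n)) * (qpoch (a * b * c * d) q n * jint q a b (aa_kernel q a b (c * q ^ n) d))"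
      by (simp add: qpoch_Suc mult_ac)
    then show ?case unfolding Suc.IH by (simp add: qpoch_Suc mult_ac)
  qed simp
  show "(\<lambda>n. qpoch (a * b * c * d) q n * jint q a b (aa_kernel q a b (c * q ^ n) d))
      \<longlonglongrightarrow> qpoch_inf (a * c) q * qpoch_inf (b * c) q * jint q a b (aa_kernel q a b c d)"
    unfolding * by (intro tendsto_intros qpoch_LIMSEQ q)
  have lim: "(\<lambda>n. \<Sum>s. q ^ s * aa_kernel q a b (c * q ^ n) d (e * q ^ s)) \<longlonglongrightarrow> (\<Sum>s. q ^ s * aa_kernel q a b 0 d (e * q ^ s))" for e
  proof -
    obtain C where C: "\<And>i. norm (1 / qpoch_inf (c * e * q ^ i) q) \<le> C"
      using qpoch_inf_shift_inverse_bounded[OF q(1)] by metis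
    define H where "H z = qpoch_inf (q / a * z) q * qpoch_inf (q / b * z) q * (1 / qpoch_inf (d * z) q)" for z
    have "jbounded q e H" unfolding H_def
      by (intro jbounded_mult jbounded_qpoch_inf jbounded_inverse_qpoch_inf q)
    from jbounded_summable_norm[OF q(1) this] have sH: "summable (\<lambda>s. norm (q ^ s * H (e * q ^ s)))" .
    have K: "aa_kernel q a b (c * q ^ n) d (e * q ^ s) = H (e * q ^ s) * (1 / qpoch_inf (c * e * q ^ (n + s)) q)" for n s
      by (simp add: aa_kernel_def H_def power_add mult_ac)
    show ?thesis
    proof (rule tannery_sequence[where M = "\<lambda>s. norm (q ^ s * H (e * q ^ s)) * C"])
      show "(\<lambda>n. q ^ s * aa_kernel q a b (c * q ^ n) d (e * q ^ s)) \<longlonglongrightarrow> q ^ s * aa_kernel q a b 0 d (e * q ^ s)" for s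
      proof -
        have "(\<lambda>n. q ^ s * (H (e * q ^ s) * (1 / qpoch_inf (c * e * q ^ s * q ^ n) q))) \<longlonglongrightarrow> q ^ s * (H (e * q ^ s) * (1 / 1))"
          by (intro tendsto_intros qpoch_inf_shift_LIMSEQ q) simp
        then show ?thesis unfolding K by (simp add: aa_kernel_def H_def power_add mult_ac)
      qed
      show "norm (q ^ s * aa_kernel q a b (c * q ^ n) d (e * q ^ s)) \<le> norm (q ^ s * H (e * q ^ s)) * C" for s n
        unfolding K norm_mult mult.assoc[symmetric]
        by (rule mult_left_mono[OF C]) simp
      show "summable (\<lambda>s. norm (q ^ s * H (e * q ^ s)) * C)" by (intro summable_mult2 sH)
    qed
  qed
  show "(\<lambda>n. qpoch (a * b * c * d) q n * jint q a b (aa_kernel q a b (c * q ^ n) d))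
      \<longlonglongrightarrow> qpoch_inf (a * b * c * d) q * jint q a b (aa_kernel q a b 0 d)"
    unfolding jint_def by (intro tendsto_intros qpoch_LIMSEQ lim q)
qed

text \<open>Removing \<open>c\<close> and \<open>d\<close> by two limits shows that the integral is
  an explicit product times a constant \<open>I0\<close> that depends on \<open>a\<close> and
  \<open>b\<close> only. The constant is found from one choice of parameters for which the integral
  is elementary.\<close>

lemma andrews_askey:
  assumes q: "norm q < 1" "q \<noteq> 0" and ab: "a \<noteq> 0" "b \<noteq> 0"
    and nz: "\<And>s. c * a * q ^ s \<noteq> 1" "\<And>s. c * b * q ^ s \<noteq> 1" "\<And>s. d * a * q ^ s \<noteq> 1" "\<And>s. d * b * q ^ s \<noteq> 1"
    and r: "\<And>s. q * a / b * q ^ s \<noteq> 1" "\<And>s. q * b / a * q ^ s \<noteq> 1"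
  shows "jint q a b (aa_kernel q a b c d) = b * qpoch_inf q q * qpoch_inf (a / b) q * qpoch_inf (q * b / a) q * qpoch_inf (a * b * c * d) q
    / (qpoch_inf (a * c) q * qpoch_inf (b * c) q * qpoch_inf (a * d) q * qpoch_inf (b * d) q)"
proof -
  define I0 where "I0 = jint q a b (aa_kernel q a b 0 0)"
  have gen: "qpoch_inf (a * b * c * d) q * I0
      = qpoch_inf (a * c) q * qpoch_inf (b * c) q * (qpoch_inf (a * d) q * qpoch_inf (b * d) q) * jint q a b (aa_kernel q a b c d)"
    if nz: "\<And>s. c * a * q ^ s \<noteq> 1" "\<And>s. c * b * q ^ s \<noteq> 1" "\<And>s. d * a * q ^ s \<noteq> 1" "\<And>s. d * b * q ^ s \<noteq> 1" for c d
  proof -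
    have sw: "aa_kernel q a b 0 d = aa_kernel q a b d 0" by (simp add: aa_kernel_def fun_eq_iff)
    have "I0 = qpoch_inf (a * d) q * qpoch_inf (b * d) q * jint q a b (aa_kernel q a b 0 d)"
      using aa_limit[OF q ab, of d 0] nz unfolding I0_def sw by simp
    then have "qpoch_inf (a * b * c * d) q * I0
        = qpoch_inf (a * d) q * qpoch_inf (b * d) q * (qpoch_inf (a * b * c * d) q * jint q a b (aa_kernel q a b 0 d))"
      by simp
    also have "\<dots> = qpoch_inf (a * d) q * qpoch_inf (b * d) q * (qpoch_inf (a * c) q * qpoch_inf (b * c) q * jint q a b (aa_kernel q a b c d))"
      by (simp only: aa_limit[OF q ab nz])
    finally show ?thesis by (simp only: mult_ac)
  qed
  have qq: "q * q ^ s \<noteq> 1" for s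
    using qpoch_self_nonzero[OF q(1), of "Suc s"] by (auto simp: qpoch_Suc)
  have q0: "qpoch_inf q q \<noteq> 0" "qpoch_inf (q * q) q \<noteq> 0" "1 - q \<noteq> 0"
    using qpoch_inf_eq_0_iff[OF q(1)] qq qq[of "Suc _"] qq[of 0] by (auto simp: mult.assoc)
  \<comment> \<open>For \<open>c = q / b\<close> and \<open>d = q / a\<close> numerator and
    denominator of the weight coincide, and the integral is a geometric series.\<close>
  have ker1: "aa_kernel q a b (q / b) (q / a) (e * q ^ s) = 1"
    if "qpoch_inf (q * e / a) q \<noteq> 0" "qpoch_inf (q * e / b) q \<noteq> 0" for e s
  proof -
    have "qpoch_inf (q / x * (e * q ^ s)) q \<noteq> 0" if "qpoch_inf (q * e / x) q \<noteq> 0" for x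
      using qpoch_inf_split[OF q(1), of "q * e / x" s] that by (auto simp: mult_ac)
    then show ?thesis using that by (simp add: aa_kernel_def)
  qed
  have nn: "qpoch_inf (q * a / b) q \<noteq> 0" "qpoch_inf (q * b / a) q \<noteq> 0"
    using r by (auto simp: qpoch_inf_eq_0_iff[OF q(1)])
  have geo: "(\<Sum>s. q ^ s) = 1 / (1 - q)" by (rule suminf_geometric[OF q(1)])
  have "jint q a b (aa_kernel q a b (q / b) (q / a)) = (b - a) / (1 - q)"
    unfolding jint_def using ker1[of a] ker1[of b] nn q0 ab by (simp add: geo diff_divide_distrib)
  moreover have "qpoch_inf (a * b * (q / b) * (q / a)) q * I0
      = qpoch_inf (a * (q / b)) q * qpoch_inf (b * (q / b)) q * (qpoch_inf (a * (q / a)) q * qpoch_inf (b * (q / a)) q)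
        * jint q a b (aa_kernel q a b (q / b) (q / a))"
    by (rule gen) (use r qq ab in \<open>simp_all add: mult_ac\<close>)
  ultimately have 1: "qpoch_inf (q * q) q * I0
     = qpoch_inf (q * a / b) q * qpoch_inf q q * (qpoch_inf q q * qpoch_inf (q * b / a) q) * ((b - a) / (1 - q))"
    using ab by (simp add: mult_ac)
  have 2: "qpoch_inf q q = (1 - q) * qpoch_inf (q * q) q" by (rule qpoch_inf_Suc[OF q(1)])
  have 3: "qpoch_inf (a / b) q = (1 - a / b) * qpoch_inf (q * a / b) q"
    using qpoch_inf_Suc[OF q(1), of "a / b"] by (simp add: mult_ac)
  have "I0 = b * qpoch_inf q q * qpoch_inf (a / b) q * qpoch_inf (q * b / a) q"
  proof -
    have e: "b - a = b * (1 - a / b)" using ab by (simp add: field_simps)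
    have "qpoch_inf (q * q) q * I0 = qpoch_inf (q * q) q * (b * qpoch_inf q q * qpoch_inf (a / b) q * qpoch_inf (q * b / a) q)"
      unfolding 1 3 e using q0(3) by (subst (1) 2) simp
    then show ?thesis using q0 by simp
  qed
  moreover have "qpoch_inf (a * c) q \<noteq> 0" "qpoch_inf (b * c) q \<noteq> 0" "qpoch_inf (a * d) q \<noteq> 0" "qpoch_inf (b * d) q \<noteq> 0"
    using nz by (auto simp: qpoch_inf_eq_0_iff[OF q(1)] mult.commute)
  ultimately show ?thesis using gen[OF nz] by (simp add: field_simps)
qed

subsection \<open>q-Meixner functions\<close>

text \<open>For nonzero \<open>X\<close> this is \<open>X ^ i * qpoch (- 1 / X) q i\<close>. It
  absorbs the power of \<open>X\<close> from the argument of the q-Meixner series and is a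
  polynomial.\<close>

definition mpsi :: "nat \<Rightarrow> complex \<Rightarrow> complex \<Rightarrow> complex" where
  "mpsi i X q = (\<Prod>l<i. X + q ^ l)"

lemma mpsi_0 [simp]: "mpsi 0 X q = 1"
  by (simp add: mpsi_def)

lemma mpsi_Suc: "mpsi (Suc i) X q = mpsi i X q * (X + q ^ i)"
  by (simp add: mpsi_def)

lemma mpsi_scale_up:
  "mpsi (Suc i) (X * q) q = mpsi (Suc i) X q - (1 - q ^ Suc i) * X * mpsi i X q"
proof -
  have "mpsi (Suc i) (X * q) q = (X * q + 1) * (\<Prod>l<i. q * (X + q ^ l))"
    unfolding mpsi_def prod.lessThan_Suc_shift by (simp add: algebra_simps)
  also have "\<dots> = (X * q + 1) * q ^ i * mpsi i X q" by (simp add: mpsi_def prod.distrib)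
  also have "\<dots> = mpsi (Suc i) X q - (1 - q ^ Suc i) * X * mpsi i X q"
    by (simp add: mpsi_Suc algebra_simps)
  finally show ?thesis .
qed

lemma mpsi_scale_down:
  assumes "q \<noteq> 0"
  shows "(1 + X) * (q ^ i * mpsi i (X / q) q) = (X + q ^ i) * mpsi i X q"
proof -
  have "q ^ i * mpsi i (X / q) q = (\<Prod>l<i. q * (X / q + q ^ l))"
    unfolding prod.distrib mpsi_def by simp
  also have "\<dots> = (\<Prod>l<i. X + q ^ Suc l)"
    using assms by (intro prod.cong refl) (simp add: field_simps)
  finally have "(1 + X) * (q ^ i * mpsi i (X / q) q) = (X + q ^ 0) * (\<Prod>l<i. X + q ^ Suc l)"
    by (simp add: add.commute)
  also have "\<dots> = mpsi (Suc i) X q" unfolding mpsi_def prod.lessThan_Suc_shift ..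
  finally show ?thesis by (simp add: mpsi_Suc)
qed

lemma norm_mpsi_le:
  assumes "norm q < 1" "norm X \<le> R"
  shows "norm (mpsi i X q) \<le> (R + 1) ^ i"
proof -
  have "norm (X + q ^ l) \<le> R + 1" for l
    using norm_triangle_ineq[of X "q ^ l"] power_le_one[of "norm q" l] assms by (simp add: norm_power)
  then have "(\<Prod>l<i. norm (X + q ^ l)) \<le> (\<Prod>l<i. R + 1)" by (intro prod_mono) auto
  then show ?thesis by (simp add: mpsi_def prod_norm)
qed

lemma triangle_Suc: "Suc i * (Suc i - 1) div 2 = i * (i - 1) div 2 + i"
  by (cases i) auto

lemma summable_gaussian:
  fixes x r :: real
  assumes "0 \<le> x" "x < 1" "0 \<le> r"
  shows "summable (\<lambda>i. x ^ (i * (i - 1) div 2) * r ^ i)"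
proof -
  have "(\<lambda>i. x ^ i * r) \<longlonglongrightarrow> 0"
    using assms by (auto intro!: tendsto_mult_left_zero LIMSEQ_power_zero)
  then have "eventually (\<lambda>i. x ^ i * r < 1 / 2) sequentially"
    by (auto dest: order_tendstoD(2)[where a = "1/2"])
  then obtain N where N: "\<And>i. i \<ge> N \<Longrightarrow> x ^ i * r < 1 / 2" by (auto simp: eventually_sequentially)
  show ?thesis
  proof (rule summable_ratio_test[of "1/2" N])
    fix n assume "n \<ge> N"
    have "x ^ (Suc n * (Suc n - 1) div 2) * r ^ Suc n = (x ^ n * r) * (x ^ (n * (n - 1) div 2) * r ^ n)"
      unfolding triangle_Suc by (simp add: power_add mult_ac)
    also have "\<dots> \<le> 1 / 2 * (x ^ (n * (n - 1) div 2) * r ^ n)"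
      using N[OF \<open>n \<ge> N\<close>] assms by (intro mult_right_mono) auto
    finally show "norm (x ^ (Suc n * (Suc n - 1) div 2) * r ^ Suc n) \<le> 1 / 2 * norm (x ^ (n * (n - 1) div 2) * r ^ n)"
      using assms by simp
  qed simp
qed

lemma qpoch_inverse_bounded:
  fixes a q :: complex
  assumes "norm q < 1" "\<And>j. a * q ^ j \<noteq> 1"
  shows "\<exists>C>0. \<forall>i. norm (1 / qpoch a q i) \<le> C"
proof -
  have "qpoch_inf a q \<noteq> 0" using assms by (auto simp: qpoch_inf_eq_0_iff)
  then have "(\<lambda>i. 1 / qpoch a q i) \<longlonglongrightarrow> 1 / qpoch_inf a q"
    by (intro tendsto_intros qpoch_LIMSEQ assms)
  from convergent_imp_Bseq[OF convergentI[OF this]] show ?thesis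
    by (auto simp: Bseq_def)
qed

lemma q_power_neq_1:
  fixes q :: "'a::real_normed_field"
  assumes "norm q < 1" shows "q * q ^ j \<noteq> 1"
  using qpoch_self_nonzero[OF assms, of "Suc j"] by (auto simp: qpoch_Suc)

definition mcoeff :: "complex \<Rightarrow> complex \<Rightarrow> complex \<Rightarrow> nat \<Rightarrow> complex" where
  "mcoeff q g u i = (- 1) ^ i * q ^ (i * (i - 1) div 2) * g ^ (2 * i)
     / (qpoch q q i * qpoch (- g * u) q i * qpoch (- g / u) q i)"

text \<open>The q-Meixner function with \<open>a = - g * u\<close> and \<open>b = - g / u\<close>,
  see \<open>qMeixner_eq_mphi\<close>, in a form that is visibly symmetric in \<open>X\<close> and
  \<open>Z\<close>. The symmetry is why an operator in \<open>X\<close> can stand for multiplication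
  by \<open>Z\<close>.\<close>

definition mphi :: "complex \<Rightarrow> complex \<Rightarrow> complex \<Rightarrow> complex \<Rightarrow> complex \<Rightarrow> complex" where
  "mphi q g u X Z = (\<Sum>i. mcoeff q g u i * mpsi i X q * mpsi i Z q)"

lemma mcoeff_Suc:
  fixes q g u :: complex
  assumes "u \<noteq> 0" "norm q < 1" "- g * u * q ^ i \<noteq> 1" "- g / u * q ^ i \<noteq> 1"
  shows "mcoeff q g u (Suc i) * (1 - q ^ Suc i) * ((1 + g * u * q ^ i) * (1 + g / u * q ^ i))
    = - (q ^ i * g ^ 2) * mcoeff q g u i"
proof -
  have nz: "1 - q * q ^ i \<noteq> 0" "1 - (- g * u * q ^ i) \<noteq> 0" "1 - (- g / u * q ^ i) \<noteq> 0"
  proof -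
    have *: "1 - x \<noteq> 0" if "x \<noteq> 1" for x :: complex using that by auto
    show "1 - q * q ^ i \<noteq> 0" "1 - (- g * u * q ^ i) \<noteq> 0" "1 - (- g / u * q ^ i) \<noteq> 0"
      by (rule *[OF q_power_neq_1[OF assms(2)]] *[OF assms(3)] *[OF assms(4)])+
  qed
  have "s * (- 1) * (t * y) * (G * g ^ 2) / ((a * A) * (b * B) * (c * C)) * A * (B * C)
      = - (y * g ^ 2) * (s * t * G / (a * b * c))"
    if "A \<noteq> 0" "B \<noteq> 0" "C \<noteq> 0" for s t y G a b c A B C :: complex
    using that by (simp add: mult_ac)
  from this[OF nz]
  have "(- 1) ^ i * (- 1) * (q ^ (i * (i - 1) div 2) * q ^ i) * (g ^ (2 * i) * g ^ 2)
      / ((qpoch q q i * (1 - q * q ^ i)) * (qpoch (- g * u) q i * (1 - (- g * u * q ^ i))) * (qpoch (- g / u) q i * (1 - (- g / u * q ^ i))))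
      * (1 - q * q ^ i) * ((1 - (- g * u * q ^ i)) * (1 - (- g / u * q ^ i)))
     = - (q ^ i * g ^ 2) * ((- 1) ^ i * q ^ (i * (i - 1) div 2) * g ^ (2 * i) / (qpoch q q i * qpoch (- g * u) q i * qpoch (- g / u) q i))" .
  moreover have "(- 1 :: complex) ^ Suc i * q ^ (Suc i * (Suc i - 1) div 2) * g ^ (2 * Suc i)
     = (- 1) ^ i * (- 1) * (q ^ (i * (i - 1) div 2) * q ^ i) * (g ^ (2 * i) * g ^ 2)"
    unfolding triangle_Suc by (simp add: power_add power2_eq_square)
  ultimately show ?thesis unfolding mcoeff_def qpoch_Suc by (simp del: power_Suc add: power_Suc[of q])
qed

lemma mcoeff_bound:
  fixes q g u :: complex
  assumes "norm q < 1" "\<And>i. - g * u * q ^ i \<noteq> 1" "\<And>i. - g / u * q ^ i \<noteq> 1"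
  shows "\<exists>C>0. \<forall>i. norm (mcoeff q g u i) \<le> C * (norm q ^ (i * (i - 1) div 2) * (norm g ^ 2) ^ i)"
proof -
  obtain C1 where C1: "C1 > 0" "\<And>i. norm (1 / qpoch q q i) \<le> C1"
    using qpoch_inverse_bounded[OF assms(1) q_power_neq_1[OF assms(1)]] by blast
  obtain C2 where C2: "C2 > 0" "\<And>i. norm (1 / qpoch (- g * u) q i) \<le> C2"
    using qpoch_inverse_bounded[OF assms(1,2)] by blast
  obtain C3 where C3: "C3 > 0" "\<And>i. norm (1 / qpoch (- g / u) q i) \<le> C3"
    using qpoch_inverse_bounded[OF assms(1,3)] by blast
  have "norm (mcoeff q g u i) \<le> (C1 * C2 * C3) * (norm q ^ (i * (i - 1) div 2) * (norm g ^ 2) ^ i)" for i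
  proof -
    have "norm (mcoeff q g u i) = (norm (1 / qpoch q q i) * norm (1 / qpoch (- g * u) q i) * norm (1 / qpoch (- g / u) q i))
        * (norm q ^ (i * (i - 1) div 2) * (norm g ^ 2) ^ i)"
      by (simp add: mcoeff_def norm_mult norm_divide norm_power power_mult)
    also have "\<dots> \<le> (C1 * C2 * C3) * (norm q ^ (i * (i - 1) div 2) * (norm g ^ 2) ^ i)"
      using C1 C2 C3 by (intro mult_right_mono mult_mono) auto
    finally show ?thesis .
  qed
  then show ?thesis using C1 C2 C3 by (intro exI[of _ "C1 * C2 * C3"]) simp
qed

text \<open>The Gaussian factor of the coefficients outweighs the exponential growth of the
  polynomials on a disc. The second bound, with one more factor in \<open>Z\<close>, serves the
  series that results from multiplication by \<open>Z\<close>.\<close>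

lemma mphi_majorant:
  fixes q g u :: complex
  assumes q: "norm q < 1" and nz: "\<And>i. - g * u * q ^ i \<noteq> 1" "\<And>i. - g / u * q ^ i \<noteq> 1" and R: "0 \<le> R"
  shows "\<exists>v. summable v \<and> (\<forall>i. v i \<ge> 0)
    \<and> (\<forall>i X Z. norm X \<le> R \<longrightarrow> norm Z \<le> R \<longrightarrow> norm (mcoeff q g u i * mpsi i X q * mpsi i Z q) \<le> v i)
    \<and> (\<forall>i X Z. norm X \<le> R \<longrightarrow> norm Z \<le> R \<longrightarrow> norm (mcoeff q g u i * mpsi i X q * mpsi (Suc i) Z q) \<le> v i)"
proof -
  obtain C where C: "C > 0" "\<And>i. norm (mcoeff q g u i) \<le> C * (norm q ^ (i * (i - 1) div 2) * (norm g ^ 2) ^ i)"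
    using mcoeff_bound[OF q nz] by blast
  define v where "v i = (R + 1) * C * (norm q ^ (i * (i - 1) div 2) * (norm g ^ 2 * (R + 1) * (R + 1)) ^ i)" for i
  have v: "(R + 1) * (C * (norm q ^ (i * (i - 1) div 2) * (norm g ^ 2) ^ i) * (R + 1) ^ i * (R + 1) ^ i) = v i" for i
    by (simp add: v_def power_mult_distrib)
  have 1: "norm (mcoeff q g u i * mpsi i X q) \<le> C * (norm q ^ (i * (i - 1) div 2) * (norm g ^ 2) ^ i) * (R + 1) ^ i"
    if "norm X \<le> R" for i X
    unfolding norm_mult using C R by (intro mult_mono C norm_mpsi_le[OF q that]) auto
  have 2: "norm (mcoeff q g u i * mpsi i X q * mpsi i Z q)
       \<le> C * (norm q ^ (i * (i - 1) div 2) * (norm g ^ 2) ^ i) * (R + 1) ^ i * (R + 1) ^ i"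
    if "norm X \<le> R" "norm Z \<le> R" for i X Z
    unfolding norm_mult[of "_ * _"] using C R
    by (intro mult_mono 1 norm_mpsi_le[OF q] that) auto
  show ?thesis
  proof (intro exI[of _ v] conjI allI impI)
    show "summable v" unfolding v_def using q R by (intro summable_mult summable_gaussian) auto
    show v0: "v i \<ge> 0" for i using C R by (simp add: v_def)
    show "norm (mcoeff q g u i * mpsi i X q * mpsi i Z q) \<le> v i" if "norm X \<le> R" "norm Z \<le> R" for i X Z
    proof -
      let ?w = "C * (norm q ^ (i * (i - 1) div 2) * (norm g ^ 2) ^ i) * (R + 1) ^ i * (R + 1) ^ i"
      have "1 * ?w \<le> (R + 1) * ?w" using R C by (intro mult_right_mono) auto
      then show ?thesis using 2[OF that, of i] v[of i] by linarith
    qed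
    show "norm (mcoeff q g u i * mpsi i X q * mpsi (Suc i) Z q) \<le> v i" if "norm X \<le> R" "norm Z \<le> R" for i X Z
    proof -
      have n: "norm (Z + q ^ i) \<le> R + 1"
        using norm_mpsi_le[OF q that(2), of 1] norm_triangle_ineq[of Z "q ^ i"] power_le_one[of "norm q" i] q that
        by (simp add: norm_power)
      have "norm (mcoeff q g u i * mpsi i X q * mpsi (Suc i) Z q)
          = norm (Z + q ^ i) * norm (mcoeff q g u i * mpsi i X q * mpsi i Z q)"
        by (simp add: mpsi_Suc norm_mult)
      also have "\<dots> \<le> (R + 1) * (C * (norm q ^ (i * (i - 1) div 2) * (norm g ^ 2) ^ i) * (R + 1) ^ i * (R + 1) ^ i)"
        by (intro mult_mono n 2 that) (use R in auto)
      finally show ?thesis unfolding v .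
    qed
  qed
qed

text \<open>Applied to the term of index \<open>i + 1\<close>, the operator in \<open>X\<close>
  produces \<open>- (g ^ 2 * X ^ 2)\<close> times the sum of \<open>1 - q ^ (i + 1)\<close> times
  this term and a term with the coefficient and the \<open>X\<close>-polynomial of index
  \<open>i\<close>. Because \<open>mpsi (Suc i) Z q = mpsi i Z q * (Z + q ^ i)\<close>, both parts
  together sum to \<open>Z + 1\<close> times the function.\<close>

lemma mphi_difference_eq:
  fixes q g u :: complex
  assumes q: "norm q < 1" "q \<noteq> 0" and u: "u \<noteq> 0" and X: "X \<noteq> 0"
    and nz: "\<And>i. - g * u * q ^ i \<noteq> 1" "\<And>i. - g / u * q ^ i \<noteq> 1"
  shows "q * (1 + X) * (mphi q g u (X / q) Z - mphi q g u X Z)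
      + (1 - g * u * X) * (1 - g / u * X) * (mphi q g u (X * q) Z - mphi q g u X Z)
    = - (g ^ 2 * X ^ 2) * (Z + 1) * mphi q g u X Z"
proof -
  define c where "c = mcoeff q g u"
  define R where "R = norm X + norm (X / q) + norm Z"
  have "0 \<le> R" by (simp add: R_def)
  from mphi_majorant[OF q(1) nz this] obtain v where v: "summable v"
    and v1: "\<And>i X Z. norm X \<le> R \<Longrightarrow> norm Z \<le> R \<Longrightarrow> norm (c i * mpsi i X q * mpsi i Z q) \<le> v i"
    and v2: "\<And>i X Z. norm X \<le> R \<Longrightarrow> norm Z \<le> R \<Longrightarrow> norm (c i * mpsi i X q * mpsi (Suc i) Z q) \<le> v i"
    unfolding c_def by blast
  have nq: "norm (X * q) \<le> norm X" using q by (simp add: norm_mult mult_left_le)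
  have RX: "norm X \<le> R" "norm (X / q) \<le> R" "norm (X * q) \<le> R" "norm Z \<le> R"
    using nq norm_ge_zero[of X] norm_ge_zero[of "X / q"] norm_ge_zero[of Z] unfolding R_def by linarith+
  have s: "(\<lambda>i. c i * mpsi i Y q * mpsi i Z q) sums mphi q g u Y Z" if "norm Y \<le> R" for Y
    unfolding mphi_def c_def[symmetric] by (intro summable_sums summable_comparison_test'[OF v] v1 that RX)
  define T where "T = (\<Sum>i. c i * mpsi i X q * mpsi (Suc i) Z q)"
  have sT: "(\<lambda>i. c i * mpsi i X q * mpsi (Suc i) Z q) sums T"
    unfolding T_def by (intro summable_sums summable_comparison_test'[OF v] v2 RX)
  let ?W = "(1 - g * u * X) * (1 - g / u * X)"
  have "(\<lambda>i. q * (1 + X) * (c i * mpsi i (X / q) q * mpsi i Z q - c i * mpsi i X q * mpsi i Z q)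
       + ?W * (c i * mpsi i (X * q) q * mpsi i Z q - c i * mpsi i X q * mpsi i Z q))
      sums (q * (1 + X) * (mphi q g u (X / q) Z - mphi q g u X Z) + ?W * (mphi q g u (X * q) Z - mphi q g u X Z))"
    (is "?f sums ?L")
    by (intro sums_add sums_mult sums_diff s RX)
  \<comment> \<open>The term of index 0 does not depend on \<open>X\<close>; dropping it aligns the
    indices of the two series.\<close>
  moreover have "?f 0 = 0" by simp
  ultimately have L: "(\<lambda>i. ?f (Suc i)) sums ?L" using sums_Suc_iff[of ?f ?L] by simp
  have "Z * (c i * mpsi i X q * mpsi i Z q) = c i * mpsi i X q * mpsi (Suc i) Z q - q ^ i * (c i * mpsi i X q * mpsi i Z q)" for i
    by (simp add: mpsi_Suc algebra_simps)
  then have "(\<lambda>i. (Z + 1) * (c i * mpsi i X q * mpsi i Z q) - c i * mpsi i X q * mpsi (Suc i) Z q)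
      = (\<lambda>i. (1 - q ^ i) * (c i * mpsi i X q * mpsi i Z q))"
    by (simp add: fun_eq_iff distrib_right left_diff_distrib)
  then have "(\<lambda>i. (1 - q ^ i) * (c i * mpsi i X q * mpsi i Z q)) sums ((Z + 1) * mphi q g u X Z - T)" (is "?h sums _")
    using sums_diff[OF sums_mult[OF s[OF RX(1)], of "Z + 1"] sT] by simp
  then have "(\<lambda>i. ?h (Suc i)) sums ((Z + 1) * mphi q g u X Z - T)"
    using sums_Suc_iff[of ?h] by simp
  from sums_mult[OF sums_add[OF this sT], of "- (g ^ 2 * X ^ 2)"]
  have R: "(\<lambda>i. - (g ^ 2 * X ^ 2) * (?h (Suc i) + c i * mpsi i X q * mpsi (Suc i) Z q))
      sums (- (g ^ 2 * X ^ 2) * ((Z + 1) * mphi q g u X Z))"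
    by simp
  \<comment> \<open>The comparison is made after multiplication by \<open>y = q ^ i\<close>, since
    the polynomial at \<open>X / q\<close> is available without division only in that form.\<close>
  have E: "?f (Suc i) = - (g ^ 2 * X ^ 2) * (?h (Suc i) + c i * mpsi i X q * mpsi (Suc i) Z q)" for i
  proof -
    define a where "a = mpsi i X q"
    define z where "z = mpsi (Suc i) Z q"
    define y where "y = q ^ i"
    define C where "C = c (Suc i)"
    have y: "y \<noteq> 0" using q by (simp add: y_def)
    have 1: "mpsi (Suc i) X q = a * (X + y)" by (simp add: mpsi_Suc a_def y_def)
    have 2: "mpsi (Suc i) (X * q) q - mpsi (Suc i) X q = - (1 - q * y) * X * a"
      unfolding mpsi_scale_up by (simp add: a_def y_def algebra_simps)
    have 3: "q * (1 + X) * (mpsi (Suc i) (X / q) q - mpsi (Suc i) X q) * y = (1 - q * y) * X * a * (X + y)"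
    proof -
      have "(1 + X) * (q * y * mpsi (Suc i) (X / q) q) = (X + q * y) * (a * (X + y))"
        using mpsi_scale_down[OF q(2), of X "Suc i"] unfolding 1 by (simp add: y_def)
      moreover have "q * (1 + X) * (M - a * (X + y)) * y = (1 - q * y) * X * a * (X + y)"
        if "(1 + X) * (q * y * M) = (X + q * y) * (a * (X + y))" for M
      proof -
        have "q * (1 + X) * (M - a * (X + y)) * y = (1 + X) * (q * y * M) - q * (1 + X) * a * (X + y) * y"
          by (simp add: algebra_simps)
        then show ?thesis unfolding that by (simp add: algebra_simps)
      qed
      ultimately show ?thesis unfolding 1 by blast
    qed
    have 4: "C * (1 - q * y) * ((1 + g * u * y) * (1 + g / u * y)) = - (y * g ^ 2) * c i"
      using mcoeff_Suc[OF u q(1) nz, of i] by (simp add: C_def c_def y_def)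
    define v where "v = g * u + g / u"
    have gg: "g * u * (g / u) = g ^ 2" using u by (simp add: power2_eq_square)
    have w: "(1 + g * u * y) * (1 + g / u * y) = 1 + v * y + g^2 * y^2" "?W = 1 - v * X + g^2 * X^2"
      unfolding v_def gg[symmetric] by (simp_all add: algebra_simps power2_eq_square)
    have "g ^ 2 * c i * y = - (- (y * g ^ 2) * c i)" by simp
    then have gci: "g ^ 2 * c i * y = - (C * (1 - q * y) * (1 + v * y + g^2 * y^2))"
      unfolding 4[symmetric] w .
    have "y * (q * (1 + X) * (C * mpsi (Suc i) (X / q) q * z - C * mpsi (Suc i) X q * z)
       + ?W * (C * mpsi (Suc i) (X * q) q * z - C * mpsi (Suc i) X q * z))
      = C * z * (q * (1 + X) * (mpsi (Suc i) (X / q) q - mpsi (Suc i) X q) * y)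
        + y * C * z * ?W * (mpsi (Suc i) (X * q) q - mpsi (Suc i) X q)"
    proof -
      have "y * (q * (1 + X) * (C * m1 * z - C * m2 * z) + W * (C * m3 * z - C * m2 * z))
          = C * z * (q * (1 + X) * (m1 - m2) * y) + y * C * z * W * (m3 - m2)" for W m1 m2 m3
        by (simp add: algebra_simps)
      then show ?thesis .
    qed
    also have "\<dots> = C * z * (1 - q * y) * X * a * (X + y - y * ?W)"
    proof -
      have "C * z * ((1 - q * y) * X * a * (X + y)) + y * C * z * W * (- (1 - q * y) * X * a)
          = C * z * (1 - q * y) * X * a * (X + y - y * W)" for W
        by (simp add: algebra_simps)
      then show ?thesis unfolding 2 3 .
    qed
    also have "\<dots> = - (X ^ 2) * (g ^ 2 * y * (1 - q * y) * (C * (a * (X + y)) * z) + (g ^ 2 * c i * y) * a * z)"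
      unfolding gci w by (simp add: algebra_simps power2_eq_square)
    also have "\<dots> = y * (- (g ^ 2 * X ^ 2) * ((1 - q * y) * (C * (a * (X + y)) * z) + c i * a * z))"
      by (simp add: algebra_simps)
    finally have F: "y * (q * (1 + X) * (C * mpsi (Suc i) (X / q) q * z - C * mpsi (Suc i) X q * z)
         + ?W * (C * mpsi (Suc i) (X * q) q * z - C * mpsi (Suc i) X q * z))
       = y * (- (g ^ 2 * X ^ 2) * ((1 - q * y) * (C * (a * (X + y)) * z) + c i * a * z))" .
    from mult_left_cancel[OF y, THEN iffD1, OF F]
    show ?thesis unfolding 1[symmetric] unfolding C_def z_def y_def a_def by (simp only: power_Suc)
  qed
  show ?thesis using sums_unique2[OF L[unfolded E] R] by (simp only: mult.assoc)
qed

text \<open>This is the summation of 1phi1 with upper parameter \<open>- 1 / X\<close>, lower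
  parameter \<open>c\<close> and argument \<open>- c * X\<close>. The sum satisfies a first order
  equation relating \<open>c\<close> and \<open>c * q\<close>; iterating it leads to
  \<open>c = 0\<close>, where the sum is 1.\<close>

lemma one_phi_one_sum:
  fixes q c X :: complex
  assumes q: "norm q < 1" "q \<noteq> 0" and c: "\<And>j. c * q ^ j \<noteq> 1"
  shows "(\<lambda>i. mpsi i X q * q ^ (i * (i - 1) div 2) * c ^ i / (qpoch q q i * qpoch c q i))
    sums (qpoch_inf (- c * X) q / qpoch_inf c q)"
proof -
  define s where "s c i = mpsi i X q * q ^ (i * (i - 1) div 2) * c ^ i / (qpoch q q i * qpoch c q i)" for c i
  obtain C1 where C1: "C1 > 0" "\<And>i. norm (1 / qpoch q q i) \<le> C1"
    using qpoch_inverse_bounded[OF q(1) q_power_neq_1[OF q(1)]] by blast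
  obtain C2 where C2: "C2 > 0" "\<And>i. norm (1 / qpoch c q i) \<le> C2"
    using qpoch_inverse_bounded[OF q(1) c] by blast
  obtain C3 where C3: "\<And>n. norm (qpoch c q n) \<le> C3"
    using convergent_imp_Bseq[OF convergentI[OF qpoch_LIMSEQ[OF q(1), of c]]] by (auto simp: Bseq_def)
  have C30: "C3 \<ge> 0" using C3[of 0] by simp
  have cn: "qpoch c q n \<noteq> 0" for n using c by (auto simp: qpoch_eq_0_iff)
  \<comment> \<open>The bound has to be uniform in \<open>n\<close> for Tannery's theorem; writing
    the reciprocal as a product of \<open>qpoch c q n\<close> and a reciprocal with parameter
    \<open>c\<close> gives it.\<close>
  have inv: "norm (1 / qpoch (c * q ^ n) q i) \<le> C3 * C2" for n i
  proof -
    have "1 / qpoch (c * q ^ n) q i = qpoch c q n * (1 / qpoch c q (n + i))"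
      using cn by (simp add: qpoch_add)
    also have "norm \<dots> \<le> C3 * C2" unfolding norm_mult using C2 C3 C30 by (intro mult_mono) auto
    finally show ?thesis .
  qed
  define M where "M i = C1 * (C3 * C2) * (norm q ^ (i * (i - 1) div 2) * ((norm X + 1) * norm c) ^ i)" for i
  have sM: "summable M" unfolding M_def using q by (intro summable_mult summable_gaussian) auto
  define K where "K n i = (norm (1 / qpoch q q i) * norm (1 / qpoch (c * q ^ n) q i))
      * (norm q ^ (i * (i - 1) div 2) * (norm (mpsi i X q) * norm c ^ i))" for n i
  have K: "norm (s (c * q ^ n) i) = K n i * (norm q ^ n) ^ i" for n i
    by (simp add: s_def K_def norm_mult norm_divide norm_power power_mult_distrib)
  have K0: "0 \<le> K n i" for n i by (simp add: K_def)
  have KM: "K n i \<le> M i" for n i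
  proof -
    have 1: "norm (1 / qpoch q q i) * norm (1 / qpoch (c * q ^ n) q i) \<le> C1 * (C3 * C2)"
      using C1 C2 C30 inv[of n i] by (intro mult_mono) auto
    have 2: "norm (mpsi i X q) * norm c ^ i \<le> (norm X + 1) ^ i * norm c ^ i"
      by (intro mult_right_mono norm_mpsi_le[OF q(1)]) auto
    have "K n i \<le> (C1 * (C3 * C2)) * (norm q ^ (i * (i - 1) div 2) * ((norm X + 1) ^ i * norm c ^ i))"
      unfolding K_def using C1 C2 C30 by (intro mult_mono[OF 1] mult_left_mono[OF 2]) auto
    then show ?thesis by (simp add: M_def power_mult_distrib)
  qed
  have bound: "norm (s (c * q ^ n) i) \<le> M i" for n i
  proof -
    have "(norm q ^ n) ^ i \<le> 1" using q by (intro power_le_one) (auto simp: power_le_one)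
    then have "K n i * (norm q ^ n) ^ i \<le> K n i * 1" by (intro mult_left_mono K0)
    then show ?thesis using KM[of n i] unfolding K by simp
  qed
  have sums: "s (c * q ^ n) sums (\<Sum>i. s (c * q ^ n) i)" for n
    by (intro summable_sums summable_comparison_test'[OF sM] bound)
  have step: "(1 - d) * (\<Sum>i. s d i) = (1 + d * X) * (\<Sum>i. s (d * q) i)"
    if d: "d = c * q ^ n" for d n
  proof -
    have dn: "d * q ^ i \<noteq> 1" for i using c[of "n + i"] by (simp add: d power_add mult.assoc)
    \<comment> \<open>\<open>T\<close> is the certificate of the first order equation: it vanishes
      at 0 and tends to 0, and its differences are the termwise differences of the two
      sides.\<close>
    define T where "T i = (1 - d) * (1 - q ^ i) * s d i" for i
    have s1: "s d sums (\<Sum>i. s d i)" using sums[of n] d by simp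
    have s2: "s (d * q) sums (\<Sum>i. s (d * q) i)" using sums[of "Suc n"] d by (simp add: mult_ac)
    have "(\<lambda>i. (1 - d) * (1 - q ^ i) * s d i) \<longlonglongrightarrow> (1 - d) * (1 - 0) * 0"
      using q by (intro tendsto_intros LIMSEQ_power_zero summable_LIMSEQ_zero[OF sums_summable[OF s1]]) auto
    then have "T \<longlonglongrightarrow> 0" by (simp add: T_def[abs_def])
    from telescope_sums'[OF this] have "(\<lambda>i. T i - T (Suc i)) sums 0" by (simp add: T_def)
    moreover have "T i - T (Suc i) = (1 - d) * s d i - (1 + d * X) * s (d * q) i" for i
    proof -
      define y where "y = q ^ i"
      have nz: "1 - q * y \<noteq> 0" "1 - d * y \<noteq> 0" "qpoch q q i \<noteq> 0" "qpoch d q i \<noteq> 0" "qpoch (d * q) q i \<noteq> 0" "1 - d \<noteq> 0"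
      proof -
        have "d * q * q ^ j \<noteq> 1" for j using dn[of "Suc j"] by (simp add: mult.assoc)
        then show "qpoch (d * q) q i \<noteq> 0" by (simp add: qpoch_eq_0_iff)
      qed (use q_power_neq_1[OF q(1), of i] dn[of i] dn[of 0] dn qpoch_self_nonzero[OF q(1)] in
           \<open>simp_all add: y_def qpoch_eq_0_iff\<close>)
      have r: "(1 - d) * qpoch (d * q) q i = qpoch d q i * (1 - d * y)"
        using qpoch_Suc[of d q i] qpoch_Suc_shift[of d q i] by (simp add: y_def)
      have sdq: "s (d * q) i * (1 - d * y) = s d i * (y * (1 - d))"
      proof -
        have "A * (D * y) / (E * F) * (1 - d * y) = A * D / (E * H) * (y * (1 - d))"
          if "(1 - d) * F = H * (1 - d * y)" "F \<noteq> 0" "H \<noteq> 0" "E \<noteq> 0" for A D E F H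
        proof -
          have "A * (D * y) / (E * F) * (1 - d * y) = A * D * y * (H * (1 - d * y)) / (E * F * H)"
            using that(3) by simp
          also have "\<dots> = A * D / (E * H) * (y * (1 - d))" unfolding that(1)[symmetric] using that(2) by simp
          finally show ?thesis .
        qed
        from this[OF r nz(5,4,3)] show ?thesis unfolding s_def power_mult_distrib y_def[symmetric] .
      qed
      have sSuc: "s d (Suc i) * ((1 - q * y) * (1 - d * y)) = s d i * ((X + y) * y * d)"
      proof -
        have "P * W * (t * y) * (d * D) / ((A * E) * (B * F)) * (E * F) = P * t * D / (A * B) * (W * y * d)"
          if "E \<noteq> 0" "F \<noteq> 0" for P W t D A B E F using that by (simp add: mult_ac)
        from this[OF nz(1,2)] show ?thesis
          unfolding s_def triangle_Suc mpsi_Suc qpoch_Suc power_add power_Suc y_def[symmetric] .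
      qed
      have "(T i - T (Suc i)) * (1 - d * y) = (1 - d) * ((1 - y) * s d i * (1 - d * y) - s d (Suc i) * ((1 - q * y) * (1 - d * y)))"
        by (simp add: T_def y_def algebra_simps)
      also have "\<dots> = (1 - d) * s d i * (1 - d * y) - (1 + d * X) * (s (d * q) i * (1 - d * y))"
        unfolding sSuc sdq by (simp add: algebra_simps)
      also have "\<dots> = ((1 - d) * s d i - (1 + d * X) * s (d * q) i) * (1 - d * y)"
        by (simp add: algebra_simps)
      finally show ?thesis using nz by simp
    qed
    ultimately have "(\<lambda>i. (1 - d) * s d i - (1 + d * X) * s (d * q) i) sums 0" by simp
    from sums_unique2[OF this sums_diff[OF sums_mult[OF s1] sums_mult[OF s2]]]
    show ?thesis by simp
  qed
  have iter: "qpoch c q n * (\<Sum>i. s c i) = qpoch (- c * X) q n * (\<Sum>i. s (c * q ^ n) i)" for n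
  proof (induction n)
    case (Suc n)
    have "qpoch c q (Suc n) * (\<Sum>i. s c i) = (1 - c * q ^ n) * (qpoch c q n * (\<Sum>i. s c i))"
      by (simp add: qpoch_Suc)
    also have "\<dots> = qpoch (- c * X) q n * ((1 - c * q ^ n) * (\<Sum>i. s (c * q ^ n) i))"
      unfolding Suc.IH by simp
    also have "\<dots> = qpoch (- c * X) q (Suc n) * (\<Sum>i. s (c * q ^ Suc n) i)"
      unfolding step[OF refl] by (simp add: qpoch_Suc mult_ac)
    finally show ?case .
  qed simp
  have "(\<lambda>n. \<Sum>i. s (c * q ^ n) i) \<longlonglongrightarrow> (\<Sum>i. if i = 0 then 1 else 0)"
  proof (rule tannery_sequence[OF _ bound sM])
    show "(\<lambda>n. s (c * q ^ n) i) \<longlonglongrightarrow> (if i = 0 then 1 else 0)" for i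
    proof (cases "i = 0")
      case False
      have A: "(\<lambda>n. (M i * norm q ^ n)) \<longlonglongrightarrow> 0"
        using q by (intro tendsto_mult_right_zero LIMSEQ_power_zero) simp
      have B: "norm (s (c * q ^ n) i) \<le> M i * norm q ^ n" for n
      proof -
        have "(norm q ^ n) ^ i \<le> (norm q ^ n) ^ 1"
          using False q by (intro power_decreasing) (auto simp: power_le_one)
        then have "K n i * (norm q ^ n) ^ i \<le> K n i * norm q ^ n" by (intro mult_left_mono K0) simp
        also have "\<dots> \<le> M i * norm q ^ n" by (intro mult_right_mono KM) simp
        finally show ?thesis unfolding K .
      qed
      have "(\<lambda>n. s (c * q ^ n) i) \<longlonglongrightarrow> 0"
        by (rule Lim_null_comparison[OF always_eventually[OF allI[OF B]] A])
      then show ?thesis using False by simp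
    qed (simp add: s_def)
  qed
  moreover have "(\<Sum>i. if i = 0 then 1 else 0 :: complex) = 1"
    using suminf_finite[of "{0}" "\<lambda>i. if i = 0 then 1 else 0 :: complex"] by simp
  ultimately have L: "(\<lambda>n. \<Sum>i. s (c * q ^ n) i) \<longlonglongrightarrow> 1" by simp
  have "qpoch_inf c q * (\<Sum>i. s c i) = qpoch_inf (- c * X) q * 1"
  proof (rule LIMSEQ_unique)
    show "(\<lambda>n. qpoch c q n * (\<Sum>i. s c i)) \<longlonglongrightarrow> qpoch_inf c q * (\<Sum>i. s c i)"
      by (intro tendsto_intros qpoch_LIMSEQ q)
    show "(\<lambda>n. qpoch c q n * (\<Sum>i. s c i)) \<longlonglongrightarrow> qpoch_inf (- c * X) q * 1"
      unfolding iter by (intro tendsto_intros qpoch_LIMSEQ q L)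
  qed
  moreover have "qpoch_inf c q \<noteq> 0" using c qpoch_inf_eq_0_iff[OF q(1)] by auto
  ultimately have "(\<Sum>i. s c i) = qpoch_inf (- c * X) q / qpoch_inf c q"
    by (simp only: nonzero_eq_divide_eq mult.commute[of _ "qpoch_inf c q"] mult_1_right not_False_eq_True)
  moreover have "s c sums (\<Sum>i. s c i)" using sums[of 0] by (simp only: power_0 mult_1_right)
  moreover have "s c = (\<lambda>i. mpsi i X q * q ^ (i * (i - 1) div 2) * c ^ i / (qpoch q q i * qpoch c q i))"
    by (rule ext) (rule s_def)
  ultimately show ?thesis by (simp only:)
qed

subsection \<open>The core summation formula\<close>

text \<open>The polynomial identity inside \<open>ff_step\<close>, separated from its meaning. There
  \<open>y = q ^ n\<close>, \<open>K = inverse q ^ k\<close> and \<open>v = u + 1 / u\<close>;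
  \<open>P\<close> denotes dual q-Hahn and \<open>G\<close> big q-Laguerre values. The suffix
  \<open>0\<close> is the value at \<open>n\<close> and \<open>X\<close>, \<open>m\<close> and
  \<open>p\<close> stand for \<open>n - 1\<close> and \<open>n + 1\<close>, \<open>u\<close> and
  \<open>d\<close> for \<open>q * X\<close> and \<open>X / q\<close>.\<close>

lemma coupling_step_algebra:
  fixes q x g t \<alpha> K \<rho> y v X w \<beta> A W b S P0 Pm Pp Pu Pd G0 Gm Gp Gu Gd :: complex
  assumes \<rho>: "\<rho> = \<alpha> * K" and X: "X = q * x" and w: "w = t * g ^ 2" and \<beta>: "\<beta> = 1 - w * x * y"
    and A: "A = 1 - w * X * y" and W: "W = 1 - g * v * X + g ^ 2 * X ^ 2" and b: "b = - t * \<rho>"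
    and S: "S = (1 - \<alpha> * (q * y)) * (1 - b * (q * y)) - \<alpha> * b * (q * y) * (1 - y)"
    and e1: "(1 + X) * Gd = (1 + X * y * \<rho>) * G0 + X * (1 - \<alpha> * y) * Gm"
    and e2: "Gu = A * G0 + X * w * y * K * Gp"
    and e3: "Pd = P0 - g * x * (1 - y) * (1 - b * y) * Pm"
    and e4: "g * X * Pp = A * (1 + q * \<rho> * X * y) * P0 - W * Pu"
    and e5: "g * Pp = (g * v - ((w - q * \<rho> + g ^ 2 * X) * y - w * \<rho> * X * y * (1 - y - q * y))) * P0
        - g * (1 - y) * (1 - b * y) * \<beta> * (1 + \<rho> * X * y) * Pm"
    and e6: "(X * q + 1) * G0 = (1 + X * q * y * \<rho>) * Gu + X * q * (1 - \<alpha> * y) * (\<beta> * Gm + w * x * y * K * G0)"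
  shows "q * \<alpha> * (q * (1 + X) * (\<beta> * A * Pd * Gd) + W * (Pu * Gu))
      + (g ^ 2 * X ^ 2 * (q * \<alpha> - 1 + S) - q * \<alpha> * (q * (1 + X) + W)) * (A * P0 * G0)
      + g ^ 2 * X ^ 2 * (q * y * \<rho> * t * g) * (Pp * Gp)
      + g * X ^ 2 * \<alpha> * q * (1 - y) * (1 - \<alpha> * y) * (1 - b * y) * (\<beta> * A * Pm * Gm) = 0"
proof -
  define R5 where "R5 = (g * v - ((w - q * \<rho> + g ^ 2 * X) * y - w * \<rho> * X * y * (1 - y - q * y))) * P0
        - g * (1 - y) * (1 - b * y) * \<beta> * (1 + \<rho> * X * y) * Pm"
  define R6 where "R6 = (1 + X * q * y * \<rho>) * (A * G0 + X * w * y * K * Gp)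
     + X * q * (1 - \<alpha> * y) * (\<beta> * Gm + w * x * y * K * G0) - (X * q + 1) * G0"
  have WPu: "W * Pu = A * (1 + q * \<rho> * X * y) * P0 - g * X * Pp" using e4 by simp
  have z5: "R5 - g * Pp = 0" using e5 by (simp add: R5_def)
  have z6: "R6 = 0" using e6 unfolding e2 by (simp add: R6_def)
  have "q * (1 + X) * (\<beta> * A * Pd * Gd) + W * (Pu * Gu) = q * \<beta> * A * Pd * ((1 + X) * Gd) + (W * Pu) * Gu"
    by (simp only: mult_ac)
  also have "\<dots> = q * \<beta> * A * (P0 - g * x * (1 - y) * (1 - b * y) * Pm) * ((1 + X * y * \<rho>) * G0 + X * (1 - \<alpha> * y) * Gm)
      + (A * (1 + q * \<rho> * X * y) * P0 - g * X * Pp) * (A * G0 + X * w * y * K * Gp)"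
    unfolding e1 WPu e2 e3 ..
  finally have 1: "q * (1 + X) * (\<beta> * A * Pd * Gd) + W * (Pu * Gu) = \<dots>" .
  \<comment> \<open>Once \<open>e1\<close> to \<open>e4\<close> have removed the values at
    \<open>X / q\<close> and \<open>q * X\<close>, the expression lies in the ideal of the two
    remaining relations; the right-hand side gives the multipliers explicitly.\<close>
  have "q * \<alpha> * (q * \<beta> * A * (P0 - g * x * (1 - y) * (1 - b * y) * Pm) * ((1 + X * y * \<rho>) * G0 + X * (1 - \<alpha> * y) * Gm)
      + (A * (1 + q * \<rho> * X * y) * P0 - g * X * Pp) * (A * G0 + X * w * y * K * Gp))
      + (g ^ 2 * X ^ 2 * (q * \<alpha> - 1 + S) - q * \<alpha> * (q * (1 + X) + W)) * (A * P0 * G0)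
      + g ^ 2 * X ^ 2 * (q * y * \<rho> * t * g) * (Pp * Gp)
      + g * X ^ 2 * \<alpha> * q * (1 - y) * (1 - \<alpha> * y) * (1 - b * y) * (\<beta> * A * Pm * Gm)
    = q * \<alpha> * A * (X * G0 * (R5 - g * Pp) + P0 * R6)"
    unfolding R5_def R6_def S b W A \<beta> w X \<rho> by algebra
  then show ?thesis unfolding 1 z5 z6 by simp
qed

text \<open>\<open>q\<close> stands for the base. The conditions \<open>A\<close> keep the
  denominators of the q-Meixner series and of the weight on \<open>- (q ^ i)\<close> away from 0,
  and \<open>T\<close> those of the weight on the points \<open>t * q ^ i / q ^ j\<close>.
  \<open>t\<close> keeps these two sequences of points apart in the Andrews-Askey integral,
  \<open>tg\<close> is the condition of the 1phi1 summation, and \<open>b\<close>, \<open>bh\<close>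
  belong to the lower parameters of the two big q-Laguerre polynomials.\<close>

locale coupling_core =
  fixes q t g u \<rho> :: complex
  assumes q: "norm q < 1" "q \<noteq> 0" and nz: "t \<noteq> 0" "g \<noteq> 0" "u \<noteq> 0" "\<rho> \<noteq> 0"
    and A: "\<And>i. - g * u * q ^ i \<noteq> 1" "\<And>i. - g / u * q ^ i \<noteq> 1"
    and T: "\<And>i j. t * g * u * q ^ i \<noteq> q ^ j" "\<And>i j. t * g / u * q ^ i \<noteq> q ^ j"
    and t: "\<And>i j. t * q ^ i \<noteq> - (q ^ j)"
    and tg: "\<And>i j. t * g ^ 2 * q ^ i \<noteq> - (q ^ j)"
    and b: "\<And>i. - t * \<rho> * q * q ^ i \<noteq> 1" and bh: "\<And>i. - q * \<rho> / (t * g ^ 2) * q * q ^ i \<noteq> 1"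
begin

text \<open>The Andrews-Askey weight with endpoints \<open>- 1\<close> and \<open>t / q ^ k\<close>.
  The factor with \<open>q ^ Suc k / t\<close> combines what the two coefficients on the side of
  \<open>Z\<close> contribute for degree \<open>k\<close>.\<close>

definition ker :: "nat \<Rightarrow> complex \<Rightarrow> complex" where
  "ker k Z = qpoch_inf (- q * Z) q * qpoch_inf (q ^ Suc k / t * Z) q / (qpoch_inf (g * u * Z) q * qpoch_inf (g / u * Z) q)"

definition HH :: "nat \<Rightarrow> nat \<Rightarrow> complex \<Rightarrow> complex" where
  "HH k n Z = ker k Z * cdqH_poly k u (q / (t * g)) (- q * \<rho> / g) (g * Z) q
     * bqL_num n (q ^ k * \<rho>) (- t * \<rho>) (- Z * q * (q ^ k * \<rho>)) q"

definition JJ :: "nat \<Rightarrow> nat \<Rightarrow> complex \<Rightarrow> complex" where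
  "JJ k n X = jint q (- 1) (t / q ^ k) (\<lambda>Z. HH k n Z * mphi q g u X Z)"

definition ff :: "nat \<Rightarrow> nat \<Rightarrow> complex \<Rightarrow> complex" where
  "ff k n X = qpoch_inf (t * g ^ 2 * X * q ^ n) q * cdqH_poly n u (t * g) (- q * \<rho> / g) (g * X) q
     * bqL_num k (q ^ n * \<rho>) (- q * \<rho> / (t * g ^ 2)) (- X * q * (q ^ n * \<rho>)) q"

text \<open>The ratio of the integral to \<open>ff\<close>, free of \<open>X\<close>. The first
  factor is its value at \<open>k = n = 0\<close>, the second is the dependence on \<open>k\<close>
  that the case \<open>n = 0\<close> produces, and the third solves the recurrence
  \<open>kap_Suc\<close> in \<open>n\<close>.\<close>

definition kap :: "nat \<Rightarrow> nat \<Rightarrow> complex" where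
  "kap k n = t * qpoch_inf q q * qtheta (- 1 / t) q
      / (qpoch_inf (- g * u) q * qpoch_inf (- g / u) q * qpoch_inf (t * g * u) q * qpoch_inf (t * g / u) q)
    * (inverse (q / (t * g)) ^ k * inverse \<rho> ^ k * qpoch (- q * \<rho> / (t * g ^ 2) * q) q k * ((- 1) ^ k / q ^ (k * (k + 1) div 2)))
    * ((- \<rho> * t * g) ^ n * q ^ (n * (n + 1) div 2) / qpoch (- t * \<rho> * q) q n)"

lemma jbounded_ker: "jbounded q x (ker k)"
proof -
  have "ker k = (\<lambda>Z. qpoch_inf (- q * Z) q * qpoch_inf (q ^ Suc k / t * Z) q
      * (1 / qpoch_inf (g * u * Z) q) * (1 / qpoch_inf (g / u * Z) q))"
    by (simp add: ker_def fun_eq_iff)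
  then show ?thesis
    by (simp only:) (intro jbounded_mult jbounded_qpoch_inf jbounded_inverse_qpoch_inf q)
qed

lemma jbounded_qpoch:
  assumes "jbounded q x F" shows "jbounded q x (\<lambda>Z. qpoch (F Z) q n)"
proof -
  have "qpoch (F Z) q n = (\<Prod>j<n. 1 + (- (q ^ j)) * F Z)" for Z
    unfolding qpoch_def by (intro prod.cong refl) simp
  then show ?thesis by (simp only:) (intro jbounded_prod jbounded_add jbounded_mult jbounded_const assms)
qed

lemma jbounded_HH: "jbounded q x (HH k n)"
proof -
  have lin: "jbounded q x (\<lambda>Z. - Z * q * (q ^ k * \<rho>))" "jbounded q x (\<lambda>Z. q / (t * g) * (g * Z) * q ^ i)" for i
  proof -
    have "(\<lambda>Z. - Z * q * (q ^ k * \<rho>)) = (\<lambda>Z. (- q * (q ^ k * \<rho>)) * Z)" by (simp add: fun_eq_iff)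
    then show "jbounded q x (\<lambda>Z. - Z * q * (q ^ k * \<rho>))"
      by (simp only:) (intro jbounded_mult jbounded_const jbounded_ident q)
    show "jbounded q x (\<lambda>Z. q / (t * g) * (g * Z) * q ^ i)"
      by (intro jbounded_mult jbounded_const jbounded_ident q)
  qed
  have B: "bqL_num n (q ^ k * \<rho>) (- t * \<rho>) z q = (\<Sum>i\<le>n. (qpoch (inverse q ^ n) q i * (qpoch (q ^ k * \<rho> * q ^ Suc i) q (n - i)
     / (qpoch q q i * qpoch (- t * \<rho> * q) q i) * q ^ i)) * qpoch z q i)" for z
    unfolding bqL_num_def by (intro sum.cong refl) (simp only: mult_ac times_divide_eq_right times_divide_eq_left)
  have "HH k n = (\<lambda>Z. ker k Z
     * (inverse (q / (t * g)) ^ k *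
     (\<Sum>i\<le>k. qpoch (q / (t * g) * (- q * \<rho> / g) * q ^ i) q (k - i) * qpoch (q / (t * g) * (g * Z) * q ^ i) q (k - i)
            * (qpoch (inverse q ^ k) q i * qpoch (q / (t * g) * u) q i * qpoch (q / (t * g) / u) q i / qpoch q q i)
            * q ^ i))
     * (\<Sum>i\<le>n. (qpoch (inverse q ^ n) q i * (qpoch (q ^ k * \<rho> * q ^ Suc i) q (n - i)
     / (qpoch q q i * qpoch (- t * \<rho> * q) q i) * q ^ i)) * qpoch (- Z * q * (q ^ k * \<rho>)) q i))"
    unfolding HH_def cdqH_poly_def B fun_eq_iff by blast
  then show ?thesis
    by (simp only:) (intro jbounded_mult jbounded_sum jbounded_const jbounded_qpoch lin jbounded_ker)
qed

lemma jbounded_mphi: "jbounded q x (mphi q g u X)"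
proof -
  have "0 \<le> norm X + norm x" by simp
  from mphi_majorant[OF q(1) A this] obtain v where v: "summable v"
    and v1: "\<And>i X' Z. norm X' \<le> norm X + norm x \<Longrightarrow> norm Z \<le> norm X + norm x
      \<Longrightarrow> norm (mcoeff q g u i * mpsi i X' q * mpsi i Z q) \<le> v i"
    by blast
  have "norm (mphi q g u X (x * q ^ s)) \<le> suminf v" for s
  proof -
    have "norm (x * q ^ s) \<le> norm x" using q by (simp add: norm_mult norm_power mult_left_le power_le_one)
    then have *: "norm (mcoeff q g u i * mpsi i X q * mpsi i (x * q ^ s) q) \<le> v i" for i
      using norm_ge_zero[of X] norm_ge_zero[of x] by (intro v1) linarith+
    show ?thesis unfolding mphi_def by (rule norm_suminf_le[OF * v])
  qed
  then show ?thesis by (auto simp: jbounded_def)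
qed

text \<open>Under the integral the recurrence in \<open>n\<close> multiplies the integrand by an
  affine function of \<open>Z\<close>, and the q-difference equation expresses \<open>Z + 1\<close>
  times the kernel through its values at \<open>X / q\<close>, \<open>X\<close> and
  \<open>X * q\<close>. Since the weight and the polynomials do not involve \<open>X\<close>, the
  operator can be taken out of the integral.\<close>

lemma JJ_step:
  fixes k n :: nat and X :: complex
  assumes X: "X \<noteq> 0"
  defines "\<alpha> \<equiv> q ^ k * \<rho>" and "bb \<equiv> - t * \<rho>" and "W \<equiv> (1 - g * u * X) * (1 - g / u * X)"
  defines "S \<equiv> (1 - \<alpha> * q ^ Suc n) * (1 - bb * q ^ Suc n) - \<alpha> * bb * q ^ Suc n * (1 - q ^ n)"
  shows "q * \<alpha> * (q * (1 + X) * JJ k n (X / q) + W * JJ k n (X * q))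
      + (g ^ 2 * X ^ 2 * (q * \<alpha> - 1 + S) - q * \<alpha> * (q * (1 + X) + W)) * JJ k n X
    = g ^ 2 * X ^ 2 * ((1 - bb * q ^ Suc n) * JJ k (Suc n) X - \<alpha> * bb * q ^ Suc n * (1 - q ^ n) * (1 - \<alpha> * q ^ n) * JJ k (n - 1) X)"
proof -
  define c1 where "c1 = q * \<alpha> * (q * (1 + X))"
  define c2 where "c2 = q * \<alpha> * W"
  define c3 where "c3 = g ^ 2 * X ^ 2 * (q * \<alpha> - 1 + S) - q * \<alpha> * (q * (1 + X) + W)"
  define c4 where "c4 = - (g ^ 2 * X ^ 2 * (1 - bb * q ^ Suc n))"
  define c5 where "c5 = g ^ 2 * X ^ 2 * (\<alpha> * bb * q ^ Suc n * (1 - q ^ n) * (1 - \<alpha> * q ^ n))"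
  let ?F = "\<lambda>n X Z. HH k n Z * mphi q g u X Z"
  have pt: "c1 * ?F n (X / q) Z + (c2 * ?F n (X * q) Z + (c3 * ?F n X Z + (c4 * ?F (Suc n) X Z + c5 * ?F (n - 1) X Z))) = 0" for Z
  proof -
    define z where "z = - Z * q * \<alpha>"
    define B where "B n = bqL_num n \<alpha> bb z q" for n
    define N where "N = ker k Z * cdqH_poly k u (q / (t * g)) (- q * \<rho> / g) (g * Z) q"
    define \<phi> where "\<phi> Y = mphi q g u Y Z" for Y
    have bb: "qpoch (bb * q) q i \<noteq> 0" for i using b by (auto simp: bb_def qpoch_eq_0_iff)
    have 1: "(z - 1) * B n = (1 - bb * q ^ Suc n) * B (Suc n) - S * B n - \<alpha> * bb * q ^ Suc n * (1 - q ^ n) * (1 - \<alpha> * q ^ n) * B (n - 1)"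
      unfolding B_def S_def by (rule bqL_num_three_term[OF q bb])
    have 2: "q * (1 + X) * (\<phi> (X / q) - \<phi> X) + W * (\<phi> (X * q) - \<phi> X) = - (g ^ 2 * X ^ 2) * (Z + 1) * \<phi> X"
      unfolding \<phi>_def W_def by (rule mphi_difference_eq[OF q nz(3) X A])
    have F: "?F n Y Z = N * B n * \<phi> Y" for n Y
      by (simp add: HH_def N_def B_def \<phi>_def z_def \<alpha>_def bb_def)
    \<comment> \<open>The recurrence has its natural origin at \<open>z = 1\<close>, the difference
      equation at \<open>Z = - 1\<close>; the constant \<open>q * \<alpha> - 1\<close> accounts for
      the mismatch and explains its place in the coefficient of \<open>JJ k n X\<close>.\<close>
    have z1: "z - 1 = - (q * \<alpha>) * (Z + 1) + (q * \<alpha> - 1)" by (simp add: z_def algebra_simps)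
    have "c1 * \<phi> (X / q) + c2 * \<phi> (X * q) + c3 * \<phi> X
       = q * \<alpha> * (q * (1 + X) * (\<phi> (X / q) - \<phi> X) + W * (\<phi> (X * q) - \<phi> X)) + g ^ 2 * X ^ 2 * (q * \<alpha> - 1 + S) * \<phi> X"
      by (simp add: c1_def c2_def c3_def algebra_simps)
    also have "\<dots> = g ^ 2 * X ^ 2 * ((z - 1) + S) * \<phi> X"
      unfolding 2 z1 by (simp add: algebra_simps)
    finally have E: "c1 * \<phi> (X / q) + c2 * \<phi> (X * q) + c3 * \<phi> X = g ^ 2 * X ^ 2 * ((z - 1) + S) * \<phi> X" .
    have "N * B n * (c1 * \<phi> (X / q) + c2 * \<phi> (X * q) + c3 * \<phi> X)
        = N * (g ^ 2 * X ^ 2) * \<phi> X * ((z - 1) * B n + S * B n)" unfolding E by (simp add: algebra_simps)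
    also have "\<dots> = - (c4 * (N * B (Suc n) * \<phi> X) + c5 * (N * B (n - 1) * \<phi> X))"
      unfolding 1 c4_def c5_def by (simp add: algebra_simps)
    finally have E: "N * B n * (c1 * \<phi> (X / q) + c2 * \<phi> (X * q) + c3 * \<phi> X)
        = - (c4 * (N * B (Suc n) * \<phi> X) + c5 * (N * B (n - 1) * \<phi> X))" .
    have "c1 * (M * p1) + (c2 * (M * p2) + (c3 * (M * p3) + r)) = 0" if "M * (c1 * p1 + c2 * p2 + c3 * p3) = - r" for M p1 p2 p3 r
    proof -
      have "c1 * (M * p1) + (c2 * (M * p2) + (c3 * (M * p3) + r)) = M * (c1 * p1 + c2 * p2 + c3 * p3) + r"
        by (simp add: algebra_simps)
      then show ?thesis unfolding that by simp
    qed
    from this[OF E] show ?thesis unfolding F .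
  qed
  have bF: "jbounded q x (?F n Y)" for x n Y by (intro jbounded_mult jbounded_HH jbounded_mphi)
  have "jint q (- 1) (t / q ^ k) (\<lambda>Z. c1 * ?F n (X / q) Z + (c2 * ?F n (X * q) Z + (c3 * ?F n X Z + (c4 * ?F (Suc n) X Z + c5 * ?F (n - 1) X Z))))
     = c1 * JJ k n (X / q) + (c2 * JJ k n (X * q) + (c3 * JJ k n X + (c4 * JJ k (Suc n) X + c5 * JJ k (n - 1) X)))"
    unfolding JJ_def
    by (simp only: jint_add[OF q(1)] jint_cmult[OF q(1)] jbounded_mult[OF jbounded_const] jbounded_add bF)
  also have "(\<lambda>Z. c1 * ?F n (X / q) Z + (c2 * ?F n (X * q) Z + (c3 * ?F n X Z + (c4 * ?F (Suc n) X Z + c5 * ?F (n - 1) X Z)))) = (\<lambda>_. 0)"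
    unfolding fun_eq_iff using pt by blast
  finally have "c1 * JJ k n (X / q) + (c2 * JJ k n (X * q) + (c3 * JJ k n X + (c4 * JJ k (Suc n) X + c5 * JJ k (n - 1) X))) = 0"
    by simp
  moreover have "q * \<alpha> * (x1 * j1 + W * j2) + c3 * j3 = G * (y * j4 - z * j5)"
    if "q * \<alpha> * x1 * j1 + (q * \<alpha> * W * j2 + (c3 * j3 + (- (G * y) * j4 + G * z * j5))) = 0" for x1 j1 j2 j3 j4 j5 G y z
    using that by algebra
  ultimately show ?thesis unfolding c1_def c2_def c4_def c5_def c3_def[symmetric] by blast
qed

text \<open>The same operator in \<open>X\<close> applied to the conjectured right-hand side. The
  six contiguous relations relate the neighbours of \<open>ff k n X\<close> in \<open>n\<close> and
  in \<open>X\<close>; the coefficients on the right differ from those in \<open>JJ_step\<close>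
  exactly by ratios of \<open>kap\<close>.\<close>

lemma ff_step:
  fixes k n :: nat and X :: complex
  assumes X: "X \<noteq> 0"
  defines "\<alpha> \<equiv> q ^ k * \<rho>" and "bb \<equiv> - t * \<rho>" and "W \<equiv> (1 - g * u * X) * (1 - g / u * X)"
  defines "S \<equiv> (1 - \<alpha> * q ^ Suc n) * (1 - bb * q ^ Suc n) - \<alpha> * bb * q ^ Suc n * (1 - q ^ n)"
  shows "q * \<alpha> * (q * (1 + X) * ff k n (X / q) + W * ff k n (X * q))
      + (g ^ 2 * X ^ 2 * (q * \<alpha> - 1 + S) - q * \<alpha> * (q * (1 + X) + W)) * ff k n X
    = g ^ 2 * X ^ 2 * (- (q ^ Suc n * \<rho> * t * g) * ff k (Suc n) X
        - \<alpha> * q / g * (1 - q ^ n) * (1 - bb * q ^ n) * (1 - \<alpha> * q ^ n) * ff k (n - 1) X)"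
proof -
  define w where "w = t * g ^ 2"
  define x where "x = X / q"
  define y where "y = q ^ n"
  define K where "K = inverse q ^ k"
  define v where "v = u + 1 / u"
  define be where "be = - q * \<rho> / w"
  \<comment> \<open>\<open>Q1\<close> is the largest common factor of the infinite products in the
    five values of \<open>ff\<close>. The value at \<open>n\<close> and \<open>X\<close> has the
    additional factor \<open>AA\<close>, those at \<open>X / q\<close> and at \<open>n - 1\<close>
    have \<open>\<beta> * AA\<close>, those at \<open>X * q\<close> and at \<open>n + 1\<close> have
    none.\<close>
  define Q1 where "Q1 = qpoch_inf (w * X * (q * y)) q"
  define AA where "AA = 1 - w * X * y"
  define \<beta> where "\<beta> = 1 - w * x * y"
  let ?P = "\<lambda>n c. cdqH_poly n u (t * g) (- q * \<rho> / g) c q" and ?G = "\<lambda>a z. bqL_num k a be z q"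
  define P0 Pm Pp Pu Pd where "P0 = ?P n (g * X)" and "Pm = ?P (n - 1) (g * X)" and "Pp = ?P (Suc n) (g * X)"
    and "Pu = ?P n (g * (X * q))" and "Pd = ?P n (g * x)"
  define G0 Gm Gp Gu Gd where "G0 = ?G (y * \<rho>) (- X * q * (y * \<rho>))" and "Gm = ?G (y * \<rho> / q) (- X * (y * \<rho>))"
    and "Gp = ?G (y * \<rho> * q) (- X * q * (y * \<rho>) * q)" and "Gu = ?G (y * \<rho>) (- X * q * (y * \<rho>) * q)"
    and "Gd = ?G (y * \<rho>) (- X * (y * \<rho>))"
  have w0: "w \<noteq> 0" "y \<noteq> 0" "K \<noteq> 0" using nz q by (auto simp: w_def y_def K_def)
  have Xq: "X = q * x" "x \<noteq> 0" using q X by (auto simp: x_def)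
  have \<rho>K: "\<rho> = \<alpha> * K" using q by (simp add: \<alpha>_def K_def power_inverse)
  have a0: "t * g \<noteq> 0" "- q * \<rho> / g \<noteq> 0" using nz q by auto
  have be: "qpoch (be * q) q i \<noteq> 0" for i using bh by (auto simp: be_def w_def qpoch_eq_0_iff)
  have ab: "t * g * (- q * \<rho> / g) = bb * q" using nz by (simp add: bb_def)
  have ac: "t * g * (g * X) = w * X" by (simp add: w_def power2_eq_square)
  have bc: "- q * \<rho> / g * (g * X) = - q * \<rho> * X" using nz by simp
  have e1: "(1 + X) * Gd = (1 + X * y * \<rho>) * G0 + X * (1 - \<alpha> * y) * Gm"
  proof -
    define a where "a = y * \<rho>"
    have a: "a \<noteq> 0" using w0 nz by (simp add: a_def)
    have "- X * a * (1 - a * q ^ k) * Gm - a * (1 - - X * a) * G0 = (- X * a - a) * Gd"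
    proof -
      have e: "- X * a * q = - X * q * a" by simp
      show ?thesis
        using bqL_num_contiguous[OF q(2), of "- X * a" a k be] unfolding e Gm_def G0_def Gd_def a_def[symmetric] .
    qed
    then have "a * ((1 + X) * Gd) = a * ((1 + X * a) * G0 + X * (1 - a * q ^ k) * Gm)" by (simp add: algebra_simps)
    then have "(1 + X) * Gd = (1 + X * a) * G0 + X * (1 - a * q ^ k) * Gm" by (rule mult_left_cancel[OF a, THEN iffD1])
    moreover have "a * q ^ k = \<alpha> * y" by (simp add: a_def \<alpha>_def)
    ultimately show ?thesis by (simp add: a_def mult.assoc)
  qed
  have shift: "?G a (z * q) = (1 - z / be) * ?G a z + z / be * K * ?G (a * q) (z * q)" for a z
  proof -
    have b0: "be \<noteq> 0" using nz q w0 by (simp add: be_def)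
    have "be * ?G a (z * q) = be * ((1 - z / be) * ?G a z + z / be * K * ?G (a * q) (z * q))"
      using bqL_num_shift[OF q be, of k a z] b0 by (simp add: K_def algebra_simps)
    then show ?thesis by (rule mult_left_cancel[OF b0, THEN iffD1])
  qed
  have zb: "- X * q * (y * \<rho>) / be = X * w * y" "- X * (y * \<rho>) / be = w * x * y"
    using nz q w0 by (simp_all add: be_def x_def)
  have e2: "Gu = AA * G0 + X * w * y * K * Gp"
    using shift[of "y * \<rho>" "- X * q * (y * \<rho>)"] unfolding zb Gu_def G0_def Gp_def AA_def by (simp add: mult.commute[of X w])
  \<comment> \<open>This value does not belong to any of the five functions; it enters through the
    contiguous relation for \<open>e6\<close> and is expressed by \<open>Gm\<close> and
    \<open>G0\<close>.\<close>
  have Gm': "?G (y * \<rho> / q) (- X * (y * \<rho>) * q) = \<beta> * Gm + w * x * y * K * G0"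
  proof -
    have 1: "y * \<rho> / q * q = y * \<rho>" using q by simp
    have "- X * q * (y * \<rho>) = - X * (y * \<rho>) * q" by simp
    then have 2: "G0 = ?G (y * \<rho>) (- X * (y * \<rho>) * q)" by (simp only: G0_def)
    show ?thesis
      using shift[of "y * \<rho> / q" "- X * (y * \<rho>)"] unfolding zb 1 2 Gm_def \<beta>_def .
  qed
  have e6: "(X * q + 1) * G0 = (1 + X * q * y * \<rho>) * Gu + X * q * (1 - \<alpha> * y) * (\<beta> * Gm + w * x * y * K * G0)"
  proof -
    define a where "a = y * \<rho>"
    have a: "a \<noteq> 0" using w0 nz by (simp add: a_def)
    have "- X * q * a * (1 - a * q ^ k) * (\<beta> * Gm + w * x * y * K * G0) - a * (1 - - X * q * a) * Gu = (- X * q * a - a) * G0"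
    proof -
      have m: "- X * q * (y * \<rho>) = - X * (y * \<rho>) * q" by simp
      have e: "?G (a / q) (- X * q * a) = \<beta> * Gm + w * x * y * K * G0" unfolding a_def m by (rule Gm')
      show ?thesis
        using bqL_num_contiguous[OF q(2), of "- X * q * a" a k be]
        unfolding e unfolding G0_def Gu_def a_def[symmetric] .
    qed
    then have "a * ((X * q + 1) * G0) = a * ((1 + X * q * a) * Gu + X * q * (1 - a * q ^ k) * (\<beta> * Gm + w * x * y * K * G0))"
      by (simp add: algebra_simps)
    then have "(X * q + 1) * G0 = (1 + X * q * a) * Gu + X * q * (1 - a * q ^ k) * (\<beta> * Gm + w * x * y * K * G0)"
      by (rule mult_left_cancel[OF a, THEN iffD1])
    moreover have "a * q ^ k = \<alpha> * y" by (simp add: a_def \<alpha>_def)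
    ultimately show ?thesis by (simp add: a_def mult.assoc)
  qed
  have bby: "bb * q * y / q = bb * y" using q by simp
  have e3: "Pd = P0 - g * x * (1 - y) * (1 - bb * y) * Pm"
  proof -
    have m: "g * x * q = g * X" using Xq by simp
    have "Pd - P0 = - (g * x) * (1 - y) * (1 - bb * y) * Pm"
      using cdqH_diff[OF q a0(1), of n u "- q * \<rho> / g" "g * x"]
      unfolding ab bby y_def[symmetric] m Pd_def P0_def Pm_def .
    then show ?thesis by (simp add: diff_eq_eq)
  qed
  have e4: "g * X * Pp = AA * (1 + q * \<rho> * X * y) * P0 - (1 - g * v * X + g ^ 2 * X ^ 2) * Pu"
  proof -
    have W: "(1 - g * X * u) * (1 - g * X / u) = 1 - g * v * X + g ^ 2 * X ^ 2"
      using nz by (simp add: v_def field_simps power2_eq_square)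
    have m: "g * X * q = g * (X * q)" by simp
    have "g * X * Pp = AA * (1 - - q * \<rho> * X * y) * P0 - (1 - g * v * X + g ^ 2 * X ^ 2) * Pu"
      using cdqH_raise[OF q a0(1) nz(3), of "g * X" n "- q * \<rho> / g"]
      unfolding ac bc W y_def[symmetric] m Pp_def P0_def Pu_def AA_def .
    then show ?thesis by simp
  qed
  have e5: "g * Pp = (g * v - ((w - q * \<rho> + g ^ 2 * X) * y - w * \<rho> * X * y * (1 - y - q * y))) * P0
        - g * (1 - y) * (1 - bb * y) * \<beta> * (1 + \<rho> * X * y) * Pm"
  proof -
    have gX: "g * X \<noteq> 0" using nz X by simp
    have r: "w * X * y / q = w * x * y" "- q * \<rho> * X * y / q = - \<rho> * X * y"
      using q by (simp_all add: x_def)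
    have abc: "t * g * (- q * \<rho> / g) * (g * X) * y / q * (1 - y - q * y) = - (t * g) * \<rho> * X * y * (1 - y - q * y)"
      using q nz by simp
    have "Pp = (u + 1 / u - ((t * g + - q * \<rho> / g + g * X) * y + - (t * g) * \<rho> * X * y * (1 - y - q * y))) * P0
        - (1 - y) * (1 - bb * y) * (1 - w * x * y) * (1 - - \<rho> * X * y) * Pm"
      using cdqH_three_term[OF q a0(1) nz(3) gX, of n "- q * \<rho> / g"]
      unfolding y_def[symmetric] abc unfolding ab ac bc bby r P0_def Pp_def Pm_def .
    moreover have "g * ((V - ((c + E + g * X) * y + - c * \<rho> * X * y * Y)) * P0 - A1 * A2 * A3 * (1 - - \<rho> * X * y) * Pm)
        = (g * V - ((g * c + g * E + g ^ 2 * X) * y - (g * c) * \<rho> * X * y * Y)) * P0 - g * A1 * A2 * A3 * (1 + \<rho> * X * y) * Pm"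
      for V c E Y A1 A2 A3
      by (simp add: algebra_simps power2_eq_square)
    ultimately have "g * Pp = (g * (u + 1 / u) - ((g * (t * g) + g * (- q * \<rho> / g) + g ^ 2 * X) * y
         - (g * (t * g)) * \<rho> * X * y * (1 - y - q * y))) * P0 - g * (1 - y) * (1 - bb * y) * (1 - w * x * y) * (1 + \<rho> * X * y) * Pm"
      by (simp only:)
    moreover have "g * (- q * \<rho> / g) = - q * \<rho>" "g * (t * g) = w" using nz by (simp_all add: w_def power2_eq_square)
    ultimately show ?thesis by (simp only: v_def \<beta>_def) simp
  qed
  have W: "W = 1 - g * v * X + g ^ 2 * X ^ 2"
    using nz by (simp add: W_def v_def field_simps power2_eq_square)
  have bb: "bb = - t * \<rho>" by (simp add: bb_def)
  have S: "S = (1 - \<alpha> * (q * y)) * (1 - bb * (q * y)) - \<alpha> * bb * (q * y) * (1 - y)"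
    by (simp add: S_def y_def)
  have main: "q * \<alpha> * (q * (1 + X) * (\<beta> * AA * Pd * Gd) + W * (Pu * Gu))
      + (g ^ 2 * X ^ 2 * (q * \<alpha> - 1 + S) - q * \<alpha> * (q * (1 + X) + W)) * (AA * P0 * G0)
      + g ^ 2 * X ^ 2 * (q * y * \<rho> * t * g) * (Pp * Gp)
      + g * X ^ 2 * \<alpha> * q * (1 - y) * (1 - \<alpha> * y) * (1 - bb * y) * (\<beta> * AA * Pm * Gm) = 0"
    by (rule coupling_step_algebra[OF \<rho>K Xq(1) w_def \<beta>_def AA_def W bb S e1 e2 e3 e4[folded W] e5 e6])
  have Q0: "qpoch_inf (w * X * y) q = AA * Q1"
    unfolding Q1_def AA_def by (subst qpoch_inf_Suc[OF q(1)]) (simp add: mult_ac)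
  have Qm: "qpoch_inf (w * x * y) q = \<beta> * (AA * Q1)"
    unfolding Q0[symmetric] \<beta>_def by (subst qpoch_inf_Suc[OF q(1)]) (simp add: Xq mult_ac)
  have f0: "ff k n X = Q1 * (AA * P0 * G0)"
    unfolding ff_def w_def[symmetric] y_def[symmetric] be_def[symmetric] Q0 P0_def G0_def by (simp add: mult_ac)
  have fu: "ff k n (X * q) = Q1 * (Pu * Gu)"
  proof -
    have "w * (X * q) * y = w * X * (q * y)" "- (X * q) * q * (y * \<rho>) = - X * q * (y * \<rho>) * q" by simp_all
    then show ?thesis
      unfolding ff_def w_def[symmetric] y_def[symmetric] be_def[symmetric] Pu_def Gu_def Q1_def by (simp add: mult_ac)
  qed
  have fp: "ff k (Suc n) X = Q1 * (Pp * Gp)"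
  proof -
    have "w * X * q ^ Suc n = w * X * (q * y)" "q ^ Suc n * \<rho> = y * \<rho> * q" "- X * q * (y * \<rho> * q) = - X * q * (y * \<rho>) * q"
      by (simp_all add: y_def)
    then show ?thesis
      unfolding ff_def w_def[symmetric] be_def[symmetric] Pp_def Gp_def Q1_def by (simp only: mult_ac)
  qed
  have fd: "ff k n (X / q) = Q1 * (\<beta> * AA * Pd * Gd)"
  proof -
    have "- x * q * (y * \<rho>) = - X * (y * \<rho>)" using Xq by simp
    then show ?thesis
      unfolding ff_def x_def[symmetric] w_def[symmetric] y_def[symmetric] be_def[symmetric] Qm Pd_def Gd_def by (simp only: mult_ac)
  qed
  \<comment> \<open>The factor \<open>1 - y\<close> is kept because for \<open>n = 0\<close> the two
    values differ, but \<open>1 - y\<close> is then 0.\<close>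
  have fm: "(1 - y) * ff k (n - 1) X = (1 - y) * (Q1 * (\<beta> * AA * Pm * Gm))"
  proof (cases n)
    case (Suc n')
    have 1: "q ^ (n - 1) = y / q" using q by (simp add: y_def Suc)
    have e: "w * X * (y / q) = w * x * y" "y / q * \<rho> = y * \<rho> / q" "- X * q * (y * \<rho> / q) = - X * (y * \<rho>)"
      using q by (simp_all add: x_def)
    show ?thesis
      unfolding ff_def w_def[symmetric] be_def[symmetric] 1 unfolding e Qm Pm_def Gm_def by (simp only: mult_ac)
  qed (simp add: y_def)
  have "q * \<alpha> * (q * (1 + X) * ff k n (X / q) + W * ff k n (X * q))
      + (g ^ 2 * X ^ 2 * (q * \<alpha> - 1 + S) - q * \<alpha> * (q * (1 + X) + W)) * ff k n X
      + g ^ 2 * X ^ 2 * (q * y * \<rho> * t * g) * ff k (Suc n) X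
      + g * X ^ 2 * \<alpha> * q * (1 - \<alpha> * y) * (1 - bb * y) * ((1 - y) * ff k (n - 1) X)
     = Q1 * (q * \<alpha> * (q * (1 + X) * (\<beta> * AA * Pd * Gd) + W * (Pu * Gu))
      + (g ^ 2 * X ^ 2 * (q * \<alpha> - 1 + S) - q * \<alpha> * (q * (1 + X) + W)) * (AA * P0 * G0)
      + g ^ 2 * X ^ 2 * (q * y * \<rho> * t * g) * (Pp * Gp)
      + g * X ^ 2 * \<alpha> * q * (1 - y) * (1 - \<alpha> * y) * (1 - bb * y) * (\<beta> * AA * Pm * Gm))"
  proof -
    have "q * \<alpha> * (q * (1 + X) * (Q1 * F1) + W * (Q1 * F2)) + C * (Q1 * F3) + D * (Q1 * F4) + E * H * I * ((1 - y) * (Q1 * F5))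
      = Q1 * (q * \<alpha> * (q * (1 + X) * F1 + W * F2) + C * F3 + D * F4 + E * (1 - y) * H * I * F5)" for C D E H I F1 F2 F3 F4 F5
      by (simp add: algebra_simps)
    then show ?thesis unfolding f0 fu fp fd fm by blast
  qed
  also have "\<dots> = 0" unfolding main by simp
  finally have fin: "q * \<alpha> * (q * (1 + X) * ff k n (X / q) + W * ff k n (X * q))
      + (g ^ 2 * X ^ 2 * (q * \<alpha> - 1 + S) - q * \<alpha> * (q * (1 + X) + W)) * ff k n X
      + g ^ 2 * X ^ 2 * (q * y * \<rho> * t * g) * ff k (Suc n) X
      + g * X ^ 2 * \<alpha> * q * (1 - \<alpha> * y) * (1 - bb * y) * ((1 - y) * ff k (n - 1) X) = 0" .
  have gg: "g ^ 2 * X ^ 2 * (- (q * y * \<rho> * t * g) * F4 - \<alpha> * q / g * (1 - y) * (1 - bb * y) * (1 - \<alpha> * y) * F5)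
     = - (g ^ 2 * X ^ 2 * (q * y * \<rho> * t * g) * F4 + g * X ^ 2 * \<alpha> * q * (1 - \<alpha> * y) * (1 - bb * y) * ((1 - y) * F5))" for F4 F5
  proof -
    define \<gamma> where "\<gamma> = \<alpha> * q / g"
    have "g * X ^ 2 * \<alpha> * q = g * X ^ 2 * (\<gamma> * g)" using nz by (simp add: \<gamma>_def)
    then have 1: "g * X ^ 2 * \<alpha> * q = g ^ 2 * X ^ 2 * \<gamma>" by (simp only: power2_eq_square mult_ac)
    have "G * (- P * F4 - \<gamma> * Y * B * C * F5) = - (G * P * F4 + G * \<gamma> * C * B * (Y * F5))" for G P Y B C
      by (simp add: algebra_simps)
    then show ?thesis unfolding 1 \<gamma>_def[symmetric] .
  qed
  have "L = - (x1 + x2)" if "L + x1 + x2 = 0" for L x1 x2 :: complex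
    using that by (simp only: add.assoc add_eq_0_iff2)
  from this[OF fin] show ?thesis unfolding power_Suc y_def[symmetric] gg .
qed

section \<open>The case n = 0: integration of the q-Meixner series term by term\<close>

lemma mpsi_mult_qpoch_inf:
  "mpsi i Z q * qpoch_inf (- q * Z) q = q ^ (i * (i - 1) div 2) * qpoch_inf (q / (- (q ^ i)) * Z) q"
proof (induction i)
  case (Suc i)
  have 1: "qpoch_inf (q / (- (q ^ Suc i)) * Z) q = ((Z + q ^ i) / q ^ i) * qpoch_inf (q / (- (q ^ i)) * Z) q"
  proof -
    have "q / (- (q ^ Suc i)) * Z * q = q / (- (q ^ i)) * Z" "1 - q / (- (q ^ Suc i)) * Z = (Z + q ^ i) / q ^ i"
      using q by (simp_all add: field_simps)
    then show ?thesis using qpoch_inf_Suc[OF q(1), of "q / (- (q ^ Suc i)) * Z"] by simp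
  qed
  have "mpsi (Suc i) Z q * qpoch_inf (- q * Z) q = (Z + q ^ i) * (q ^ (i * (i - 1) div 2) * qpoch_inf (q / (- (q ^ i)) * Z) q)"
    unfolding Suc.IH[symmetric] by (simp add: mpsi_Suc)
  also have "\<dots> = q ^ (Suc i * (Suc i - 1) div 2) * qpoch_inf (q / (- (q ^ Suc i)) * Z) q"
    unfolding 1 triangle_Suc power_add using q by simp
  finally show ?case .
qed simp

lemma qtheta_neg_power:
  "q ^ (s * (s - 1) div 2) * qtheta (- (q ^ s) / t) q = t ^ s * qtheta (- 1 / t) q"
proof (induction s)
  case (Suc s)
  have "qtheta (- (q ^ s) / t * q) q = - qtheta (- (q ^ s) / t) q / (- (q ^ s) / t)"
    using q nz by (intro qtheta_shift) auto
  then have "qtheta (- (q ^ Suc s) / t) q = qtheta (- (q ^ s) / t) q * t / q ^ s"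
    by (simp add: mult.commute[of q])
  then have "q ^ (Suc s * (Suc s - 1) div 2) * qtheta (- (q ^ Suc s) / t) q
      = t * (q ^ (s * (s - 1) div 2) * qtheta (- (q ^ s) / t) q)"
    unfolding triangle_Suc power_add using q by simp
  then show ?case unfolding Suc.IH by simp
qed simp

text \<open>The zeros of \<open>mpsi i Z q\<close> are the first \<open>i\<close> points
  \<open>- (q ^ s)\<close> of the lower branch, and the polynomial merges with the infinite product
  that vanishes beyond \<open>- 1\<close>. The result is again an Andrews-Askey weight, with lower
  endpoint \<open>- (q ^ i)\<close>.\<close>

lemma jint_ker_mpsi:
  "jint q (- 1) (t / q ^ j) (\<lambda>Z. ker j Z * mpsi i Z q)
    = q ^ (i * (i - 1) div 2) * jint q (- (q ^ i)) (t / q ^ j) (aa_kernel q (- (q ^ i)) (t / q ^ j) (g * u) (g / u))"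
proof -
  define F where "F Z = ker j Z * mpsi i Z q" for Z
  have pt: "F Z = q ^ (i * (i - 1) div 2) * aa_kernel q (- (q ^ i)) (t / q ^ j) (g * u) (g / u) Z" for Z
  proof -
    have "q / (t / q ^ j) = q ^ Suc j / t" by simp
    moreover have "F Z = (mpsi i Z q * qpoch_inf (- q * Z) q) * qpoch_inf (q ^ Suc j / t * Z) q
        / (qpoch_inf (g * u * Z) q * qpoch_inf (g / u * Z) q)"
      by (simp add: F_def ker_def mult_ac)
    ultimately show ?thesis unfolding mpsi_mult_qpoch_inf aa_kernel_def by simp
  qed
  have bF: "jbounded q x F" for x
    unfolding pt[abs_def] by (intro jbounded_mult jbounded_const jbounded_aa_kernel q)
  have "F (- 1 * q ^ s) = 0" if "s < i" for s
    using that by (auto simp: F_def mpsi_def intro!: prod_zero)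
  from jsum_drop_zeros[OF q(1) bF this]
  have "jint q (- 1) (t / q ^ j) F = jint q (- (q ^ i)) (t / q ^ j) F" unfolding jint_def by simp
  also have "\<dots> = q ^ (i * (i - 1) div 2) * jint q (- (q ^ i)) (t / q ^ j) (aa_kernel q (- (q ^ i)) (t / q ^ j) (g * u) (g / u))"
    unfolding pt[abs_def] by (intro jint_cmult jbounded_aa_kernel q)
  finally show ?thesis unfolding F_def .
qed

text \<open>Sum and integral may be interchanged because on a disc containing the points the series
  has a majorant independent of \<open>Z\<close>, while the weight is bounded and the integral adds
  a geometric factor.\<close>

lemma jint_ker_mphi_sums:
  "(\<lambda>i. mcoeff q g u i * mpsi i X q * jint q a b (\<lambda>Z. ker j Z * mpsi i Z q)) sums jint q a b (\<lambda>Z. ker j Z * mphi q g u X Z)"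
proof -
  have half: "(\<lambda>i. mcoeff q g u i * mpsi i X q * (\<Sum>s. q ^ s * (ker j (x * q ^ s) * mpsi i (x * q ^ s) q)))
      sums (\<Sum>s. q ^ s * (ker j (x * q ^ s) * mphi q g u X (x * q ^ s)))" for x
  proof -
    have "0 \<le> norm X + norm x" by simp
    from mphi_majorant[OF q(1) A this] obtain v where v: "summable v" "\<And>i. 0 \<le> v i"
      and v1: "\<And>i X' Z. norm X' \<le> norm X + norm x \<Longrightarrow> norm Z \<le> norm X + norm x
        \<Longrightarrow> norm (mcoeff q g u i * mpsi i X' q * mpsi i Z q) \<le> v i"
      by blast
    have vb: "norm (mcoeff q g u i * mpsi i X q * mpsi i (x * q ^ s) q) \<le> v i" for i s
    proof -
      have "norm (x * q ^ s) \<le> norm x" using q by (simp add: norm_mult norm_power mult_left_le power_le_one)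
      then show ?thesis using norm_ge_zero[of X] norm_ge_zero[of x] by (intro v1) linarith+
    qed
    obtain C where C: "\<And>s. norm (ker j (x * q ^ s)) \<le> C" using jbounded_ker[of x j] by (auto simp: jbounded_def)
    have C0: "0 \<le> C" using order_trans[OF norm_ge_zero C[of 0]] .
    define h where "h i s = q ^ s * (ker j (x * q ^ s) * (mcoeff q g u i * mpsi i X q * mpsi i (x * q ^ s) q))" for i s
    have hb: "norm (h i s) \<le> v i * (C * norm q ^ s)" for i s
    proof -
      have "norm (h i s) = norm q ^ s * (norm (ker j (x * q ^ s)) * norm (mcoeff q g u i * mpsi i X q * mpsi i (x * q ^ s) q))"
        by (simp add: h_def norm_mult norm_power)
      also have "\<dots> \<le> norm q ^ s * (C * v i)"
        by (intro mult_left_mono mult_mono C vb C0) auto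
      finally show ?thesis by (simp add: mult_ac)
    qed
    have w: "summable (\<lambda>s. C * norm q ^ s)" using q by (intro summable_mult summable_geometric) auto
    have "(\<lambda>i. \<Sum>s. h i s) sums (\<Sum>s. \<Sum>i. h i s)"
      by (rule sums_swap[OF hb v(1) w v(2)]) (use C0 in auto)
    moreover have "(\<Sum>i. h i s) = q ^ s * (ker j (x * q ^ s) * mphi q g u X (x * q ^ s))" for s
    proof -
      have "summable (\<lambda>i. mcoeff q g u i * mpsi i X q * mpsi i (x * q ^ s) q)"
        by (rule summable_comparison_test'[OF v(1) vb])
      then show ?thesis unfolding h_def mphi_def by (simp add: suminf_mult summable_mult)
    qed
    moreover have "(\<Sum>s. h i s) = mcoeff q g u i * mpsi i X q * (\<Sum>s. q ^ s * (ker j (x * q ^ s) * mpsi i (x * q ^ s) q))" for i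
    proof -
      have "jbounded q x (\<lambda>Z. ker j Z * mpsi i Z q)"
        unfolding mpsi_def by (intro jbounded_mult jbounded_ker jbounded_prod jbounded_add jbounded_ident jbounded_const q)
      from jbounded_summable[OF q(1) this]
      have "(\<Sum>s. mcoeff q g u i * mpsi i X q * (q ^ s * (ker j (x * q ^ s) * mpsi i (x * q ^ s) q)))
          = mcoeff q g u i * mpsi i X q * (\<Sum>s. q ^ s * (ker j (x * q ^ s) * mpsi i (x * q ^ s) q))"
        by (rule suminf_mult)
      moreover have "h i s = mcoeff q g u i * mpsi i X q * (q ^ s * (ker j (x * q ^ s) * mpsi i (x * q ^ s) q))" for s
        by (simp add: h_def mult_ac)
      ultimately show ?thesis by simp
    qed
    ultimately show ?thesis by simp
  qed
  have "(\<lambda>i. b * (mcoeff q g u i * mpsi i X q * (\<Sum>s. q ^ s * (ker j (b * q ^ s) * mpsi i (b * q ^ s) q)))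
      - a * (mcoeff q g u i * mpsi i X q * (\<Sum>s. q ^ s * (ker j (a * q ^ s) * mpsi i (a * q ^ s) q))))
    sums jint q a b (\<lambda>Z. ker j Z * mphi q g u X Z)"
    unfolding jint_def by (intro sums_diff sums_mult half)
  moreover have "b * (m * x) - a * (m * y) = m * (b * x - a * y)" for m x y by (simp add: algebra_simps)
  ultimately show ?thesis unfolding jint_def by simp
qed

text \<open>Each term is an Andrews-Askey integral. Its numerator, quasi-periodicity of theta
  included, turns the q-Meixner coefficients into those of the 1phi1 series with lower parameter
  \<open>c\<close>, which is summable in closed form.\<close>

lemma jint_ker_mphi:
  "jint q (- 1) (t / q ^ j) (\<lambda>Z. ker j Z * mphi q g u X Z)
    = t / q ^ j * qpoch_inf q q * (t ^ j * qtheta (- 1 / t) q)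
      / (q ^ (j * (j - 1) div 2) * (qpoch_inf (- g * u) q * qpoch_inf (- g / u) q
          * qpoch_inf (t / q ^ j * (g * u)) q * qpoch_inf (t / q ^ j * (g / u)) q))
      * qpoch_inf (t * g ^ 2 * X / q ^ j) q"
proof -
  \<comment> \<open>The product of the four parameters of the i-th Andrews-Askey integral is
    \<open>c * q ^ i\<close>.\<close>
  define c where "c = - (t * g ^ 2) / q ^ j"
  define D where "D = qpoch_inf (t / q ^ j * (g * u)) q * qpoch_inf (t / q ^ j * (g / u)) q"
  have cn: "c * q ^ i \<noteq> 1" for i
  proof
    assume "c * q ^ i = 1"
    then have "- (t * g ^ 2 * q ^ i) = q ^ j" using q by (simp add: c_def field_simps)
    from arg_cong[OF this, of uminus] have "t * g ^ 2 * q ^ i = - (q ^ j)" by simp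
    then show False using tg by blast
  qed
  have ci: "qpoch_inf c q \<noteq> 0" using cn by (simp add: qpoch_inf_eq_0_iff[OF q(1)])
  have ai: "qpoch_inf (- g * u) q \<noteq> 0" "qpoch_inf (- g / u) q \<noteq> 0"
    using A by (simp_all add: qpoch_inf_eq_0_iff[OF q(1)])
  have trm: "mcoeff q g u i * mpsi i X q * jint q (- 1) (t / q ^ j) (\<lambda>Z. ker j Z * mpsi i Z q)
    = t / q ^ j * qpoch_inf q q * (t ^ j * qtheta (- 1 / t) q) * qpoch_inf c q
      / (q ^ (j * (j - 1) div 2) * (qpoch_inf (- g * u) q * qpoch_inf (- g / u) q * D))
      * (mpsi i X q * q ^ (i * (i - 1) div 2) * c ^ i / (qpoch q q i * qpoch c q i))" for i
  proof -
    let ?a = "- (q ^ i)" and ?b = "t / q ^ j"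
    have qj: "q ^ m \<noteq> 0" for m using q by simp
    have AA: "jint q ?a ?b (aa_kernel q ?a ?b (g * u) (g / u)) = ?b * qpoch_inf q q * qpoch_inf (?a / ?b) q * qpoch_inf (q * ?b / ?a) q
        * qpoch_inf (?a * ?b * (g * u) * (g / u)) q
      / (qpoch_inf (?a * (g * u)) q * qpoch_inf (?b * (g * u)) q * qpoch_inf (?a * (g / u)) q * qpoch_inf (?b * (g / u)) q)"
    proof (rule andrews_askey[OF q])
      show "?a \<noteq> 0" "?b \<noteq> 0" using qj nz by auto
      show "g * u * ?a * q ^ s \<noteq> 1" "g / u * ?a * q ^ s \<noteq> 1" for s
        using A[of "i + s"] by (simp_all add: power_add mult_ac)
      show "g * u * ?b * q ^ s \<noteq> 1" for s
      proof
        assume "g * u * ?b * q ^ s = 1"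
        then have "t * g * u * q ^ s = q ^ j" using qj[of j] by (simp add: field_simps)
        then show False using T by blast
      qed
      show "g / u * ?b * q ^ s \<noteq> 1" for s
      proof
        assume "g / u * ?b * q ^ s = 1"
        then have "t * g / u * q ^ s = q ^ j" using qj[of j] by (simp add: field_simps)
        then show False using T by blast
      qed
      show "q * ?a / ?b * q ^ s \<noteq> 1" for s
      proof
        assume "q * ?a / ?b * q ^ s = 1"
        then have "t * q ^ 0 = - (q ^ (1 + i + j + s))" using qj[of j] nz by (simp add: field_simps power_add)
        then show False using t by blast
      qed
      show "q * ?b / ?a * q ^ s \<noteq> 1" for s
      proof
        assume *: "q * ?b / ?a * q ^ s = 1"
        have "t * q ^ (1 + s) = q * ?b / ?a * q ^ s * (q ^ j * ?a)" using qj[of j] qj[of i] by (simp add: power_add)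
        then have "t * q ^ (1 + s) = - (q ^ (i + j))" unfolding * by (simp add: power_add)
        then show False using t by blast
      qed
    qed
    have th: "qpoch_inf (?a / ?b) q * qpoch_inf (q * ?b / ?a) q = qtheta (- (q ^ (i + j)) / t) q"
    proof -
      have pq: "q ^ (i + j) = q ^ i * q ^ j" by (rule power_add)
      have e: "?a / ?b = - (q ^ (i + j)) / t" "q * ?b / ?a = q / (- (q ^ (i + j)) / t)"
        unfolding pq using qj nz by simp_all
      show ?thesis unfolding e qtheta_def ..
    qed
    have tri: "(i + j) * (i + j - 1) div 2 = i * (i - 1) div 2 + j * (j - 1) div 2 + i * j"
    proof (induction i)
      case (Suc i)
      have "(Suc i + j) * (Suc i + j - 1) div 2 = (i + j) * (i + j - 1) div 2 + (i + j)"
        using triangle_Suc[of "i + j"] by simp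
      then show ?case unfolding Suc.IH triangle_Suc by simp
    qed simp
    have th2: "qtheta (- (q ^ (i + j)) / t) q = t ^ i * (t ^ j * qtheta (- 1 / t) q)
        / (q ^ (i * (i - 1) div 2) * q ^ (j * (j - 1) div 2) * (q ^ j) ^ i)"
    proof -
      have "(q ^ j) ^ i = q ^ (i * j)" by (simp add: power_mult[symmetric] mult.commute)
      then have "q ^ (i * (i - 1) div 2) * q ^ (j * (j - 1) div 2) * (q ^ j) ^ i * qtheta (- (q ^ (i + j)) / t) q
          = t ^ i * (t ^ j * qtheta (- 1 / t) q)"
        using qtheta_neg_power[of "i + j"] unfolding tri power_add by (simp only: mult.assoc)
      note E = this
      have r: "x = y / c" if "c * x = y" "c \<noteq> 0" for x y c :: complex using that by auto
      show ?thesis by (rule r[OF E]) (use qj in simp)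
    qed
    have c1: "qpoch_inf (?a * ?b * (g * u) * (g / u)) q = qpoch_inf c q / qpoch c q i"
    proof -
      have "?a * ?b * (g * u) * (g / u) = c * q ^ i" using nz by (simp add: c_def power2_eq_square)
      then show ?thesis using qpoch_inf_split[OF q(1), of c i] ci by (auto simp: field_simps)
    qed
    have a1: "qpoch_inf (?a * (g * u)) q = qpoch_inf (- g * u) q / qpoch (- g * u) q i"
      using qpoch_inf_split[OF q(1), of "- g * u" i] ai by (auto simp: field_simps)
    have a2: "qpoch_inf (?a * (g / u)) q = qpoch_inf (- g / u) q / qpoch (- g / u) q i"
      using qpoch_inf_split[OF q(1), of "- g / u" i] ai by (auto simp: field_simps)
    have n1: "qpoch (- g * u) q i \<noteq> 0" "qpoch (- g / u) q i \<noteq> 0" using A by (auto simp: qpoch_eq_0_iff)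
    have cc: "c ^ i = (- 1) ^ i * t ^ i * g ^ (2 * i) / (q ^ j) ^ i"
    proof -
      have "c = (- 1) * t * g ^ 2 / q ^ j" by (simp add: c_def)
      then show ?thesis by (simp only: power_divide power_mult_distrib power_mult)
    qed
    have AAv: "jint q ?a ?b (aa_kernel q ?a ?b (g * u) (g / u)) = ?b * qpoch_inf q q
        * (t ^ i * (t ^ j * qtheta (- 1 / t) q) / (q ^ (i * (i - 1) div 2) * q ^ (j * (j - 1) div 2) * (q ^ j) ^ i))
        * (qpoch_inf c q / qpoch c q i)
        / ((qpoch_inf (- g * u) q / qpoch (- g * u) q i) * (qpoch_inf (- g / u) q / qpoch (- g / u) q i) * D)"
      unfolding AA D_def c1 a1 a2 unfolding th2[symmetric] th[symmetric] by (simp only: mult_ac)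
    have alg: "s * T1 * G / (Qi * M1 * M2) * ps * (T1 * (bb * qq * (ti * tj / (T1 * Tj * qji)) * (ci / Ci) / ((a1 / M1) * (a2 / M2) * D)))
      = bb * qq * tj * ci / (Tj * (a1 * a2 * D)) * (ps * T1 * (s * ti * G / qji) / (Qi * Ci))"
      if "M1 \<noteq> 0" "M2 \<noteq> 0" "T1 \<noteq> 0" for s T1 G Qi M1 M2 ps bb qq ti tj Tj qji ci Ci a1 a2 D :: complex
      using that by (simp add: mult_ac)
    show ?thesis
      unfolding jint_ker_mpsi AAv mcoeff_def cc by (rule alg[OF n1 qj])
  qed
  have "(\<lambda>i. mcoeff q g u i * mpsi i X q * jint q (- 1) (t / q ^ j) (\<lambda>Z. ker j Z * mpsi i Z q))
     sums (t / q ^ j * qpoch_inf q q * (t ^ j * qtheta (- 1 / t) q) * qpoch_inf c q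
      / (q ^ (j * (j - 1) div 2) * (qpoch_inf (- g * u) q * qpoch_inf (- g / u) q * D)) * (qpoch_inf (- c * X) q / qpoch_inf c q))"
    unfolding trm by (intro sums_mult one_phi_one_sum q cn)
  note E = sums_unique2[OF jint_ker_mphi_sums this]
  have r: "x * C / y * (z / C) = x / y * z" if "C \<noteq> 0" for x y z C :: complex using that by simp
  have cX: "- c * X = t * g ^ 2 * X / q ^ j" by (simp add: c_def)
  show ?thesis unfolding E r[OF ci] cX D_def by (simp only: mult.assoc)
qed

lemma qpoch_div_power:
  "qpoch (x / q ^ j) q j * q ^ (j * (j + 1) div 2) = (\<Prod>l<j. q ^ Suc l - x)"
proof (induction j)
  case (Suc j)
  have "x / q ^ Suc j * q = x / q ^ j" using q by simp
  note e = this
  have 1: "qpoch (x / q ^ Suc j) q (Suc j) = (1 - x / q ^ Suc j) * qpoch (x / q ^ j) q j"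
    unfolding qpoch_Suc_shift e ..
  have 2: "Suc j * (Suc j + 1) div 2 = j * (j + 1) div 2 + Suc j" by simp
  have "(1 - x / q ^ Suc j) * q ^ Suc j = q ^ Suc j - x" using q by (simp add: field_simps)
  note R = this
  have "qpoch (x / q ^ Suc j) q (Suc j) * q ^ (Suc j * (Suc j + 1) div 2)
      = (qpoch (x / q ^ j) q j * q ^ (j * (j + 1) div 2)) * (q ^ Suc j - x)"
  proof -
    have g: "A * D * (T * Q) = D * T * R" if "A * Q = R" for A D T Q R :: complex
      unfolding that[symmetric] by (simp only: mult_ac)
    show ?thesis unfolding 1 2 power_add by (rule g[OF R])
  qed
  then show ?case unfolding Suc.IH by simp
qed simp

lemma qpoch_div_power':
  assumes "x \<noteq> 0"
  shows "qpoch (x / q ^ j) q j * q ^ (j * (j + 1) div 2) = (- x) ^ j * qpoch (q / x) q j"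
proof -
  have "(\<Prod>l<j. q ^ Suc l - x) = (\<Prod>l<j. (- x) * (1 - q / x * q ^ l))"
    using assms by (intro prod.cong refl) (simp add: field_simps)
  then show ?thesis unfolding qpoch_div_power unfolding qpoch_def by (simp only: prod.distrib prod_constant card_lessThan)
qed

text \<open>The dual q-Hahn polynomial is expanded around the parameter \<open>q / (t * g)\<close>.
  Its basis then depends on \<open>u\<close> only, and the products containing \<open>Z\<close> fit
  into the weight, so that only the integral over \<open>ker j\<close> times the kernel is needed.
  The resulting sum over \<open>j\<close> is the big q-Laguerre polynomial in \<open>X\<close> in
  its second representation.\<close>

lemma JJ_0: "JJ k 0 X = kap k 0 * ff k 0 X"
proof -
  define w where "w = t * g ^ 2"
  define d where "d = q / (t * g)"
  define e where "e = - q * \<rho> / g"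
  define be where "be = - q * \<rho> / w"
  define W where "W = qpoch_inf (w * X) q"
  define K0 where "K0 = t * qpoch_inf q q * qtheta (- 1 / t) q
      / (qpoch_inf (- g * u) q * qpoch_inf (- g / u) q * qpoch_inf (t * g * u) q * qpoch_inf (t * g / u) q)"
  define L where "L j = inverse d ^ k * qpoch (d * e * q ^ j) q (k - j)
     * (qpoch (inverse q ^ k) q j * qpoch (d * u) q j * qpoch (d / u) q j / qpoch q q j) * q ^ j" for j
  define P where "P j = (\<Prod>l<j. q ^ Suc l - w * X)" for j
  have w0: "w \<noteq> 0" and d0: "d \<noteq> 0" using nz q by (auto simp: w_def d_def)
  have qj: "q ^ m \<noteq> 0" for m using q by simp
  have be: "qpoch (be * q) q i \<noteq> 0" for i using bh by (auto simp: be_def w_def qpoch_eq_0_iff)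
  have de: "d * e = be * q" using nz by (simp add: d_def e_def be_def w_def power2_eq_square mult_ac)
  \<comment> \<open>The factor \<open>qpoch (q ^ Suc j / t * Z) q (k - j)\<close> of the j-th term
    extends the infinite product in \<open>ker k\<close> to the one in \<open>ker j\<close>.\<close>
  have pt: "HH k 0 Z = (\<Sum>j\<le>k. L j * ker j Z)" for Z
  proof -
    have "ker k Z * (inverse d ^ k * (qpoch (d * e * q ^ j) q (k - j) * qpoch (d * (g * Z) * q ^ j) q (k - j)
            * (qpoch (inverse q ^ k) q j * qpoch (d * u) q j * qpoch (d / u) q j / qpoch q q j) * q ^ j)) = L j * ker j Z"
      if "j \<le> k" for j
    proof -
      have 1: "d * (g * Z) * q ^ j = q ^ Suc j / t * Z" using nz by (simp add: d_def)
      have "Suc j + (k - j) = Suc k" using that by simp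
      then have "q ^ Suc j * q ^ (k - j) = q ^ Suc k" by (simp only: power_add[symmetric])
      moreover have "q ^ Suc j / t * Z * q ^ (k - j) = (q ^ Suc j * q ^ (k - j)) / t * Z" by simp
      ultimately have E: "q ^ Suc j / t * Z * q ^ (k - j) = q ^ Suc k / t * Z" by (simp only:)
      have 2: "qpoch_inf (q ^ Suc j / t * Z) q = qpoch (q ^ Suc j / t * Z) q (k - j) * qpoch_inf (q ^ Suc k / t * Z) q"
        using qpoch_inf_split[OF q(1), of "q ^ Suc j / t * Z" "k - j"] unfolding E .
      show ?thesis unfolding L_def ker_def 1 2 by (simp add: mult_ac)
    qed
    then show ?thesis
      unfolding HH_def cdqH_poly_def bqL_num_0 d_def[symmetric] e_def[symmetric] mult_1_right sum_distrib_left
      by (intro sum.cong refl) simp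
  qed
  have bk: "jbounded q x (\<lambda>Z. ker j Z * mphi q g u X Z)" for x j by (intro jbounded_mult jbounded_ker jbounded_mphi)
  \<comment> \<open>\<open>ker j\<close> vanishes at the points \<open>t / q ^ k * q ^ s\<close>
    with \<open>s < k - j\<close>, so its natural upper endpoint \<open>t / q ^ j\<close> can be
    used.\<close>
  have move: "jint q (- 1) (t / q ^ k) (\<lambda>Z. ker j Z * mphi q g u X Z) = jint q (- 1) (t / q ^ j) (\<lambda>Z. ker j Z * mphi q g u X Z)"
    if "j \<le> k" for j
  proof -
    have z: "ker j (t / q ^ k * q ^ s) * mphi q g u X (t / q ^ k * q ^ s) = 0" if "s < k - j" for s
    proof -
      have "q ^ Suc j / t * (t / q ^ k * q ^ s) * q ^ (k - Suc j - s) = q ^ (Suc j + s + (k - Suc j - s)) / q ^ k"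
        using nz by (simp add: power_add)
      also have "Suc j + s + (k - Suc j - s) = k" using that by simp
      finally have "q ^ Suc j / t * (t / q ^ k * q ^ s) * q ^ (k - Suc j - s) = 1" using qj[of k] by simp
      then have "qpoch_inf (q ^ Suc j / t * (t / q ^ k * q ^ s)) q = 0" using qpoch_inf_eq_0_iff[OF q(1)] by blast
      then show ?thesis by (simp add: ker_def)
    qed
    have qk: "q ^ k = q ^ j * q ^ (k - j)" using \<open>j \<le> k\<close> by (simp flip: power_add)
    have e: "t / q ^ k * q ^ (k - j) = t / q ^ j" unfolding qk using qj[of "k - j"] by simp
    have "t / q ^ k * (\<Sum>s. q ^ s * (ker j (t / q ^ k * q ^ s) * mphi q g u X (t / q ^ k * q ^ s)))
        = (t / q ^ k * q ^ (k - j)) * (\<Sum>s. q ^ s * (ker j ((t / q ^ k * q ^ (k - j)) * q ^ s) * mphi q g u X ((t / q ^ k * q ^ (k - j)) * q ^ s)))"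
      by (rule jsum_drop_zeros[OF q(1) bk]) (rule z)
    then show ?thesis unfolding jint_def e by (simp only:)
  qed
  have "JJ k 0 X = jint q (- 1) (t / q ^ k) (\<lambda>Z. \<Sum>j\<le>k. L j * (ker j Z * mphi q g u X Z))"
    unfolding JJ_def pt by (simp only: sum_distrib_right mult.assoc)
  also have "\<dots> = (\<Sum>j\<le>k. jint q (- 1) (t / q ^ k) (\<lambda>Z. L j * (ker j Z * mphi q g u X Z)))"
    by (rule jint_sum[OF q(1)], simp, rule jbounded_mult[OF jbounded_const bk], rule jbounded_mult[OF jbounded_const bk])
  also have "\<dots> = (\<Sum>j\<le>k. L j * jint q (- 1) (t / q ^ j) (\<lambda>Z. ker j Z * mphi q g u X Z))"
  proof (intro sum.cong refl)
    fix j assume "j \<in> {..k}"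
    then have j: "j \<le> k" by simp
    show "jint q (- 1) (t / q ^ k) (\<lambda>Z. L j * (ker j Z * mphi q g u X Z)) = L j * jint q (- 1) (t / q ^ j) (\<lambda>Z. ker j Z * mphi q g u X Z)"
      unfolding jint_cmult[OF q(1) bk bk] move[OF j] ..
  qed
  also have "\<dots> = (\<Sum>j\<le>k. K0 * W * (inverse d ^ k * qpoch (be * q * q ^ j) q (k - j) * qpoch (inverse q ^ k) q j / qpoch q q j
       * (q ^ j / w ^ j) * P j))"
  proof (intro sum.cong refl)
    fix j
    have n1: "t * g * u \<noteq> 0" "t * g / u \<noteq> 0" using nz by auto
    have du: "d / u = q / (t * g * u)" "d * u = q / (t * g / u)" by (simp_all add: d_def)
    \<comment> \<open>\<open>m1\<close> and \<open>m2\<close> are the finite parts by which the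
      denominators at \<open>t / q ^ j\<close> exceed those at \<open>t\<close>. Reversed, they are
      the basis products \<open>qpoch (d / u) q j\<close> and \<open>qpoch (d * u) q j\<close>, and
      everything that depends on \<open>u\<close> in the j-th term cancels.\<close>
    define m1 where "m1 = qpoch (t * g * u / q ^ j) q j"
    define m2 where "m2 = qpoch (t * g / u / q ^ j) q j"
    define T where "T = q ^ (j * (j + 1) div 2)"
    define Tj where "Tj = q ^ (j * (j - 1) div 2)"
    have TT: "T = Tj * q ^ j" using triangle_Suc[of j] unfolding T_def Tj_def by (simp only: power_add Suc_eq_plus1 diff_add_inverse2 mult.commute)
    have m1: "m1 * T = (- (t * g * u)) ^ j * qpoch (d / u) q j"
      using qpoch_div_power'[OF n1(1), of j] unfolding m1_def T_def du(1) .
    have m2: "m2 * T = (- (t * g / u)) ^ j * qpoch (d * u) q j"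
      using qpoch_div_power'[OF n1(2), of j] unfolding m2_def T_def du(2) .
    have mn: "m1 \<noteq> 0" "m2 \<noteq> 0"
    proof -
      have nn: "z / Q * P \<noteq> 1" if "z * P \<noteq> Q" "Q \<noteq> 0" for z P Q :: complex
        using that by (simp add: field_simps)
      have "t * g * u / q ^ j * q ^ i \<noteq> 1" for i by (rule nn[OF T(1) qj])
      moreover have "t * g / u / q ^ j * q ^ i \<noteq> 1" for i by (rule nn[OF T(2) qj])
      ultimately show "m1 \<noteq> 0" "m2 \<noteq> 0" unfolding m1_def m2_def qpoch_eq_0_iff by blast+
    qed
    have ss: "(- (t * g * u)) ^ j * (- (t * g / u)) ^ j = t ^ j * w ^ j"
    proof -
      have g0: "- (t * g * u) * - (t * g / u) = t * (t * g ^ 2)" if "u \<noteq> 0" for t g u :: complex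
        using that by (simp add: power2_eq_square)
      have e: "- (t * g * u) * - (t * g / u) = t * w" unfolding w_def by (rule g0[OF nz(3)])
      show ?thesis unfolding power_mult_distrib[symmetric] e ..
    qed
    have BB: "qpoch (d * u) q j * qpoch (d / u) q j = m1 * m2 * T * T / (t ^ j * w ^ j)"
    proof -
      have "m1 * m2 * T * T = (m1 * T) * (m2 * T)" by (simp only: mult_ac)
      also have "\<dots> = (t ^ j * w ^ j) * (qpoch (d * u) q j * qpoch (d / u) q j)"
        unfolding m1 m2 ss[symmetric] by (simp only: mult_ac)
      finally have e: "m1 * m2 * T * T = t ^ j * w ^ j * (qpoch (d * u) q j * qpoch (d / u) q j)" .
      have r: "x = y / c" if "y = c * x" "c \<noteq> 0" for x y c :: complex unfolding that(1) using that(2) by simp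
      have "t ^ j * w ^ j \<noteq> 0" using nz w0 by simp
      then show ?thesis by (rule r[OF e])
    qed
    have V: "qpoch (w * X / q ^ j) q j = P j / T"
    proof -
      have r: "x = y / c" if "x * c = y" "c \<noteq> 0" for x y c :: complex using that by auto
      show ?thesis unfolding T_def P_def by (rule r[OF qpoch_div_power qj])
    qed
    have div: "x / q ^ j * q ^ j = x" for x using qj[of j] by simp
    have D1: "qpoch_inf (t / q ^ j * (g * u)) q = m1 * qpoch_inf (t * g * u) q"
    proof -
      have e: "t / q ^ j * (g * u) = t * g * u / q ^ j" by simp
      show ?thesis using qpoch_inf_split[OF q(1), of "t * g * u / q ^ j" j] unfolding div e m1_def .
    qed
    have D2: "qpoch_inf (t / q ^ j * (g / u)) q = m2 * qpoch_inf (t * g / u) q"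
    proof -
      have e: "t / q ^ j * (g / u) = t * g / u / q ^ j" by (simp add: mult.commute)
      show ?thesis using qpoch_inf_split[OF q(1), of "t * g / u / q ^ j" j] unfolding div e m2_def .
    qed
    have WW: "qpoch_inf (t * g ^ 2 * X / q ^ j) q = P j / T * W"
      using qpoch_inf_split[OF q(1), of "w * X / q ^ j" j] unfolding div V unfolding W_def w_def .
    have alg: "C * A1 * (A2 * B2 * B1 / Q) * qj * (t / qj * qi * (tj * th) / (Tj * (a1 * a2 * (m1 * E1) * (m2 * E2))) * (p / T * W))
       = t * qi * th / (a1 * a2 * E1 * E2) * W * (C * A1 * A2 / Q * (qj / wj) * p)"
      if "B2 * B1 = m1 * m2 * T * T / (tj * wj)" "T = Tj * qj" "m1 \<noteq> 0" "m2 \<noteq> 0" "tj \<noteq> 0" "qj \<noteq> 0" "Tj \<noteq> 0"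
      for C A1 A2 B1 B2 Q qj qi tj th Tj a1 a2 m1 m2 E1 E2 p T W wj :: complex
    proof -
      have e: "A2 * B2 * B1 = A2 * (m1 * m2 * T * T / (tj * wj))" unfolding that(1)[symmetric] by simp
      show ?thesis unfolding e that(2) using that(3-) by (simp add: mult_ac)
    qed
    show "L j * jint q (- 1) (t / q ^ j) (\<lambda>Z. ker j Z * mphi q g u X Z)
        = K0 * W * (inverse d ^ k * qpoch (be * q * q ^ j) q (k - j) * qpoch (inverse q ^ k) q j / qpoch q q j * (q ^ j / w ^ j) * P j)"
      unfolding L_def de jint_ker_mphi D1 D2 WW K0_def Tj_def[symmetric]
      by (rule alg[OF BB TT mn]) (use nz qj in \<open>simp_all add: Tj_def\<close>)
  qed
  \<comment> \<open>The products \<open>P j\<close> are proportional to the basis products of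
    \<open>bqL_alt\<close> at \<open>z = - X * q * \<rho>\<close>; the powers of
    \<open>\<rho>\<close> provide the required \<open>\<rho> ^ (k - j)\<close>.\<close>
  also have "\<dots> = K0 * W * inverse d ^ k * inverse \<rho> ^ k * qpoch (be * q) q k * bqL_alt k \<rho> be (- X * q * \<rho>) q"
    unfolding bqL_alt_def sum_distrib_left
  proof (intro sum.cong refl)
    fix j assume "j \<in> {..k}"
    then have j: "j \<le> k" by simp
    have 1: "(\<Prod>l<j. - X * q * \<rho> - be * q ^ Suc l) = (\<rho> * q / w) ^ j * P j"
    proof -
      have "- X * q * \<rho> - be * q ^ Suc l = \<rho> * q / w * (q ^ Suc l - w * X)" for l
        using w0 by (simp add: be_def field_simps)
      then show ?thesis by (simp only: prod.distrib prod_constant card_lessThan P_def)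
    qed
    have 2: "qpoch (be * q) q k = qpoch (be * q) q j * qpoch (be * q * q ^ j) q (k - j)"
      using qpoch_add[of "be * q" q j "k - j"] j by simp
    have 3: "inverse \<rho> ^ k * \<rho> ^ (k - j) * (\<rho> * q / w) ^ j = q ^ j / w ^ j"
    proof -
      have r1: "\<rho> ^ (k - j) * \<rho> ^ j = \<rho> ^ k" using j by (simp flip: power_add)
      have r2: "inverse \<rho> ^ k * \<rho> ^ k = 1" using nz by (simp flip: power_mult_distrib)
      have r3: "a * b * (c * d / e) = (a * (b * c)) * (d / e)" for a b c d e :: complex by simp
      show ?thesis unfolding power_divide power_mult_distrib r3 r1 r2 by simp
    qed
    have alg: "K * (D * B2 * N / Q * (r3) * p) = K * D * ir * (B1 * B2) * (N / (Q * B1) * rk * (rq * p))"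
      if "ir * rk * rq = r3" "B1 \<noteq> 0" for K D B1 B2 N Q r3 p ir rk rq :: complex
      using that(2) unfolding that(1)[symmetric] by simp
    show "K0 * W * (inverse d ^ k * qpoch (be * q * q ^ j) q (k - j) * qpoch (inverse q ^ k) q j / qpoch q q j * (q ^ j / w ^ j) * P j)
        = K0 * W * inverse d ^ k * inverse \<rho> ^ k * qpoch (be * q) q k * (qpoch (inverse q ^ k) q j / (qpoch q q j * qpoch (be * q) q j)
          * \<rho> ^ (k - j) * (\<Prod>l<j. - X * q * \<rho> - be * q ^ Suc l))"
      unfolding 1 2 by (rule alg[OF 3 be])
  qed
  also have "\<dots> = kap k 0 * ff k 0 X"
  proof -
    have s: "(- 1) ^ k / Qk * ((- 1) ^ k * Qk * a) = a" if "Qk \<noteq> 0" for Qk a :: complex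
    proof -
      have "(- 1 :: complex) ^ k * (- 1) ^ k = 1" by (simp flip: power_mult_distrib)
      moreover have "s / Qk * (s * Qk * a) = (s * s) * a" for s using that by simp
      ultimately show ?thesis by (simp only: mult_1)
    qed
    have f: "ff k 0 X = W * ((- 1) ^ k * q ^ (k * (k + 1) div 2) * bqL_alt k \<rho> be (- X * q * \<rho>) q)"
      unfolding bqL_num_eq_alt[OF q be, symmetric] by (simp add: ff_def W_def w_def be_def)
    have kp: "kap k 0 = K0 * (inverse d ^ k * inverse \<rho> ^ k * qpoch (be * q) q k * ((- 1) ^ k / q ^ (k * (k + 1) div 2)))"
      by (simp add: kap_def K0_def d_def be_def w_def)
    have "K0 * (D * R * B * S) * (W * (S' * a)) = K0 * W * D * R * B * (S * (S' * a))" for D R B S S' a by (simp only: mult_ac)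
    then have "kap k 0 * ff k 0 X = K0 * W * inverse d ^ k * inverse \<rho> ^ k * qpoch (be * q) q k
        * ((- 1) ^ k / q ^ (k * (k + 1) div 2) * ((- 1) ^ k * q ^ (k * (k + 1) div 2) * bqL_alt k \<rho> be (- X * q * \<rho>) q))"
      unfolding f kp .
    then show ?thesis unfolding s[OF qj] by simp
  qed
  finally show ?thesis .
qed

text \<open>The ratio that converts the recurrence coefficients of the integral into those of
  \<open>ff\<close>.\<close>

lemma kap_Suc: "kap k (Suc n) * (1 - - t * \<rho> * q ^ Suc n) = - (q ^ Suc n * \<rho> * t * g) * kap k n"
proof -
  have n: "1 - - t * \<rho> * q * q ^ n \<noteq> 0" using b[of n] unfolding right_minus_eq by (rule not_sym)
  have tri: "Suc n * (Suc n + 1) div 2 = n * (n + 1) div 2 + Suc n" by simp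
  have "C * (r * R * (T * Q) / (B * x)) * x = - (Q * \<rho> * t * g) * (C * (R * T / B))"
    if "r = - \<rho> * t * g" "x \<noteq> 0" for C r R T Q B x
    using that(2) unfolding that(1) by simp
  note g = this[OF refl n]
  have e: "- t * \<rho> * q ^ Suc n = - t * \<rho> * q * q ^ n" by simp
  show ?thesis
    unfolding kap_def tri e qpoch_Suc power_Suc[of "- \<rho> * t * g"] power_add by (rule g)
qed

text \<open>The two step relations have the same operator on the left, so equality at
  \<open>n\<close> and \<open>n - 1\<close> for all nonzero arguments gives equality at
  \<open>n + 1\<close>. \<open>X\<close> is arbitrary in the induction because the operator uses
  \<open>X / q\<close> and \<open>X * q\<close>; the leading coefficients are nonzero by
  \<open>b\<close> and \<open>X \<noteq> 0\<close>.\<close>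

theorem JJ_eq:
  assumes "X \<noteq> 0"
  shows "JJ k n X = kap k n * ff k n X"
  using assms
proof (induction n arbitrary: X rule: less_induct)
  case (less n)
  show ?case
  proof (cases n)
    case 0
    then show ?thesis using JJ_0 by simp
  next
    case (Suc m)
    define bb where "bb = - t * \<rho>"
    define \<alpha> where "\<alpha> = q ^ k * \<rho>"
    have IH: "JJ k m X = kap k m * ff k m X" "JJ k m (X / q) = kap k m * ff k m (X / q)" "JJ k m (X * q) = kap k m * ff k m (X * q)"
      using less.IH[of m] less.prems q Suc by auto
    \<comment> \<open>For \<open>m = 0\<close> both sides contain \<open>1 - q ^ m = 0\<close>,
      hence no value of negative index is involved.\<close>
    have prev: "\<alpha> * bb * q ^ Suc m * (1 - q ^ m) * (1 - \<alpha> * q ^ m) * JJ k (m - 1) X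
        = kap k m * (\<alpha> * q / g * (1 - q ^ m) * (1 - bb * q ^ m) * (1 - \<alpha> * q ^ m) * ff k (m - 1) X)"
    proof (cases m)
      case (Suc m')
      have J: "JJ k m' X = kap k m' * ff k m' X" using less.IH[of m'] less.prems Suc \<open>n = Suc m\<close> by simp
      have "kap k m * (1 - bb * q ^ m) = - (q ^ m * \<rho> * t * g) * kap k m'"
        using kap_Suc[of k m'] by (simp add: Suc bb_def)
      moreover have "\<kappa> * (x * A * C * B * f) = x * A * B * f * (\<kappa> * C)" for \<kappa> x A B C f :: complex by (simp only: mult_ac)
      ultimately have 1: "kap k m * (\<alpha> * q / g * A * (1 - bb * q ^ m) * B * f) = \<alpha> * q / g * A * B * f * (- (q ^ m * \<rho> * t * g) * kap k m')" for A B f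
        by (simp only:)
      have 2: "\<alpha> * q / g * A * B * f * (- (Q * \<rho> * t * g) * \<kappa>) = \<alpha> * bb * (q * Q) * A * B * (\<kappa> * f)" for A B f Q \<kappa>
        using nz by (simp add: bb_def)
      have m: "m - 1 = m'" using Suc by simp
      show ?thesis unfolding m J 1 2 power_Suc ..
    qed simp
    have n0: "1 - bb * q ^ Suc m \<noteq> 0" proof -
      have "bb * q ^ Suc m \<noteq> 1" using b[of m] by (simp only: bb_def power_Suc mult.assoc not_False_eq_True)
      then show ?thesis unfolding right_minus_eq by (rule not_sym)
    qed
    have g0: "g ^ 2 * X ^ 2 \<noteq> 0" using nz less.prems by simp
    let ?L = "\<lambda>F. q * \<alpha> * (q * (1 + X) * F (X / q) + (1 - g * u * X) * (1 - g / u * X) * F (X * q))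
      + (g ^ 2 * X ^ 2 * (q * \<alpha> - 1 + ((1 - \<alpha> * q ^ Suc m) * (1 - bb * q ^ Suc m) - \<alpha> * bb * q ^ Suc m * (1 - q ^ m)))
        - q * \<alpha> * (q * (1 + X) + (1 - g * u * X) * (1 - g / u * X))) * F X"
    have "?L (JJ k m) = kap k m * ?L (ff k m)"
    proof -
      have "c * (a * (\<kappa> * x) + w * (\<kappa> * y)) + d * (\<kappa> * z) = \<kappa> * (c * (a * x + w * y) + d * z)" for a c d w x y z \<kappa> :: complex
        by (simp add: algebra_simps)
      then show ?thesis unfolding IH .
    qed
    then have E: "g ^ 2 * X ^ 2 * ((1 - bb * q ^ Suc m) * JJ k (Suc m) X - \<alpha> * bb * q ^ Suc m * (1 - q ^ m) * (1 - \<alpha> * q ^ m) * JJ k (m - 1) X)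
       = kap k m * (g ^ 2 * X ^ 2 * (- (q ^ Suc m * \<rho> * t * g) * ff k (Suc m) X
        - \<alpha> * q / g * (1 - q ^ m) * (1 - bb * q ^ m) * (1 - \<alpha> * q ^ m) * ff k (m - 1) X))"
      unfolding \<alpha>_def bb_def JJ_step[OF less.prems] ff_step[OF less.prems] .
    have "g ^ 2 * X ^ 2 * ((1 - bb * q ^ Suc m) * JJ k (Suc m) X)
       = g ^ 2 * X ^ 2 * (- (q ^ Suc m * \<rho> * t * g) * kap k m * ff k (Suc m) X)"
    proof -
      have "G * x = G * (y * \<kappa> * f)" if "G * (x - \<kappa> * R) = \<kappa> * (G * (y * f - R))" for G x \<kappa> R y f :: complex
        using that by (simp add: algebra_simps)
      from this[OF E[unfolded prev]] show ?thesis .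
    qed
    then have "(1 - bb * q ^ Suc m) * JJ k (Suc m) X = (1 - bb * q ^ Suc m) * (kap k (Suc m) * ff k (Suc m) X)"
      unfolding mult_left_cancel[OF g0] kap_Suc[symmetric] bb_def by (simp only: mult_ac)
    then show ?thesis unfolding mult_left_cancel[OF n0] Suc .
  qed
qed

end

subsection \<open>Real parameters\<close>

lemma qpoch_pos:
  fixes a q :: real
  assumes "0 < q" "q < 1" "a < 1"
  shows "0 < qpoch a q n"
  unfolding qpoch_def
proof (rule prod_pos)
  fix j
  have "a * q ^ j < 1"
  proof (cases "0 \<le> a")
    case True
    then have "a * q ^ j \<le> a" using assms by (intro mult_left_le power_le_one) auto
    then show ?thesis using assms by simp
  next
    case False
    then have "a * q ^ j \<le> 0" using assms by (intro mult_nonpos_nonneg) auto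
    then show ?thesis by simp
  qed
  then show "0 < 1 - a * q ^ j" by simp
qed

lemma qpoch_inf_pos:
  fixes a q :: real
  assumes "0 < q" "q < 1" "a < 1"
  shows "0 < qpoch_inf a q"
proof -
  have q: "norm q < 1" using assms by simp
  have "0 \<le> qpoch_inf a q"
    by (rule LIMSEQ_le_const[OF qpoch_LIMSEQ[OF q]]) (use qpoch_pos[OF assms] in \<open>auto intro: less_imp_le\<close>)
  moreover have "qpoch_inf a q \<noteq> 0"
  proof
    assume "qpoch_inf a q = 0"
    then obtain j where "a * q ^ j = 1" using qpoch_inf_eq_0_iff[OF q] by blast
    then have "qpoch a q (Suc j) = 0" using qpoch_eq_0_iff by blast
    then show False using qpoch_pos[OF assms, of "Suc j"] by simp
  qed
  ultimately show ?thesis by simp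
qed

lemma qtheta_neg_pos:
  fixes s q :: real
  assumes "0 < q" "q < 1" "0 < s"
  shows "0 < qtheta (- s) q"
proof -
  have "q / - s < 1" "- s < 1" using assms by (auto simp: divide_neg_pos intro: order.strict_trans[of _ 0])
  then show ?thesis unfolding qtheta_def using assms by (intro mult_pos_pos qpoch_inf_pos) auto
qed

text \<open>Quasi-periodicity iterated in both directions, since \<open>r\<close> may have either
  sign. With \<open>- s\<close> negative both theta values are positive, so this can be used under
  roots.\<close>

lemma qtheta_neg_powi:
  fixes s q :: real
  assumes q: "0 < q" "q < 1" and s: "0 < s"
  shows "qtheta (- (s * q powi (- r))) q * q powi (r * (r + 1) div 2) = s powi r * qtheta (- s) q"
proof -
  have q': "norm q < 1" "q \<noteq> 0" using q by auto
  have up: "qtheta (- (s * q powi (- (r + 1)))) q * q powi ((r + 1) * (r + 2) div 2)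
      = s * (qtheta (- (s * q powi (- r))) q * q powi (r * (r + 1) div 2))" for r :: int
  proof -
    have e: "- (s * q powi (- (r + 1))) * q = - (s * q powi (- r))"
    proof -
      have "q powi (- (r + 1) + 1) = q powi (- (r + 1)) * q powi 1" using q by (intro power_int_add) simp
      moreover have "- (r + 1) + 1 = - r" by simp
      ultimately show ?thesis by (simp only: power_int_1_right mult_minus_left mult.assoc)
    qed
    have "qtheta (- (s * q powi (- r))) q = qtheta (- (s * q powi (- (r + 1)))) q / (s * q powi (- (r + 1)))"
      using qtheta_shift[OF q', of "- (s * q powi (- (r + 1)))"] q s unfolding e by simp
    moreover have "(r + 1) * (r + 2) div 2 = r * (r + 1) div 2 + (r + 1)"
    proof -
      have "(r + 1) * (r + 2) = r * (r + 1) + (r + 1) * 2" by (simp add: algebra_simps)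
      then show ?thesis by simp
    qed
    note th = calculation this
    have iq: "q powi (- (r + 1)) * q powi (r + 1) = 1" unfolding power_int_minus using q by simp
    have g: "th' * (T * Q) = s * (th * T)" if "th = th' / (s * iQ)" "iQ * Q = 1" "s \<noteq> 0" for th th' T Q iQ :: real
    proof -
      have "iQ \<noteq> 0" using that(2) by auto
      then have "th' = th * s * iQ" using that(1,3) by simp
      then have "th' * (T * Q) = s * (th * T) * (iQ * Q)" by simp
      then show ?thesis unfolding that(2) by simp
    qed
    have e': "q powi (r * (r + 1) div 2 + (r + 1)) = q powi (r * (r + 1) div 2) * q powi (r + 1)"
      using q by (intro power_int_add) simp
    show ?thesis unfolding th(2) e' by (rule g[OF th(1) iq]) (use s in simp)
  qed
  show ?thesis
  proof (induction r rule: int_induct[where k = 0])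
    case (step1 i)
    then show ?case using up[of i] s by (simp add: power_int_add algebra_simps)
  next
    case (step2 i)
    have e: "i - 1 + 1 = i" "i - 1 + 2 = i + 1" by simp_all
    have "s powi i = s * s powi (i - 1)" using s by (simp add: power_int_diff)
    note sp = this
    have E: "s * (qtheta (- (s * q powi (- (i - 1)))) q * q powi ((i - 1) * (i - 1 + 1) div 2)) = s * (s powi (i - 1) * qtheta (- s) q)"
      using up[of "i - 1"] step2(2) unfolding e sp mult.assoc by (simp only:)
    have "s \<noteq> 0" using s by simp
    from mult_left_cancel[OF this, THEN iffD1, OF E] show ?case .
  qed simp
qed

lemma cnj_qpoch_inf:
  assumes "norm q < 1"
  shows "cnj (qpoch_inf a q) = qpoch_inf (cnj a) (cnj q)"
proof (rule LIMSEQ_unique)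
  have "norm (cnj q) < 1" using assms by simp
  then show "(\<lambda>n. qpoch (cnj a) (cnj q) n) \<longlonglongrightarrow> qpoch_inf (cnj a) (cnj q)" by (rule qpoch_LIMSEQ)
  have "(\<lambda>n. cnj (qpoch a q n)) \<longlonglongrightarrow> cnj (qpoch_inf a q)" by (intro tendsto_cnj qpoch_LIMSEQ assms)
  then show "(\<lambda>n. qpoch (cnj a) (cnj q) n) \<longlonglongrightarrow> cnj (qpoch_inf a q)" by (simp add: qpoch_def)
qed

text \<open>On the unit circle \<open>1 / u\<close> is the conjugate of \<open>u\<close>, and the
  two products are conjugate to each other. All radicands become real and nonnegative through
  this.\<close>

lemma qpoch_inf_unit_pair:
  assumes "0 < q" "q < 1" "cmod u = 1"
  shows "qpoch_inf (of_real c * u) (of_real q) * qpoch_inf (of_real c / u) (of_real q)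
    = of_real ((cmod (qpoch_inf (of_real c * u) (of_real q)))\<^sup>2)"
proof -
  have "u * cnj u = 1" using assms complex_norm_square[of u] by simp
  moreover from this have "u \<noteq> 0" by auto
  ultimately have "cnj u = 1 / u" by (simp add: field_simps)
  then have "of_real c / u = cnj (of_real c * u)" by simp
  moreover have "of_real q = cnj (of_real q)" by simp
  ultimately have "qpoch_inf (of_real c / u) (of_real q) = cnj (qpoch_inf (of_real c * u) (of_real q))"
    using cnj_qpoch_inf[of "of_real q" "of_real c * u"] assms by simp
  then show ?thesis by (simp only: complex_norm_square)
qed

text \<open>For \<open>u ^ 2 \<noteq> 1\<close> the value \<open>mu u\<close> is the real part of
  \<open>u\<close>, of modulus less than 1, and the two infinite products are conjugate and
  nonzero.\<close>

lemma cdqH_density_pos: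
  assumes q: "0 < q" "q < 1" and u: "cmod u = 1"
  shows "\<exists>D>0. cdqH_density u (of_real q) = of_real D"
proof (cases "u ^ 2 = 1")
  case True
  then show ?thesis by (intro exI[of _ 1]) (simp add: cdqH_density_def)
next
  case False
  have q': "norm (of_real q :: complex) < 1" using q by simp
  have uu: "u * cnj u = 1" using u complex_norm_square[of u] by simp
  then have iu: "inverse u = cnj u" by (rule inverse_unique)
  have mu: "mu u = of_real (Re u)" unfolding mu_def iu by (simp add: complex_add_cnj)
  have RI: "(Re u)\<^sup>2 + (Im u)\<^sup>2 = 1" using u by (simp add: cmod_def)
  have "Im u \<noteq> 0"
  proof
    assume 0: "Im u = 0"
    then have "u = of_real (Re u)" by (simp add: complex_eq_iff)
    have "(Re u)\<^sup>2 = 1" using 0 RI by simp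
    then have "u ^ 2 = 1" unfolding \<open>u = of_real (Re u)\<close>[THEN arg_cong[of _ _ "\<lambda>x. x ^ 2"]] by (simp flip: of_real_power)
    then show False using False by simp
  qed
  then have "0 < (Im u)\<^sup>2" by simp
  then have R: "(Re u)\<^sup>2 < 1" using RI by linarith
  then have s: "csqrt (1 - mu u ^ 2) = of_real (sqrt (1 - (Re u)\<^sup>2))"
  proof -
    have "1 - mu u ^ 2 = of_real (1 - (Re u)\<^sup>2)" unfolding mu by simp
    moreover have "csqrt (of_real (1 - (Re u)\<^sup>2)) = of_real (sqrt (1 - (Re u)\<^sup>2))"
      by (rule of_real_sqrt[symmetric]) (use R in simp)
    ultimately show ?thesis by (simp only:)
  qed
  have nz: "qpoch_inf (u ^ 2) (of_real q) \<noteq> 0"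
  proof
    assume "qpoch_inf (u ^ 2) (of_real q) = 0"
    then obtain j where j: "u ^ 2 * of_real q ^ j = 1" using qpoch_inf_eq_0_iff[OF q'] by blast
    then have "cmod (u ^ 2 * of_real q ^ j) = 1" by simp
    then have "q ^ j = 1" using u q by (simp add: norm_mult norm_power)
    then have "j = 0" using q power_Suc_less_one[of q "j - 1"] by (cases j) auto
    then show False using j False by simp
  qed
  have c: "inverse u ^ 2 = of_real 1 / (u ^ 2)" by (simp add: power_inverse divide_inverse)
  have "cmod (u ^ 2) = 1" using u by (simp add: norm_power)
  from qpoch_inf_unit_pair[OF q this, of 1]
  have "qpoch_inf (u ^ 2) (of_real q) * qpoch_inf (inverse u ^ 2) (of_real q) = of_real ((cmod (qpoch_inf (u ^ 2) (of_real q)))\<^sup>2)"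
    unfolding c by simp
  then have "cdqH_density u (of_real q) = of_real ((cmod (qpoch_inf (u ^ 2) (of_real q)))\<^sup>2 / (2 * pi * sqrt (1 - (Re u)\<^sup>2)))"
    unfolding cdqH_density_def s using False by simp
  moreover have "0 < (cmod (qpoch_inf (u ^ 2) (of_real q)))\<^sup>2 / (2 * pi * sqrt (1 - (Re u)\<^sup>2))"
    using nz R by (intro divide_pos_pos mult_pos_pos) auto
  ultimately show ?thesis by blast
qed

lemma bqL_poly_sum:
  assumes "q \<noteq> 0"
  shows "bqL_poly n x a b q = (\<Sum>i\<le>n. qpoch (inverse q ^ n) q i * qpoch x q i / (qpoch q q i * (qpoch (a * q) q i * qpoch (b * q) q i)) * q ^ i)"
proof -
  have z: "qpoch 0 q i = 1" for i by (simp add: qpoch_def)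
  have "bqL_poly n x a b q = (\<Sum>i. qpoch (inverse q ^ n) q i * qpoch x q i / (qpoch q q i * (qpoch (a * q) q i * qpoch (b * q) q i)) * q ^ i)"
    unfolding bqL_poly_def qhyp_def by (intro arg_cong[of _ _ suminf] ext) (simp add: z)
  also have "\<dots> = (\<Sum>i\<le>n. qpoch (inverse q ^ n) q i * qpoch x q i / (qpoch q q i * (qpoch (a * q) q i * qpoch (b * q) q i)) * q ^ i)"
    by (rule suminf_finite) (auto simp: qpoch_inverse_power_eq_0[OF assms])
  finally show ?thesis .
qed

lemma bqL_poly_eq_num:
  assumes "0 < q" "q < 1" "\<And>i. qpoch (a * q) q i \<noteq> 0"
  shows "qpoch (a * q) q n * bqL_poly n x a b q = bqL_num n a b x q"
proof -
  have q0: "q \<noteq> 0" using assms by simp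
  let ?f = "\<lambda>i. qpoch (inverse q ^ n) q i * qpoch x q i / (qpoch q q i * (qpoch (a * q) q i * qpoch (b * q) q i)) * q ^ i"
  show ?thesis
    unfolding bqL_poly_sum[OF q0] bqL_num_def sum_distrib_left
  proof (rule sum.cong[OF refl])
    fix i assume "i \<in> {..n}"
    then have e: "qpoch (a * q) q n = qpoch (a * q) q i * qpoch (a * q ^ Suc i) q (n - i)"
      using qpoch_add[of "a * q" q i "n - i"] by (simp add: mult_ac)
    have g: "X * Y * (N * x / (D * (X * B)) * p) = N * x * Y / (D * B) * p" if "X \<noteq> 0" for X Y N x D B p :: real
      using that by simp
    show "qpoch (a * q) q n * ?f i = qpoch (inverse q ^ n) q i * qpoch x q i * qpoch (a * q ^ Suc i) q (n - i)
        / (qpoch q q i * qpoch (b * q) q i) * q ^ i"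
      unfolding e by (rule g[OF assms(3)])
  qed
qed

text \<open>Since \<open>a * b < 0\<close>, the base of the power in the normalisation is positive,
  and both half-integral powers can be taken under the same root.\<close>

lemma bqL_fun_sqrt:
  assumes q: "0 < q" "q < 1" and ab: "a * b < 0"
  shows "bqL_fun n x a b q = sqrt (\<bar>x\<bar> * (qpoch_inf (x / a) q * qpoch_inf (x / b) q
                     * qpoch_inf (a * q) q * qpoch_inf (b * q) q)
                  * (qpoch (a * q) q n * qpoch (b * q) q n)
             / (\<bar>a * q\<bar> * (qpoch_inf q q * qpoch_inf x q) * qtheta (b / a) q * qpoch q q n)
             / ((- a * b * q ^ 2) ^ n * q ^ (n * (n - 1) div 2))) * bqL_poly n x a b q"
proof -
  have c: "0 < - a * b * q ^ 2" using ab q by (simp add: mult_neg_pos)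
  have half: "c powr (real m * (1/2)) = sqrt (c ^ m)" if "0 < c" for c m
  proof -
    have "c powr (real m * (1/2)) = (c powr real m) powr (1/2)" by (rule powr_powr[symmetric])
    then show ?thesis using that by (simp add: powr_realpow powr_half_sqrt)
  qed
  have 1: "(- a * b * q ^ 2) powr (- real n / 2) = 1 / sqrt ((- a * b * q ^ 2) ^ n)"
  proof -
    have "- real n / 2 = - (real n * (1/2))" by simp
    then have "(- a * b * q ^ 2) powr (- real n / 2) = inverse ((- a * b * q ^ 2) powr (real n * (1/2)))"
      by (simp only: powr_minus)
    also have "(- a * b * q ^ 2) powr (real n * (1/2)) = sqrt ((- a * b * q ^ 2) ^ n)"
      by (rule half[OF c])
    finally show ?thesis by (simp add: inverse_eq_divide)
  qed
  have 2: "q powr (- (real n * (real n - 1) / 4)) = 1 / sqrt (q ^ (n * (n - 1) div 2))"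
  proof -
    have "real (n * (n - 1) div 2) = real n * (real n - 1) / 2"
    proof (induction n)
      case (Suc n)
      then show ?case unfolding triangle_Suc by (simp add: algebra_simps)
    qed simp
    then have "- (real n * (real n - 1) / 4) = - (real (n * (n - 1) div 2) * (1/2))" by simp
    then have "q powr (- (real n * (real n - 1) / 4)) = inverse (q powr (real (n * (n - 1) div 2) * (1/2)))"
      by (simp only: powr_minus)
    also have "q powr (real (n * (n - 1) div 2) * (1/2)) = sqrt (q ^ (n * (n - 1) div 2))"
      by (rule half[OF q(1)])
    finally show ?thesis by (simp add: inverse_eq_divide)
  qed
  have g: "1 / sqrt A * (1 / sqrt B) * sqrt M * L = sqrt (M / (A * B)) * L" for A B M L :: real
    by (simp only: real_sqrt_divide real_sqrt_mult times_divide_times_eq mult_1 times_divide_eq_left divide_divide_eq_left mult.commute[of "sqrt B"])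
  show ?thesis unfolding bqL_fun_def 1 2 by (rule g)
qed

lemma bqL_poly_commute: "bqL_poly n x a b q = bqL_poly n x b a q"
  unfolding bqL_poly_def qhyp_def by (simp add: mult_ac)

text \<open>The only asymmetric part of the radicand is
  \<open>\<bar>a * q\<bar> * qtheta (b / a) q\<close>, and the inversion formula of theta shows that
  it is symmetric as well. This covers the two choices of \<open>l\<close>, for which the parameters
  come in opposite order.\<close>

lemma bqL_fun_commute:
  assumes q: "0 < q" "q < 1" and ab: "a * b < 0"
  shows "bqL_fun n x a b q = bqL_fun n x b a q"
proof -
  have nz: "a \<noteq> 0" "b \<noteq> 0" using ab by auto
  have "b / a < 0" using ab by (auto simp: mult_less_0_iff divide_less_0_iff)
  then have ba: "\<bar>b / a\<bar> = - (b / a)" by (rule abs_of_neg)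
  have "qtheta (a / b) q = - qtheta (b / a) q / (b / a)"
    using qtheta_inverse[of q "b / a"] q nz by simp
  then have "\<bar>b\<bar> * qtheta (a / b) q = \<bar>a\<bar> * qtheta (b / a) q"
  proof -
    have "\<bar>b\<bar> = \<bar>b / a\<bar> * \<bar>a\<bar>" using nz abs_mult[of "b / a" a] by simp
    then have 1: "\<bar>b\<bar> = - (b / a) * \<bar>a\<bar>" unfolding ba .
    have g: "- m * A * (- T / m) = A * T" if "m \<noteq> 0" for m A T :: real using that by simp
    show ?thesis unfolding 1 \<open>qtheta (a / b) q = - qtheta (b / a) q / (b / a)\<close> by (rule g) (use nz in simp)
  qed
  then have th: "\<bar>b * q\<bar> * Y * qtheta (a / b) q = \<bar>a * q\<bar> * Y * qtheta (b / a) q" for Y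
  proof -
    have g: "B * Q * Y * z = A * Q * Y * z'" if "B * z = A * z'" for A B Q z z' :: real
    proof -
      have "B * Q * Y * z = Q * Y * (B * z)" by (simp only: mult_ac)
      then show ?thesis unfolding that by (simp only: mult_ac)
    qed
    show ?thesis unfolding abs_mult by (rule g) fact
  qed
  have ba': "b * a < 0" using ab by (subst mult.commute)
  have e: "- b * a = - a * b" by simp
  show ?thesis
    unfolding bqL_fun_sqrt[OF assms] bqL_fun_sqrt[OF q ba'] th e bqL_poly_commute[of n x b a]
    by (simp only: mult_ac)
qed

lemma even_mult_pred: "2 * (n * (n - 1) div 2) = n * (n - 1)" for n :: nat
  by (cases n) auto

subsection \<open>Big q-Laguerre functions with degenerate parameters\<close>

text \<open>The part of the squared normalisation that is independent of the point, with one formula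
  for both signs of the index \<open>j\<close>. Here \<open>n\<close> is the index of the
  coefficient and \<open>d = n + j\<close> the degree in the core identity.\<close>

definition bqL_norm :: "nat \<Rightarrow> nat \<Rightarrow> int \<Rightarrow> real \<Rightarrow> real \<Rightarrow> real" where
  "bqL_norm n d j \<beta> q = qpoch_inf (q ^ Suc n) q * qpoch_inf (- \<beta> * q) q * qpoch (- \<beta> * q) q d
     / (qpoch_inf q q * qpoch q q d * qtheta (- \<beta>) q)
     * (q powi (j\<^sup>2 - 2 * j) / (\<beta> ^ n * q ^ (n * (n + 3) div 2)))"

text \<open>The case of index \<open>- J\<close>: the polynomial already has degree \<open>d\<close>
  and parameter \<open>q ^ J\<close>. The factor on the left cancels \<open>qpoch_inf x q\<close> in
  the denominator of the radicand, and the square of \<open>qpoch (q ^ J * q) q d\<close> leaves the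
  root and turns \<open>bqL_poly\<close> into \<open>bqL_num\<close>.\<close>

lemma bqL_fun_lower:
  fixes q \<beta> W :: real
  assumes q: "0 < q" "q < 1" and \<beta>: "0 < \<beta>" and W: "- W * q < 1" and n: "n = d + J"
  shows "sqrt (qpoch_inf (- W * q * q ^ J) q) * bqL_fun d (- W * q * q ^ J) (q ^ J) (- \<beta>) q
    = sqrt (bqL_norm n d (- int J) \<beta> q * (\<bar>W\<bar> * qpoch_inf (- W * q) q * qpoch_inf (W * q * q ^ J / \<beta>) q))
      * bqL_num d (q ^ J) (- \<beta>) (- W * q * q ^ J) q"
proof -
  have q': "norm q < 1" "q \<noteq> 0" and qJ: "q ^ J \<noteq> 0" "0 < q ^ J" using q by auto
  define x1 where "x1 = qpoch (q ^ J * q) q d"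
  have aq: "q ^ J * q < 1" using power_Suc_less_one[OF q, of J] by (simp add: mult.commute)
  have ai: "qpoch (q ^ J * q) q i \<noteq> 0" for i using qpoch_pos[OF q aq, of i] by simp
  have x1: "0 < x1" unfolding x1_def by (rule qpoch_pos[OF q aq])
  have y: "0 < qpoch_inf (- W * q * q ^ J) q"
  proof (rule qpoch_inf_pos[OF q])
    show "- W * q * q ^ J < 1"
    proof (cases "0 \<le> - W * q")
      case True
      then have "- W * q * q ^ J \<le> - W * q" using q by (intro mult_left_le power_le_one) auto
      then show ?thesis using W by linarith
    next
      case False
      then have "- W * q * q ^ J \<le> 0" using qJ(2) by (intro mult_nonpos_nonneg less_imp_le) simp_all
      then show ?thesis by linarith
    qed
  qed
  have F: "qpoch_inf (q ^ J * q) q = x1 * qpoch_inf (q ^ Suc n) q"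
  proof -
    have "q ^ J * q * q ^ d = q ^ Suc n" unfolding n by (simp add: power_add mult_ac)
    then show ?thesis using qpoch_inf_split[OF q'(1), of "q ^ J * q" d] by (simp only: x1_def)
  qed
  have th: "qtheta (- \<beta> / q ^ J) q * q ^ (J * (J + 1) div 2) = \<beta> ^ J * qtheta (- \<beta>) q"
  proof -
    have 1: "- (\<beta> * q powi (- int J)) = - \<beta> / q ^ J" by (simp add: power_int_minus divide_inverse)
    have 2: "int J * (int J + 1) div 2 = int (J * (J + 1) div 2)"
      by (simp only: zdiv_int of_nat_mult of_nat_add of_nat_1 of_nat_numeral)
    show ?thesis using qtheta_neg_powi[OF q \<beta>, of "int J"] unfolding 1 2 power_int_of_nat .
  qed
  have thp: "0 < qtheta (- \<beta>) q" by (rule qtheta_neg_pos[OF q \<beta>])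
  have tz: "qtheta (- \<beta> / q ^ J) q \<noteq> 0"
  proof
    assume "qtheta (- \<beta> / q ^ J) q = 0"
    then have "\<beta> ^ J * qtheta (- \<beta>) q = 0" using th by simp
    then show False using thp \<beta> by simp
  qed
  have E: "q powi ((- int J)\<^sup>2 - 2 * (- int J)) = q ^ (J * J + 2 * J)"
  proof -
    have "(- int J)\<^sup>2 - 2 * (- int J) = int (J * J + 2 * J)" by (simp add: power2_eq_square)
    then show ?thesis by (simp only: power_int_of_nat)
  qed
  have exps: "q ^ (J * J + 2 * J) * (q ^ J * q ^ 2) ^ d * q ^ (d * (d - 1) div 2)
      = q ^ (n * (n + 3) div 2) * q ^ (J * (J + 1) div 2)"
  proof -
    have "2 * (n * (n + 3) div 2) = n * (n + 3)" "2 * (J * (J + 1) div 2) = J * (J + 1)" by auto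
    \<comment> \<open>The exponents are compared after doubling, which avoids the divisions by
      2.\<close>
    then have E2: "2 * (J * J + 2 * J + (J + 2) * d + d * (d - 1) div 2) = 2 * (n * (n + 3) div 2 + J * (J + 1) div 2)"
      using even_mult_pred[of d] unfolding n by (cases d) (simp_all add: algebra_simps)
    have two: "(2 :: nat) \<noteq> 0" by simp
    have e: "J * J + 2 * J + (J + 2) * d + d * (d - 1) div 2 = n * (n + 3) div 2 + J * (J + 1) div 2"
      by (rule mult_left_cancel[OF two, THEN iffD1, OF E2])
    have "(q ^ J * q ^ 2) ^ d = q ^ ((J + 2) * d)" by (simp only: power_add[symmetric] power_mult[symmetric])
    then show ?thesis by (simp only: power_add[symmetric] e)
  qed
  have nn: "sqrt y * (sqrt M * L) = sqrt C * (f * L)" if "y * M = C * f\<^sup>2" "0 \<le> f" for y M L C f :: real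
  proof -
    have "sqrt y * sqrt M = sqrt C * f" using that by (simp flip: real_sqrt_mult add: real_sqrt_mult)
    then show ?thesis by (simp only: mult.assoc[symmetric])
  qed
  have alg: "y * (w * qj * q1 * (wq * v * (x1 * F) * T) * (x1 * Td) / (qj * q1 * (Q * y) * th' * Qd) / ((qj2 * \<beta>') * T1))
     = F * T * Td / (Q * Qd * th) * (E / (bn * E2)) * (w * wq * v) * x1\<^sup>2"
    if "y \<noteq> 0" "qj \<noteq> 0" "q1 \<noteq> 0" "th' \<noteq> 0" "th \<noteq> 0" "bn \<noteq> 0" "E2 \<noteq> 0" "qj2 * \<beta>' \<noteq> 0" "T1 \<noteq> 0"
      and k: "E * th' * (qj2 * \<beta>') * T1 = th * bn * E2"
    for y w qj q1 wq v x1 F T Td Q th' Qd qj2 \<beta>' T1 th E bn E2 :: real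
  proof -
    have "1 / (th' * (qj2 * \<beta>') * T1) = E / (th * bn * E2)"
      using that by (simp add: frac_eq_eq mult_ac)
    then have "F * T * Td / (Q * Qd) * (w * wq * v) * x1\<^sup>2 * (1 / (th' * (qj2 * \<beta>') * T1))
      = F * T * Td / (Q * Qd) * (w * wq * v) * x1\<^sup>2 * (E / (th * bn * E2))" by (simp only:)
    then show ?thesis using that(1-3) by (simp add: power2_eq_square mult_ac)
  qed
  have ab: "q ^ J * - \<beta> < 0" using \<beta> qJ by (simp add: mult_pos_neg)
  have e1: "- W * q * q ^ J / q ^ J = - W * q" using qJ by simp
  have e2: "- W * q * q ^ J / - \<beta> = W * q * q ^ J / \<beta>" by simp
  have e3: "\<bar>- W * q * q ^ J\<bar> = \<bar>W\<bar> * q ^ J * q" using q by (simp add: abs_mult)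
  have e4: "\<bar>q ^ J * q\<bar> = q ^ J * q" using q by simp
  have e5: "(- (q ^ J) * - \<beta> * q ^ 2) ^ d = (q ^ J * q ^ 2) ^ d * \<beta> ^ d" by (simp add: power_mult_distrib)
  show ?thesis
    unfolding bqL_fun_sqrt[OF q ab] e1 e2 e3 e4 e5 F bqL_norm_def E bqL_poly_eq_num[OF q ai, symmetric]
    unfolding x1_def[symmetric]
  proof (rule nn)
    show "0 \<le> x1" using x1 by simp
    show "qpoch_inf (- W * q * q ^ J) q *
      (\<bar>W\<bar> * q ^ J * q * (qpoch_inf (- W * q) q * qpoch_inf (W * q * q ^ J / \<beta>) q * (x1 * qpoch_inf (q ^ Suc n) q) *
          qpoch_inf (- \<beta> * q) q) * (x1 * qpoch (- \<beta> * q) q d) /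
       (q ^ J * q * (qpoch_inf q q * qpoch_inf (- W * q * q ^ J) q) * qtheta (- \<beta> / q ^ J) q * qpoch q q d) /
       ((q ^ J * q\<^sup>2) ^ d * \<beta> ^ d * q ^ (d * (d - 1) div 2))) =
      qpoch_inf (q ^ Suc n) q * qpoch_inf (- \<beta> * q) q * qpoch (- \<beta> * q) q d /
        (qpoch_inf q q * qpoch q q d * qtheta (- \<beta>) q) *
      (q ^ (J * J + 2 * J) / (\<beta> ^ n * q ^ (n * (n + 3) div 2))) *
      (\<bar>W\<bar> * qpoch_inf (- W * q) q * qpoch_inf (W * q * q ^ J / \<beta>) q) * x1\<^sup>2"
    proof (rule alg)
      show "q ^ (J * J + 2 * J) * qtheta (- \<beta> / q ^ J) q * ((q ^ J * q\<^sup>2) ^ d * \<beta> ^ d) * q ^ (d * (d - 1) div 2)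
        = qtheta (- \<beta>) q * \<beta> ^ n * q ^ (n * (n + 3) div 2)"
      proof -
        have g: "a * th' * (b * c) * e = (a * b * e) * c * th'" for a th' b c e :: real by (simp only: mult_ac)
        have "\<beta> ^ n = \<beta> ^ d * \<beta> ^ J" unfolding n by (rule power_add)
        moreover have "A * B * c * th' = th * (c * bJ) * A" if "th' * B = bJ * th" for A B c th' th bJ :: real
        proof -
          have "A * B * c * th' = A * c * (th' * B)" by (simp only: mult_ac)
          then show ?thesis unfolding that by (simp only: mult_ac)
        qed
        note h = this[OF th]
        ultimately show ?thesis unfolding g exps by (simp only: h)
      qed
    qed (use y qJ q tz thp \<beta> in \<open>auto simp: less_imp_neq[THEN not_sym]\<close>)
  qed
qed

text \<open>The leading factor of the degenerate sum, with its sign \<open>(- 1) ^ J\<close>; this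
  is the sign that has to agree with the convention for negative indices in
  \<open>c_inf\<close>.\<close>

lemma qpoch_inverse_power_self:
  fixes q :: "'a::real_normed_field"
  assumes "q \<noteq> 0"
  shows "qpoch (inverse q ^ (n + J)) q J * q ^ (n * J + J * (J + 1) div 2) * qpoch q q n = (- 1) ^ J * qpoch q q (n + J)"
proof (induction J)
  case (Suc J)
  have e0: "n + Suc J = Suc (n + J)" by simp
  have e: "n * Suc J + Suc J * (Suc J + 1) div 2 = n * J + J * (J + 1) div 2 + Suc (n + J)" by simp
  have s: "(1 - inverse q ^ Suc (n + J)) * q ^ Suc (n + J) = - (1 - q * q ^ (n + J))"
  proof -
    have m: "inverse q ^ Suc (n + J) * q ^ Suc (n + J) = 1"
      by (simp only: power_mult_distrib[symmetric] left_inverse[OF assms] power_one)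
    show ?thesis unfolding left_diff_distrib m by simp
  qed
  have g: "(A * X) * (P * Y) * Z = (X * P * Z) * (A * Y)" for A X P Y Z :: 'a by (simp only: mult_ac)
  show ?case
    unfolding e0 qpoch_inverse_power_shift[OF assms] e power_add[of q "n * J + J * (J + 1) div 2"] g Suc.IH s
    unfolding qpoch_Suc by (simp add: algebra_simps)
qed simp

text \<open>The first \<open>J\<close> terms of the sum on the left vanish.\<close>

lemma bqL_num_degenerate:
  fixes q b z :: real
  assumes q: "0 < q" "q < 1"
  shows "bqL_num (n + J) (1 / q ^ J) b (z / q ^ J) q
    = qpoch (inverse q ^ (n + J)) q J * q ^ J * qpoch q q n / (qpoch q q J * qpoch (b * q) q J)
      * qpoch (z / q ^ J) q J * bqL_poly n z (q ^ J) (b * q ^ J) q"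
proof -
  have q': "norm q < 1" "q \<noteq> 0" and qJ: "q ^ J \<noteq> 0" for J using q by auto
  define f where "f i = qpoch (inverse q ^ (n + J)) q i * qpoch (z / q ^ J) q i * qpoch (1 / q ^ J * q ^ Suc i) q (n + J - i)
     / (qpoch q q i * qpoch (b * q) q i) * q ^ i" for i
  have z0: "f i = 0" if "i < J" for i
  proof -
    have "Suc i + (J - Suc i) = J" using that by simp
    then have "q ^ Suc i * q ^ (J - Suc i) = q ^ J" by (simp only: power_add[symmetric])
    then have "1 / q ^ J * q ^ Suc i * q ^ (J - Suc i) = 1" using qJ[of J] by (simp add: mult.assoc)
    moreover have "J - Suc i < n + J - i" using that by simp
    ultimately have "qpoch (1 / q ^ J * q ^ Suc i) q (n + J - i) = 0" using qpoch_eq_0_iff by blast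
    then show ?thesis by (simp add: f_def)
  qed
  have "bqL_num (n + J) (1 / q ^ J) b (z / q ^ J) q = (\<Sum>i<J + Suc n. f i)"
    unfolding bqL_num_def f_def by (rule sum.cong) auto
  also have "\<dots> = (\<Sum>i<J. f i) + (\<Sum>i\<in>{J..<J + Suc n}. f i)"
    by (simp only: lessThan_atLeast0 sum.atLeastLessThan_concat[OF le0 le_add1])
  also have "\<dots> = (\<Sum>s\<le>n. f (J + s))"
    using sum.shift_bounds_nat_ivl[of f 0 J "Suc n"] z0
    by (simp add: add.commute lessThan_atLeast0[symmetric] lessThan_Suc_atMost)
  also have "\<dots> = (\<Sum>s\<le>n. qpoch (inverse q ^ (n + J)) q J * q ^ J * qpoch q q n / (qpoch q q J * qpoch (b * q) q J)
      * qpoch (z / q ^ J) q J * (qpoch (inverse q ^ n) q s * qpoch z q s / (qpoch q q s * (qpoch (q ^ J * q) q s * qpoch (b * q ^ J * q) q s)) * q ^ s))"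
  proof (rule sum.cong[OF refl])
    fix s assume "s \<in> {..n}"
    then have s: "s \<le> n" by simp
    have 1: "qpoch (inverse q ^ (n + J)) q (J + s) = qpoch (inverse q ^ (n + J)) q J * qpoch (inverse q ^ n) q s"
    proof -
      have "inverse q ^ (n + J) * q ^ J = inverse q ^ n" using qJ[of J] by (simp add: power_add power_inverse)
      then show ?thesis unfolding qpoch_add by (simp only:)
    qed
    have 2: "qpoch (z / q ^ J) q (J + s) = qpoch (z / q ^ J) q J * qpoch z q s"
      using qJ[of J] unfolding qpoch_add by simp
    have 3: "qpoch (1 / q ^ J * q ^ Suc (J + s)) q (n + J - (J + s)) * qpoch q q s = qpoch q q n"
    proof -
      have "1 / q ^ J * q ^ Suc (J + s) = q * q ^ s" using qJ[of J] by (simp add: power_add)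
      moreover have "n + J - (J + s) = n - s" by simp
      ultimately show ?thesis using qpoch_add[of q q s "n - s"] s by (simp add: mult.commute)
    qed
    have 4: "qpoch q q (J + s) = qpoch q q J * qpoch (q ^ J * q) q s"
      unfolding qpoch_add by (simp only: mult.commute)
    have 5: "qpoch (b * q) q (J + s) = qpoch (b * q) q J * qpoch (b * q ^ J * q) q s"
      unfolding qpoch_add by (simp only: mult.assoc mult.commute[of q])
    have g: "A * N * (Y * Z) * P / (QJ * Q' * (BJ * B')) * (qj * qs) = A * qj * Qn / (QJ * BJ) * Y * (N * Z / (Qs * (Q' * B')) * qs)"
      if "P * Qs = Qn" "Qs \<noteq> 0" for A N Y Z P QJ Q' BJ B' qj qs Qn Qs :: real
      using that(2) unfolding that(1)[symmetric] by (simp add: mult_ac)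
    show "f (J + s) = qpoch (inverse q ^ (n + J)) q J * q ^ J * qpoch q q n / (qpoch q q J * qpoch (b * q) q J)
      * qpoch (z / q ^ J) q J * (qpoch (inverse q ^ n) q s * qpoch z q s / (qpoch q q s * (qpoch (q ^ J * q) q s * qpoch (b * q ^ J * q) q s)) * q ^ s)"
      unfolding f_def 1 2 4 5 power_add[of q J s] by (rule g[OF 3 qpoch_self_nonzero[OF q'(1)]])
  qed
  finally show ?thesis unfolding bqL_poly_sum[OF q'(2)] sum_distrib_left .
qed

text \<open>The case of index \<open>J\<close>: the function has degree \<open>n\<close>, the core
  identity uses degree \<open>n + J\<close> with \<open>\<alpha> = 1 / q ^ J\<close>. The finite
  product \<open>yJ\<close> occurs twice under the root, once from the factor on the left and once
  from \<open>x / a\<close>, and so supplies the factor that the degenerate sum splits off; taking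
  it out of the root requires \<open>0 \<le> yJ\<close>.\<close>

lemma bqL_fun_upper:
  fixes q \<beta> W :: real
  assumes q: "0 < q" "q < 1" and \<beta>: "0 < \<beta>" and W: "- W * q < 1" and y: "0 \<le> qpoch (- W * q / q ^ J) q J" and d: "d = n + J"
  shows "sqrt (qpoch_inf (- W * q / q ^ J) q) * bqL_fun n (- W * q) (q ^ J) (- \<beta> * q ^ J) q
    = sqrt (bqL_norm n d (int J) \<beta> q * (\<bar>W\<bar> * qpoch_inf (- W * q) q * qpoch_inf (W * q / q ^ J / \<beta>) q))
      * ((- 1) ^ J * bqL_num d (1 / q ^ J) (- \<beta>) (- W * q / q ^ J) q)"
proof -
  have q': "norm q < 1" "q \<noteq> 0" and qJ: "q ^ J \<noteq> 0" "0 < q ^ J" using q by auto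
  define yJ w v Q T QJ TJ Qn Qd Td th where "yJ = qpoch (- W * q / q ^ J) q J" and "w = qpoch_inf (- W * q) q"
    and "v = qpoch_inf (W * q / q ^ J / \<beta>) q" and "Q = qpoch_inf q q" and "T = qpoch_inf (- \<beta> * q) q"
    and "QJ = qpoch q q J" and "TJ = qpoch (- \<beta> * q) q J" and "Qn = qpoch q q n" and "Qd = qpoch q q d"
    and "Td = qpoch (- \<beta> * q) q d" and "th = qtheta (- \<beta>) q"
  define e where "e = q ^ (n * J + J * (J + 1) div 2)"
  define cc where "cc = qpoch (inverse q ^ d) q J * q ^ J * Qn / (QJ * TJ)"
  have bq: "- \<beta> * q < 1" using \<beta> q by (simp add: mult_pos_pos order.strict_trans[of _ 0])
  have pos: "0 < w" "0 < Q" "0 < T" "0 < QJ" "0 < TJ" "0 < Qn" "0 < Qd" "0 < Td" "0 < th" "0 < e"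
    unfolding w_def Q_def T_def QJ_def TJ_def Qn_def Qd_def Td_def th_def e_def
    using qpoch_inf_pos[OF q W] qpoch_inf_pos[OF q q(2)] qpoch_inf_pos[OF q bq] qpoch_pos[OF q q(2)] qpoch_pos[OF q bq]
      qtheta_neg_pos[OF q \<beta>] q by auto
  have yy: "qpoch_inf (- W * q / q ^ J) q = yJ * w"
  proof -
    have "- W * q / q ^ J * q ^ J = - W * q" using qJ by simp
    then show ?thesis using qpoch_inf_split[OF q'(1), of "- W * q / q ^ J" J] by (simp only: yJ_def w_def)
  qed
  have add: "qpoch_inf (a * q ^ J) q = qpoch_inf a q / qpoch a q J" "qpoch (a * q ^ J) q n = qpoch a q d / qpoch a q J"
    if "qpoch a q J \<noteq> 0" for a
    using qpoch_inf_split[OF q'(1), of a J] qpoch_add[of a q J n] that d by (simp_all add: add.commute)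
  have Qs: "qpoch_inf (q ^ J * q) q = Q / QJ" "qpoch (q ^ J * q) q n = Qd / QJ"
    using add[of q] pos(4) unfolding Q_def QJ_def Qd_def by (simp_all add: mult.commute)
  have e0: "- \<beta> * q ^ J * q = - \<beta> * q * q ^ J" by simp
  have Ts: "qpoch_inf (- \<beta> * q ^ J * q) q = T / TJ" "qpoch (- \<beta> * q ^ J * q) q n = Td / TJ"
    using add[of "- \<beta> * q"] pos(5) unfolding e0 T_def TJ_def Td_def by simp_all
  have F: "qpoch_inf (q ^ Suc n) q = Q / Qn"
    using qpoch_inf_split[OF q'(1), of q n] pos(6) unfolding Q_def Qn_def by simp
  have cc: "cc = (- 1) ^ J * (Qd * q ^ J / (e * QJ * TJ))"
  proof -
    have 1: "qpoch (inverse q ^ d) q J * e * Qn = (- 1) ^ J * Qd"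
      unfolding d e_def Qn_def Qd_def by (rule qpoch_inverse_power_self[OF q'(2)])
    have g: "P * qj * Qn / (QJ * TJ) = s * (Qd * qj / (e * QJ * TJ))" if "P * e * Qn = s * Qd" "e \<noteq> 0" for P qj Qn QJ TJ s Qd e :: real
    proof -
      have "P * qj * Qn / (QJ * TJ) = (P * e * Qn) * qj / (e * QJ * TJ)" using that(2) by simp
      then show ?thesis unfolding that(1) by simp
    qed
    show ?thesis unfolding cc_def by (rule g[OF 1]) (use pos in simp)
  qed
  have ab: "q ^ J * (- \<beta> * q ^ J) < 0" using \<beta> qJ by (simp add: mult_pos_neg)
  have e1: "- W * q / (- \<beta> * q ^ J) = W * q / q ^ J / \<beta>" by simp
  have e3: "\<bar>- W * q\<bar> = \<bar>W\<bar> * q" using q by (simp add: abs_mult)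
  have e4: "\<bar>q ^ J * q\<bar> = q ^ J * q" using q by simp
  have e5: "- (q ^ J) * (- \<beta> * q ^ J) * q ^ 2 = \<beta> * q ^ (2 * J + 2)"
    by (simp add: power_add power_mult power2_eq_square power_mult_distrib)
  have e6: "- \<beta> * q ^ J / q ^ J = - \<beta>" using qJ by simp
  have bE: "bqL_norm n d (int J) \<beta> q * q ^ (2 * J) = Q / Qn * T * Td / (Q * Qd * th) * (q ^ (J * J) / (\<beta> ^ n * q ^ (n * (n + 3) div 2)))"
  proof -
    have "(int J)\<^sup>2 - 2 * int J = int (J * J) - int (2 * J)" by (simp add: power2_eq_square)
    moreover have "q powi (int (J * J) - int (2 * J)) = q powi int (J * J) / q powi int (2 * J)"
      using q'(2) by (intro power_int_diff) simp
    ultimately have "q powi ((int J)\<^sup>2 - 2 * int J) = q ^ (J * J) / q ^ (2 * J)" by (simp only: power_int_of_nat)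
    then show ?thesis
      unfolding bqL_norm_def F Q_def[symmetric] T_def[symmetric] Td_def[symmetric] Qd_def[symmetric] th_def[symmetric]
      using q'(2) by simp
  qed
  have exps: "q ^ (2 * J) * (q ^ J * (q ^ (2 * J + 2)) ^ n * q ^ (n * (n - 1) div 2)) * q ^ (J * J) = q ^ (n * (n + 3) div 2) * e\<^sup>2 * q ^ (2 * J)"
  proof -
    have "2 * (n * (n + 3) div 2) = n * (n + 3)" "2 * (J * (J + 1) div 2) = J * (J + 1)" by auto
    then have "2 * (2 * J + (J + (2 * J + 2) * n + n * (n - 1) div 2) + J * J)
        = 2 * (n * (n + 3) div 2 + (n * J + J * (J + 1) div 2) * 2 + 2 * J)"
      using even_mult_pred[of n] by (cases n) (simp_all add: algebra_simps)
    then have E: "2 * J + (J + (2 * J + 2) * n + n * (n - 1) div 2) + J * J = n * (n + 3) div 2 + (n * J + J * (J + 1) div 2) * 2 + 2 * J"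
      by simp
    show ?thesis unfolding e_def by (simp only: power_add[symmetric] power_mult[symmetric] E)
  qed
  have M: "yJ * w * (\<bar>W\<bar> * q * (yJ * w * v * (Q / QJ) * (T / TJ)) * (Qd / QJ * (Td / TJ)) / (q ^ J * q * (Q * w) * th * Qn)
        / ((\<beta> * q ^ (2 * J + 2)) ^ n * q ^ (n * (n - 1) div 2)))
      = bqL_norm n d (int J) \<beta> q * (\<bar>W\<bar> * w * v) * (Qd * q ^ J / (e * QJ * TJ) * yJ)\<^sup>2"
  proof -
    have g: "yJ * w * (aW * q * (yJ * w * v * (Q / QJ) * (T / TJ)) * (Qd / QJ * (Td / TJ)) / (qj * q * (Q * w) * th * Qn) / ((bn * q3) * q4))
      = N * (aW * w * v) * (Qd * qj / (e * QJ * TJ) * yJ)\<^sup>2"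
      if "N * qj2 = Q / Qn * T * Td / (Q * Qd * th) * (q5 / (bn * q6))" "qj\<^sup>2 = qj2" "qj2 * (qj * q3 * q4) * q5 = q6 * e\<^sup>2 * qj2"
        "w \<noteq> 0" "Q \<noteq> 0" "Qd \<noteq> 0" "q \<noteq> 0" "e \<noteq> 0" "q6 \<noteq> 0" "qj * q3 * q4 \<noteq> 0" "qj2 \<noteq> 0" "qj \<noteq> 0"
      for yJ w v Q QJ T TJ Qd Td qj q th Qn bn q3 q4 N aW e qj2 q5 q6 :: real
    proof -
      have x: "(qj * q3 * q4) * q5 = q6 * e\<^sup>2" using that(3,11) by (simp add: mult.assoc)
      have x': "1 / (qj * q3 * q4) = q5 / (q6 * e\<^sup>2)" using x that(8-10) by (simp add: frac_eq_eq mult.commute)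
      have "N * (aW * w * v) * (Qd * qj / (e * QJ * TJ) * yJ)\<^sup>2 = (N * qj2) * (aW * w * v) * (Qd / (QJ * TJ) * yJ)\<^sup>2 / e\<^sup>2"
        unfolding that(2)[symmetric] by (simp add: power2_eq_square mult_ac)
      also have "\<dots> = T * Td * Qd * aW * w * v * yJ\<^sup>2 / (Qn * th * bn * QJ\<^sup>2 * TJ\<^sup>2) * (q5 / (q6 * e\<^sup>2))"
        unfolding that(1) using that(5,6) by (simp add: power2_eq_square mult_ac)
      also have "\<dots> = T * Td * Qd * aW * w * v * yJ\<^sup>2 / (Qn * th * bn * QJ\<^sup>2 * TJ\<^sup>2) * (1 / (qj * q3 * q4))" unfolding x' ..
      also have "\<dots> = yJ * w * (aW * q * (yJ * w * v * (Q / QJ) * (T / TJ)) * (Qd / QJ * (Td / TJ)) / (qj * q * (Q * w) * th * Qn) / ((bn * q3) * q4))"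
        using that(4,5,7) by (simp add: power2_eq_square mult_ac)
      finally show ?thesis ..
    qed
    show ?thesis unfolding power_mult_distrib[of \<beta>]
      by (rule g[OF bE _ exps]) (use pos q' in \<open>simp_all add: power_mult[symmetric] mult.commute\<close>)
  qed
  have nn: "sqrt y * (sqrt M * L) = sqrt C * (s * (s * f' * yJ * L))" if "y * M = C * (f' * yJ)\<^sup>2" "0 \<le> f' * yJ" "s * s = 1" for y M L C f' yJ s :: real
  proof -
    have "sqrt y * sqrt M = sqrt C * (f' * yJ)" using that by (simp flip: real_sqrt_mult add: real_sqrt_mult)
    then have "sqrt y * (sqrt M * L) = sqrt C * (1 * (f' * yJ * L))" by (simp only: mult.assoc[symmetric] mult_1)
    then show ?thesis unfolding that(3)[symmetric] by (simp only: mult.assoc)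
  qed
  have R: "bqL_num d (1 / q ^ J) (- \<beta>) (- W * q / q ^ J) q = (- 1) ^ J * (Qd * q ^ J / (e * QJ * TJ)) * yJ * bqL_poly n (- W * q) (q ^ J) (- \<beta> * q ^ J) q"
    using bqL_num_degenerate[OF q, of n J "- \<beta>" "- W * q"] unfolding d[symmetric] cc[symmetric] unfolding cc_def Qn_def QJ_def TJ_def yJ_def .
  show ?thesis
    unfolding R bqL_fun_sqrt[OF q ab] e1 e3 e4 e5 e6 Qs Ts yy
    unfolding Q_def[symmetric] w_def[symmetric] v_def[symmetric] th_def[symmetric] Qn_def[symmetric]
  proof (rule nn[OF M])
    show "0 \<le> Qd * q ^ J / (e * QJ * TJ) * yJ"
      using pos qJ y unfolding yJ_def[symmetric] by (intro mult_nonneg_nonneg divide_nonneg_nonneg) auto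
    show "(- 1 :: real) ^ J * (- 1) ^ J = 1" by (simp flip: power_mult_distrib)
  qed
qed

text \<open>For \<open>i \<le> 0\<close> one of the factors is 0, so on a lattice the product may
  vanish but never becomes negative.\<close>

lemma qpoch_inf_powi_nonneg:
  fixes q :: real
  assumes q: "0 < q" "q < 1"
  shows "0 \<le> qpoch_inf (q powi i) q"
proof (cases "0 < i")
  case True
  then obtain j where "i = int (Suc j)" using zero_less_imp_eq_int[of i] by (metis gr0_implies_Suc of_nat_0_less_iff)
  then have "q powi i = q ^ Suc j" by (simp only: power_int_of_nat)
  then show ?thesis using qpoch_inf_pos[OF q power_Suc_less_one[OF q]] by (simp add: less_imp_le)
next
  case False
  then have "q powi i * q ^ nat (- i) = 1" using q by (simp add: power_int_def power_inverse)
  then have "qpoch_inf (q powi i) q = 0" using qpoch_inf_eq_0_iff[of q "q powi i"] q by auto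
  then show ?thesis by simp
qed

text \<open>For \<open>- J < i \<le> 0\<close> the vanishing factor is among the first
  \<open>J\<close> ones.\<close>

lemma qpoch_powi_nonneg:
  fixes q :: real
  assumes q: "0 < q" "q < 1" and i: "- int J < i"
  shows "0 \<le> qpoch (q powi i) q J"
proof (cases "0 < i")
  case True
  then obtain j where "i = int (Suc j)" using zero_less_imp_eq_int[of i] by (metis gr0_implies_Suc of_nat_0_less_iff)
  then have "q powi i = q ^ Suc j" by (simp only: power_int_of_nat)
  then show ?thesis using qpoch_pos[OF q power_Suc_less_one[OF q]] by (simp add: less_imp_le)
next
  case False
  then have "q powi i * q ^ nat (- i) = 1" using q by (simp add: power_int_def power_inverse)
  moreover have "nat (- i) < J" using False i by simp
  ultimately have "qpoch (q powi i) q J = 0" using qpoch_eq_0_iff by blast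
  then show ?thesis by simp
qed

lemma powr_add_2: "q powr (2 + x) = q ^ 2 * q powr x" if "0 < q" for q x :: real
  using that by (simp add: powr_add)

text \<open>\<open>W\<close> is the rescaled point, \<open>x'\<close> or \<open>z'\<close> in the
  application, and \<open>\<beta>\<close> the absolute value of the ratio of the two parameters. In
  these variables both choices of \<open>l\<close> give the same formula up to the sign of
  \<open>l\<close>.\<close>

lemma c_inf_nonneg_index:
  fixes q \<kappa> X l W \<beta> p :: real
  assumes q: "0 < q" "q < 1" and l: "l \<in> {- 1, q powr (2 * \<kappa>)}" and p: "p = q ^ 2"
    and W: "W = l * X * q powi (2 * j) * q powr (- 2 * \<kappa>)" and \<beta>: "\<beta> = l ^ 2 * q powr (- 2 * \<kappa>)"
    and j: "j = int J"
  shows "c_inf q \<kappa> X l j n = (of_real (sgn l) * \<i>) ^ n * of_real (bqL_fun n (- W * p) (p ^ J) (- \<beta> * p ^ J) p)"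
proof -
  have pp: "0 < p" "p < 1" using q unfolding p by (simp_all add: power_less_one_iff)
  have \<beta>0: "0 < \<beta>" using l q unfolding \<beta> by auto
  have q2j: "q powi (2 * j) = p powi j" unfolding p using power_int_mult[of q 2 j] by simp
  have pj: "0 < p powi j" using pp by simp
  have sg: "sgn (l * q powi (2 * j)) = sgn l" using q by (simp add: sgn_mult)
  have r2: "q powr (2 - 2 * \<kappa>) = p * q powr (- 2 * \<kappa>)" using powr_add_2[OF q(1), of "- 2 * \<kappa>"] unfolding p by simp

    have pJ: "p powi j = p ^ J" "p powi (- j) = 1 / p ^ J" unfolding j by (simp_all add: power_int_minus inverse_eq_divide)
    \<comment> \<open>For \<open>l = q powr (2 * \<kappa>)\<close> it is the second parameter that
      equals \<open>p ^ J\<close>, and the symmetry of \<open>bqL_fun\<close> is applied.\<close>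
    have ab: "bqL_fun n x (- (l * p ^ J)) (l * p ^ J * q powr (- 2 * \<kappa>)) p = bqL_fun n x (p ^ J) (- \<beta> * p ^ J) p" for x
    proof (cases "l = - 1")
      case True
      then show ?thesis by (simp add: \<beta> mult.commute)
    next
      case False
      then have ll: "l = q powr (2 * \<kappa>)" using l by simp
      have i1: "l * q powr (- 2 * \<kappa>) = 1" using q unfolding ll by (simp flip: powr_add)
      have i2: "l ^ 2 * q powr (- 2 * \<kappa>) = l" using i1 unfolding power2_eq_square by (simp add: mult.assoc)
      have i3: "l * p ^ J * q powr (- 2 * \<kappa>) = p ^ J" using i1 by (metis mult.assoc mult.commute mult_1)
      have bl: "\<beta> = l" unfolding \<beta> by (rule i2)
      have i4: "- (l * p ^ J) = - \<beta> * p ^ J" unfolding bl by simp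
      have "- \<beta> * p ^ J * p ^ J < 0" using \<beta>0 pp by (simp add: mult_pos_pos)
      then show ?thesis unfolding i3 i4 by (rule bqL_fun_commute[OF pp])
    qed
    have x: "- X * (l * p ^ J) * (p * q powr (- 2 * \<kappa>)) = - W * p" unfolding W q2j pJ by simp
    show "c_inf q \<kappa> X l j n = (of_real (sgn l) * \<i>) ^ n * of_real (bqL_fun n (- W * p) (p ^ J) (- \<beta> * p ^ J) p)"
    proof -
      have "c_inf q \<kappa> X l j n = (of_real (sgn (l * q powi (2 * j))) * \<i>) ^ n * of_real
        (bqL_fun n (- X * (l * q powi (2 * j)) * q powr (2 - 2 * \<kappa>)) (- (l * q powi (2 * j))) (l * q powi (2 * j) * q powr (- 2 * \<kappa>)) (q ^ 2))"
        unfolding c_inf_def Let_def using j by simp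
      note c0 = this
      have "sgn (l * p ^ J) = sgn l" using pp by (simp add: sgn_mult)
      note sgJ = this
      show ?thesis unfolding c0 q2j pJ r2 p[symmetric] ab x sgJ ..
    qed

qed

lemma c_inf_neg_index:
  fixes q \<kappa> X l W \<beta> p :: real
  assumes q: "0 < q" "q < 1" and p: "p = q ^ 2"
    and W: "W = l * X * q powi (2 * j) * q powr (- 2 * \<kappa>)" and \<beta>: "\<beta> = l ^ 2 * q powr (- 2 * \<kappa>)"
    and j: "j = - int J" "j < 0" and d: "int d = int n + j"
  shows "c_inf q \<kappa> X l j n = (of_real (sgn l) * \<i>) ^ n * of_real ((- 1) powi j * bqL_fun d (- W * p * p ^ J) (p ^ J) (- \<beta>) p)"
proof -
  have pp: "0 < p" "p < 1" using q unfolding p by (simp_all add: power_less_one_iff)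
  have q2j: "q powi (2 * j) = p powi j" unfolding p using power_int_mult[of q 2 j] by simp
  have pj: "0 < p powi j" using pp by simp
  have sg: "sgn (l * q powi (2 * j)) = sgn l" using q by (simp add: sgn_mult)
  have r2: "q powr (2 - 2 * \<kappa>) = p * q powr (- 2 * \<kappa>)" using powr_add_2[OF q(1), of "- 2 * \<kappa>"] unfolding p by simp

    have pJ: "p powi (- j) = p ^ J" "p powi j = inverse (p ^ J)" unfolding j(1) by (simp_all add: power_int_minus)
    have x: "- l * X * (p * q powr (- 2 * \<kappa>)) = - W * p * p ^ J"
    proof -
      have g: "- l * X * (p * c) = - (l * X * inverse P * c) * p * P" if "P \<noteq> 0" for P l X c :: real using that by simp
      show ?thesis unfolding W q2j pJ by (rule g) (use pp in simp)
    qed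
    have q2: "q powi (- 2 * j) = p ^ J"
    proof -
      have "q powi (- 2 * j) = (q powi 2) powi (- j)" using power_int_mult[of q 2 "- j"] by simp
      then show ?thesis using pJ unfolding p by simp
    qed
    have b: "- (l ^ 2) * q powr (- 2 * \<kappa>) = - \<beta>" by (simp add: \<beta>)
    show "c_inf q \<kappa> X l j n = (of_real (sgn l) * \<i>) ^ n * of_real ((- 1) powi j * bqL_fun d (- W * p * p ^ J) (p ^ J) (- \<beta>) p)"
    proof -
      have 1: "nat (int n + j) = d" "- j \<le> int n" using d by simp_all
      have "c_inf q \<kappa> X l j n = (of_real (sgn (l * q powi (2 * j))) * \<i>) ^ n * of_real
        ((- 1) powi j * bqL_fun (nat (int n + j)) (- l * X * q powr (2 - 2 * \<kappa>)) (q powi (- 2 * j)) (- (l ^ 2) * q powr (- 2 * \<kappa>)) (q ^ 2))"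
        unfolding c_inf_def Let_def using j(2) 1(2) by simp
      then show ?thesis unfolding sg r2 p[symmetric] q2 b x 1(1) .
    qed

qed

text \<open>The root on the left is the contribution of the matching dual q-Hahn coefficient; with
  it the two branches of \<open>c_inf\<close> agree in form. The condition \<open>good\<close>
  describes the points where the coefficients live and makes \<open>- W * p < 1\<close>.\<close>

lemma c_inf_eq_bqL_num:
  fixes q \<kappa> X l W \<beta> p :: real
  assumes q: "0 < q" "q < 1" and l: "l \<in> {- 1, q powr (2 * \<kappa>)}" and p: "p = q ^ 2"
    and W: "W = l * X * q powi (2 * j) * q powr (- 2 * \<kappa>)" and \<beta>: "\<beta> = l ^ 2 * q powr (- 2 * \<kappa>)"
    and good: "0 < W \<or> (\<exists>i::nat. W = - (p ^ i))" and d: "int d = int n + j"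
  shows "of_real (sqrt (qpoch_inf (- W * p * p powi (- j)) p)) * c_inf q \<kappa> X l j n
    = (of_real (sgn l) * \<i>) ^ n * of_real ((- 1) powi j
        * sqrt (bqL_norm n d j \<beta> p * (\<bar>W\<bar> * qpoch_inf (- W * p) p * qpoch_inf (W * p * p powi (- j) / \<beta>) p))
        * bqL_num d (p powi (- j)) (- \<beta>) (- W * p * p powi (- j)) p)"
proof -
  have pp: "0 < p" "p < 1" using q unfolding p by (simp_all add: power_less_one_iff)
  have \<beta>0: "0 < \<beta>" using l q unfolding \<beta> by auto
  have Wp: "- W * p < 1"
  proof -
    consider "0 < W" | i where "W = - (p ^ i)" using good by blast
    then show ?thesis
    proof cases
      case 1
      then have "- W * p < 0" using pp by (simp add: mult_pos_pos)
      then show ?thesis by simp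
    next
      case 2
      then show ?thesis using power_Suc_less_one[OF pp, of i] by (simp add: mult.commute)
    qed
  qed
  show ?thesis
  proof (cases "0 \<le> j")
    case True
    define J where "J = nat j"
    have j: "j = int J" using True by (simp add: J_def)
    have pJ: "p powi j = p ^ J" "p powi (- j) = 1 / p ^ J" unfolding j by (simp_all add: power_int_minus inverse_eq_divide)
    have c: "c_inf q \<kappa> X l j n = (of_real (sgn l) * \<i>) ^ n * of_real (bqL_fun n (- W * p) (p ^ J) (- \<beta> * p ^ J) p)"
      by (rule c_inf_nonneg_index[OF q l p W \<beta> j])
    have y: "0 \<le> qpoch (- W * p / p ^ J) p J"
    proof -
      consider "0 < W" | i where "W = - (p ^ i)" using good by blast
      then show ?thesis
      proof cases
        case 1
        then have "- W * p / p ^ J < 1" using pp by (simp add: divide_neg_pos mult_pos_pos order.strict_trans[of _ 0])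
        then show ?thesis using qpoch_pos[OF pp] by (simp add: less_imp_le)
      next
        case 2
        have "p powi (int (Suc i) - int J) = p powi int (Suc i) / p powi int J" using pp by (intro power_int_diff) simp
        then have "- W * p / p ^ J = p powi (int (Suc i) - int J)" unfolding power_int_of_nat 2 by simp
        then show ?thesis using qpoch_powi_nonneg[OF pp, of J "int (Suc i) - int J"] by simp
      qed
    qed
    have dd: "d = n + J" using d j by simp
    have s: "(- 1 :: real) powi j = (- 1) ^ J" unfolding j by simp
    have e1: "- W * p * (1 / p ^ J) = - W * p / p ^ J" "W * p * (1 / p ^ J) = W * p / p ^ J" by simp_all
    have g: "of_real a * (P * of_real b) = P * of_real (s * S * G)" if "a * b = S * (s * G)" for a b s S G :: real and P :: complex
    proof -
      have "of_real a * (P * of_real b) = P * of_real (a * b)" by simp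
      then show ?thesis unfolding that by (simp add: mult_ac)
    qed
    show ?thesis unfolding c pJ e1 s
      by (rule g) (rule bqL_fun_upper[OF pp \<beta>0 Wp y dd, folded j])
  next
    case False
    define J where "J = nat (- j)"
    have j: "j = - int J" using False by (simp add: J_def)
    have pJ: "p powi (- j) = p ^ J" "p powi j = inverse (p ^ J)" unfolding j by (simp_all add: power_int_minus)
    have nd: "n = d + J" using d j by simp
    have jn: "j < 0" using False by simp
    have c: "c_inf q \<kappa> X l j n = (of_real (sgn l) * \<i>) ^ n * of_real ((- 1) powi j * bqL_fun d (- W * p * p ^ J) (p ^ J) (- \<beta>) p)"
      by (rule c_inf_neg_index[OF q p W \<beta> j jn d])
    have g: "of_real a * (P * of_real (s * b)) = P * of_real (s * S * G)" if "a * b = S * G" for a b s S G :: real and P :: complex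
    proof -
      have "of_real a * (P * of_real (s * b)) = P * of_real (s * (a * b))" by simp
      then show ?thesis unfolding that by (simp add: mult_ac)
    qed
    show ?thesis unfolding c pJ by (rule g) (rule bqL_fun_lower[OF pp \<beta>0 Wp nd, folded j])
  qed
qed

text \<open>The numerator \<open>(x/a, x/b;q)\<^sub>\<infinity>\<close> of the radicand of \<open>bqL_fun\<close> vanishes here.\<close>

lemma c_inf_eq_0:
  fixes q \<kappa> X l W p :: real
  assumes q: "0 < q" "q < 1" and l: "l \<in> {- 1, q powr (2 * \<kappa>)}" and p: "p = q ^ 2"
    and W: "W = l * X * q powi (2 * j) * q powr (- 2 * \<kappa>)" and out: "W = - (p powi (- 1 - int i))"
  shows "c_inf q \<kappa> X l j n = 0"
proof -
  have pp: "0 < p" "p < 1" using q unfolding p by (simp_all add: power_less_one_iff)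
  have Wi: "- W * p * p ^ i = 1"
  proof -
    have "p powi (- 1 - int i) = inverse (p * p ^ i)"
      using pp power_int_minus[of p "int (Suc i)"] by (simp only: power_int_of_nat power_Suc) (simp add: algebra_simps)
    note e = this
    have "p * p ^ i \<noteq> 0" using pp by simp
    then have "p powi (- 1 - int i) * (p * p ^ i) = 1" unfolding e by (rule left_inverse)
    then show ?thesis unfolding out by (simp add: mult.assoc)
  qed
  have zero: "bqL_fun m x a b p = 0" if "x / a * p ^ s = 1" for m x a b s
  proof -
    have "qpoch_inf (x / a) p = 0" using qpoch_inf_eq_0_iff[of p "x / a"] pp that by auto
    then show ?thesis by (simp add: bqL_fun_def)
  qed
  show ?thesis
  proof (cases "0 \<le> j")
    case True
    define J where "J = nat j"
    have j: "j = int J" using True by (simp add: J_def)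
    have "- W * p / p ^ J * p ^ (i + J) = - W * p * p ^ i" using pp by (simp add: power_add)
    then have "bqL_fun n (- W * p) (p ^ J) b p = 0" for b using zero[of "- W * p" "p ^ J" "i + J" n b] Wi by simp
    then show ?thesis unfolding c_inf_nonneg_index[OF q l p W refl j] by simp
  next
    case False
    define J where "J = nat (- j)"
    have j: "j = - int J" "j < 0" using False by (simp_all add: J_def)
    show ?thesis
    proof (cases "- j \<le> int n")
      case True
      then have d: "int (nat (int n + j)) = int n + j" by simp
      have "- W * p * p ^ J / p ^ J * p ^ i = 1" using pp Wi by simp
      then have "bqL_fun m (- W * p * p ^ J) (p ^ J) b p = 0" for b m using zero[of "- W * p * p ^ J" "p ^ J" i m b] by simp
      then show ?thesis unfolding c_inf_neg_index[OF q p W refl j d] by simp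
    next
      case nj: False
      then show ?thesis unfolding c_inf_def Let_def using False by simp
    qed
  qed
qed

subsection \<open>The factors of the coupling relation\<close>

definition qpoch_sq :: "complex \<Rightarrow> real \<Rightarrow> real \<Rightarrow> real" where
  "qpoch_sq u p c = (cmod (qpoch_inf (of_real c * u) (of_real p)))\<^sup>2"

lemma qpoch_sq:
  assumes "0 < p" "p < 1" "cmod u = 1"
  shows "qpoch_inf (of_real c * u) (of_real p) * qpoch_inf (of_real c / u) (of_real p) = of_real (qpoch_sq u p c)"
  unfolding qpoch_sq_def by (rule qpoch_inf_unit_pair[OF assms])

lemma qpoch_sq_nonneg: "0 \<le> qpoch_sq u p c"
  by (simp add: qpoch_sq_def)

text \<open>The radicand consists of real products and of conjugate pairs. Where it is nonnegative,
  the complex root is the real one, and roots of different coefficients may be multiplied.\<close>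

lemma cdqH_fun_real:
  assumes p: "0 < p" "p < 1" and u: "cmod u = 1" and D: "cdqH_density u (of_real p) = of_real D"
    and nn: "0 \<le> D * (qpoch_inf (p ^ Suc k) p * qpoch_inf (d * e * p ^ k) p * qpoch_inf (d * c * p ^ k) p * qpoch_inf (e * c * p ^ k) p)
      / (qpoch_sq u p d * qpoch_sq u p e * qpoch_sq u p c)"
  shows "cdqH_fun k u (of_real d) (of_real e) (of_real c) (of_real p)
    = of_real (sqrt (D * (qpoch_inf (p ^ Suc k) p * qpoch_inf (d * e * p ^ k) p * qpoch_inf (d * c * p ^ k) p * qpoch_inf (e * c * p ^ k) p)
      / (qpoch_sq u p d * qpoch_sq u p e * qpoch_sq u p c))) * cdqH_poly k u (of_real d) (of_real e) (of_real c) (of_real p)"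
proof -
  have pa: "\<bar>p\<bar> < 1" using p by simp
  have r: "qpoch_inf (of_real a) (of_real p) = (of_real (qpoch_inf a p) :: complex)" for a
    by (rule qpoch_inf_of_real[OF pa])
  have g: "d1 * d2 * e1 * e2 * c1 * c2 = (d1 * d2) * (e1 * e2) * (c1 * c2)" for d1 d2 e1 e2 c1 c2 :: complex
    by (simp only: mult.assoc)
  have "csqrt (cdqH_density u (of_real p)
            * (qpoch_inf (of_real p ^ (k + 1)) (of_real p) * qpoch_inf (of_real d * of_real e * of_real p ^ k) (of_real p)
               * qpoch_inf (of_real d * of_real c * of_real p ^ k) (of_real p) * qpoch_inf (of_real e * of_real c * of_real p ^ k) (of_real p))
            / (qpoch_inf (of_real d * u) (of_real p) * qpoch_inf (of_real d / u) (of_real p) * qpoch_inf (of_real e * u) (of_real p)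
               * qpoch_inf (of_real e / u) (of_real p) * qpoch_inf (of_real c * u) (of_real p) * qpoch_inf (of_real c / u) (of_real p)))
    = csqrt (of_real (D * (qpoch_inf (p ^ Suc k) p * qpoch_inf (d * e * p ^ k) p * qpoch_inf (d * c * p ^ k) p * qpoch_inf (e * c * p ^ k) p)
      / (qpoch_sq u p d * qpoch_sq u p e * qpoch_sq u p c)))"
    unfolding D g unfolding qpoch_sq[OF p u] Suc_eq_plus1
    by (simp only: of_real_mult[symmetric] of_real_power[symmetric] of_real_divide[symmetric] r)
  also have "\<dots> = of_real (sqrt (D * (qpoch_inf (p ^ Suc k) p * qpoch_inf (d * e * p ^ k) p * qpoch_inf (d * c * p ^ k) p * qpoch_inf (e * c * p ^ k) p)
      / (qpoch_sq u p d * qpoch_sq u p e * qpoch_sq u p c)))"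
    by (rule of_real_sqrt[OF nn, symmetric])
  finally show ?thesis unfolding cdqH_fun_def by (simp only:)
qed

lemma cdqH_fun_commute:
  assumes "norm q < 1" "q \<noteq> 0" "a \<noteq> 0" "b \<noteq> 0" "u \<noteq> 0" "c \<noteq> 0"
  shows "cdqH_fun n u a b c q = cdqH_fun n u b a c q"
proof -
  have g: "D * (p1 * p2 * p3 * p4) / (a1 * a2 * b1 * b2 * c1 * c2) = D * (p1 * p2 * p4 * p3) / (b1 * b2 * a1 * a2 * c1 * c2)"
    for D p1 p2 p3 p4 a1 a2 b1 b2 c1 c2 :: complex by (simp only: mult_ac)
  show ?thesis unfolding cdqH_fun_def cdqH_commute[OF assms] mult.commute[of b a]
    by (rule arg_cong[where f = "\<lambda>x. csqrt x * cdqH_poly n u b a c q"], rule g)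
qed

lemma powi_eq_powr: "(q ^ 2) powi i = q powr (2 * of_int i)" if "0 < q" for q :: real
proof -
  have "(q ^ 2) powi i = q powi (2 * i)" using power_int_mult[of q 2 i] by simp
  also have "\<dots> = q powr of_int (2 * i)" by (rule powr_real_of_int'[symmetric]) (use that in auto)
  finally show ?thesis by simp
qed

text \<open>\<open>g\<close> satisfies \<open>a = - g * u\<close> and \<open>b = - g / u\<close>,
  and \<open>th\<close> is the dual parameter \<open>q ^ 2 / (a * b * t)\<close>. All definitions
  are invariant under exchanging \<open>l\<close>, \<open>\<tau>\<close>, \<open>t\<close> with
  \<open>\<xi>\<close>, \<open>\<sigma>\<close>, \<open>th\<close>. The dual q-Hahn parameters on
  the side of \<open>Z\<close> are \<open>th * g\<close> and \<open>- p * \<rho> / g\<close>, in an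
  order that depends on \<open>l\<close>.\<close>

lemma coupling_parameters:
  fixes q \<tau> \<sigma> l \<xi> p g t th \<rho> :: real
  assumes q: "0 < q" "q < 1" and l: "l \<in> {- 1, q powr (2 * \<tau>)}" and \<xi>: "\<xi> \<in> {- 1, q powr (2 * \<sigma>)}"
    and p: "p = q ^ 2" and g: "g = q powr (1 + \<sigma> + \<tau> - 2 * of_int r) / (l * \<xi>)"
    and t: "t = l ^ 2 * q powr (2 * of_int r - 2 * \<tau>)" and th: "th = \<xi> ^ 2 * q powr (2 * of_int r - 2 * \<sigma>)"
    and \<rho>: "\<rho> = p powi (- r)"
  shows "0 < t" "0 < th" "0 < \<rho>" "g \<noteq> 0" "t * th * g ^ 2 = p" "sgn g = sgn (l * \<xi>)"
    and "g * (l * z * q powr (2 * of_int r - 2 * \<tau>)) = z * q powr (1 + \<sigma> - \<tau>) / \<xi>"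
    and "(th * g = - \<xi> * q powr (1 - \<sigma> + \<tau>) \<and> - p * \<rho> / g = \<xi> * q powr (1 - \<sigma> - \<tau>))
      \<or> (th * g = \<xi> * q powr (1 - \<sigma> - \<tau>) \<and> - p * \<rho> / g = - \<xi> * q powr (1 - \<sigma> + \<tau>))"
    and "l ^ 2 * q powr (- 2 * \<tau>) = t * \<rho>"
proof -
  have nz: "l \<noteq> 0" "\<xi> \<noteq> 0" using l \<xi> q by auto
  have pa: "q powr a * q powr b = q powr c" if "a + b = c" for a b c using that by (simp flip: powr_add)
  define A where "A = q powr (2 * of_int r - 2 * \<sigma>)"
  define A' where "A' = q powr (2 * of_int r - 2 * \<tau>)"
  define B where "B = q powr (1 + \<sigma> + \<tau> - 2 * of_int r)"
  have pos: "0 < A" "0 < A'" "0 < B" using q by (simp_all add: A_def A'_def B_def)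
  have \<rho>': "\<rho> = q powr (- 2 * of_int r)" unfolding \<rho> p using powi_eq_powr[OF q(1), of "- r"] by simp
  have p': "p = q powr 2" using q by (simp add: p)
  show tp: "0 < t" "0 < th" "0 < \<rho>" "g \<noteq> 0" using nz q by (simp_all add: t th \<rho>' g)
  have AB: "A * B = q powr (1 - \<sigma> + \<tau>)" unfolding A_def B_def by (rule pa) simp
  have A'B: "A' * B = q powr (1 + \<sigma> - \<tau>)" unfolding A'_def B_def by (rule pa) simp
  have "q powr (1 - \<sigma> + \<tau>) * q powr (1 + \<sigma> - \<tau>) = p" unfolding p' by (rule pa) simp
  then have AA: "A * B * (A' * B) = p" unfolding AB A'B .
  have g': "g = B / (l * \<xi>)" and t': "t = l ^ 2 * A'" and th': "th = \<xi> ^ 2 * A" unfolding g t th A_def A'_def B_def by simp_all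
  have gg: "l ^ 2 * A' * (\<xi> ^ 2 * A) * (B / (l * \<xi>)) ^ 2 = A * B * (A' * B)" if "l \<noteq> 0" "\<xi> \<noteq> 0" for l \<xi> A A' B :: real
    using that by (simp add: power2_eq_square mult_ac)
  show "t * th * g ^ 2 = p" unfolding g' t' th' gg[OF nz] by (rule AA)
  show "sgn g = sgn (l * \<xi>)" using pos unfolding g' by (simp add: sgn_mult sgn_divide divide_inverse)
  show "g * (l * z * q powr (2 * of_int r - 2 * \<tau>)) = z * q powr (1 + \<sigma> - \<tau>) / \<xi>"
    unfolding A'_def[symmetric] A'B[symmetric] g' using nz by simp
  have C: "p * \<rho> = q powr (1 - \<sigma> - \<tau>) * B" unfolding p' \<rho>' B_def by (subst pa[OF refl], subst pa[OF refl]) simp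
  have e: "- p * \<rho> / g = - (l * \<xi>) * q powr (1 - \<sigma> - \<tau>)"
  proof -
    have "- p * \<rho> / g = - (p * \<rho>) / g" by simp
    also have "\<dots> = - (l * \<xi>) * q powr (1 - \<sigma> - \<tau>)" unfolding C g' using pos(3) nz by simp
    finally show ?thesis .
  qed
  have d: "th * g = \<xi> / l * q powr (1 - \<sigma> + \<tau>)"
    unfolding AB[symmetric] g' th' using nz by (simp add: power2_eq_square)
  show "(th * g = - \<xi> * q powr (1 - \<sigma> + \<tau>) \<and> - p * \<rho> / g = \<xi> * q powr (1 - \<sigma> - \<tau>))
      \<or> (th * g = \<xi> * q powr (1 - \<sigma> - \<tau>) \<and> - p * \<rho> / g = - \<xi> * q powr (1 - \<sigma> + \<tau>))"
  proof (cases "l = - 1")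
    case True
    then show ?thesis unfolding d e by simp
  next
    case False
    then have ll: "l = q powr (2 * \<tau>)" using l by simp
    have 1: "q powr (1 - \<sigma> + \<tau>) = l * q powr (1 - \<sigma> - \<tau>)" unfolding ll by (rule pa[symmetric]) simp
    then show ?thesis unfolding d e using nz by simp
  qed
  have "q powr (2 * of_int r - 2 * \<tau>) * \<rho> = q powr (- 2 * \<tau>)" unfolding \<rho>' by (rule pa) simp
  then show "l ^ 2 * q powr (- 2 * \<tau>) = t * \<rho>" unfolding t by simp
qed

text \<open>In the big q-Laguerre coefficient the power of \<open>q\<close> attached to the point
  and the one in the index \<open>l q\<^sup>2\<^sup>(r-k)\<close> compensate each other. The
  rescaled point is therefore the same for all \<open>k\<close>, and relations for different
  \<open>k\<close>, \<open>m\<close>, \<open>n\<close> concern the same variable.\<close>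

lemma lattice_shift:
  fixes q \<kappa> :: real
  assumes q: "0 < q"
  shows "l * y * q powr (2 * of_int r - 2 * \<kappa>) = l * (y * q ^ (2 * k)) * q powi (2 * (r - int k)) * q powr (- 2 * \<kappa>)"
proof -
  have "q powi (2 * (r - int k)) = q powr (2 * of_int r) / q ^ (2 * k)"
  proof -
    have "q powi (2 * r - int (2 * k)) = q powi (2 * r) / q powi int (2 * k)" using q by (intro power_int_diff) simp
    moreover have "q powi (2 * r) = q powr (2 * of_int r)" using q powr_real_of_int'[of q "2 * r"] by simp
    moreover have "2 * (r - int k) = 2 * r - int (2 * k)" by simp
    ultimately show ?thesis by (simp only: power_int_of_nat)
  qed
  note 1 = this
  have 2: "q powr (2 * of_int r - 2 * \<kappa>) = q powr (2 * of_int r) * q powr (- 2 * \<kappa>)" by (simp flip: powr_add)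
  have g: "l * y * (R * T) = l * (y * K) * (R / K) * T" if "K \<noteq> 0" for R T K using that by simp
  show ?thesis unfolding 1 2 by (rule g) (use q in simp)
qed

text \<open>The product of both coefficients on the side of \<open>Z\<close>, sorted into phase,
  sign, a root that depends on the indices only, the root of the weight, and polynomials. By the
  symmetry of the parameters the side of \<open>X\<close> is another instance.\<close>

lemma coupling_side:
  fixes q \<tau> \<sigma> l \<xi> p g t th \<rho> z Z D :: real
  assumes q: "0 < q" "q < 1" and l: "l \<in> {- 1, q powr (2 * \<tau>)}" and \<xi>: "\<xi> \<in> {- 1, q powr (2 * \<sigma>)}"
    and p: "p = q ^ 2" and g: "g = q powr (1 + \<sigma> + \<tau> - 2 * of_int r) / (l * \<xi>)"
    and t: "t = l ^ 2 * q powr (2 * of_int r - 2 * \<tau>)" and th: "th = \<xi> ^ 2 * q powr (2 * of_int r - 2 * \<sigma>)"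
    and \<rho>: "\<rho> = p powi (- r)" and Z: "Z = l * z * q powr (2 * of_int r - 2 * \<tau>)" and u: "cmod u = 1"
    and D: "cdqH_density u (of_real p) = of_real D" "0 < D"
    and good: "(\<exists>i::nat. Z = - (p ^ i)) \<or> (\<exists>i::int. Z = t * p powi i)"
    and nk: "int n + int k = int m + r"
  shows "c_fin q \<sigma> \<tau> u \<xi> k z * c_inf q \<tau> (z * q ^ (2 * k)) l (r - int k) m
    = (of_real (sgn l) * \<i>) ^ m * of_real ((- 1) powi (r - int k)
        * (sqrt (D * (qpoch_inf (p ^ Suc k) p * qpoch_inf (- th * \<rho> * p * p ^ k) p) / (qpoch_sq u p (th * g) * qpoch_sq u p (- p * \<rho> / g))
            * bqL_norm m n (r - int k) (t * \<rho>) p)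
          * sqrt (\<bar>Z\<bar> * qpoch_inf (- Z * p) p / qpoch_sq u p (g * Z)) * qpoch_inf (p ^ Suc k / t * Z) p
          * bqL_num n (p ^ k * \<rho>) (- (t * \<rho>)) (- Z * p * (p ^ k * \<rho>)) p))
      * cdqH_poly k u (of_real (th * g)) (of_real (- p * \<rho> / g)) (of_real (g * Z)) (of_real p)"
proof -
  note P = coupling_parameters[OF q l \<xi> p g t th \<rho>]
  have pp: "0 < p" "p < 1" using q unfolding p by (simp_all add: power_less_one_iff)
  have pk: "p powi (- (r - int k)) = p ^ k * \<rho>"
  proof -
    have "p powi (int k + - r) = p powi int k * p powi (- r)" using pp by (intro power_int_add) simp
    then show ?thesis by (simp add: \<rho>)
  qed
  define v where "v = qpoch_inf (p ^ Suc k / t * Z) p"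
  define y where "y = qpoch_inf (- Z * p * (p ^ k * \<rho>)) p"
  define w where "w = qpoch_inf (- Z * p) p"
  define N where "N = D * (qpoch_inf (p ^ Suc k) p * qpoch_inf (- th * \<rho> * p * p ^ k) p) / (qpoch_sq u p (th * g) * qpoch_sq u p (- p * \<rho> / g))"
  have Z0: "Z \<noteq> 0" using good pp P(1) by auto
  have vy: "0 \<le> v" "0 \<le> y" "0 < w"
  proof -
    consider i :: nat where "Z = - (p ^ i)" | i :: int where "Z = t * p powi i" using good by blast
    then show "0 \<le> v"
    proof cases
      case 1
      then have "p ^ Suc k / t * Z < 0" using pp P(1) by (simp add: divide_neg_pos mult_pos_neg)
      then show ?thesis unfolding v_def using qpoch_inf_pos[OF pp] by (simp add: less_imp_le)
    next
      case 2
      have "p powi (int (Suc k) + i) = p powi int (Suc k) * p powi i" using pp by (intro power_int_add) simp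
      then have "p ^ Suc k / t * Z = p powi (int (Suc k) + i)" unfolding 2 using P(1) by (simp only: power_int_of_nat) simp
      then show ?thesis unfolding v_def using qpoch_inf_powi_nonneg[OF pp] by simp
    qed
    consider i :: nat where "Z = - (p ^ i)" | "0 < Z" using good P(1) pp by auto
    then have "0 \<le> y \<and> 0 < w"
    proof cases
      case 1
      have "p powi (int (Suc i) + - (r - int k)) = p powi int (Suc i) * p powi (- (r - int k))" using pp by (intro power_int_add) simp
      then have "- Z * p * (p ^ k * \<rho>) = p powi (int (Suc i) + - (r - int k))" unfolding 1 pk power_int_of_nat by simp
      moreover have "- Z * p < 1" using power_Suc_less_one[OF pp, of i] unfolding 1 by (simp add: mult.commute)
      ultimately show ?thesis unfolding y_def w_def using qpoch_inf_powi_nonneg[OF pp] qpoch_inf_pos[OF pp] by simp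
    next
      case 2
      then have "- Z * p < 0" "- Z * p * (p ^ k * \<rho>) < 0" using pp P(3) by (simp_all add: mult_pos_pos)
      then show ?thesis unfolding y_def w_def using qpoch_inf_pos[OF pp] by (simp add: less_imp_le)
    qed
    then show "0 \<le> y" "0 < w" by simp_all
  qed
  have N: "0 \<le> N"
  proof -
    have "- th * \<rho> * p * p ^ k < 1" using P(2,3) pp by (simp add: mult_pos_pos order.strict_trans[of _ 0])
    then show ?thesis unfolding N_def using D pp power_Suc_less_one[OF pp, of k]
      by (intro divide_nonneg_nonneg mult_nonneg_nonneg qpoch_sq_nonneg less_imp_le[OF qpoch_inf_pos[OF pp]]) auto
  qed
  have W: "Z = l * (z * q ^ (2 * k)) * q powi (2 * (r - int k)) * q powr (- 2 * \<tau>)"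
    unfolding Z by (rule lattice_shift[OF q(1)])
  have good': "0 < Z \<or> (\<exists>i::nat. Z = - (p ^ i))" using good P(1) pp by auto
  have nm: "int n = int m + (r - int k)" using nk by simp
  have a2: "Z * p * (p ^ k * \<rho>) / (t * \<rho>) = p ^ Suc k / t * Z" using P(1,3) by simp
  have ci: "of_real (sqrt y) * c_inf q \<tau> (z * q ^ (2 * k)) l (r - int k) m
    = (of_real (sgn l) * \<i>) ^ m * of_real ((- 1) powi (r - int k)
        * sqrt (bqL_norm m n (r - int k) (t * \<rho>) p * (\<bar>Z\<bar> * w * v)) * bqL_num n (p ^ k * \<rho>) (- (t * \<rho>)) (- Z * p * (p ^ k * \<rho>)) p)"
    using c_inf_eq_bqL_num[OF q l p W P(9)[symmetric] good' nm] unfolding pk a2 y_def[symmetric] w_def[symmetric] v_def[symmetric] .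
  have u0: "u \<noteq> 0" using u by auto
  have z0: "z \<noteq> 0" using Z0 Z by auto
  have cf: "c_fin q \<sigma> \<tau> u \<xi> k z = cdqH_fun k u (of_real (th * g)) (of_real (- p * \<rho> / g)) (of_real (g * Z)) (of_real p)"
  proof -
    have c: "of_real (z * q powr (1 + \<sigma> - \<tau>) / \<xi>) = (of_real (g * Z) :: complex)" unfolding Z P(7) ..
    have gz: "(of_real (g * Z) :: complex) \<noteq> 0" using P(4) Z0 by simp
    have \<xi>0: "\<xi> \<noteq> 0" using \<xi> q by auto
    show ?thesis
    \<comment> \<open>The order of the first two parameters depends on \<open>l\<close>; the
      symmetry of the dual q-Hahn function makes it irrelevant.\<close>
    proof (rule disjE[OF P(8)])
      assume a: "th * g = - \<xi> * q powr (1 - \<sigma> + \<tau>) \<and> - p * \<rho> / g = \<xi> * q powr (1 - \<sigma> - \<tau>)"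
      show ?thesis unfolding c_fin_def c p[symmetric] unfolding a[THEN conjunct1, symmetric] a[THEN conjunct2, symmetric] ..
    next
      assume a: "th * g = \<xi> * q powr (1 - \<sigma> - \<tau>) \<and> - p * \<rho> / g = - \<xi> * q powr (1 - \<sigma> + \<tau>)"
      have "c_fin q \<sigma> \<tau> u \<xi> k z = cdqH_fun k u (of_real (- p * \<rho> / g)) (of_real (th * g)) (of_real (g * Z)) (of_real p)"
        unfolding c_fin_def c p[symmetric] unfolding a[THEN conjunct1, symmetric] a[THEN conjunct2, symmetric] ..
      also have "\<dots> = cdqH_fun k u (of_real (th * g)) (of_real (- p * \<rho> / g)) (of_real (g * Z)) (of_real p)"
      proof (rule cdqH_fun_commute[OF _ _ _ _ u0 gz])
        show "norm (of_real p :: complex) < 1" "(of_real p :: complex) \<noteq> 0" using pp by auto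
        show "(of_real (- p * \<rho> / g) :: complex) \<noteq> 0" "(of_real (th * g) :: complex) \<noteq> 0" using pp P(2,3,4) by auto
      qed
      finally show ?thesis .
    qed
  qed
  have ee: "th * g * (- p * \<rho> / g) * p ^ k = - th * \<rho> * p * p ^ k" "- p * \<rho> / g * (g * Z) * p ^ k = - Z * p * (p ^ k * \<rho>)"
    "th * g * (g * Z) * p ^ k = p ^ Suc k / t * Z"
  proof -
    show "th * g * (- p * \<rho> / g) * p ^ k = - th * \<rho> * p * p ^ k" "- p * \<rho> / g * (g * Z) * p ^ k = - Z * p * (p ^ k * \<rho>)"
      using P(4) by simp_all
    have "th * g * (g * Z) * p ^ k = (t * th * g ^ 2) * p ^ k / t * Z" using P(1) by (simp add: power2_eq_square)
    then show "th * g * (g * Z) * p ^ k = p ^ Suc k / t * Z" unfolding P(5) by simp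
  qed
  have rad: "D * (F * de * v * y) / (sd * se * sc) = D * (F * de) / (sd * se) * (v * y / sc)" for F de sd se sc by simp
  have "0 \<le> D * (qpoch_inf (p ^ Suc k) p * qpoch_inf (th * g * (- p * \<rho> / g) * p ^ k) p * qpoch_inf (th * g * (g * Z) * p ^ k) p
      * qpoch_inf (- p * \<rho> / g * (g * Z) * p ^ k) p) / (qpoch_sq u p (th * g) * qpoch_sq u p (- p * \<rho> / g) * qpoch_sq u p (g * Z))"
    unfolding ee v_def[symmetric] y_def[symmetric] rad N_def[symmetric] using N vy
    by (intro mult_nonneg_nonneg divide_nonneg_nonneg qpoch_sq_nonneg) auto
  from cdqH_fun_real[OF pp u D(1) this]
  have cf': "c_fin q \<sigma> \<tau> u \<xi> k z = of_real (sqrt (N * (v * y / qpoch_sq u p (g * Z))))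
      * cdqH_poly k u (of_real (th * g)) (of_real (- p * \<rho> / g)) (of_real (g * Z)) (of_real p)"
    unfolding cf ee v_def[symmetric] y_def[symmetric] rad N_def[symmetric] .
  \<comment> \<open>The root of \<open>y\<close> is passed on to \<open>c_inf\<close>, as
    \<open>c_inf_eq_bqL_num\<close> demands. The factor \<open>v\<close> occurs under the roots of
    both coefficients and hence appears without a root in the product.\<close>
  have s1: "sqrt (N * (v * y / S)) = sqrt (N * (v / S)) * sqrt y" for S by (simp flip: real_sqrt_mult)
  have s2: "sqrt (N * (v / S)) * sqrt (b * (aZ * w * v)) = sqrt (N * b) * sqrt (aZ * w / S) * v" for S b aZ
  proof -
    have "N * (v / S) * (b * (aZ * w * v)) = N * b * (aZ * w / S) * (v * v)" by simp
    then have "sqrt (N * (v / S)) * sqrt (b * (aZ * w * v)) = sqrt (N * b * (aZ * w / S) * (v * v))" by (simp only: real_sqrt_mult[symmetric])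
    moreover have "sqrt (A * B * (v * v)) = sqrt A * sqrt B * v" for A B
      using vy(1) by (simp only: real_sqrt_mult real_sqrt_mult_self abs_of_nonneg)
    ultimately show ?thesis by (simp only:)
  qed
  have G: "of_real (a * sy) * Pk * ci = ph * of_real (s * (a * b * L)) * Pk" if "of_real sy * ci = ph * of_real (s * b * L)"
    for a sy s b L :: real and Pk ci ph :: complex
  proof -
    have "of_real (a * sy) * Pk * ci = of_real a * Pk * (of_real sy * ci)" by (simp only: of_real_mult mult_ac)
    then show ?thesis unfolding that by (simp only: of_real_mult mult_ac)
  qed
  show ?thesis
    unfolding cf' s1 v_def[symmetric] w_def[symmetric] N_def[symmetric] s2[symmetric] by (rule G[OF ci])
qed

subsection \<open>Determination by moments\<close>

text \<open>A three-term recurrence trades multiplication by \<open>Y\<close> for a change of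
  \<open>n\<close>. So orthogonality to all \<open>G n\<close> passes to \<open>Y ^ i * G n\<close>
  by induction on \<open>i\<close>, for all \<open>n\<close> at once; no formula for the connection
  coefficients is needed.\<close>

lemma has_sum_recurrence_moments:
  fixes h :: "'a \<Rightarrow> complex" and G :: "nat \<Rightarrow> 'a \<Rightarrow> complex" and Y :: "'a \<Rightarrow> complex"
  assumes h: "\<And>n. ((\<lambda>z. h z * G n z) has_sum 0) A" and G0: "\<And>z. G 0 z = 1"
    and rec: "\<And>n z. Y z * G n z = a n * G (Suc n) z + b n * G n z + c n * G (n - 1) z"
  shows "((\<lambda>z. h z * Y z ^ i) has_sum 0) A"
proof -
  have "((\<lambda>z. h z * (Y z ^ i * G n z)) has_sum 0) A" for n
  proof (induction i arbitrary: n)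
    case 0
    then show ?case using h by simp
  next
    case (Suc i)
    have "((\<lambda>z. a n * (h z * (Y z ^ i * G (Suc n) z)) + b n * (h z * (Y z ^ i * G n z)) + c n * (h z * (Y z ^ i * G (n - 1) z)))
        has_sum (a n * 0 + b n * 0 + c n * 0)) A"
      by (intro has_sum_add has_sum_cmult_right Suc)
    moreover have "a n * (h z * (Y z ^ i * G (Suc n) z)) + b n * (h z * (Y z ^ i * G n z)) + c n * (h z * (Y z ^ i * G (n - 1) z))
        = h z * (Y z ^ Suc i * G n z)" for z
    proof -
      have g: "a * (h * (y * g1)) + b * (h * (y * g0)) + c * (h * (y * g2)) = h * (y * (a * g1 + b * g0 + c * g2))" for a h y g1 b g0 c g2 :: complex
        by (simp add: algebra_simps)
      show ?thesis unfolding g rec[symmetric] by simp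
    qed
    ultimately show ?case by simp
  qed
  from this[of 0] show ?thesis by (simp add: G0)
qed

text \<open>The powers of \<open>1 - (y - y\<^sub>0)\<^sup>2 / 4M\<^sup>2\<close> are 1 at the isolated point \<open>y\<^sub>0\<close> and tend to 0
  uniformly on the rest of the support.\<close>

lemma moments_determine_coefficient:
  fixes h :: "'a \<Rightarrow> complex" and Y :: "'a \<Rightarrow> real"
  assumes mom: "\<And>i. ((\<lambda>z. h z * of_real (Y z) ^ i) has_sum 0) A"
    and M: "\<And>z. z \<in> A \<Longrightarrow> h z \<noteq> 0 \<Longrightarrow> \<bar>Y z\<bar> \<le> M" and z0: "z0 \<in> A"
    and \<delta>: "0 < \<delta>" "\<And>z. z \<in> A \<Longrightarrow> z \<noteq> z0 \<Longrightarrow> h z \<noteq> 0 \<Longrightarrow> \<delta> \<le> \<bar>Y z - Y z0\<bar>"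
  shows "h z0 = 0"
proof (rule ccontr)
  assume hz: "h z0 \<noteq> 0"
  \<comment> \<open>The summands beyond \<open>4 * M\<^sup>2\<close> make \<open>K\<close> positive
    and at least \<open>\<delta>\<^sup>2\<close>, so that \<open>c\<close> lies between 0 and 1
    without a case distinction.\<close>
  define K where "K = 4 * M\<^sup>2 + \<delta>\<^sup>2 + 1"
  define B where "B y = 1 - (y - Y z0)\<^sup>2 / K" for y
  define c where "c = 1 - \<delta>\<^sup>2 / K"
  have K: "0 < K" "4 * M\<^sup>2 \<le> K" "\<delta>\<^sup>2 \<le> K"
    unfolding K_def using zero_le_power2[of M] zero_le_power2[of \<delta>] by linarith+
  have S: "((\<lambda>z. h z * of_real (B (Y z) ^ N) * of_real (Y z) ^ i) has_sum 0) A" for N i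
  proof (induction N arbitrary: i)
    case 0
    then show ?case using mom by simp
  next
    case (Suc N)
    let ?f = "\<lambda>i z. h z * of_real (B (Y z) ^ N) * of_real (Y z) ^ i"
    have "((\<lambda>z. of_real (1 - (Y z0)\<^sup>2 / K) * ?f i z + of_real (2 * Y z0 / K) * ?f (Suc i) z + of_real (- 1 / K) * ?f (Suc (Suc i)) z)
        has_sum (of_real (1 - (Y z0)\<^sup>2 / K) * 0 + of_real (2 * Y z0 / K) * 0 + of_real (- 1 / K) * 0)) A"
      by (intro has_sum_add has_sum_cmult_right Suc)
    moreover have "of_real (1 - (Y z0)\<^sup>2 / K) * ?f i z + of_real (2 * Y z0 / K) * ?f (Suc i) z + of_real (- 1 / K) * ?f (Suc (Suc i)) z
        = h z * of_real (B (Y z) ^ Suc N) * of_real (Y z) ^ i" for z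
    proof -
      have "B (Y z) = (1 - (Y z0)\<^sup>2 / K) + 2 * Y z0 / K * Y z + (- 1 / K) * Y z * Y z"
        unfolding B_def using K by (simp add: field_simps power2_eq_square)
      then have e: "complex_of_real (B (Y z)) = of_real (1 - (Y z0)\<^sup>2 / K) + of_real (2 * Y z0 / K) * of_real (Y z) + of_real (- 1 / K) * of_real (Y z) * of_real (Y z)"
        by (simp only: of_real_add of_real_mult)
      have g: "a * (x * y) + b * (x * (w * y)) + c * (x * (w * (w * y))) = x * (a + b * w + c * w * w) * y" for a b c x y w :: complex
        by (simp add: algebra_simps)
      show ?thesis unfolding power_Suc[of "B (Y z)"] power_Suc[of "complex_of_real (Y z)"] of_real_mult[of "B (Y z)"] g e[symmetric]
        by (simp only: mult_ac)
    qed
    ultimately show ?case by simp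
  qed
  have hs: "(\<lambda>z. norm (h z)) summable_on A"
    using has_sum_imp_summable[OF mom[of 0]] by (simp add: summable_on_iff_abs_summable_on_complex)
  have Bb: "\<bar>B (Y z)\<bar> \<le> c" if z: "z \<in> A" "z \<noteq> z0" "h z \<noteq> 0" for z
  proof -
    have "\<bar>Y z - Y z0\<bar> \<le> 2 * M" using M[OF z(1,3)] M[OF z0 hz] by linarith
    then have "(Y z - Y z0)\<^sup>2 \<le> (2 * M)\<^sup>2" using abs_le_square_iff[of "Y z - Y z0" "2 * M"] by linarith
    then have "(Y z - Y z0)\<^sup>2 \<le> K" using K(2) by (simp add: power_mult_distrib)
    then have "(Y z - Y z0)\<^sup>2 / K \<le> 1" using K by simp
    moreover have "\<delta>\<^sup>2 \<le> (Y z - Y z0)\<^sup>2" using \<delta>(2)[OF z] \<delta>(1) abs_le_square_iff[of \<delta> "Y z - Y z0"] by linarith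
    then have "\<delta>\<^sup>2 / K \<le> (Y z - Y z0)\<^sup>2 / K" using K by (simp add: divide_right_mono)
    ultimately show ?thesis unfolding B_def c_def by linarith
  qed
  have c: "0 \<le> c" "c < 1"
  proof -
    show "0 \<le> c" unfolding c_def using K by simp
    show "c < 1" unfolding c_def using K \<delta>(1) by simp
  qed
  define H where "H = (\<Sum>\<^sub>\<infinity>z\<in>A. norm (h z))"
  \<comment> \<open>The value at \<open>z0\<close> is minus the sum of the remaining terms, and
    these are dominated by \<open>c ^ N\<close> times an absolutely convergent series.\<close>
  have bound: "norm (h z0) \<le> c ^ N * H" for N
  proof -
    let ?f = "\<lambda>z. h z * of_real (B (Y z) ^ N)"
    have f0: "(?f has_sum 0) A" using S[of N 0] by simp
    have "((\<lambda>z. if z = z0 then - h z0 else 0) has_sum (- h z0)) A"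
      using has_sum_finite_neutralI[of "{z0}" A "\<lambda>z. if z = z0 then - h z0 else 0" "- h z0"] z0 by simp
    from has_sum_add[OF f0 this] have "((\<lambda>z. ?f z + (if z = z0 then - h z0 else 0)) has_sum (- h z0)) A" by simp
    moreover have nb: "norm (?f z + (if z = z0 then - h z0 else 0)) \<le> c ^ N * norm (h z)" if "z \<in> A" for z
    proof (cases "z = z0 \<or> h z = 0")
      case True
      then show ?thesis using c by (auto simp: B_def)
    next
      case False
      then have "\<bar>B (Y z)\<bar> ^ N \<le> c ^ N" using Bb that by (intro power_mono) auto
      then have "norm (h z) * \<bar>B (Y z)\<bar> ^ N \<le> norm (h z) * c ^ N" by (rule mult_left_mono) simp
      then show ?thesis using False by (simp add: norm_mult norm_power mult.commute)
    qed
    moreover have "((\<lambda>z. c ^ N * norm (h z)) has_sum (c ^ N * H)) A"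
      unfolding H_def by (intro has_sum_cmult_right has_sum_infsum hs)
    ultimately have F: "((\<lambda>z. ?f z + (if z = z0 then - h z0 else 0)) has_sum (- h z0)) A"
      and nb: "\<And>z. z \<in> A \<Longrightarrow> norm (?f z + (if z = z0 then - h z0 else 0)) \<le> c ^ N * norm (h z)"
      and cH: "((\<lambda>z. c ^ N * norm (h z)) has_sum (c ^ N * H)) A" by blast+
    have "(\<lambda>z. norm (?f z + (if z = z0 then - h z0 else 0))) summable_on A"
      using has_sum_imp_summable[OF F] by (rule summable_on_iff_abs_summable_on_complex[THEN iffD1])
    note ns = has_sum_infsum[OF this]
    have "norm (- h z0) \<le> c ^ N * H"
      by (rule order.trans[OF norm_has_sum_bound[OF ns F] has_sum_mono[OF ns cH nb]])
    then show ?thesis by simp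
  qed
  have "(\<lambda>N. c ^ N * H) \<longlonglongrightarrow> 0 * H" using c by (intro tendsto_mult LIMSEQ_power_zero tendsto_const) auto
  then have "norm (h z0) \<le> 0 * H" by (rule LIMSEQ_le_const) (use bound in blast)
  then show False using hz by simp
qed

text \<open>Suppose all degrees from \<open>N + 1\<close> on vanish at \<open>c\<close>. Then
  \<open>cdqH_raise\<close> makes them vanish at \<open>c * q\<close>, and \<open>cdqH_diff\<close>
  adds degree \<open>N\<close> to the list. Descending in this way reaches degree 0, where the
  polynomial is 1.\<close>

lemma cdqH_poly_nonvanishing:
  assumes q: "norm q < 1" "q \<noteq> 0" and a: "a \<noteq> 0" and u: "u \<noteq> 0" and c: "c \<noteq> 0"
    and ab: "\<And>n. a * b * q ^ n \<noteq> q" and cu: "\<And>s. c * u * q ^ s \<noteq> 1" "\<And>s. c / u * q ^ s \<noteq> 1"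
  shows "\<exists>n\<ge>N. cdqH_poly n u a b c q \<noteq> 0"
  using c cu
proof (induction N arbitrary: c)
  case 0
  show ?case by (intro exI[of _ 0]) simp
next
  case (Suc N)
  show ?case
  proof (rule ccontr)
    assume "\<not> ?thesis"
    then have z: "cdqH_poly n u a b c q = 0" if "Suc N \<le> n" for n using that by blast
    have cu1: "(1 - c * u) * (1 - c / u) \<noteq> 0" using Suc.prems(2)[of 0] Suc.prems(3)[of 0] by simp
    have z2: "cdqH_poly n u a b (c * q) q = 0" if "Suc N \<le> n" for n
    proof -
      have "(1 - c * u) * (1 - c / u) * cdqH_poly n u a b (c * q) q = 0"
        using cdqH_raise[OF q a u, of c n b] z[OF that] z[of "Suc n"] that by simp
      then show ?thesis using cu1 by (simp only: mult_eq_0_iff simp_thms)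
    qed
    have z3: "cdqH_poly n u a b (c * q) q = 0" if "N \<le> n" for n
    proof -
      have nz: "- c * (1 - q ^ Suc n) * (1 - a * b * q ^ Suc n / q) \<noteq> 0"
      proof -
        have "q ^ Suc n \<noteq> 1" using q_power_neq_1[OF q(1), of n] by simp
        moreover have "a * b * q ^ Suc n / q \<noteq> 1" using ab[of "Suc n"] q(2) by simp
        ultimately show ?thesis using Suc.prems(1) by simp
      qed
      have "- c * (1 - q ^ Suc n) * (1 - a * b * q ^ Suc n / q) * cdqH_poly n u a b (c * q) q = 0"
        using cdqH_diff[OF q a, of "Suc n" u b c] z[of "Suc n"] z2[of "Suc n"] that by simp
      then show ?thesis using nz by (simp only: mult_eq_0_iff simp_thms)
    qed
    have "\<exists>n\<ge>N. cdqH_poly n u a b (c * q) q \<noteq> 0"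
    proof (rule Suc.IH)
      show "c * q \<noteq> 0" using Suc.prems(1) q by simp
      show "c * q * u * q ^ s \<noteq> 1" "c * q / u * q ^ s \<noteq> 1" for s
        using Suc.prems(2)[of "Suc s"] Suc.prems(3)[of "Suc s"] by (simp_all add: mult_ac)
    qed
    then show False using z3 by blast
  qed
qed

lemma qMeixner_eq_mphi:
  assumes "X \<noteq> 0" "Z \<noteq> 0" "u \<noteq> 0"
  shows "qMeixner X Z (- g * u) (- g / u) q = mphi q g u X Z"
proof -
  have m: "qpoch (- 1 / X) q i * X ^ i = mpsi i X q" if "X \<noteq> 0" for i X
  proof -
    have "qpoch (- 1 / X) q i * X ^ i = (\<Prod>l<i. (1 - (- 1 / X) * q ^ l) * X)"
      by (simp add: qpoch_def prod.distrib)
    also have "\<dots> = mpsi i X q" unfolding mpsi_def using that by (intro prod.cong refl) (simp add: field_simps)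
    finally show ?thesis .
  qed
  have ab: "- g * u * (- g / u) * X * Z = g ^ 2 * X * Z" using assms(3) by (simp add: power2_eq_square)
  have gg: "(g ^ 2) ^ n = g ^ (2 * n)" for n by (simp only: power_mult)
  show ?thesis
    unfolding qMeixner_def qhyp_def mphi_def mcoeff_def ab
    by (intro arg_cong[of _ _ suminf] ext)
      (simp add: m[OF assms(1), symmetric] m[OF assms(2), symmetric] power_mult_distrib gg mult_ac)
qed

text \<open>In the rescaled variable the lattice is the same for both choices of \<open>l\<close>;
  for \<open>l = - 1\<close> the map exchanges the negative and the positive branch.\<close>

lemma lattice_set_scaled:
  fixes q \<tau> l p t :: real
  assumes q: "0 < q" "q < 1" and l: "l \<in> {- 1, q powr (2 * \<tau>)}" and p: "p = q ^ 2"
    and t: "t = l ^ 2 * q powr (2 * of_int r - 2 * \<tau>)"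
  shows "(\<lambda>z. l * z * q powr (2 * of_int r - 2 * \<tau>)) ` lattice_set q \<tau> = range (\<lambda>i::int. - (p powi i)) \<union> range (\<lambda>i::int. t * p powi i)"
proof -
  let ?f = "\<lambda>z. l * z * q powr (2 * of_int r - 2 * \<tau>)"
  have pa: "q powr a * q powr b = q powr c" if "a + b = c" for a b c using that by (simp flip: powr_add)
  have pw: "p powi i = q powr (2 * of_int i)" for i unfolding p by (rule powi_eq_powr[OF q(1)])
  have qw: "q powi (2 * i) = q powr (2 * of_int i)" for i using power_int_mult[of q 2 i] pw[of i] unfolding p by simp
  have L: "lattice_set q \<tau> = range (\<lambda>i::int. - (q powr (2 * of_int i))) \<union> range (\<lambda>i::int. q powr (2 * \<tau> + 2 * of_int i))"
    unfolding lattice_set_def pos_lattice_def qw by auto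
  show ?thesis
  proof (cases "l = - 1")
    case True
    have 1: "?f ` range (\<lambda>i::int. - (q powr (2 * of_int i))) = range (\<lambda>i::int. t * p powi i)"
      unfolding image_image t True pw by (simp add: mult.commute)
    have "?f (q powr (2 * \<tau> + 2 * of_int i)) = - (p powi (i + r))" for i
      using pa[of "2 * \<tau> + 2 * of_int i" "2 * of_int r - 2 * \<tau>" "2 * of_int (i + r)"] unfolding True pw by simp
    then have "?f ` range (\<lambda>i::int. q powr (2 * \<tau> + 2 * of_int i)) = (\<lambda>i. - (p powi i)) ` range (\<lambda>i. i + r)"
      unfolding image_image by simp
    also have "range (\<lambda>i. i + r) = UNIV" by (rule surjI[of _ "\<lambda>i. i - r"]) simp
    finally show ?thesis unfolding L image_Un 1 by (simp add: Un_commute)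
  next
    case False
    then have ll: "l = q powr (2 * \<tau>)" using l by simp
    have lq: "l * q powr (2 * of_int r - 2 * \<tau>) = q powr (2 * of_int r)" unfolding ll by (rule pa) simp
    have e: "?f z = z * q powr (2 * of_int r)" for z unfolding lq[symmetric] by (simp only: mult_ac)
    have tt: "t = q powr (2 * \<tau>) * q powr (2 * of_int r)" unfolding t power2_eq_square mult.assoc lq unfolding ll ..
    have "?f (- (q powr (2 * of_int i))) = - (p powi (i + r))" for i
      using pa[of "2 * of_int i" "2 * of_int r" "2 * of_int (i + r)"] unfolding e pw by simp
    then have "?f ` range (\<lambda>i::int. - (q powr (2 * of_int i))) = (\<lambda>i. - (p powi i)) ` range (\<lambda>i. i + r)"
      unfolding image_image by simp
    also have "range (\<lambda>i. i + r) = UNIV" by (rule surjI[of _ "\<lambda>i. i - r"]) simp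
    finally have 1: "?f ` range (\<lambda>i::int. - (q powr (2 * of_int i))) = range (\<lambda>i. - (p powi i))" .
    have "?f (q powr (2 * \<tau> + 2 * of_int i)) = t * p powi i" for i :: int
      unfolding e tt pw powr_add by (simp only: mult_ac)
    then have 2: "?f ` range (\<lambda>i::int. q powr (2 * \<tau> + 2 * of_int i)) = range (\<lambda>i. t * p powi i)"
      unfolding image_image by simp
    show ?thesis unfolding L image_Un 1 2 ..
  qed
qed

subsection \<open>The coupling coefficients\<close>

text \<open>Comparing moduli, an equality would force \<open>u = 1\<close> or \<open>u = - 1\<close>
  and a power of \<open>q\<close> with exponent 0. The exponent condition says that
  \<open>\<tau> - \<sigma>\<close> or \<open>\<tau> + \<sigma>\<close>, respectively, is an odd
  integer, which the hypotheses exclude.\<close>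

lemma coupling_nonresonant:
  fixes q \<tau> \<sigma> l \<xi> p g t :: real and u :: complex
  assumes q: "0 < q" "q < 1" and l: "l \<in> {- 1, q powr (2 * \<tau>)}" and \<xi>: "\<xi> \<in> {- 1, q powr (2 * \<sigma>)}"
    and p: "p = q ^ 2" and g: "g = q powr (1 + \<sigma> + \<tau> - 2 * of_int r) / (l * \<xi>)"
    and t: "t = l ^ 2 * q powr (2 * of_int r - 2 * \<tau>)"
    and u: "cmod u = 1" and u_p1: "u = 1 \<Longrightarrow> \<forall>j::int. \<tau> - \<sigma> \<noteq> 2 * of_int j + 1"
    and u_m1: "u = -1 \<Longrightarrow> \<forall>j::int. \<tau> + \<sigma> \<noteq> 2 * of_int j + 1"
  shows "of_real (g * p powi i) * u \<noteq> - 1" "of_real (g * p powi i) / u \<noteq> - 1"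
    and "of_real (t * g * p powi i) * u \<noteq> 1" "of_real (t * g * p powi i) / u \<noteq> 1"
proof -
  have pa: "q powr a * q powr b = q powr (a + b)" for a b by (simp flip: powr_add)
  have pw: "p powi i = q powr (2 * of_int i)" for i unfolding p by (rule powi_eq_powr[OF q(1)])
  \<comment> \<open>Sign and exponent of \<open>l\<close> are separated, and likewise for
    \<open>\<xi>\<close> below, so that the four combinations are treated by linear arithmetic in
    the exponents.\<close>
  obtain \<epsilon>1 L where L: "(\<epsilon>1 = - 1 \<and> L = 0) \<or> (\<epsilon>1 = 1 \<and> L = 2 * \<tau>)" "l = \<epsilon>1 * q powr L"
  proof (cases "l = - 1")
    case True
    then show ?thesis using q that[of "- 1" 0] by simp
  next
    case False
    then show ?thesis using l that[of 1 "2 * \<tau>"] by simp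
  qed
  obtain \<epsilon>2 X where X: "(\<epsilon>2 = - 1 \<and> X = 0) \<or> (\<epsilon>2 = 1 \<and> X = 2 * \<sigma>)" "\<xi> = \<epsilon>2 * q powr X"
  proof (cases "\<xi> = - 1")
    case True
    then show ?thesis using q that[of "- 1" 0] by simp
  next
    case False
    then show ?thesis using \<xi> that[of 1 "2 * \<sigma>"] by simp
  qed
  have \<epsilon>: "\<epsilon>1 * \<epsilon>1 = 1" "\<epsilon>2 * \<epsilon>2 = 1" using L(1) X(1) by auto
  have gi: "g * p powi i = \<epsilon>1 * \<epsilon>2 * q powr (1 + \<sigma> + \<tau> - 2 * of_int r + 2 * of_int i - L - X)"
  proof -
    have "g = \<epsilon>1 * \<epsilon>2 * (q powr (1 + \<sigma> + \<tau> - 2 * of_int r) / (q powr L * q powr X))"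
    proof -
      have "b / (e1 * x * (e2 * y)) = e1 * e2 * (b / (x * y))" if "e1 * e1 = 1" "e2 * e2 = 1" for b e1 e2 x y :: real
      proof -
        have "inverse e1 = e1" "inverse e2 = e2" using that by (auto intro: inverse_unique)
        then show ?thesis by (simp add: divide_inverse mult_ac)
      qed
      from this[OF \<epsilon>] show ?thesis unfolding g L(2) X(2) .
    qed
    then show ?thesis unfolding pw by (simp add: powr_add powr_diff)
  qed
  have ti: "t * g * p powi i = \<epsilon>1 * \<epsilon>2 * q powr (1 + \<sigma> - \<tau> + 2 * of_int i + L - X)"
  proof -
    have "t = q powr (2 * L + 2 * of_int r - 2 * \<tau>)"
    proof -
      have "l ^ 2 = q powr L * q powr L" unfolding L(2) using \<epsilon>(1) by (simp add: power_mult_distrib power2_eq_square)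
      then show ?thesis unfolding t by (simp add: pa add_diff_eq)
    qed
    then have "t * (g * p powi i) = \<epsilon>1 * \<epsilon>2 * (q powr (2 * L + 2 * of_int r - 2 * \<tau>) * q powr (1 + \<sigma> + \<tau> - 2 * of_int r + 2 * of_int i - L - X))"
      unfolding gi by simp
    also have "q powr (2 * L + 2 * of_int r - 2 * \<tau>) * q powr (1 + \<sigma> + \<tau> - 2 * of_int r + 2 * of_int i - L - X)
        = q powr (1 + \<sigma> - \<tau> + 2 * of_int i + L - X)" unfolding pa by (rule arg_cong[of _ _ "(powr) q"]) simp
    finally show ?thesis by (simp only: mult.assoc)
  qed
  have one: "x = 0 \<and> e = s" if "e * q powr x = s" "e = 1 \<or> e = - 1" "s = 1 \<or> s = - 1" for e x s :: real
  proof -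
    have g: "y = 1 \<and> e = s" if "e * y = s" "e = 1 \<or> e = - 1" "s = 1 \<or> s = - 1" "0 < y" for e y s :: real
      using that by auto
    have "0 < q powr x" using q by simp
    from g[OF that this] show ?thesis using q by simp
  qed
  have e12: "\<epsilon>1 * \<epsilon>2 = 1 \<or> \<epsilon>1 * \<epsilon>2 = - 1" using L(1) X(1) by auto
  have G1: "g * p powi i \<noteq> - 1" if "u = 1"
  proof
    assume "g * p powi i = - 1"
    from one[OF this[unfolded gi] e12] have x: "1 + \<sigma> + \<tau> - 2 * of_int r + 2 * of_int i - L - X = 0" "\<epsilon>1 * \<epsilon>2 = - 1" by auto
    then consider "L = 0" "X = 2 * \<sigma>" | "L = 2 * \<tau>" "X = 0" using L(1) X(1) by auto
    then show False
    proof cases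
      case 1
      then have "\<tau> - \<sigma> = 2 * of_int (r - i - 1) + 1" using x by simp
      then show False using u_p1[OF that] by blast
    next
      case 2
      then have "\<tau> - \<sigma> = 2 * of_int (i - r) + 1" using x by simp
      then show False using u_p1[OF that] by blast
    qed
  qed
  have G2: "g * p powi i \<noteq> 1" if "u = - 1"
  proof
    assume "g * p powi i = 1"
    from one[OF this[unfolded gi] e12] have x: "1 + \<sigma> + \<tau> - 2 * of_int r + 2 * of_int i - L - X = 0" "\<epsilon>1 * \<epsilon>2 = 1" by auto
    then consider "L = 0" "X = 0" | "L = 2 * \<tau>" "X = 2 * \<sigma>" using L(1) X(1) by auto
    then show False
    proof cases
      case 1
      then have "\<tau> + \<sigma> = 2 * of_int (r - i - 1) + 1" using x by simp
      then show False using u_m1[OF that] by blast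
    next
      case 2
      then have "\<tau> + \<sigma> = 2 * of_int (i - r) + 1" using x by simp
      then show False using u_m1[OF that] by blast
    qed
  qed
  have T1: "t * g * p powi i \<noteq> 1" if "u = 1"
  proof
    assume "t * g * p powi i = 1"
    from one[OF this[unfolded ti] e12] have x: "1 + \<sigma> - \<tau> + 2 * of_int i + L - X = 0" "\<epsilon>1 * \<epsilon>2 = 1" by auto
    then consider "L = 0" "X = 0" | "L = 2 * \<tau>" "X = 2 * \<sigma>" using L(1) X(1) by auto
    then show False
    proof cases
      case 1
      then have "\<tau> - \<sigma> = 2 * of_int i + 1" using x by simp
      then show False using u_p1[OF that] by blast
    next
      case 2
      then have "\<tau> - \<sigma> = 2 * of_int (- i - 1) + 1" using x by simp
      then show False using u_p1[OF that] by blast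
    qed
  qed
  have T2: "t * g * p powi i \<noteq> - 1" if "u = - 1"
  proof
    assume "t * g * p powi i = - 1"
    from one[OF this[unfolded ti] e12] have x: "1 + \<sigma> - \<tau> + 2 * of_int i + L - X = 0" "\<epsilon>1 * \<epsilon>2 = - 1" by auto
    then consider "L = 0" "X = 2 * \<sigma>" | "L = 2 * \<tau>" "X = 0" using L(1) X(1) by auto
    then show False
    proof cases
      case 1
      then have "\<tau> + \<sigma> = 2 * of_int i + 1" using x by simp
      then show False using u_m1[OF that] by blast
    next
      case 2
      then have "\<tau> + \<sigma> = 2 * of_int (- i - 1) + 1" using x by simp
      then show False using u_m1[OF that] by blast
    qed
  qed
  have u0: "u \<noteq> 0" using u by auto
  have m: "(c = 1 \<and> u = s) \<or> (c = - 1 \<and> u = - s)" if "of_real c * u = s" "cmod s = 1" for c s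
  proof -
    have "\<bar>c\<bar> * cmod u = cmod s" using that(1) by (metis norm_mult norm_of_real real_norm_def)
    then have "\<bar>c\<bar> = 1" using u that(2) by simp
    then have "c = 1 \<or> c = - 1" by linarith
    then show ?thesis
    proof
      assume "c = 1"
      then show ?thesis using that(1) by simp
    next
      assume "c = - 1"
      then have "- u = s" using that(1) by simp
      then show ?thesis using \<open>c = - 1\<close> by auto
    qed
  qed
  have d: "(c = 1 \<and> u = s) \<or> (c = - 1 \<and> u = - s)" if "of_real c / u = s" "s * s = 1" "cmod s = 1" for c s
  proof -
    have e: "of_real c = s * u" using that(1) u0 by auto
    have "\<bar>c\<bar> = cmod (s * u)" using e by (metis norm_of_real real_norm_def)
    then have "c = 1 \<or> c = - 1" using u that(3) by (simp add: norm_mult) linarith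
    moreover have "u = s * of_real c" using e that(2) by (metis mult.assoc mult_1)
    ultimately show ?thesis by auto
  qed
  show "of_real (g * p powi i) * u \<noteq> - 1"
  proof
    assume "of_real (g * p powi i) * u = - 1"
    then show False using m[of "g * p powi i" "- 1"] G1 G2 by auto
  qed
  show "of_real (g * p powi i) / u \<noteq> - 1"
  proof
    assume "of_real (g * p powi i) / u = - 1"
    then show False using d[of "g * p powi i" "- 1"] G1 G2 by auto
  qed
  show "of_real (t * g * p powi i) * u \<noteq> 1"
  proof
    assume "of_real (t * g * p powi i) * u = 1"
    then show False using m[of "t * g * p powi i" 1] T1 T2 by auto
  qed
  show "of_real (t * g * p powi i) / u \<noteq> 1"
  proof
    assume "of_real (t * g * p powi i) / u = 1"
    then show False using d[of "t * g * p powi i" 1] T1 T2 by auto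
  qed
qed

text \<open>The squared form of the statement that the normalisations on the two sides differ by
  \<open>kap\<close> and the q-Meixner constants. The infinite and finite products cancel in pairs;
  theta at \<open>t * \<rho>\<close> and \<open>th * \<rho>\<close> is brought back to
  \<open>t\<close> and \<open>th\<close> by quasi-periodicity with the same power of
  \<open>p\<close>. The rest is an identity between powers.\<close>

lemma coupling_constants:
  fixes p t th g \<rho> D :: real and r :: int
  assumes p: "0 < p" "p < 1" and pos: "0 < t" "0 < th" and g: "g \<noteq> 0" "t * th * g ^ 2 = p"
    and \<rho>: "\<rho> = p powi (- r)" and nk: "int n + int k = int m + r"
    and Kt: "Kt = qpoch_inf p p * qtheta (- t) p / (qpoch_sq u p (- g) * qpoch_sq u p (t * g))"
    and Kth: "Kth = qpoch_inf p p * qtheta (- th) p / (qpoch_sq u p (- g) * qpoch_sq u p (th * g))"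
    and AG: "AG = D * (qpoch_inf (p ^ Suc k) p * qpoch_inf (- th * \<rho> * p * p ^ k) p) / (qpoch_sq u p (th * g) * qpoch_sq u p (- p * \<rho> / g))
            * bqL_norm m n (r - int k) (t * \<rho>) p"
    and AF: "AF = D * (qpoch_inf (p ^ Suc n) p * qpoch_inf (- t * \<rho> * p * p ^ n) p) / (qpoch_sq u p (t * g) * qpoch_sq u p (- p * \<rho> / g))
            * bqL_norm m k (r - int n) (th * \<rho>) p"
    and \<kappa>: "\<kappa> = inverse (th * g) ^ k * inverse \<rho> ^ k * qpoch (- th * \<rho> * p) p k / p ^ (k * (k + 1) div 2)
      * ((\<rho> * t * g) ^ n * p ^ (n * (n + 1) div 2) / qpoch (- t * \<rho> * p) p n)"
  shows "AG * Kt * \<kappa>\<^sup>2 = AF * Kth"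
proof -
  have p': "norm p < 1" "p \<noteq> 0" using p by auto
  have \<rho>0: "0 < \<rho>" using p by (simp add: \<rho>)
  define Q T Th Tn Thk Qk Qn Fm th1 thh1 thT thTh where "Q = qpoch_inf p p" and "T = qpoch_inf (- t * \<rho> * p) p"
    and "Th = qpoch_inf (- th * \<rho> * p) p" and "Tn = qpoch (- t * \<rho> * p) p n" and "Thk = qpoch (- th * \<rho> * p) p k"
    and "Qk = qpoch p p k" and "Qn = qpoch p p n" and "Fm = qpoch_inf (p ^ Suc m) p" and "th1 = qtheta (- (t * \<rho>)) p"
    and "thh1 = qtheta (- (th * \<rho>)) p" and "thT = qtheta (- t) p" and "thTh = qtheta (- th) p"
  define P where "P = p powi (r * (r + 1) div 2)"
  have lt: "- t * \<rho> * p < 1" "- th * \<rho> * p < 1" using pos \<rho>0 p by (simp_all add: mult_pos_pos order.strict_trans[of _ 0])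
  have ps: "0 < Q" "0 < Tn" "0 < Thk" "0 < Qk" "0 < Qn" "0 < th1" "0 < thh1" "0 < thT" "0 < thTh" "0 < P" "0 < T" "0 < Th"
    unfolding Q_def Tn_def Thk_def Qk_def Qn_def th1_def thh1_def thT_def thTh_def P_def T_def Th_def
    using qpoch_inf_pos[OF p p(2)] qpoch_pos[OF p lt(1)] qpoch_pos[OF p lt(2)] qpoch_pos[OF p p(2)]
      qtheta_neg_pos[OF p mult_pos_pos[OF pos(1) \<rho>0]] qtheta_neg_pos[OF p mult_pos_pos[OF pos(2) \<rho>0]]
      qtheta_neg_pos[OF p pos(1)] qtheta_neg_pos[OF p pos(2)] qpoch_inf_pos[OF p lt(1)] qpoch_inf_pos[OF p lt(2)] p
    by auto
  have tt: "th1 * P = t powi r * thT" "thh1 * P = th powi r * thTh"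
    unfolding th1_def thh1_def thT_def thTh_def P_def \<rho> by (rule qtheta_neg_powi[OF p pos(1)], rule qtheta_neg_powi[OF p pos(2)])
  have sp: "qpoch_inf (p ^ Suc k) p = Q / Qk" "qpoch_inf (p ^ Suc n) p = Q / Qn"
    "qpoch_inf (- th * \<rho> * p * p ^ k) p = Th / Thk" "qpoch_inf (- t * \<rho> * p * p ^ n) p = T / Tn"
  proof -
    have dv: "c = a / b" if "a = b * c" "0 < b" for a b c :: real using that by simp
    show "qpoch_inf (p ^ Suc k) p = Q / Qk" "qpoch_inf (p ^ Suc n) p = Q / Qn"
      "qpoch_inf (- th * \<rho> * p * p ^ k) p = Th / Thk" "qpoch_inf (- t * \<rho> * p * p ^ n) p = T / Tn"
      unfolding Q_def Qk_def Qn_def Th_def Thk_def T_def Tn_def power_Suc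
      by (rule dv[OF qpoch_inf_split[OF p'(1)]], use ps in \<open>simp add: Qk_def Qn_def Thk_def Tn_def\<close>)+
  qed
  define E Eh where "E = p powi ((r - int k)\<^sup>2 - 2 * (r - int k))" and "Eh = p powi ((r - int n)\<^sup>2 - 2 * (r - int n))"
  define M where "M = p ^ (m * (m + 3) div 2)"
  have b1: "bqL_norm m n (r - int k) (t * \<rho>) p = Fm * T * Tn / (Q * Qn * th1) * (E / ((t * \<rho>) ^ m * M))"
    unfolding bqL_norm_def E_def M_def Fm_def T_def Tn_def Q_def Qn_def th1_def by simp
  have b2: "bqL_norm m k (r - int n) (th * \<rho>) p = Fm * Th * Thk / (Q * Qk * thh1) * (Eh / ((th * \<rho>) ^ m * M))"
    unfolding bqL_norm_def Eh_def M_def Fm_def Th_def Thk_def Q_def Qk_def thh1_def by simp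
  define \<kappa>a where "\<kappa>a = inverse (th * g) ^ k * inverse \<rho> ^ k / p ^ (k * (k + 1) div 2) * ((\<rho> * t * g) ^ n * p ^ (n * (n + 1) div 2))"
  have \<kappa>': "\<kappa> = \<kappa>a * Thk / Tn" unfolding \<kappa> \<kappa>a_def Thk_def Tn_def by simp
  \<comment> \<open>Here \<open>g\<close> is eliminated through \<open>t * th * g ^ 2 = p\<close>
    and \<open>\<rho>\<close> is a power of \<open>p\<close>, which leaves an identity between
    quadratic exponents of \<open>p\<close>.\<close>
  have key: "E * \<kappa>a\<^sup>2 * th ^ (n + k) = Eh * t ^ (n + k)"
  proof -
    define tri where "tri k = k * (k + 1) div 2" for k :: nat
    have tr: "p ^ (tri k) * p ^ (tri k) = p ^ (k * (k + 1))" for k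
    proof -
      have "2 * tri k = k * (k + 1)" unfolding tri_def by auto
      then have "tri k + tri k = k * (k + 1)" by (simp only: mult_2)
      then show ?thesis by (simp only: power_add[symmetric])
    qed
    have a: "\<kappa>a\<^sup>2 * th ^ (n + k) * (p ^ (k * (k + 1)) * \<rho> ^ (2 * k) * p ^ k) = t ^ (n + k) * (\<rho> ^ (2 * n) * p ^ n * p ^ (n * (n + 1)))"
    proof -
      have k2: "\<kappa>a * (th ^ k * g ^ k * \<rho> ^ k * p ^ tri k) = \<rho> ^ n * t ^ n * g ^ n * p ^ tri n"
      proof -
        have g0: "inverse A * inverse B * inverse C / P * (R * T * G * N) * (A * B * C * P) = R * T * G * N"
          if "A \<noteq> 0" "B \<noteq> 0" "C \<noteq> 0" "P \<noteq> 0" for A B C P R T G N :: real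
          using that by (simp add: field_simps)
        show ?thesis unfolding \<kappa>a_def tri_def power_mult_distrib inverse_mult_distrib power_inverse
          by (rule g0) (use pos g \<rho>0 p in auto)
      qed
      have pn: "t ^ i * th ^ i * (g ^ i * g ^ i) = p ^ i" for i
        unfolding g(2)[symmetric] by (simp add: power_mult_distrib power2_eq_square)
      have sq: "(\<kappa>a * \<kappa>a) * ((th ^ k * th ^ k) * (g ^ k * g ^ k) * (\<rho> ^ k * \<rho> ^ k) * (p ^ tri k * p ^ tri k))
          = (\<rho> ^ n * \<rho> ^ n) * (t ^ n * t ^ n) * (g ^ n * g ^ n) * (p ^ tri n * p ^ tri n)"
      proof -
        have "(a * (b * c * d * e)) * (a * (b * c * d * e)) = (a * a) * ((b * b) * (c * c) * (d * d) * (e * e))" for a b c d e :: real by (simp only: mult_ac)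
        from this[of \<kappa>a "th ^ k" "g ^ k" "\<rho> ^ k" "p ^ tri k"] show ?thesis unfolding k2 by (simp only: mult_ac)
      qed
      have "(\<kappa>a * \<kappa>a) * (th ^ n * th ^ k) * ((p ^ tri k * p ^ tri k) * (\<rho> ^ k * \<rho> ^ k) * (t ^ k * th ^ k * (g ^ k * g ^ k)))
        = ((\<kappa>a * \<kappa>a) * ((th ^ k * th ^ k) * (g ^ k * g ^ k) * (\<rho> ^ k * \<rho> ^ k) * (p ^ tri k * p ^ tri k))) * (th ^ n * t ^ k)"
        by (simp only: mult_ac)
      also have "\<dots> = (t ^ n * t ^ k) * ((\<rho> ^ n * \<rho> ^ n) * (t ^ n * th ^ n * (g ^ n * g ^ n)) * (p ^ tri n * p ^ tri n))"
        unfolding sq by (simp only: mult_ac)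
      finally show ?thesis unfolding pn tr unfolding power_add[symmetric] power2_eq_square mult_2 .
    qed
    have b: "E * (\<rho> ^ (2 * n) * p ^ n * p ^ (n * (n + 1))) = Eh * (p ^ (k * (k + 1)) * \<rho> ^ (2 * k) * p ^ k)"
    proof -
      have rp: "\<rho> ^ i = p powi (- r * int i)" for i unfolding \<rho> power_int_mult by simp
      have pp: "p ^ i = p powi int i" for i by simp
      have ad: "p powi a * p powi b = p powi (a + b)" for a b using p' by (simp add: power_int_add)
      show ?thesis unfolding E_def Eh_def rp pp ad
        by (rule arg_cong[of _ _ "(powi) p"]) (simp add: power2_eq_square algebra_simps)
    qed
    have nz: "p ^ (k * (k + 1)) * \<rho> ^ (2 * k) * p ^ k \<noteq> 0" using p' \<rho>0 by simp
    have "(p ^ (k * (k + 1)) * \<rho> ^ (2 * k) * p ^ k) * (E * \<kappa>a\<^sup>2 * th ^ (n + k))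
        = E * (\<kappa>a\<^sup>2 * th ^ (n + k) * (p ^ (k * (k + 1)) * \<rho> ^ (2 * k) * p ^ k))" by (simp only: mult_ac)
    also have "\<dots> = (E * (\<rho> ^ (2 * n) * p ^ n * p ^ (n * (n + 1)))) * t ^ (n + k)" unfolding a by (simp only: mult_ac)
    also have "\<dots> = (p ^ (k * (k + 1)) * \<rho> ^ (2 * k) * p ^ k) * (Eh * t ^ (n + k))" unfolding b by (simp only: mult_ac)
    finally show ?thesis by (rule mult_left_cancel[OF nz, THEN iffD1])
  qed
  have main: "E * thT * \<kappa>a\<^sup>2 / (th1 * (t * \<rho>) ^ m) = Eh * thTh / (thh1 * (th * \<rho>) ^ m)"
  proof -
    have nn: "t ^ (n + k) = t ^ m * t powi r" "th ^ (n + k) = th ^ m * th powi r"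
    proof -
      have "x ^ (n + k) = x ^ m * x powi r" if "0 < x" for x :: real
      proof -
        have "x powi (int m + r) = x powi int m * x powi r" using that by (intro power_int_add) simp
        moreover have "x powi int (n + k) = x ^ (n + k)" by (rule power_int_of_nat)
        ultimately show ?thesis using nk by (simp only: of_nat_add power_int_of_nat)
      qed
      then show "t ^ (n + k) = t ^ m * t powi r" "th ^ (n + k) = th ^ m * th powi r" using pos by blast+
    qed
    have "E * thT * \<kappa>a\<^sup>2 * (thh1 * (th * \<rho>) ^ m) * P = \<rho> ^ m * thT * thTh * (E * \<kappa>a\<^sup>2 * th ^ (n + k))"
    proof -
      have "E * thT * \<kappa>a\<^sup>2 * (thh1 * (th * \<rho>) ^ m) * P = E * thT * \<kappa>a\<^sup>2 * (th ^ m * \<rho> ^ m) * (thh1 * P)"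
        unfolding power_mult_distrib by (simp only: mult_ac)
      then show ?thesis unfolding tt nn by (simp only: mult_ac)
    qed
    also have "\<dots> = \<rho> ^ m * thT * thTh * (Eh * t ^ (n + k))" unfolding key ..
    also have "\<dots> = Eh * thTh * (t ^ m * \<rho> ^ m) * (th1 * P)" unfolding tt nn by (simp only: mult_ac)
    also have "\<dots> = Eh * thTh * (th1 * (t * \<rho>) ^ m) * P" unfolding power_mult_distrib by (simp only: mult_ac)
    finally have "E * thT * \<kappa>a\<^sup>2 * (thh1 * (th * \<rho>) ^ m) = Eh * thTh * (th1 * (t * \<rho>) ^ m)" using ps by simp
    then show ?thesis using ps pos \<rho>0 by (simp add: frac_eq_eq)
  qed
  have alg: "D * (Q / Qk * (Th / Thk)) / (s1 * s2) * (Fm * T * Tn / (Q * Qn * th1) * (E / (tm * M))) * (Q * thT / (s3 * s4)) * (\<kappa>a * Thk / Tn)\<^sup>2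
     = D * (Q / Qn * (T / Tn)) / (s4 * s2) * (Fm * Th * Thk / (Q * Qk * thh1) * (Eh / (hm * M))) * (Q * thTh / (s3 * s1))"
    if "E * thT * \<kappa>a\<^sup>2 / (th1 * tm) = Eh * thTh / (thh1 * hm)" for s1 s2 s3 s4 tm hm
  proof -
    have "D * (Q / Qk * (Th / Thk)) / (s1 * s2) * (Fm * T * Tn / (Q * Qn * th1) * (E / (tm * M))) * (Q * thT / (s3 * s4)) * (\<kappa>a * Thk / Tn)\<^sup>2
      = D * Q * Th * Thk * Fm * T / (Qk * Qn * Tn * s1 * s2 * s3 * s4 * M) * (E * thT * \<kappa>a\<^sup>2 / (th1 * tm))"
      using ps by (simp add: power2_eq_square mult_ac)
    also have "\<dots> = D * (Q / Qn * (T / Tn)) / (s4 * s2) * (Fm * Th * Thk / (Q * Qk * thh1) * (Eh / (hm * M))) * (Q * thTh / (s3 * s1))"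
      unfolding that using ps by (simp add: mult_ac)
    finally show ?thesis .
  qed
  show ?thesis
    unfolding AG AF Kt Kth b1 b2 sp \<kappa>' Q_def[symmetric] thT_def[symmetric] thTh_def[symmetric] by (rule alg[OF main])
qed

lemma qpoch_sq_pos:
  assumes "0 < p" "p < 1" "\<And>s. of_real (c * p ^ s) * u \<noteq> 1"
  shows "0 < qpoch_sq u p c"
proof -
  have "qpoch_inf (of_real c * u) (of_real p) \<noteq> 0"
  proof
    assume "qpoch_inf (of_real c * u) (of_real p) = 0"
    then obtain s where "of_real c * u * of_real p ^ s = 1" using qpoch_inf_eq_0_iff[of "of_real p :: complex"] assms(1,2) by auto
    then have "of_real (c * p ^ s) * u = 1" by (simp add: mult_ac)
    then show False using assms(3) by blast
  qed
  then show ?thesis by (simp add: qpoch_sq_def)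
qed

lemma bqL_num_of_real:
  "bqL_num n (of_real \<alpha>) (of_real b) (of_real z) (of_real q) = (of_real (bqL_num n \<alpha> b z q) :: complex)"
proof -
  have "inverse (complex_of_real q) ^ n = of_real (inverse q ^ n)" by simp
  note e = this
  show ?thesis unfolding bqL_num_def e
    by (simp only: of_real_power[symmetric] of_real_mult[symmetric] qpoch_of_real of_real_divide[symmetric] of_real_sum)
qed

lemma powi_gap:
  fixes p :: real
  assumes p: "0 < p" "p < 1" and ij: "i \<noteq> j"
  shows "(1 - p) * p powi j \<le> \<bar>p powi i - p powi j\<bar>"
proof (cases "j < i")
  case True
  then obtain e where e: "i = j + int (Suc e)" using zless_iff_Suc_zadd[of j i] by auto
  have "p powi i = p powi j * p ^ Suc e" unfolding e using p power_int_add[of p j "int (Suc e)"] by (simp only: power_int_of_nat) simp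
  moreover have "p ^ Suc e \<le> p" using p by (simp add: mult_left_le power_le_one)
  ultimately have "p powi i \<le> p powi j * p" using p by simp
  then have "(1 - p) * p powi j \<le> p powi j - p powi i" by (simp add: algebra_simps)
  then show ?thesis by linarith
next
  case False
  then obtain e where e: "j = i + int (Suc e)" using zless_iff_Suc_zadd[of i j] ij by auto
  have "p powi j = p powi i * p ^ Suc e" unfolding e using p power_int_add[of p i "int (Suc e)"] by (simp only: power_int_of_nat) simp
  moreover have "p ^ Suc e \<le> p" using p by (simp add: mult_left_le power_le_one)
  ultimately have 1: "p powi j \<le> p powi i * p" using p by simp
  have "p powi j \<le> p powi i" by (rule order.trans[OF 1 mult_left_le]) (use p in auto)
  then have "(1 - p) * p powi j \<le> (1 - p) * p powi i" using p by (intro mult_left_mono) auto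
  also have "\<dots> \<le> p powi i - p powi j" using 1 by (simp add: algebra_simps)
  finally show ?thesis by linarith
qed

text \<open>The two geometric sequences of the Jackson integral as one unordered sum over the full
  lattice; the factor \<open>\<bar>Z\<bar>\<close> collects the lengths and the minus sign of the
  lower branch. Points \<open>- (p powi (- 1 - j))\<close> are set to 0 by the conditional, and at
  \<open>t * p powi i\<close> with \<open>i < - k\<close> the weight is 0.\<close>

lemma coupling_core_has_sum:
  fixes p t g \<rho> :: real and u X :: complex
  assumes core: "coupling_core (of_real p) (of_real t) (of_real g) u (of_real \<rho>)"
    and p: "0 < p" "p < 1" and t: "0 < t"
  shows "((\<lambda>Z. if \<exists>j::nat. Z = - (p powi (- 1 - int j)) then 0
      else of_real \<bar>Z\<bar> * coupling_core.HH (of_real p) (of_real t) (of_real g) u (of_real \<rho>) k n (of_real Z)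
        * mphi (of_real p) (of_real g) u X (of_real Z))
    has_sum coupling_core.JJ (of_real p) (of_real t) (of_real g) u (of_real \<rho>) k n X)
    (range (\<lambda>i::int. - (p powi i)) \<union> range (\<lambda>i::int. t * p powi i))"
proof -
  interpret C: coupling_core "of_real p" "of_real t" "of_real g" u "of_real \<rho>" by (rule core)
  define G where "G Z = C.HH k n Z * mphi (of_real p) (of_real g) u X Z" for Z
  define F where "F Z = of_real \<bar>Z\<bar> * C.HH k n (of_real Z) * mphi (of_real p) (of_real g) u X (of_real Z)" for Z :: real
  define A where "A = range (\<lambda>i::nat. - (p ^ i))"
  define B where "B = range (\<lambda>i::nat. t / p ^ k * p ^ i)"
  have pi: "p ^ i = p ^ j \<longleftrightarrow> i = j" for i j using power_eq_iff_norm_less_1[of p i j] p by simp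
  have bG: "jbounded (of_real p) x G" for x unfolding G_def by (intro jbounded_mult C.jbounded_HH C.jbounded_mphi)
  have sumS: "(\<lambda>s. of_real p ^ s * G (x * of_real p ^ s)) sums (\<Sum>s. of_real p ^ s * G (x * of_real p ^ s))"
    "summable (\<lambda>s. norm (of_real p ^ s * G (x * of_real p ^ s)))" for x
    using jbounded_summable[OF C.q(1) bG] jbounded_summable_norm[OF C.q(1) bG] by (simp_all add: summable_sums)
  have SA: "(F has_sum (\<Sum>s. of_real p ^ s * G (- 1 * of_real p ^ s))) A"
  proof -
    have "inj_on (\<lambda>i::nat. - (p ^ i)) UNIV" using pi by (auto intro: inj_onI)
    moreover have "(F \<circ> (\<lambda>i::nat. - (p ^ i))) = (\<lambda>s. of_real p ^ s * G (- 1 * of_real p ^ s))"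
      using p by (auto simp: F_def G_def mult.assoc)
    ultimately show ?thesis unfolding A_def
      using norm_summable_imp_has_sum[OF sumS(2) sumS(1), of "- 1"] by (simp only: has_sum_reindex)
  qed
  have SB: "(F has_sum (of_real (t / p ^ k) * (\<Sum>s. of_real p ^ s * G (of_real (t / p ^ k) * of_real p ^ s)))) B"
  proof -
    have tp: "0 < t / p ^ k" using t p by simp
    have "inj_on (\<lambda>i::nat. t / p ^ k * p ^ i) UNIV" using pi t p by (auto intro: inj_onI)
    moreover have "(F \<circ> (\<lambda>i::nat. t / p ^ k * p ^ i)) = (\<lambda>s. of_real (t / p ^ k) * (of_real p ^ s * G (of_real (t / p ^ k) * of_real p ^ s)))"
    proof
      fix s
      have "\<bar>t / p ^ k * p ^ s\<bar> = t / p ^ k * p ^ s" using t p by simp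
      then show "(F \<circ> (\<lambda>i::nat. t / p ^ k * p ^ i)) s = of_real (t / p ^ k) * (of_real p ^ s * G (of_real (t / p ^ k) * of_real p ^ s))"
        unfolding F_def G_def comp_def by (simp only: of_real_mult of_real_power mult.assoc)
    qed
    moreover have "((\<lambda>s. of_real (t / p ^ k) * (of_real p ^ s * G (of_real (t / p ^ k) * of_real p ^ s))) has_sum
        (of_real (t / p ^ k) * (\<Sum>s. of_real p ^ s * G (of_real (t / p ^ k) * of_real p ^ s)))) (UNIV :: nat set)"
      by (intro has_sum_cmult_right norm_summable_imp_has_sum[OF sumS(2) sumS(1)])
    ultimately show ?thesis unfolding B_def by (simp only: has_sum_reindex)
  qed
  have posB: "0 < Z" if "Z \<in> B" for Z using that t p by (auto simp: B_def)
  have negA: "Z < 0" if "Z \<in> A" for Z using that p by (auto simp: A_def)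
  have "A \<inter> B = {}" using posB negA by force
  from has_sum_Un_disjoint[OF SA SB this]
  have S: "(F has_sum C.JJ k n X) (A \<union> B)"
    unfolding C.JJ_def jint_def G_def[symmetric] by (simp add: add.commute)
  show ?thesis
  \<comment> \<open>\<open>A\<close> and \<open>B\<close> are the points actually sampled by the
    integral, and the three goals are the parts of the comparison with the full lattice.\<close>
  proof (subst has_sum_cong_neutral[where g = F and T = "A \<union> B"])
    fix Z assume Z: "Z \<in> A \<union> B - (range (\<lambda>i::int. - (p powi i)) \<union> range (\<lambda>i::int. t * p powi i))"
    have "- (p ^ i) = - (p powi int i)" for i by simp
    then have "A \<subseteq> range (\<lambda>i::int. - (p powi i))" unfolding A_def by blast
    moreover have "t / p ^ k * p ^ i = t * p powi (int i - int k)" for i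
      using p power_int_diff[of p "int i" "int k"] by simp
    then have "B \<subseteq> range (\<lambda>i::int. t * p powi i)" unfolding B_def by blast
    ultimately show "F Z = 0" using Z by blast
  next
    fix Z assume Z: "Z \<in> range (\<lambda>i::int. - (p powi i)) \<union> range (\<lambda>i::int. t * p powi i) - (A \<union> B)"
    show "(if \<exists>j::nat. Z = - (p powi (- 1 - int j)) then 0
      else of_real \<bar>Z\<bar> * C.HH k n (of_real Z) * mphi (of_real p) (of_real g) u X (of_real Z)) = 0"
    proof (cases "\<exists>i::int. Z = - (p powi i)")
      case True
      then obtain i where i: "Z = - (p powi i)" by blast
      have "\<not> 0 \<le> i"
      proof
        assume "0 \<le> i"
        then have "Z = - (p ^ nat i)" unfolding i using power_int_of_nat[of p "nat i"] by simp
        then show False using Z unfolding A_def by blast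
      qed
      then have "i = - 1 - int (nat (- 1 - i))" by simp
      then have "p powi i = p powi (- 1 - int (nat (- 1 - i)))" by (rule arg_cong)
      then have "Z = - (p powi (- 1 - int (nat (- 1 - i))))" unfolding i by (simp only:)
      then have "\<exists>j::nat. Z = - (p powi (- 1 - int j))" by blast
      then show ?thesis by simp
    next
      case False
      then obtain i where i: "Z = t * p powi i" using Z by blast
      have "\<not> 0 \<le> i + int k"
      proof
        assume h: "0 \<le> i + int k"
        have "p powi (i + int k) = p powi i * p powi int k" using p by (intro power_int_add) simp
        then have "p ^ nat (i + int k) = p powi i * p ^ k" using h power_int_of_nat[of p "nat (i + int k)"] by simp
        then have "Z = t / p ^ k * p ^ nat (i + int k)" unfolding i using p by simp
        then show False using Z unfolding B_def by blast
      qed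
      then have h: "0 = int (Suc k) + i + int (nat (- 1 - int k - i))" by simp
      have "p powi (int (Suc k) + i + int (nat (- 1 - int k - i))) = p powi int (Suc k) * p powi i * p powi int (nat (- 1 - int k - i))"
        using p by (simp only: power_int_add order.strict_implies_not_eq[THEN not_sym] simp_thms)
      then have "p ^ Suc k * p powi i * p ^ nat (- 1 - int k - i) = 1" unfolding h[symmetric] power_int_of_nat by simp
      then have "p ^ Suc k / t * Z * p ^ nat (- 1 - int k - i) = 1" unfolding i using t by simp
      then have "qpoch_inf (p ^ Suc k / t * Z) p = 0" using qpoch_inf_eq_0_iff[of p "p ^ Suc k / t * Z"] p by auto
      then have "qpoch_inf (of_real p ^ Suc k / of_real t * of_real Z) (of_real p) = (0 :: complex)"
        using qpoch_inf_of_real[of p "p ^ Suc k / t * Z", where 'a = complex] p by simp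
      then have "C.HH k n (of_real Z) = 0" unfolding C.HH_def C.ker_def by (simp del: power_Suc)
      then show ?thesis by simp
    qed
  next
    fix Z assume Z: "Z \<in> (range (\<lambda>i::int. - (p powi i)) \<union> range (\<lambda>i::int. t * p powi i)) \<inter> (A \<union> B)"
    have "\<not> (\<exists>j::nat. Z = - (p powi (- 1 - int j)))"
    proof
      assume "\<exists>j::nat. Z = - (p powi (- 1 - int j))"
      then obtain j where j: "Z = - (p powi (- 1 - int j))" by blast
      then have "Z < 0" using p by simp
      then have "Z \<in> A" using Z posB by force
      then obtain i where i: "Z = - (p ^ i)" unfolding A_def by blast
      have "(1 - p) * p powi (- 1 - int j) \<le> \<bar>p powi int i - p powi (- 1 - int j)\<bar>" by (rule powi_gap[OF p]) simp
      moreover have "p powi int i = p powi (- 1 - int j)" using i j by simp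
      ultimately have "(1 - p) * p powi (- 1 - int j) \<le> 0" by simp
      moreover have "0 < (1 - p) * p powi (- 1 - int j)" using p by simp
      ultimately show False by linarith
    qed
    then show "(if \<exists>j::nat. Z = - (p powi (- 1 - int j)) then 0
      else of_real \<bar>Z\<bar> * C.HH k n (of_real Z) * mphi (of_real p) (of_real g) u X (of_real Z)) = F Z"
      unfolding F_def by (simp only: if_False)
  qed (rule S)
qed

lemma unit_powi_cong:
  fixes e :: real
  assumes "e * e = 1" "a = b + 2 * c"
  shows "e powi a = e powi b"
proof -
  have "e \<noteq> 0" using assms(1) by auto
  moreover have "e powi (2 * c) = 1" using assms(1) power_int_mult[of e 2 c] by (simp add: power2_eq_square)
  ultimately show ?thesis unfolding assms(2) by (simp add: power_int_add)
qed

text \<open>All signs have square 1, so only the parity of the exponents matters, and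
  \<open>n + k = m + r\<close> supplies it. The factor \<open>s ^ (k + n)\<close> is the sign of
  \<open>\<kappa>\<close>, and \<open>(- 1) ^ (k + n)\<close> the explicit sign in
  \<open>kap\<close>.\<close>

lemma coupling_phase:
  fixes sl sx s :: real
  assumes s: "s = sl * sx" "sl * sl = 1" "sx * sx = 1" and nk: "int n + int k = int m + r"
  shows "of_real (s powi r) * ((of_real sl * \<i>) ^ m * of_real ((- 1) powi (r - int k))) * of_real ((- 1) ^ (k + n) * s ^ (k + n))
    = (of_real sx * \<i>) ^ m * of_real ((- 1) powi (r - int n))"
proof -
  have ss: "s * s = 1" "s \<noteq> 0" using s by (auto simp: mult_ac)
  have 1: "s powi r * s ^ (k + n) = s ^ m"
  proof -
    have "s powi (r + int (k + n)) = s powi int m" by (rule unit_powi_cong[OF ss(1), where c = r]) (use nk in simp)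
    then show ?thesis using ss by (simp add: power_int_add del: of_nat_add)
  qed
  have 2: "(- 1) powi (r - int k) * (- 1) ^ (k + n) = ((- 1) powi (r - int n) :: real)"
  proof -
    have "(- 1 :: real) powi (r - int k + int (k + n)) = (- 1) powi (r - int n)"
      by (rule unit_powi_cong[where c = "int n"]) simp_all
    then show ?thesis by (simp add: power_int_add del: of_nat_add)
  qed
  have 3: "(of_real sl * \<i>) ^ m * of_real (s ^ m) = (of_real sx * \<i>) ^ m"
  proof -
    have "of_real sl * \<i> * of_real s = of_real (sl * sl) * of_real sx * \<i>" unfolding s(1) by simp
    note e = this[unfolded s(2) of_real_1 mult_1]
    show ?thesis unfolding of_real_power power_mult_distrib[symmetric] e ..
  qed
  have "of_real (s powi r) * ((of_real sl * \<i>) ^ m * of_real ((- 1) powi (r - int k))) * of_real ((- 1) ^ (k + n) * s ^ (k + n))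
    = ((of_real sl * \<i>) ^ m * of_real (s powi r * s ^ (k + n))) * of_real ((- 1) powi (r - int k) * (- 1) ^ (k + n))"
    by (simp only: of_real_mult mult_ac)
  then show ?thesis unfolding 1 2 3 .
qed

text \<open>For \<open>\<xi> = - 1\<close> the positive values of \<open>x'\<close> lie in
  \<open>pos_lattice q (- \<sigma>)\<close>, for the other choice of \<open>\<xi>\<close> in
  \<open>pos_lattice q \<sigma>\<close>; this is why both occur, and similarly for
  \<open>z'\<close>. The conditions at \<open>u = 1\<close> and \<open>u = - 1\<close> keep the
  denominators of the parameters away from 0.\<close>

theorem theorem6p4:
  fixes q \<tau> \<sigma> l \<xi> x z x' z' :: real and u a b t :: complex and r :: int
    and R :: "real \<Rightarrow> complex"
  assumes q: "0 < q" "q < 1"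
    and u: "cmod u = 1"
    and u_p1: "u = 1 \<Longrightarrow> \<forall>j::int. \<tau> - \<sigma> \<noteq> 2 * of_int j + 1"
    and u_m1: "u = -1 \<Longrightarrow> \<forall>j::int. \<tau> + \<sigma> \<noteq> 2 * of_int j + 1"
    and l: "l \<in> {-1, q powr (2 * \<tau>)}"
    and \<xi>: "\<xi> \<in> {-1, q powr (2 * \<sigma>)}"
    and x: "x \<in> lattice_set q \<sigma>"
    and z: "z \<in> lattice_set q \<tau>"
    and x': "x' = \<xi> * x * q powr (2 * of_int r - 2 * \<sigma>)"
    and z': "z' = l * z * q powr (2 * of_int r - 2 * \<tau>)"
    and a: "a = - of_real (q powr (1 + \<sigma> + \<tau> - 2 * of_int r)) * u / of_real (l * \<xi>)"
    and b: "b = - of_real (q powr (1 + \<sigma> + \<tau> - 2 * of_int r)) / (u * of_real (l * \<xi>))"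
    and t: "t = of_real (l ^ 2 * q powr (2 * of_int r - 2 * \<tau>))"
    and R: "is_coupling q \<tau> \<sigma> l \<xi> u r x R"
  shows "(x' \<in> neg_in q \<union> pos_lattice q \<sigma> \<union> pos_lattice q (- \<sigma>) \<and>
          z' \<in> neg_in q \<union> pos_lattice q \<tau> \<union> pos_lattice q (- \<tau>) \<longrightarrow>
            R z = of_real (sgn (l * \<xi>) powi r)
              * csqrt (of_real \<bar>x' * z'\<bar>
                       * qMeixner_weight (of_real z') a b (of_real (q ^ 2))
                       * qMeixner_weight (of_real x') a b (of_real (q ^ 2))
                       / (qMeixner_K t a b (of_real (q ^ 2))
                          * qMeixner_K (of_real (q ^ 2) / (a * b * t)) a b (of_real (q ^ 2))))
              * qMeixner (of_real x') (of_real z') a b (of_real (q ^ 2))) \<and>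
         (x' \<in> neg_out q \<or> z' \<in> neg_out q \<longrightarrow> R z = 0)"
proof -

  \<comment> \<open>Parameters, nonresonance and the rescaled lattices\<close>
  define p where "p = q ^ 2"
  define g where "g = q powr (1 + \<sigma> + \<tau> - 2 * of_int r) / (l * \<xi>)"
  define tt where "tt = l ^ 2 * q powr (2 * of_int r - 2 * \<tau>)"
  define th where "th = \<xi> ^ 2 * q powr (2 * of_int r - 2 * \<sigma>)"
  define \<rho> where "\<rho> = p powi (- r)"
  note P = coupling_parameters[OF q l \<xi> p_def g_def tt_def th_def \<rho>_def]
  have g': "g = q powr (1 + \<tau> + \<sigma> - 2 * of_int r) / (\<xi> * l)" unfolding g_def by (simp add: add_ac mult.commute)
  note P' = coupling_parameters[OF q \<xi> l p_def g' th_def tt_def \<rho>_def]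
  have pp: "0 < p" "p < 1" using q unfolding p_def by (simp_all add: power_less_one_iff)
  have lx0: "l \<noteq> 0" "\<xi> \<noteq> 0" using l \<xi> q by auto
  have u0: "u \<noteq> 0" using u by auto
  note NR = coupling_nonresonant[OF q l \<xi> p_def g_def tt_def u u_p1 u_m1]
  have pd: "p powi (int i - int j) = p ^ i / p ^ j" for i j using pp power_int_diff[of p "int i" "int j"] by simp
  have core: "coupling_core (of_real p) (of_real tt) (of_real g) u (of_real \<rho>)"
  proof
    show "norm (of_real p :: complex) < 1" "(of_real p :: complex) \<noteq> 0" "(of_real tt :: complex) \<noteq> 0" "(of_real g :: complex) \<noteq> 0"
      "u \<noteq> 0" "(of_real \<rho> :: complex) \<noteq> 0" using pp P(1,3,4) u0 by auto
    show "- of_real g * u * of_real p ^ i \<noteq> 1" for i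
    proof
      assume "- of_real g * u * of_real p ^ i = 1"
      then have "of_real (g * p powi int i) * u = - 1" by (simp add: mult_ac) (metis minus_equation_iff mult.commute mult.left_commute)
      then show False using NR(1) by blast
    qed
    show "- of_real g / u * of_real p ^ i \<noteq> 1" for i
    proof
      assume "- of_real g / u * of_real p ^ i = 1"
      then have "- (of_real (g * p powi int i) / u) = 1" by simp
      then have "of_real (g * p powi int i) / u = - 1" by (metis minus_equation_iff)
      then show False using NR(2) by blast
    qed
    show "of_real tt * of_real g * u * of_real p ^ i \<noteq> of_real p ^ j" for i j
    proof
      assume "of_real tt * of_real g * u * of_real p ^ i = of_real p ^ j"
      then have "of_real (tt * g * p powi (int i - int j)) * u = 1" unfolding pd using pp by (simp add: mult_ac)
      then show False using NR(3) by blast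
    qed
    show "of_real tt * of_real g / u * of_real p ^ i \<noteq> of_real p ^ j" for i j
    proof
      assume "of_real tt * of_real g / u * of_real p ^ i = of_real p ^ j"
      then have "of_real (tt * g * p powi (int i - int j)) / u = 1" unfolding pd using pp u0 by (simp add: field_simps)
      then show False using NR(4) by blast
    qed
    have neg: "complex_of_real c \<noteq> - (of_real d)" "complex_of_real (- c) \<noteq> 1" if "0 < c" "0 < d" for c d
    proof -
      have "c \<noteq> - d" "- c \<noteq> 1" using that by linarith+
      then show "complex_of_real c \<noteq> - (of_real d)" "complex_of_real (- c) \<noteq> 1"
        by (metis of_real_eq_iff of_real_minus) (metis \<open>- c \<noteq> 1\<close> of_real_1 of_real_eq_iff)
    qed
    show "of_real tt * of_real p ^ i \<noteq> - (of_real p ^ j :: complex)" for i j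
      using neg(1)[of "tt * p ^ i" "p ^ j"] pp P(1) by simp
    show "of_real tt * of_real g ^ 2 * of_real p ^ i \<noteq> - (of_real p ^ j :: complex)" for i j
      using neg(1)[of "tt * g ^ 2 * p ^ i" "p ^ j"] pp P(1,4) by simp
    show "- of_real tt * of_real \<rho> * of_real p * of_real p ^ i \<noteq> (1 :: complex)" for i
      using neg(2)[of "tt * \<rho> * p * p ^ i" 1] pp P(1,3) by simp
    show "- of_real p * of_real \<rho> / (of_real tt * of_real g ^ 2) * of_real p * of_real p ^ i \<noteq> (1 :: complex)" for i
      using neg(2)[of "p * \<rho> / (tt * g ^ 2) * p * p ^ i" 1] pp P(1,3,4) by simp
  qed
  interpret C: coupling_core "of_real p" "of_real tt" "of_real g" u "of_real \<rho>" by (rule core)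
  obtain D where D: "cdqH_density u (of_real p) = of_real D" "0 < D" using cdqH_density_pos[OF pp u] by blast
  define X where "X = x'"
  define Zf where "Zf y = l * y * q powr (2 * of_int r - 2 * \<tau>)" for y
  define out where "out Z \<longleftrightarrow> (\<exists>j::nat. Z = - (p powi (- 1 - int j)))" for Z
  define \<Lambda> where "\<Lambda> = range (\<lambda>i::int. - (p powi i)) \<union> range (\<lambda>i::int. tt * p powi i)"
  have Zim: "Zf ` lattice_set q \<tau> = \<Lambda>" unfolding Zf_def \<Lambda>_def by (rule lattice_set_scaled[OF q l p_def tt_def])
  have Xim: "X \<in> range (\<lambda>i::int. - (p powi i)) \<union> range (\<lambda>i::int. th * p powi i)"
    using lattice_set_scaled[OF q \<xi> p_def th_def] x unfolding X_def x' by blast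
  have Zinj: "inj_on Zf A" for A
  proof (rule inj_onI)
    fix y y' assume "Zf y = Zf y'"
    moreover have "q powr (2 * of_int r - 2 * \<tau>) \<noteq> 0" using q by simp
    ultimately show "y = y'" using lx0 unfolding Zf_def by simp
  qed
  have neg_good: "out (- (p powi i)) \<or> (\<exists>i'::nat. - (p powi i) = - (p ^ i'))" for i
  proof (cases "0 \<le> i")
    case True
    then have "- (p powi i) = - (p ^ nat i)" using power_int_of_nat[of p "nat i"] by simp
    then show ?thesis by (intro disjI2 exI)
  next
    case False
    then have "i = - 1 - int (nat (- 1 - i))" by simp
    then have "- (p powi i) = - (p powi (- 1 - int (nat (- 1 - i))))" by (rule arg_cong)
    then show ?thesis unfolding out_def by (intro disjI1 exI)
  qed
  have goodZ: "(\<exists>i::nat. Z = - (p ^ i)) \<or> (\<exists>i::int. Z = tt * p powi i)" if "Z \<in> \<Lambda>" "\<not> out Z" for Z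
    using that neg_good unfolding \<Lambda>_def by blast
  have goodX: "(\<exists>i::nat. X = - (p ^ i)) \<or> (\<exists>i::int. X = th * p powi i)" if "\<not> out X"
    using that neg_good Xim by blast
  have L0: "Z \<noteq> 0" if "Z \<in> \<Lambda>" for Z using that pp P(1) unfolding \<Lambda>_def by auto
  have X0: "X \<noteq> 0" using Xim pp P(2) by auto
  have neg_out: "neg_out q = {Z. out Z}"
  proof -
    have "q powi (- 2 - 2 * int j) = p powi (- 1 - int j)" for j
    proof -
      have "q powi (2 * (- 1 - int j)) = (q powi 2) powi (- 1 - int j)" by (rule power_int_mult)
      moreover have "2 * (- 1 - int j) = - 2 - 2 * int j" by simp
      ultimately show ?thesis unfolding p_def by simp
    qed
    then show ?thesis unfolding neg_out_def out_def by auto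
  qed
  \<comment> \<open>Passing to the reciprocal reduces conditions on \<open>th * g\<close> and
    \<open>- p * \<rho> / g\<close> to those on \<open>t * g\<close> and \<open>g\<close>, because
    \<open>t * th * g ^ 2 = p\<close>.\<close>
  have res: "of_real c * u \<noteq> 1" if "of_real (1 / c) / u \<noteq> 1" "c \<noteq> 0" for c
  proof
    assume h: "of_real c * u = 1"
    then have "u = 1 / of_real c" using that(2) by (simp add: eq_divide_eq mult.commute)
    then have "of_real (1 / c) / u = 1" using that(2) by simp
    then show False using that(1) by blast
  qed
  have NR': "of_real (- (g * p powi i)) * u \<noteq> 1" for i
  proof
    assume "of_real (- (g * p powi i)) * u = 1"
    then have "- (of_real (g * p powi i) * u) = 1" by simp
    then have "of_real (g * p powi i) * u = - 1" by (metis minus_equation_iff)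
    then show False using NR(1) by blast
  qed
  have ad: "p powi i * p ^ s = p powi (i + int s)" for i s using pp by (simp add: power_int_add)
  have sqZ: "of_real (g * Z * p ^ s) * u \<noteq> 1" if "Z \<in> \<Lambda>" for Z s
  proof -
    consider i where "Z = - (p powi i)" | i where "Z = tt * p powi i" using \<open>Z \<in> \<Lambda>\<close> unfolding \<Lambda>_def by blast
    then show ?thesis
    proof cases
      case 1
      have "g * Z * p ^ s = - (g * p powi (i + int s))" unfolding 1 ad[symmetric] by simp
      then show ?thesis using NR' by (simp only: not_False_eq_True)
    next
      case 2
      have "g * Z * p ^ s = tt * g * p powi (i + int s)" unfolding 2 ad[symmetric] by simp
      then show ?thesis using NR(3) by (simp only: not_False_eq_True)
    qed
  qed
  have sqZ': "of_real (g * Z * p ^ s) / u \<noteq> 1" if "Z \<in> \<Lambda>" for Z s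
  proof -
    consider i where "Z = - (p powi i)" | i where "Z = tt * p powi i" using \<open>Z \<in> \<Lambda>\<close> unfolding \<Lambda>_def by blast
    then show ?thesis
    proof cases
      case 1
      have e: "g * Z * p ^ s = - (g * p powi (i + int s))" unfolding 1 ad[symmetric] by simp
      show ?thesis
      proof
        assume "of_real (g * Z * p ^ s) / u = 1"
        then have "- (of_real (g * p powi (i + int s)) / u) = 1" unfolding e by simp
        then have "of_real (g * p powi (i + int s)) / u = - 1" by (metis minus_equation_iff)
        then show False using NR(2) by blast
      qed
    next
      case 2
      have "g * Z * p ^ s = tt * g * p powi (i + int s)" unfolding 2 ad[symmetric] by simp
      then show ?thesis using NR(4) by (simp only: not_False_eq_True)
    qed
  qed
  have sq1: "0 < qpoch_sq u p (- g)"
  proof (rule qpoch_sq_pos[OF pp])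
    show "of_real (- g * p ^ s) * u \<noteq> 1" for s using NR'[of "int s"] by simp
  qed
  have sq2: "0 < qpoch_sq u p (tt * g)"
  proof (rule qpoch_sq_pos[OF pp])
    show "of_real (tt * g * p ^ s) * u \<noteq> 1" for s using NR(3)[of "int s"] by simp
  qed
  have sq3: "0 < qpoch_sq u p (th * g)"
  proof (rule qpoch_sq_pos[OF pp], rule res)
    fix s
    show "th * g * p ^ s \<noteq> 0" using P(2,4) pp by simp
    have "1 / (th * g * p ^ s) = tt * g * p powi (- int (Suc s))"
    proof -
      have "tt * g * (th * g * p ^ s) = p * p ^ s" using P(5) by (simp add: power2_eq_square mult_ac)
      then have "th * g * p ^ s * (tt * g * inverse (p * p ^ s)) = 1" using pp by (simp add: mult_ac) (simp add: field_simps)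
      then have "inverse (th * g * p ^ s) = tt * g * inverse (p * p ^ s)" by (rule inverse_unique)
      then show ?thesis unfolding power_int_minus power_int_of_nat power_Suc by (simp add: inverse_eq_divide)
    qed
    then show "of_real (1 / (th * g * p ^ s)) / u \<noteq> 1" using NR(4) by (simp only: not_False_eq_True)
  qed
  have sq4: "0 < qpoch_sq u p (- p * \<rho> / g)"
  proof (rule qpoch_sq_pos[OF pp], rule res)
    fix s
    show n: "- p * \<rho> / g * p ^ s \<noteq> 0" using P(3,4) pp by simp
    have "1 / (- p * \<rho> / g * p ^ s) = - (g * p powi (r - int (Suc s)))"
    proof -
      have "p powi (r - int (Suc s)) = p powi r / p ^ Suc s" using pp power_int_diff[of p r "int (Suc s)"] by (simp only: power_int_of_nat) simp
      moreover have "p powi r = inverse \<rho>" unfolding \<rho>_def by (simp add: power_int_minus)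
      ultimately show ?thesis using P(3,4) pp by (simp add: field_simps)
    qed
    note e = this
    show "of_real (1 / (- p * \<rho> / g * p ^ s)) / u \<noteq> 1"
    proof
      assume "of_real (1 / (- p * \<rho> / g * p ^ s)) / u = 1"
      then have "- (of_real (g * p powi (r - int (Suc s))) / u) = 1" unfolding e by simp
      then have "of_real (g * p powi (r - int (Suc s))) / u = - 1" by (metis minus_equation_iff)
      then show False using NR(2) by blast
    qed
  qed

  \<comment> \<open>Real weights, normalising constants and the candidate\<close>
  define Kt where "Kt = qpoch_inf p p * qtheta (- tt) p / (qpoch_sq u p (- g) * qpoch_sq u p (tt * g))"
  define Kth where "Kth = qpoch_inf p p * qtheta (- th) p / (qpoch_sq u p (- g) * qpoch_sq u p (th * g))"
  have Kpos: "0 < Kt" "0 < Kth"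
    unfolding Kt_def Kth_def
    by (intro divide_pos_pos mult_pos_pos qpoch_inf_pos[OF pp pp(2)] qtheta_neg_pos[OF pp] P(1,2) sq1 sq2 sq3)+
  define wt where "wt Z = \<bar>Z\<bar> * qpoch_inf (- Z * p) p / qpoch_sq u p (g * Z)" for Z
  define s where "s = sgn (l * \<xi>)"
  define c0 where "c0 = s powi r * (sqrt (wt X) / sqrt (Kt * Kth))"
  \<comment> \<open>The claimed value of the coefficient, with the single root of the statement
    split into a part \<open>c0\<close> that is constant in the summation variable and the root of
    the weight at \<open>Zf y\<close>.\<close>
  define Rf where "Rf y = (if out X \<or> out (Zf y) then 0 else of_real (c0 * sqrt (wt (Zf y))) * mphi (of_real p) (of_real g) u (of_real X) (of_real (Zf y)))" for y
  have wp: "0 < qpoch_inf (- Z * p) p" if w: "0 < Z \<or> (\<exists>i::nat. Z = - (p ^ i))" for Z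
  proof (rule qpoch_inf_pos[OF pp])
    show "- Z * p < 1"
    proof (cases "0 < Z")
      case True
      then have "- Z * p < 0" using pp by (simp add: mult_pos_pos)
      then show ?thesis by simp
    next
      case False
      then obtain i where "Z = - (p ^ i)" using w by blast
      then show ?thesis using power_Suc_less_one[OF pp, of i] by (simp add: mult.commute)
    qed
  qed
  have wtZ: "0 < wt Z" if "Z \<in> \<Lambda>" "\<not> out Z" for Z
  proof -
    have "0 < qpoch_inf (- Z * p) p" using goodZ[OF that] P(1) pp by (intro wp) auto
    moreover have "0 < qpoch_sq u p (g * Z)" using sqZ[OF that(1)] by (intro qpoch_sq_pos pp)
    ultimately show ?thesis unfolding wt_def using L0[OF that(1)] by simp
  qed
  have wtX: "0 \<le> wt X" if "\<not> out X"
  proof -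
    have "0 < qpoch_inf (- X * p) p" using goodX[OF that] P(2) pp by (intro wp) auto
    then show ?thesis unfolding wt_def by (intro divide_nonneg_nonneg mult_nonneg_nonneg qpoch_sq_nonneg) auto
  qed
  define AG where "AG k n m = D * (qpoch_inf (p ^ Suc k) p * qpoch_inf (- th * \<rho> * p * p ^ k) p) / (qpoch_sq u p (th * g) * qpoch_sq u p (- p * \<rho> / g))
            * bqL_norm m n (r - int k) (tt * \<rho>) p" for k n m
  define AF where "AF k n m = D * (qpoch_inf (p ^ Suc n) p * qpoch_inf (- tt * \<rho> * p * p ^ n) p) / (qpoch_sq u p (tt * g) * qpoch_sq u p (- p * \<rho> / g))
            * bqL_norm m k (r - int n) (th * \<rho>) p" for k n m
  have AGpos: "0 < AG k n m" for k n m
  proof -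
    have lt: "- th * \<rho> * p * p ^ k < 1" "- (tt * \<rho>) * p < 1" using P(1,2,3) pp by (simp_all add: mult_pos_pos order.strict_trans[of _ 0])
    have "0 < bqL_norm m n (r - int k) (tt * \<rho>) p"
      unfolding bqL_norm_def using P(1,3) pp
      by (intro mult_pos_pos divide_pos_pos qpoch_inf_pos[OF pp] qpoch_pos[OF pp] qtheta_neg_pos[OF pp] zero_less_power zero_less_power_int
        power_Suc_less_one lt pp)
    then show ?thesis unfolding AG_def using D(2) sq3 sq4
      by (intro mult_pos_pos divide_pos_pos qpoch_inf_pos[OF pp] power_Suc_less_one lt pp)
  qed
  have s1: "sgn l * sgn l = 1" "sgn \<xi> * sgn \<xi> = 1" "s = sgn l * sgn \<xi>" "s * s = 1" "sgn g = s"
  proof -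
    show 1: "sgn l * sgn l = 1" "sgn \<xi> * sgn \<xi> = 1" using lx0 by (simp_all add: sgn_if)
    show 2: "s = sgn l * sgn \<xi>" unfolding s_def by (rule sgn_mult)
    have "s * s = (sgn l * sgn l) * (sgn \<xi> * sgn \<xi>)" unfolding 2 by (simp only: mult_ac)
    then show "s * s = 1" unfolding 1 by simp
    show "sgn g = s" unfolding s_def by (rule P(6))
  qed
  have pabs: "\<bar>p\<bar> < 1" using pp by simp
  have ri: "qpoch_inf (of_real c) (of_real p) = (of_real (qpoch_inf c p) :: complex)" for c by (rule qpoch_inf_of_real[OF pabs])
  have rt: "qtheta (of_real c) (of_real p) = (of_real (qtheta c p) :: complex)" for c
    unfolding qtheta_def of_real_divide[symmetric] ri by simp
  have pth: "p / (tt * g) = th * g" "p / (tt * g ^ 2) = th"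
    using P(1,4) unfolding P(5)[symmetric] by (simp_all add: power2_eq_square)

  \<comment> \<open>Comparison of the constant of the core identity with the normalisations\<close>
  define \<kappa> where "\<kappa> k n = inverse (th * g) ^ k * inverse \<rho> ^ k * qpoch (- th * \<rho> * p) p k / p ^ (k * (k + 1) div 2)
      * ((\<rho> * tt * g) ^ n * p ^ (n * (n + 1) div 2) / qpoch (- tt * \<rho> * p) p n)" for k n
  have kap: "C.kap k n = of_real (Kt * ((- 1) ^ (k + n) * \<kappa> k n))" for k n
  proof -
    have 1: "of_real tt * qpoch_inf (of_real p) (of_real p) * qtheta (- 1 / of_real tt) (of_real p)
        = (of_real (qpoch_inf p p * qtheta (- tt) p) :: complex)"
    proof -
      have "qtheta (1 / (- tt)) p = - qtheta (- tt) p / (- tt)" using pp P(1) by (intro qtheta_inverse) auto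
      then have "tt * qtheta (- 1 / tt) p = qtheta (- tt) p" using P(1) by simp
      moreover have "- 1 / of_real tt = (of_real (- 1 / tt) :: complex)" by simp
      moreover have "of_real tt * (of_real A) * (of_real B) = (of_real (A * (tt * B)) :: complex)" for A B by simp
      ultimately show ?thesis by (simp only: rt ri)
    qed
    have 2: "qpoch_inf (- of_real g * u) (of_real p) * qpoch_inf (- of_real g / u) (of_real p) = of_real (qpoch_sq u p (- g))"
      using qpoch_sq[OF pp u, of "- g"] by simp
    have 3: "qpoch_inf (of_real tt * of_real g * u) (of_real p) * qpoch_inf (of_real tt * of_real g / u) (of_real p) = of_real (qpoch_sq u p (tt * g))"
      using qpoch_sq[OF pp u, of "tt * g"] by simp
    have 4: "of_real p / (of_real tt * of_real g) = (of_real (th * g) :: complex)" unfolding pth(1)[symmetric] by simp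
    have 5: "- of_real p * of_real \<rho> / (of_real tt * of_real g ^ 2) * of_real p = (of_real (- th * \<rho> * p) :: complex)"
      unfolding pth(2)[symmetric] by simp
    have 6: "- of_real tt * of_real \<rho> * of_real p = (of_real (- tt * \<rho> * p) :: complex)" by simp
    have 7: "- of_real \<rho> * of_real tt * of_real g = (of_real (- 1 * (\<rho> * tt * g)) :: complex)" by simp
    have 8: "(- 1 :: complex) = of_real (- 1)" by simp
    have g4: "a1 * a2 * b1 * b2 = (a1 * a2) * (b1 * b2)" for a1 a2 b1 b2 :: complex by (simp only: mult.assoc)
    have 9: "inverse (complex_of_real y) = of_real (inverse y)" for y by simp
    have "C.kap k n = of_real (qpoch_inf p p * qtheta (- tt) p) / (of_real (qpoch_sq u p (- g)) * of_real (qpoch_sq u p (tt * g)))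
      * (of_real (inverse (th * g)) ^ k * of_real (inverse \<rho>) ^ k * of_real (qpoch (- th * \<rho> * p) p k) * (of_real (- 1) ^ k / of_real p ^ (k * (k + 1) div 2)))
      * (of_real (- 1 * (\<rho> * tt * g)) ^ n * of_real p ^ (n * (n + 1) div 2) / of_real (qpoch (- tt * \<rho> * p) p n))"
      unfolding C.kap_def 1 g4 unfolding 2 3 4 5 6 7 9 qpoch_of_real by (simp only: of_real_minus of_real_1)
    also have "\<dots> = of_real (qpoch_inf p p * qtheta (- tt) p / (qpoch_sq u p (- g) * qpoch_sq u p (tt * g))
      * (inverse (th * g) ^ k * inverse \<rho> ^ k * qpoch (- th * \<rho> * p) p k * ((- 1) ^ k / p ^ (k * (k + 1) div 2)))
      * ((- 1 * (\<rho> * tt * g)) ^ n * p ^ (n * (n + 1) div 2) / qpoch (- tt * \<rho> * p) p n))"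
      by (simp only: of_real_mult of_real_divide of_real_power)
    also have "qpoch_inf p p * qtheta (- tt) p / (qpoch_sq u p (- g) * qpoch_sq u p (tt * g))
      * (inverse (th * g) ^ k * inverse \<rho> ^ k * qpoch (- th * \<rho> * p) p k * ((- 1) ^ k / p ^ (k * (k + 1) div 2)))
      * ((- 1 * (\<rho> * tt * g)) ^ n * p ^ (n * (n + 1) div 2) / qpoch (- tt * \<rho> * p) p n) = Kt * ((- 1) ^ (k + n) * \<kappa> k n)"
    proof -
      have g: "K * (A * B * C * (s1 / E)) * (s2 * F * G / H) = K * ((s1 * s2) * (A * B * C / E * (F * G / H)))" for K A B C s1 E s2 F G H :: real
        by simp
      show ?thesis unfolding \<kappa>_def Kt_def[symmetric] power_mult_distrib[of "- 1"] power_add[of "- 1"] by (rule g)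
    qed
    finally show ?thesis .
  qed
  \<comment> \<open>Only \<open>g\<close> can be negative, and it occurs \<open>k\<close> times
    inverted and \<open>n\<close> times directly.\<close>
  have \<kappa>s: "\<kappa> k n = s ^ (k + n) * \<bar>\<kappa> k n\<bar>" for k n
  proof -
    have gs: "g = s * \<bar>g\<bar>" using s1(5) sgn_mult_abs[of g] by simp
    define c where "c = inverse th ^ k * inverse \<rho> ^ k * qpoch (- th * \<rho> * p) p k / p ^ (k * (k + 1) div 2)
      * ((\<rho> * tt) ^ n * p ^ (n * (n + 1) div 2) / qpoch (- tt * \<rho> * p) p n)"
    have lt: "- th * \<rho> * p < 1" "- tt * \<rho> * p < 1" using P(1,2,3) pp by (simp_all add: mult_pos_pos order.strict_trans[of _ 0])
    have c: "0 < c" unfolding c_def using P(1,2,3) pp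
      by (intro mult_pos_pos divide_pos_pos zero_less_power qpoch_pos[OF pp] lt) auto
    have "\<kappa> k n = c * (inverse g ^ k * g ^ n)" unfolding \<kappa>_def c_def power_mult_distrib inverse_mult_distrib by simp
    also have "inverse g = s * inverse \<bar>g\<bar>"
    proof -
      have "inverse s = s" by (rule inverse_unique) (rule s1(4))
      then show ?thesis by (subst gs) (simp only: inverse_mult_distrib)
    qed
    also have "(s * inverse \<bar>g\<bar>) ^ k * g ^ n = s ^ (k + n) * (inverse \<bar>g\<bar> ^ k * \<bar>g\<bar> ^ n)"
      by (subst gs) (simp only: power_mult_distrib power_add mult_ac)
    finally have e: "\<kappa> k n = s ^ (k + n) * (c * (inverse \<bar>g\<bar> ^ k * \<bar>g\<bar> ^ n))" by (simp only: mult_ac)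
    have "\<bar>s\<bar> = 1" using s1(4) by (metis abs_1 abs_mult abs_mult_self_eq mult.left_neutral abs_sgn_eq_1 mult_zero_left s1(5) sgn_eq_0_iff zero_neq_one)
    then have "\<bar>\<kappa> k n\<bar> = c * (inverse \<bar>g\<bar> ^ k * \<bar>g\<bar> ^ n)"
      unfolding e using c by (simp add: abs_mult power_abs)
    then show ?thesis using e by simp
  qed
  \<comment> \<open>\<open>coupling_constants\<close> fixes the absolute value of the constant and
    \<open>coupling_phase\<close> its sign and phase.\<close>
  have const: "of_real (s powi r / sqrt (Kt * Kth)) * ((of_real (sgn l) * \<i>) ^ m * of_real ((- 1) powi (r - int k)) * of_real (sqrt (AG k n m))) * C.kap k n
      = (of_real (sgn \<xi>) * \<i>) ^ m * of_real ((- 1) powi (r - int n)) * of_real (sqrt (AF k n m))"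
    if nk: "int n + int k = int m + r" for k n m
  proof -
    have cc: "AG k n m * Kt * (\<kappa> k n)\<^sup>2 = AF k n m * Kth"
      by (rule coupling_constants[OF pp P(1,2,4,5) \<rho>_def nk Kt_def Kth_def AG_def AF_def \<kappa>_def])
    have rr: "sqrt (AG k n m) * (Kt * \<bar>\<kappa> k n\<bar>) / sqrt (Kt * Kth) = sqrt (AF k n m)"
    proof -
      have "AF k n m = AG k n m * Kt * (\<kappa> k n)\<^sup>2 / Kth" unfolding cc using Kpos by simp
      then have "sqrt (AF k n m) = sqrt (AG k n m) * sqrt Kt * \<bar>\<kappa> k n\<bar> / sqrt Kth" by (simp add: real_sqrt_mult real_sqrt_divide)
      moreover have "A * (Kt * \<kappa>) / (sqrt Kt * sqrt Kth) = A * sqrt Kt * \<kappa> / sqrt Kth" for A \<kappa>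
      proof -
        have "A * (Kt * \<kappa>) / (sqrt Kt * sqrt Kth) = A * ((sqrt Kt * sqrt Kt) * \<kappa>) / (sqrt Kt * sqrt Kth)"
          using Kpos by simp
        also have "\<dots> = A * sqrt Kt * \<kappa> / sqrt Kth"
        proof -
          have "A * ((a * a) * \<kappa>) / (a * b) = A * a * \<kappa> / b" if "a \<noteq> 0" for a b :: real using that by simp
          then show ?thesis using Kpos by (simp only: real_sqrt_eq_zero_cancel_iff order.strict_implies_not_eq[THEN not_sym] not_False_eq_True)
        qed
        finally show ?thesis .
      qed
      ultimately show ?thesis by (simp only: real_sqrt_mult)
    qed
    have K: "C.kap k n = of_real (Kt * \<bar>\<kappa> k n\<bar>) * of_real ((- 1) ^ (k + n) * s ^ (k + n))"
    proof -
      have "Kt * ((- 1) ^ (k + n) * \<kappa> k n) = Kt * \<bar>\<kappa> k n\<bar> * ((- 1) ^ (k + n) * s ^ (k + n))" by (subst \<kappa>s) (simp only: mult_ac)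
      then show ?thesis unfolding kap by (simp only: of_real_mult)
    qed
    have g: "of_real (sr / S) * (A * B * of_real G) * (of_real K * E) = of_real (G * K / S) * (of_real sr * (A * B) * E)"
      for sr S G K :: real and A B E :: complex by simp
    show ?thesis unfolding K g rr coupling_phase[OF s1(3,1,2) nk] by (simp only: mult_ac)
  qed

  \<comment> \<open>Both sides of the relation in terms of the core functions\<close>
  define Pk where "Pk k Z = cdqH_poly k u (of_real (th * g)) (of_real (- p * \<rho> / g)) (of_real (g * Z)) (of_real p)" for k and Z :: real
  define Gn where "Gn k n Z = bqL_num n (p ^ k * \<rho>) (- (tt * \<rho>)) (- Z * p * (p ^ k * \<rho>)) p" for k n Z
  define v where "v k Z = qpoch_inf (p ^ Suc k / tt * Z) p" for k Z
  have HH: "of_real \<bar>Z\<bar> * C.HH k n (of_real Z) = of_real (wt Z * v k Z * Gn k n Z) * Pk k Z" for k n Z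
  proof -
    have 1: "qpoch_inf (of_real g * u * of_real Z) (of_real p) * qpoch_inf (of_real g / u * of_real Z) (of_real p) = of_real (qpoch_sq u p (g * Z))"
      using qpoch_sq[OF pp u, of "g * Z"] by (simp add: mult_ac)
    have 2: "qpoch_inf (- of_real p * of_real Z) (of_real p) = (of_real (qpoch_inf (- Z * p) p) :: complex)"
      using ri[of "- Z * p"] by (simp add: mult.commute)
    have 3: "qpoch_inf (of_real p ^ Suc k / of_real tt * of_real Z) (of_real p) = (of_real (v k Z) :: complex)"
      using ri[of "p ^ Suc k / tt * Z"] unfolding v_def by simp
    have 4: "bqL_num n (of_real p ^ k * of_real \<rho>) (- of_real tt * of_real \<rho>) (- of_real Z * of_real p * (of_real p ^ k * of_real \<rho>)) (of_real p) = (of_real (Gn k n Z) :: complex)"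
      unfolding Gn_def bqL_num_of_real[symmetric] by simp
    have 5: "cdqH_poly k u (of_real p / (of_real tt * of_real g)) (- of_real p * of_real \<rho> / of_real g) (of_real g * of_real Z) (of_real p) = Pk k Z"
      unfolding Pk_def pth(1)[symmetric] by simp
    have g: "of_real aZ * (of_real A * of_real B / of_real S * P * of_real G) = of_real (aZ * A / S * B * G) * P" for aZ A B S G :: real and P :: complex by simp
    show ?thesis unfolding C.HH_def C.ker_def 1 2 3 4 5 g wt_def ..
  qed
  have side: "c_fin q \<sigma> \<tau> u \<xi> k y * c_inf q \<tau> (y * q ^ (2 * k)) l (r - int k) m
      = (of_real (sgn l) * \<i>) ^ m * of_real ((- 1) powi (r - int k)) * of_real (sqrt (AG k n m)) * of_real (sqrt (wt (Zf y)) * v k (Zf y) * Gn k n (Zf y)) * Pk k (Zf y)"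
    if nk: "int n + int k = int m + r" and y: "Zf y \<in> \<Lambda>" "\<not> out (Zf y)" for k n m y
  proof -
    have "c_fin q \<sigma> \<tau> u \<xi> k y * c_inf q \<tau> (y * q ^ (2 * k)) l (r - int k) m
      = (of_real (sgn l) * \<i>) ^ m * of_real ((- 1) powi (r - int k) * (sqrt (AG k n m) * sqrt (wt (Zf y)) * v k (Zf y) * Gn k n (Zf y))) * Pk k (Zf y)"
      using coupling_side[OF q l \<xi> p_def g_def tt_def th_def \<rho>_def Zf_def u D goodZ[OF y] nk]
      unfolding AG_def wt_def v_def Gn_def Pk_def .
    then show ?thesis by (simp only: of_real_mult mult.assoc)
  qed
  have c_inf_G: "c_inf q \<tau> (y * q ^ (2 * k)) l (r - int k) m = 0" if o: "out (Zf y)" for y k m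
  proof -
    obtain i where i: "Zf y = - (p powi (- 1 - int i))" using o unfolding out_def by blast
    have "Zf y = l * (y * q ^ (2 * k)) * q powi (2 * (r - int k)) * q powr (- 2 * \<tau>)"
      unfolding Zf_def by (rule lattice_shift[OF q(1)])
    from c_inf_eq_0[OF q l p_def this i] show ?thesis .
  qed
  have c_inf_F: "c_inf q \<sigma> (x * q ^ (2 * n)) \<xi> (r - int n) m = 0" if o: "out X" for n m
  proof -
    obtain i where i: "X = - (p powi (- 1 - int i))" using o unfolding out_def by blast
    have "X = \<xi> * (x * q ^ (2 * n)) * q powi (2 * (r - int n)) * q powr (- 2 * \<sigma>)"
      unfolding X_def x' by (rule lattice_shift[OF q(1)])
    from c_inf_eq_0[OF q \<xi> p_def this i] show ?thesis .
  qed
  \<comment> \<open>\<open>coupling_side\<close> with \<open>l\<close>, \<open>\<tau>\<close>,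
    \<open>k\<close> exchanged against \<open>\<xi>\<close>, \<open>\<sigma>\<close>,
    \<open>n\<close>.\<close>
  have ff: "of_real (sqrt (wt X)) * C.ff k n (of_real X) * ((of_real (sgn \<xi>) * \<i>) ^ m * of_real ((- 1) powi (r - int n)) * of_real (sqrt (AF k n m)))
      = c_fin q \<tau> \<sigma> u l n x * c_inf q \<sigma> (x * q ^ (2 * n)) \<xi> (r - int n) m"
    if nk: "int n + int k = int m + r" and o: "\<not> out X" for k n m
  proof -
    have nk': "int k + int n = int m + r" using nk by simp
    have Xx: "X = \<xi> * x * q powr (2 * of_int r - 2 * \<sigma>)" unfolding X_def x' ..
    have S: "c_fin q \<tau> \<sigma> u l n x * c_inf q \<sigma> (x * q ^ (2 * n)) \<xi> (r - int n) m
      = (of_real (sgn \<xi>) * \<i>) ^ m * of_real ((- 1) powi (r - int n) * (sqrt (AF k n m) * sqrt (wt X) * qpoch_inf (p ^ Suc n / th * X) p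
          * bqL_num k (p ^ n * \<rho>) (- (th * \<rho>)) (- X * p * (p ^ n * \<rho>)) p))
        * cdqH_poly n u (of_real (tt * g)) (of_real (- p * \<rho> / g)) (of_real (g * X)) (of_real p)"
      using coupling_side[OF q \<xi> l p_def g' th_def tt_def \<rho>_def Xx u D goodX[OF o] nk'] unfolding AF_def wt_def .
    have 1: "qpoch_inf (of_real tt * of_real g ^ 2 * of_real X * of_real p ^ n) (of_real p) = (of_real (qpoch_inf (p ^ Suc n / th * X) p) :: complex)"
    proof -
      have "p / th = tt * g ^ 2" unfolding P(5)[symmetric] using P(2) by simp
      moreover have "p ^ Suc n / th * X = (p / th) * X * p ^ n" by simp
      ultimately have "p ^ Suc n / th * X = tt * g ^ 2 * X * p ^ n" by simp
      then show ?thesis unfolding ri[symmetric] by simp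
    qed
    have 2: "bqL_num k (of_real p ^ n * of_real \<rho>) (- of_real p * of_real \<rho> / (of_real tt * of_real g ^ 2)) (- of_real X * of_real p * (of_real p ^ n * of_real \<rho>)) (of_real p)
       = (of_real (bqL_num k (p ^ n * \<rho>) (- (th * \<rho>)) (- X * p * (p ^ n * \<rho>)) p) :: complex)"
      unfolding bqL_num_of_real[symmetric] pth(2)[symmetric] by simp
    have 3: "cdqH_poly n u (of_real tt * of_real g) (- of_real p * of_real \<rho> / of_real g) (of_real g * of_real X) (of_real p)
       = cdqH_poly n u (of_real (tt * g)) (of_real (- p * \<rho> / g)) (of_real (g * X)) (of_real p)" by simp
    show ?thesis unfolding S C.ff_def 1 2 3 of_real_mult by (simp only: mult_ac)
  qed

  \<comment> \<open>The candidate satisfies all relations\<close>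
  have cl: "((\<lambda>y. Rf y * c_fin q \<sigma> \<tau> u \<xi> k y * c_inf q \<tau> (y * q ^ (2 * k)) l (r - int k) m)
      has_sum (c_fin q \<tau> \<sigma> u l n x * c_inf q \<sigma> (x * q ^ (2 * n)) \<xi> (r - int n) m)) (lattice_set q \<tau>)"
    if nk: "int n + int k = int m + r" for k n m
  proof (cases "out X")
    case True
    then show ?thesis unfolding c_inf_F[OF True] by (simp add: Rf_def)
  next
    case o: False
    define H where "H Z = (if \<exists>j::nat. Z = - (p powi (- 1 - int j)) then 0
      else of_real \<bar>Z\<bar> * C.HH k n (of_real Z) * mphi (of_real p) (of_real g) u (of_real X) (of_real Z))" for Z :: real
    define K where "K = of_real c0 * ((of_real (sgn l) * \<i>) ^ m * of_real ((- 1) powi (r - int k)) * of_real (sqrt (AG k n m)))"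
    have eq: "Rf y * c_fin q \<sigma> \<tau> u \<xi> k y * c_inf q \<tau> (y * q ^ (2 * k)) l (r - int k) m = K * H (Zf y)" if y: "y \<in> lattice_set q \<tau>" for y
    proof (cases "out (Zf y)")
      case True
      then show ?thesis unfolding H_def out_def[symmetric] by (simp add: Rf_def)
    next
      case False
      have L: "Zf y \<in> \<Lambda>" using Zim y by blast
      \<comment> \<open>One root of the weight comes from the candidate and one from the two
        coefficients; together they form the weight under the integral.\<close>
      have w: "sqrt (wt (Zf y)) * sqrt (wt (Zf y)) = wt (Zf y)" using wtZ[OF L False] by simp
      have g: "of_real (c * sw) * M * (A * of_real (sw * V * G) * P) = of_real c * A * (of_real ((sw * sw) * V * G) * P * M)"
        for c sw V G :: real and M A P :: complex by (simp only: of_real_mult mult_ac)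
      have "Rf y * c_fin q \<sigma> \<tau> u \<xi> k y * c_inf q \<tau> (y * q ^ (2 * k)) l (r - int k) m
        = of_real (c0 * sqrt (wt (Zf y))) * mphi (of_real p) (of_real g) u (of_real X) (of_real (Zf y))
          * ((of_real (sgn l) * \<i>) ^ m * of_real ((- 1) powi (r - int k)) * of_real (sqrt (AG k n m)) * of_real (sqrt (wt (Zf y)) * v k (Zf y) * Gn k n (Zf y)) * Pk k (Zf y))"
        unfolding mult.assoc[of "Rf y"] side[OF nk L False] using o False by (simp only: Rf_def if_False simp_thms)
      then show ?thesis unfolding g w H_def out_def[symmetric] HH K_def using False by (simp only: if_False)
    qed
    have "(H has_sum C.JJ k n (of_real X)) (Zf ` lattice_set q \<tau>)"
      unfolding Zim \<Lambda>_def H_def by (rule coupling_core_has_sum[OF core pp P(1)])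
    then have "((H \<circ> Zf) has_sum C.JJ k n (of_real X)) (lattice_set q \<tau>)" unfolding has_sum_reindex[OF Zinj] .
    then have "((\<lambda>y. K * H (Zf y)) has_sum (K * C.JJ k n (of_real X))) (lattice_set q \<tau>)"
      unfolding comp_def by (rule has_sum_cmult_right)
    moreover have "K * C.JJ k n (of_real X) = c_fin q \<tau> \<sigma> u l n x * c_inf q \<sigma> (x * q ^ (2 * n)) \<xi> (r - int n) m"
    proof -
      have J: "C.JJ k n (of_real X) = C.kap k n * C.ff k n (of_real X)" by (rule C.JJ_eq) (use X0 in simp)
      have g: "of_real (sr * (w / S)) * A * (\<kappa> * f) = of_real w * f * (of_real (sr / S) * A * \<kappa>)" for sr w S :: real and A \<kappa> f :: complex by simp
      show ?thesis unfolding J K_def c0_def g const[OF nk] by (rule ff[OF nk o])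
    qed
    ultimately have "((\<lambda>y. K * H (Zf y)) has_sum (c_fin q \<tau> \<sigma> u l n x * c_inf q \<sigma> (x * q ^ (2 * n)) \<xi> (r - int n) m)) (lattice_set q \<tau>)"
      by (simp only:)
    moreover have "((\<lambda>y. Rf y * c_fin q \<sigma> \<tau> u \<xi> k y * c_inf q \<tau> (y * q ^ (2 * k)) l (r - int k) m) has_sum S) (lattice_set q \<tau>)
        \<longleftrightarrow> ((\<lambda>y. K * H (Zf y)) has_sum S) (lattice_set q \<tau>)" for S
      by (rule has_sum_cong) (rule eq)
    ultimately show ?thesis by blast
  qed
  have cR: "((\<lambda>y. R y * c_fin q \<sigma> \<tau> u \<xi> k y * c_inf q \<tau> (y * q ^ (2 * k)) l (r - int k) m)
      has_sum (c_fin q \<tau> \<sigma> u l n x * c_inf q \<sigma> (x * q ^ (2 * n)) \<xi> (r - int n) m)) (lattice_set q \<tau>)"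
    if nk: "int n + int k = int m + r" for k n m
  proof -
    have e: "r = int n - int m + int k" "int n - int m = r - int k" "int k - int m = r - int n" using nk by simp_all
    show ?thesis using R e(1) unfolding is_coupling_def e(2,3)[symmetric] by blast
  qed

  \<comment> \<open>Uniqueness of the coefficients\<close>
  have RRf: "R y = Rf y" if y: "y \<in> lattice_set q \<tau>" for y
  proof (cases "out (Zf y)")
    case True
    \<comment> \<open>At such a point all components vanish and the relations say nothing about
      \<open>R y\<close>; the convention for zero vectors in \<open>is_coupling\<close>
      applies.\<close>
    have "c_fin q \<sigma> \<tau> u \<xi> k y * c_inf q \<tau> (y * q ^ (2 * k)) l (int n - int m) m = 0" if "r = int n - int m + int k" for k m n
    proof -
      have "int n - int m = r - int k" using that by simp
      then show ?thesis using c_inf_G[OF True] by (simp only: mult_zero_right)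
    qed
    then have "R y = 0" using R y unfolding is_coupling_def by blast
    then show ?thesis using True by (simp add: Rf_def)
  next
    case ny: False
    have Ly: "Zf y \<in> \<Lambda>" using Zim y by blast
    \<comment> \<open>The weight factor at a fixed point of the upper branch vanishes for small
      \<open>k\<close> and is positive from some \<open>k\<close> on.\<close>
    obtain N where N: "\<And>k. N \<le> k \<Longrightarrow> 0 < v k (Zf y)"
    proof -
      consider i :: nat where "Zf y = - (p ^ i)" | i :: int where "Zf y = tt * p powi i" using goodZ[OF Ly ny] by blast
      then show ?thesis
      proof cases
        case 1
        have "0 < v k (Zf y)" for k unfolding v_def 1
        proof (rule qpoch_inf_pos[OF pp])
          have "p ^ Suc k / tt * - (p ^ i) < 0" using pp P(1) by (simp add: divide_neg_pos mult_pos_neg)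
          then show "p ^ Suc k / tt * - (p ^ i) < 1" by linarith
        qed
        then show ?thesis using that by blast
      next
        case 2
        have "0 < v k (Zf y)" if "nat (- i) \<le> k" for k unfolding v_def 2
        proof (rule qpoch_inf_pos[OF pp])
          have h: "int (Suc k) + i = int (Suc (nat (int k + i)))" using that by simp
          have "p ^ Suc k / tt * (tt * p powi i) = p ^ Suc k * p powi i" using P(1) by simp
          also have "\<dots> = p powi (int (Suc k) + i)" using pp by (subst power_int_add) (simp_all only: power_int_of_nat, auto)
          also have "\<dots> = p ^ Suc (nat (int k + i))" unfolding h by (rule power_int_of_nat)
          finally show "p ^ Suc k / tt * (tt * p powi i) < 1" using power_Suc_less_one[OF pp, of "nat (int k + i)"] by (simp only:)
        qed
        then show ?thesis using that by blast
      qed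
    qed
    \<comment> \<open>\<open>k \<ge> nat r\<close> ensures that \<open>m = n + k - r\<close> is a
      natural number for every \<open>n\<close>, so the relations with this \<open>k\<close> exist
      for all degrees.\<close>
    have "\<exists>k\<ge>max N (nat r). Pk k (Zf y) \<noteq> 0" unfolding Pk_def
    proof (rule cdqH_poly_nonvanishing)
      show "norm (of_real p :: complex) < 1" "(of_real p :: complex) \<noteq> 0" "u \<noteq> 0" using pp u0 by auto
      show "(of_real (th * g) :: complex) \<noteq> 0" "(of_real (g * Zf y) :: complex) \<noteq> 0" using P(2,4) L0[OF Ly] by auto
      show "of_real (th * g) * of_real (- p * \<rho> / g) * of_real p ^ n \<noteq> (of_real p :: complex)" for n
      proof -
        have "th * g * (- p * \<rho> / g) * p ^ n < 0" using P(2,3,4) pp by (simp add: mult_pos_pos)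
        then have "th * g * (- p * \<rho> / g) * p ^ n \<noteq> p" using pp by linarith
        then have "(of_real (th * g * (- p * \<rho> / g) * p ^ n) :: complex) \<noteq> of_real p" unfolding of_real_eq_iff .
        then show ?thesis unfolding of_real_mult of_real_power .
      qed
      show "of_real (g * Zf y) * u * of_real p ^ s \<noteq> 1" for s using sqZ[OF Ly, of s] by (simp add: mult_ac)
      show "of_real (g * Zf y) / u * of_real p ^ s \<noteq> 1" for s using sqZ'[OF Ly, of s] by (simp add: mult_ac)
    qed
    then obtain k where k: "max N (nat r) \<le> k" "Pk k (Zf y) \<noteq> 0" by blast
    \<comment> \<open>The difference of the two coefficients times all factors that do not depend on
      \<open>n\<close>. At \<open>y\<close> the multiplier is nonzero by the choice of
      \<open>k\<close>.\<close>
    define h where "h y' = (if out (Zf y') then 0 else (R y' - Rf y') * (of_real (sqrt (wt (Zf y')) * v k (Zf y')) * Pk k (Zf y')))" for y'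
    have hG: "((\<lambda>y'. h y' * of_real (Gn k n (Zf y'))) has_sum 0) (lattice_set q \<tau>)" for n
    proof -
      define m where "m = nat (int n + int k - r)"
      have "r \<le> int k" using k(1) by (simp add: nat_le_iff)
      then have nk: "int n + int k = int m + r" by (simp add: m_def)
      define K where "K = (of_real (sgn l) * \<i>) ^ m * of_real ((- 1) powi (r - int k)) * of_real (sqrt (AG k n m))"
      have K0: "K \<noteq> 0" using AGpos[of k n m] lx0 by (simp add: K_def sgn_if)
      have eq: "R y' * c_fin q \<sigma> \<tau> u \<xi> k y' * c_inf q \<tau> (y' * q ^ (2 * k)) l (r - int k) m - Rf y' * c_fin q \<sigma> \<tau> u \<xi> k y' * c_inf q \<tau> (y' * q ^ (2 * k)) l (r - int k) m
          = K * (h y' * of_real (Gn k n (Zf y')))" if y': "y' \<in> lattice_set q \<tau>" for y'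
      proof (cases "out (Zf y')")
        case True
        then show ?thesis unfolding c_inf_G[OF True] by (simp add: h_def)
      next
        case False
        have L: "Zf y' \<in> \<Lambda>" using Zim y' by blast
        have g1: "a * c * d - b * c * d = (a - b) * (c * d)" for a b c d :: complex by (simp add: algebra_simps)
        have g2: "d * (A * of_real (sw * V * G) * P) = A * (d * (of_real (sw * V) * P) * of_real G)" for d A P :: complex and sw V G :: real
          by (simp only: of_real_mult mult_ac)
        show ?thesis unfolding g1 side[OF nk L False] g2 K_def h_def using False by (simp only: if_False)
      qed
      have "((\<lambda>y'. R y' * c_fin q \<sigma> \<tau> u \<xi> k y' * c_inf q \<tau> (y' * q ^ (2 * k)) l (r - int k) m - Rf y' * c_fin q \<sigma> \<tau> u \<xi> k y' * c_inf q \<tau> (y' * q ^ (2 * k)) l (r - int k) m) has_sum 0) (lattice_set q \<tau>)"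
        using has_sum_add[OF cR[OF nk] has_sum_cmult_right[OF cl[OF nk], of "- 1"]] by (simp only: mult_minus1 right_minus add_uminus_conv_diff)
      moreover have "((\<lambda>y'. R y' * c_fin q \<sigma> \<tau> u \<xi> k y' * c_inf q \<tau> (y' * q ^ (2 * k)) l (r - int k) m - Rf y' * c_fin q \<sigma> \<tau> u \<xi> k y' * c_inf q \<tau> (y' * q ^ (2 * k)) l (r - int k) m) has_sum 0) (lattice_set q \<tau>)
          \<longleftrightarrow> ((\<lambda>y'. K * (h y' * of_real (Gn k n (Zf y')))) has_sum 0) (lattice_set q \<tau>)"
        by (rule has_sum_cong) (rule eq)
      ultimately have "((\<lambda>y'. K * (h y' * of_real (Gn k n (Zf y')))) has_sum 0) (lattice_set q \<tau>)" by blast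
      from has_sum_cmult_right[OF this, of "inverse K"] show ?thesis using K0 by (simp add: mult.assoc[symmetric])
    qed
    have mom: "((\<lambda>y'. h y' * of_real (Zf y') ^ i) has_sum 0) (lattice_set q \<tau>)" for i
    proof (rule has_sum_recurrence_moments[OF hG])
      show "of_real (Gn k 0 (Zf y')) = (1 :: complex)" for y' by (simp add: Gn_def)
      define \<alpha> bb cc where "\<alpha> = p ^ k * \<rho>" and "bb = - (tt * \<rho>)" and "cc = p * (p ^ k * \<rho>)"
      have cc: "cc \<noteq> 0" unfolding cc_def using pp P(3) by simp
      define B where "B n = (1 - \<alpha> * p ^ Suc n) * (1 - bb * p ^ Suc n) - \<alpha> * bb * p ^ Suc n * (1 - p ^ n)" for n
      define E where "E n = \<alpha> * bb * p ^ Suc n * (1 - p ^ n) * (1 - \<alpha> * p ^ n)" for n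
      have lt: "bb * p < 1" unfolding bb_def using P(1,3) pp by (simp add: mult_pos_pos order.strict_trans[of _ 0])
      have bz: "qpoch (bb * p) p i \<noteq> 0" for i using qpoch_pos[OF pp lt, of i] by simp
      show "of_real (Zf y') * of_real (Gn k n (Zf y')) = of_real (- (1 - bb * p ^ Suc n) / cc) * of_real (Gn k (Suc n) (Zf y'))
         + of_real ((B n - 1) / cc) * of_real (Gn k n (Zf y')) + of_real (E n / cc) * (of_real (Gn k (n - 1) (Zf y')) :: complex)" for n y'
      proof -
        have p': "norm p < 1" "p \<noteq> 0" using pp by auto
        have T: "(- Zf y' * p * (p ^ k * \<rho>) - 1) * Gn k n (Zf y') = (1 - bb * p ^ Suc n) * Gn k (Suc n) (Zf y') - B n * Gn k n (Zf y') - E n * Gn k (n - 1) (Zf y')"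
          unfolding Gn_def bb_def[symmetric] B_def E_def \<alpha>_def by (rule bqL_num_three_term[OF p' bz])
        have g: "Z * G0 = - u1 / c * G1 + (b - 1) / c * G0 + e / c * G2" if "(- Z * c - 1) * G0 = u1 * G1 - b * G0 - e * G2" "c \<noteq> 0" for Z G0 u1 c G1 b e G2 :: real
        proof -
          have "c * (- u1 / c * G1 + (b - 1) / c * G0 + e / c * G2) = - u1 * G1 + (b - 1) * G0 + e * G2"
            using that(2) by (simp add: distrib_left right_diff_distrib)
          moreover have "c * (Z * G0) = - u1 * G1 + (b - 1) * G0 + e * G2" using that(1) by (simp add: algebra_simps)
          ultimately have "c * (Z * G0) = c * (- u1 / c * G1 + (b - 1) / c * G0 + e / c * G2)" by (simp only:)
          then show ?thesis using that(2) by simp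
        qed
        have "- Zf y' * p * (p ^ k * \<rho>) = - Zf y' * cc" by (simp add: cc_def)
        from g[OF T[unfolded this] cc] show ?thesis by (simp only: of_real_mult[symmetric] of_real_add[symmetric])
      qed
    qed
    \<comment> \<open>For fixed \<open>k\<close> the factor \<open>v k\<close> cuts off the
      unbounded part of the upper branch, and the lower branch lies in the unit interval up to sign;
      this boundedness is what the moment argument needs.\<close>
    have hb: "\<bar>Zf y'\<bar> \<le> 1 + tt / p ^ k" if "y' \<in> lattice_set q \<tau>" "h y' \<noteq> 0" for y'
    proof -
      have L: "Zf y' \<in> \<Lambda>" using Zim that(1) by blast
      have o: "\<not> out (Zf y')" and vv: "v k (Zf y') \<noteq> 0" using that(2) by (auto simp: h_def split: if_splits)
      have tk: "0 \<le> tt / p ^ k" using P(1) pp by simp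
      consider i :: nat where "Zf y' = - (p ^ i)" | i :: int where "Zf y' = tt * p powi i" using goodZ[OF L o] by blast
      then show ?thesis
      proof cases
        case 1
        have "p ^ i \<le> 1" using pp by (simp add: power_le_one)
        moreover have "\<bar>Zf y'\<bar> = p ^ i" unfolding 1 using pp by simp
        ultimately show ?thesis using tk by linarith
      next
        case 2
        have "0 \<le> int k + i"
        proof (rule ccontr)
          assume "\<not> 0 \<le> int k + i"
          then have h: "int (Suc k) + i + int (nat (- 1 - int k - i)) = 0" by simp
          have "p ^ Suc k / tt * Zf y' * p ^ nat (- 1 - int k - i) = p ^ Suc k * p powi i * p ^ nat (- 1 - int k - i)" unfolding 2 using P(1) by simp
          also have "\<dots> = p powi (int (Suc k) + i + int (nat (- 1 - int k - i)))"
            using pp by (simp only: power_int_add power_int_of_nat order.strict_implies_not_eq[THEN not_sym] simp_thms)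
          also have "\<dots> = 1" unfolding h by simp
          finally have "p ^ Suc k / tt * Zf y' * p ^ nat (- 1 - int k - i) = 1" .
          then have "v k (Zf y') = 0" unfolding v_def using qpoch_inf_eq_0_iff[of p "p ^ Suc k / tt * Zf y'"] pp by auto
          then show False using vv by blast
        qed
        then have "p powi i \<le> p powi (- int k)" using pp by (intro power_int_decreasing) auto
        then have "tt * p powi i \<le> tt / p ^ k" using P(1) by (simp add: power_int_minus divide_inverse)
        moreover have "0 < tt * p powi i" using P(1) pp by simp
        ultimately show ?thesis unfolding 2 by linarith
      qed
    qed
    have gap: "(1 - p) * \<bar>Zf y\<bar> \<le> \<bar>Zf y' - Zf y\<bar>" if "y' \<in> lattice_set q \<tau>" "y' \<noteq> y" for y'
    proof -
      have L: "Zf y' \<in> \<Lambda>" using Zim that(1) by blast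
      have ne: "Zf y' \<noteq> Zf y" using inj_onD[OF Zinj[of UNIV]] that(2) by blast
      have z1: "(1 - p) * \<bar>Z\<bar> \<le> \<bar>Z\<bar>" for Z using pp by (simp add: mult_left_le_one_le)
      consider i j where "Zf y' = - (p powi i)" "Zf y = - (p powi j)" | i j where "Zf y' = tt * p powi i" "Zf y = tt * p powi j"
        | i j where "Zf y' = - (p powi i)" "Zf y = tt * p powi j" | i j where "Zf y' = tt * p powi i" "Zf y = - (p powi j)"
        using L Ly unfolding \<Lambda>_def by blast
      then show ?thesis
      proof cases
        case 1
        then have "i \<noteq> j" using ne by auto
        from powi_gap[OF pp this] show ?thesis unfolding 1 using pp by (simp add: abs_minus_commute)
      next
        case 2
        then have "i \<noteq> j" using ne by auto
        from powi_gap[OF pp this] have "tt * ((1 - p) * p powi j) \<le> tt * \<bar>p powi i - p powi j\<bar>" using P(1) by simp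
        moreover have "\<bar>tt * p powi i - tt * p powi j\<bar> = tt * \<bar>p powi i - p powi j\<bar>" using P(1) by (simp add: right_diff_distrib[symmetric] abs_mult)
        moreover have "\<bar>tt * p powi j\<bar> = tt * p powi j" using P(1) pp by simp
        ultimately show ?thesis unfolding 2 by (simp only: mult_ac)
      next
        case 3
        have "0 < p powi i" "0 < tt * p powi j" using pp P(1) by simp_all
        then show ?thesis using z1[of "Zf y"] unfolding 3 by linarith
      next
        case 4
        have "0 < p powi j" "0 < tt * p powi i" using pp P(1) by simp_all
        then show ?thesis using z1[of "Zf y"] unfolding 4 by linarith
      qed
    qed
    have "h y = 0"
    proof (rule moments_determine_coefficient[OF mom _ y])
      show "\<And>z. z \<in> lattice_set q \<tau> \<Longrightarrow> h z \<noteq> 0 \<Longrightarrow> \<bar>Zf z\<bar> \<le> 1 + tt / p ^ k" by (rule hb)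
      show "0 < (1 - p) * \<bar>Zf y\<bar>" using pp L0[OF Ly] by simp
      show "\<And>z. z \<in> lattice_set q \<tau> \<Longrightarrow> z \<noteq> y \<Longrightarrow> h z \<noteq> 0 \<Longrightarrow> (1 - p) * \<bar>Zf y\<bar> \<le> \<bar>Zf z - Zf y\<bar>" by (rule gap)
    qed
    then show ?thesis using ny wtZ[OF Ly ny] N[of k] k by (auto simp: h_def)
  qed

  \<comment> \<open>Translation back to q-Meixner functions\<close>
  have Zz: "Zf z = z'" unfolding Zf_def z' ..
  have Lz: "z' \<in> \<Lambda>" using Zim z unfolding Zz[symmetric] by blast
  have Rz: "R z = Rf z" by (rule RRf[OF z])
  show ?thesis
  proof (intro conjI impI)
    assume "x' \<in> neg_out q \<or> z' \<in> neg_out q"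
    then show "R z = 0" unfolding Rz Rf_def Zz neg_out X_def by auto
  next
    assume A: "x' \<in> neg_in q \<union> pos_lattice q \<sigma> \<union> pos_lattice q (- \<sigma>) \<and> z' \<in> neg_in q \<union> pos_lattice q \<tau> \<union> pos_lattice q (- \<tau>)"
    have no: "\<not> out Z" if ZA: "Z \<in> neg_in q \<union> pos_lattice q c \<union> pos_lattice q d" for Z c d
    proof
      assume "out Z"
      then obtain j where j: "Z = - (p powi (- 1 - int j))" unfolding out_def by blast
      have pj: "0 < p powi (- 1 - int j)" using pp by simp
      consider "0 < Z" | i :: nat where "Z = - (q ^ (2 * i))" using ZA q unfolding neg_in_def pos_lattice_def by auto
      then show False
      proof cases
        case 1
        then show False using j pj by linarith
      next
        case (2 i)
        have "q ^ (2 * i) = p powi int i" unfolding p_def by (simp add: power_mult)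
        then have "p powi int i = p powi (- 1 - int j)" using 2 j by simp
        moreover have "(1 - p) * p powi (- 1 - int j) \<le> \<bar>p powi int i - p powi (- 1 - int j)\<bar>" by (rule powi_gap[OF pp]) simp
        moreover have "0 < (1 - p) * p powi (- 1 - int j)" using pj pp by simp
        ultimately show False by simp
      qed
    qed
    have oX: "\<not> out X" and oZ: "\<not> out z'" using A no unfolding X_def by blast+
    have a': "a = - of_real g * u" unfolding a g_def by simp
    have b': "b = - of_real g / u" unfolding b g_def by simp
    have t': "t = of_real tt" unfolding t tt_def ..
    have W: "qMeixner_weight (of_real Z) a b (of_real p) = of_real (qpoch_inf (- Z * p) p / qpoch_sq u p (g * Z))" for Z
    proof -
      have 1: "qpoch_inf (- a * of_real Z) (of_real p) * qpoch_inf (- b * of_real Z) (of_real p) = of_real (qpoch_sq u p (g * Z))"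
        using qpoch_sq[OF pp u, of "g * Z"] unfolding a' b' by (simp add: mult_ac)
      have 2: "qpoch_inf (- of_real p * of_real Z) (of_real p) = (of_real (qpoch_inf (- Z * p) p) :: complex)"
        using ri[of "- Z * p"] by (simp add: mult.commute)
      show ?thesis unfolding qMeixner_weight_def 1 2 by simp
    qed
    have K: "qMeixner_K (of_real c) a b (of_real p) = of_real (qpoch_inf p p * qtheta (- c) p / (qpoch_sq u p (- g) * qpoch_sq u p (c * g)))" for c
    proof -
      have 1: "qpoch_inf a (of_real p) * qpoch_inf b (of_real p) = of_real (qpoch_sq u p (- g))"
        using qpoch_sq[OF pp u, of "- g"] unfolding a' b' by simp
      have 2: "qpoch_inf (- a * of_real c) (of_real p) * qpoch_inf (- b * of_real c) (of_real p) = of_real (qpoch_sq u p (c * g))"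
        using qpoch_sq[OF pp u, of "c * g"] unfolding a' b' by (simp add: mult_ac)
      have 3: "qtheta (- of_real c) (of_real p) = (of_real (qtheta (- c) p) :: complex)" using rt[of "- c"] by simp
      have g4: "a1 * a2 * b1 * b2 = (a1 * a2) * (b1 * b2)" for a1 a2 b1 b2 :: complex by (simp only: mult.assoc)
      show ?thesis unfolding qMeixner_K_def g4 unfolding 1 2 3 ri by simp
    qed
    have ab: "of_real p / (a * b * of_real tt) = of_real th"
    proof -
      have "a * b = of_real (g ^ 2)" unfolding a' b' using u0 by (simp add: power2_eq_square)
      then have "of_real p / (a * b * of_real tt) = of_real (p / (tt * g ^ 2))" by (simp add: mult.commute)
      then show ?thesis unfolding pth .
    qed
    have p2: "of_real (q ^ 2) = (of_real p :: complex)" unfolding p_def ..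
    have M: "qMeixner (of_real x') (of_real z') a b (of_real p) = mphi (of_real p) (of_real g) u (of_real X) (of_real z')"
      unfolding a' b' X_def[symmetric] by (rule qMeixner_eq_mphi) (use X0 L0[OF Lz] u0 in auto)
    \<comment> \<open>The weights and constants are real and nonnegative, so the complex root of the
      statement splits into the three real roots used in the candidate.\<close>
    have sq: "csqrt (of_real \<bar>x' * z'\<bar> * of_real (qpoch_inf (- z' * p) p / qpoch_sq u p (g * z'))
        * of_real (qpoch_inf (- x' * p) p / qpoch_sq u p (g * x')) / (of_real Kt * of_real Kth))
      = of_real (sqrt (wt X) / sqrt (Kt * Kth) * sqrt (wt z'))"
    proof -
      have e: "\<bar>x' * z'\<bar> * (qpoch_inf (- z' * p) p / qpoch_sq u p (g * z')) * (qpoch_inf (- x' * p) p / qpoch_sq u p (g * x')) / (Kt * Kth)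
          = wt X * wt z' / (Kt * Kth)"
        unfolding wt_def X_def abs_mult by (simp add: mult_ac)
      have nn: "0 \<le> wt X * wt z' / (Kt * Kth)" using wtX[OF oX] wtZ[OF Lz oZ] Kpos by simp
      have s: "sqrt (wt X * wt z' / (Kt * Kth)) = sqrt (wt X) / sqrt (Kt * Kth) * sqrt (wt z')"
        by (simp add: real_sqrt_mult real_sqrt_divide)
      show ?thesis unfolding of_real_mult[symmetric] of_real_divide[symmetric] e of_real_sqrt[OF nn, symmetric] s ..
    qed
    have "R z = of_real (c0 * sqrt (wt z')) * mphi (of_real p) (of_real g) u (of_real X) (of_real z')"
      unfolding Rz Rf_def Zz using oX oZ by simp
    then show "R z = of_real (sgn (l * \<xi>) powi r)
              * csqrt (of_real \<bar>x' * z'\<bar>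
                       * qMeixner_weight (of_real z') a b (of_real (q ^ 2))
                       * qMeixner_weight (of_real x') a b (of_real (q ^ 2))
                       / (qMeixner_K t a b (of_real (q ^ 2))
                          * qMeixner_K (of_real (q ^ 2) / (a * b * t)) a b (of_real (q ^ 2))))
              * qMeixner (of_real x') (of_real z') a b (of_real (q ^ 2))"
      unfolding p2 t' ab W K M Kt_def[symmetric] Kth_def[symmetric] sq c0_def s_def[symmetric] by (simp only: of_real_mult mult.assoc)
  qed
qed

end
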